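(* Assume all prop-categories and signatures under consideration are small. For every $\mathcal{X}\subseteq\mathrm{Ob}(\mathbf{FA})$, $\mathrm{Ob}(\mathbf{FA}_{\models_{\mathcal{X}}})=\mathbb{U}\mathbb{S}\mathbb{P}(\mathcal{X})$; that is, the class of all $(\mathcal{D},Q)\in\mathrm{Ob}(\mathbf{FA})$ such that, for every signature $Sg$ and all $Sg$-theories $T,T'$, $T\models_{\mathcal{X}}T'$ implies $T\models_{(\mathcal{D},Q)}T'$, equals $\mathbb{U}\mathbb{S}\mathbb{P}(\mathcal{X})$.
   Context: Syntax: first-order language $\mathscr{L}$ (quantifier symbols $\mathscr{L}_q$, connectives $\mathscr{L}_\omega$ with arities, designated $e\in\mathscr{L}_0$, $\otimes\in\mathscr{L}_2$); signatures; terms- and formulas-in-context; assertions are equations-in-context and sequents-in-context; an $Sg$-theory is a set of $Sg$-assertions. $\mathcal{L}^m$ is the least logic (closure operator on theories satisfying typed equational logic) closed under Ax, Cut, context weakening, substitution of provably equal terms, congruence of quantifiers and connectives w.r.t. mutual derivability, and the two-way rules $\Phi,\alpha,\beta,\Psi\vdash\theta\iff\Phi,\alpha\otimes\beta,\Psi\vdash\theta$ and $\Phi,e,\Psi\vdash\phi\iff\Phi,\Psi\vdash\phi$. $\mathrm{Ob}(\mathbf{FA})$: prop-categories $(\mathcal{C},P)$ ($\mathcal{C}$ with designated finite products, $P:\mathcal{C}^{op}\to\mathbf{Pos}$) with $\mathscr{L}_\omega$-algebra structures on each $P(c)$ preserved by $P(f)$, elements $Eq_c\in P(c\times c)$, maps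 $\Omega_{b,c}:P(b\times c)\to P(b)$ natural in $b$, such that $(P(c),\otimes,e_c)$ is a monoid, $\Omega_{b,1}\circ P(\pi_1^{b,1})=\mathrm{id}$, $\Omega_{b,c\times d}\circ P(a_{b,c,d})=\Omega_{b,c}\circ\Omega_{b\times c,d}$, $Eq_1=e_{1\times1}$, $Eq_{c_1\times c_2}=P(\langle\pi_1^{c_1,c_2}\pi_1,\pi_1^{c_1,c_2}\pi_2\rangle)(Eq_{c_1})\otimes P(\langle\pi_2^{c_1,c_2}\pi_1,\pi_2^{c_1,c_2}\pi_2\rangle)(Eq_{c_2})$. Structures interpret terms as morphisms and formulas as elements of $P$ in the standard way; equations are satisfied when both sides agree, sequents $\phi_1..\phi_n\vdash\phi$ when $\bigotimes[\![\phi_i]\!]\le[\![\phi]\!]$. For $\mathcal{X}\subseteq\mathrm{Ob}(\mathbf{FA})$, $\models_{\mathcal{X}}$ is the logic with $T\models_{\mathcal{X}}T'$ iff every $T$-model in a member of $\mathcal{X}$ satisfies $T'$. For a logic $\mathcal{L}$, $\mathrm{Ob}(\mathbf{FA}_{\mathcal{L}})$ is the class of $(\mathcal{C},P)\in\mathrm{Ob}(\mathbf{FA})$ with $T\vdash_{\mathcal{L}}T'\Rightarrow T\models_{(\mathcal{C},P)}T'$. Morphisms $F=(F^o,F^p)$: finite-product-preserving $F^o$, natural $F^p:P\Rightarrow QF^o$ with $\mathscr{L}_\omega$-homomorphic components commuting with quantifiers and equality up to canonical product isomorphisms. A subprop-category of $(\mathcal{D},Q)$: some $(\mathcal{E},R)\in\mathrm{Ob}(\mathbf{FA})$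 with a morphism $\iota:(\mathcal{E},R)\to(\mathcal{D},Q)$, $\iota^o$ faithful, each $\iota^p$-component an order embedding. For an $\mathcal{L}^m$-theory $T$, $(\mathcal{C}_T,P_T)$ is its classifying prop-category: objects contexts, morphisms lists of terms modulo equality in $T$, $P_T(\Gamma)$ formulas modulo mutual derivability in $T$ ordered by derivability, operations on representatives, $\Omega_{\Gamma,\Gamma'}[\phi]=[\Omega_{y_1:\tau_1}\cdots\Omega_{y_m:\tau_m}\phi]$, $Eq_\Gamma=[x_1=_{\sigma_1}x_1'\otimes\dots\otimes x_n=_{\sigma_n}x_n']$ ($[e]$ for empty $\Gamma$). A classifying subprop-category of $(\mathcal{D},Q)$ is a subprop-category of the form $(\mathcal{C}_T,P_T)$ for an $\mathcal{L}^m$-theory $T$ (over any signature). Operators: $\mathbb{P}(\mathcal{X})$ = closure under products (componentwise $(\prod\mathcal{C}_i,\prod P_i)$); $\mathbb{S}(\mathcal{X})$ = closure under subprop-categories; $(\mathcal{D},Q)\in\mathbb{U}(\mathcal{X})$ iff every classifying subprop-category of $(\mathcal{D},Q)$ belongs to $\mathcal{X}$.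
   Formalization: Each monoid (P(c),⊗,e) is required to be an ordered monoid, i.e. ⊗ is monotone in the order of P(c); with merely a monoid structure Cut is unsound and the stated equality fails (e.g. Z/2 ordered by e<a over the terminal category). *)

theory Defs
  imports "HOL-Library.Equipollence" "HOL-Library.Countable_Set"
begin

section \<open>Languages, signatures, terms and formulas\<close>

record ('k, 'q) lang =
  conns :: "'k set"
  arity :: "'k \<Rightarrow> nat"
  quants :: "'q set"
  unit_c :: 'k
  tensor_c :: 'k

definition language :: "('k, 'q) lang \<Rightarrow> bool" where
  "language L \<longleftrightarrow> unit_c L \<in> conns L \<and> arity L (unit_c L) = 0 \<and>
     tensor_c L \<in> conns L \<and> arity L (tensor_c L) = 2"

record 'u signature =
  sorts :: "'u set"
  funs :: "'u set"
  fdom :: "'u \<Rightarrow> 'u list"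
  fcod :: "'u \<Rightarrow> 'u"
  rels :: "'u set"
  rdom :: "'u \<Rightarrow> 'u list"

definition is_sig :: "'u signature \<Rightarrow> bool" where
  "is_sig Sg \<longleftrightarrow> (\<forall>f\<in>funs Sg. set (fdom Sg f) \<subseteq> sorts Sg \<and> fcod Sg f \<in> sorts Sg) \<and>
     (\<forall>r\<in>rels Sg. set (rdom Sg r) \<subseteq> sorts Sg)"

text \<open>
  Syntax is taken up to renaming of variables, by de Bruijn indices.  A context is the list of its
  sorts with the most recently added variable at the head: the context written
  \<open>x\<^sub>1 : \<sigma>\<^sub>1, \<dots>, x\<^sub>n : \<sigma>\<^sub>n\<close> is the list \<open>[\<sigma>\<^sub>n, \<dots>, \<sigma>\<^sub>1]\<close>, and \<open>Var i\<close> is the variable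
  of sort \<open>\<Gamma> ! i\<close>.  The concatenation written \<open>\<Gamma>, \<Delta>\<close> is therefore the list \<open>\<Delta> @ \<Gamma>\<close>.  The
  argument sorts of function and relation symbols are listed in the same order as contexts.
\<close>

type_synonym 'u ctx = "'u list"

datatype 'u trm = Var nat | Fn 'u "'u trm list"

datatype ('u, 'k, 'q) fml =
    Rel 'u "'u trm list"
  | Equ 'u "'u trm" "'u trm"
  | Conn 'k "('u, 'k, 'q) fml list"
  | Quant 'q 'u "('u, 'k, 'q) fml"

definition is_ctx :: "'u signature \<Rightarrow> 'u ctx \<Rightarrow> bool" where
  "is_ctx Sg \<Gamma> \<longleftrightarrow> set \<Gamma> \<subseteq> sorts Sg"

inductive wt_trm :: "'u signature \<Rightarrow> 'u ctx \<Rightarrow> 'u trm \<Rightarrow> 'u \<Rightarrow> bool" for Sg \<Gamma> where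
  "i < length \<Gamma> \<Longrightarrow> wt_trm Sg \<Gamma> (Var i) (\<Gamma> ! i)"
| "f \<in> funs Sg \<Longrightarrow> list_all2 (wt_trm Sg \<Gamma>) Ms (fdom Sg f) \<Longrightarrow> wt_trm Sg \<Gamma> (Fn f Ms) (fcod Sg f)"

fun wt_fml :: "('k, 'q) lang \<Rightarrow> 'u signature \<Rightarrow> 'u ctx \<Rightarrow> ('u, 'k, 'q) fml \<Rightarrow> bool" where
  "wt_fml L Sg \<Gamma> (Rel r Ms) \<longleftrightarrow> r \<in> rels Sg \<and> list_all2 (wt_trm Sg \<Gamma>) Ms (rdom Sg r)"
| "wt_fml L Sg \<Gamma> (Equ \<sigma> M N) \<longleftrightarrow> \<sigma> \<in> sorts Sg \<and> wt_trm Sg \<Gamma> M \<sigma> \<and> wt_trm Sg \<Gamma> N \<sigma>"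
| "wt_fml L Sg \<Gamma> (Conn k \<phi>s) \<longleftrightarrow>
     k \<in> conns L \<and> length \<phi>s = arity L k \<and> (\<forall>\<phi>\<in>set \<phi>s. wt_fml L Sg \<Gamma> \<phi>)"
| "wt_fml L Sg \<Gamma> (Quant q \<tau> \<phi>) \<longleftrightarrow> q \<in> quants L \<and> \<tau> \<in> sorts Sg \<and> wt_fml L Sg (\<tau> # \<Gamma>) \<phi>"

fun tsub :: "(nat \<Rightarrow> 'u trm) \<Rightarrow> 'u trm \<Rightarrow> 'u trm" where
  "tsub s (Var i) = s i"
| "tsub s (Fn f Ms) = Fn f (map (tsub s) Ms)"

definition wk :: "nat \<Rightarrow> 'u trm" where
  "wk i = Var (Suc i)"

definition up :: "(nat \<Rightarrow> 'u trm) \<Rightarrow> nat \<Rightarrow> 'u trm" where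
  "up s i = (case i of 0 \<Rightarrow> Var 0 | Suc j \<Rightarrow> tsub wk (s j))"

fun fsub :: "(nat \<Rightarrow> 'u trm) \<Rightarrow> ('u, 'k, 'q) fml \<Rightarrow> ('u, 'k, 'q) fml" where
  "fsub s (Rel r Ms) = Rel r (map (tsub s) Ms)"
| "fsub s (Equ \<sigma> M N) = Equ \<sigma> (tsub s M) (tsub s N)"
| "fsub s (Conn k \<phi>s) = Conn k (map (fsub s) \<phi>s)"
| "fsub s (Quant q \<tau> \<phi>) = Quant q \<tau> (fsub (up s) \<phi>)"

definition inst :: "'u trm list \<Rightarrow> nat \<Rightarrow> 'u trm" where
  "inst Ms i = (if i < length Ms then Ms ! i else Var i)"

definition unit_f :: "('k, 'q) lang \<Rightarrow> ('u, 'k, 'q) fml" where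
  "unit_f L = Conn (unit_c L) []"

definition tensor_f ::
  "('k, 'q) lang \<Rightarrow> ('u, 'k, 'q) fml \<Rightarrow> ('u, 'k, 'q) fml \<Rightarrow> ('u, 'k, 'q) fml" where
  "tensor_f L \<phi> \<psi> = Conn (tensor_c L) [\<phi>, \<psi>]"


section \<open>Assertions, theories and the logic \<open>L\<^sup>m\<close>\<close>

text \<open>\<open>EqA \<Gamma> \<sigma> M N\<close> is \<open>M = N : \<sigma> [\<Gamma>]\<close> and \<open>SeqA \<Gamma> \<Phi> \<phi>\<close> is \<open>\<Phi> \<turnstile> \<phi> [\<Gamma>]\<close>.\<close>

datatype ('u, 'k, 'q) assertion =
    EqA "'u ctx" 'u "'u trm" "'u trm"
  | SeqA "'u ctx" "('u, 'k, 'q) fml list" "('u, 'k, 'q) fml"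

fun wf_assertion :: "('k, 'q) lang \<Rightarrow> 'u signature \<Rightarrow> ('u, 'k, 'q) assertion \<Rightarrow> bool" where
  "wf_assertion L Sg (EqA \<Gamma> \<sigma> M N) \<longleftrightarrow> is_ctx Sg \<Gamma> \<and> wt_trm Sg \<Gamma> M \<sigma> \<and> wt_trm Sg \<Gamma> N \<sigma>"
| "wf_assertion L Sg (SeqA \<Gamma> \<Phi> \<phi>) \<longleftrightarrow>
     is_ctx Sg \<Gamma> \<and> (\<forall>\<psi>\<in>set \<Phi>. wt_fml L Sg \<Gamma> \<psi>) \<and> wt_fml L Sg \<Gamma> \<phi>"

definition is_theory :: "('k, 'q) lang \<Rightarrow> 'u signature \<Rightarrow> ('u, 'k, 'q) assertion set \<Rightarrow> bool" where
  "is_theory L Sg T \<longleftrightarrow> (\<forall>a\<in>T. wf_assertion L Sg a)"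

text \<open>
  Substitution is simultaneous: the terms \<open>Ms\<close> in context \<open>\<Gamma>\<close> replace the variables of \<open>\<Delta>\<close>.
  In \<open>eq_subst\<close>, taking \<open>N' = N\<close> gives congruence of function symbols and weakening; in \<open>subst\<close>,
  taking \<open>Ms' = Ms\<close> gives plain substitution of terms into sequents.
\<close>

inductive Lm :: "('k, 'q) lang \<Rightarrow> 'u signature \<Rightarrow> ('u, 'k, 'q) assertion set \<Rightarrow>
    ('u, 'k, 'q) assertion \<Rightarrow> bool" for L Sg T where
  hyp: "a \<in> T \<Longrightarrow> Lm L Sg T a"
| eq_refl: "is_ctx Sg \<Gamma> \<Longrightarrow> wt_trm Sg \<Gamma> M \<sigma> \<Longrightarrow> Lm L Sg T (EqA \<Gamma> \<sigma> M M)"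
| eq_sym: "Lm L Sg T (EqA \<Gamma> \<sigma> M N) \<Longrightarrow> Lm L Sg T (EqA \<Gamma> \<sigma> N M)"
| eq_trans: "Lm L Sg T (EqA \<Gamma> \<sigma> M N) \<Longrightarrow> Lm L Sg T (EqA \<Gamma> \<sigma> N K) \<Longrightarrow> Lm L Sg T (EqA \<Gamma> \<sigma> M K)"
| eq_subst: "is_ctx Sg \<Gamma> \<Longrightarrow> Lm L Sg T (EqA \<Delta> \<sigma> N N') \<Longrightarrow>
    length Ms = length \<Delta> \<Longrightarrow> length Ms' = length \<Delta> \<Longrightarrow>
    (\<And>i. i < length \<Delta> \<Longrightarrow> Lm L Sg T (EqA \<Gamma> (\<Delta> ! i) (Ms ! i) (Ms' ! i))) \<Longrightarrow>
    Lm L Sg T (EqA \<Gamma> \<sigma> (tsub (inst Ms) N) (tsub (inst Ms') N'))"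
| ax: "is_ctx Sg \<Gamma> \<Longrightarrow> wt_fml L Sg \<Gamma> \<phi> \<Longrightarrow> Lm L Sg T (SeqA \<Gamma> [\<phi>] \<phi>)"
| cut: "Lm L Sg T (SeqA \<Gamma> \<Phi> \<phi>) \<Longrightarrow> Lm L Sg T (SeqA \<Gamma> (\<Psi> @ [\<phi>] @ \<Psi>') \<theta>) \<Longrightarrow>
    Lm L Sg T (SeqA \<Gamma> (\<Psi> @ \<Phi> @ \<Psi>') \<theta>)"
| weaken: "Lm L Sg T (SeqA \<Gamma> \<Phi> \<phi>) \<Longrightarrow> \<tau> \<in> sorts Sg \<Longrightarrow>
    Lm L Sg T (SeqA (\<tau> # \<Gamma>) (map (fsub wk) \<Phi>) (fsub wk \<phi>))"
| subst: "is_ctx Sg \<Gamma> \<Longrightarrow> Lm L Sg T (SeqA \<Delta> \<Phi> \<phi>) \<Longrightarrow>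
    length Ms = length \<Delta> \<Longrightarrow> length Ms' = length \<Delta> \<Longrightarrow>
    (\<And>i. i < length \<Delta> \<Longrightarrow> Lm L Sg T (EqA \<Gamma> (\<Delta> ! i) (Ms ! i) (Ms' ! i))) \<Longrightarrow>
    Lm L Sg T (SeqA \<Gamma> (map (fsub (inst Ms)) \<Phi>) (fsub (inst Ms') \<phi>))"
| conn_cong: "is_ctx Sg \<Gamma> \<Longrightarrow> k \<in> conns L \<Longrightarrow> length \<phi>s = arity L k \<Longrightarrow> length \<psi>s = arity L k \<Longrightarrow>
    (\<And>i. i < arity L k \<Longrightarrow> Lm L Sg T (SeqA \<Gamma> [\<phi>s ! i] (\<psi>s ! i))) \<Longrightarrow>
    (\<And>i. i < arity L k \<Longrightarrow> Lm L Sg T (SeqA \<Gamma> [\<psi>s ! i] (\<phi>s ! i))) \<Longrightarrow>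
    Lm L Sg T (SeqA \<Gamma> [Conn k \<phi>s] (Conn k \<psi>s))"
| quant_cong: "q \<in> quants L \<Longrightarrow> Lm L Sg T (SeqA (\<tau> # \<Gamma>) [\<phi>] \<psi>) \<Longrightarrow>
    Lm L Sg T (SeqA (\<tau> # \<Gamma>) [\<psi>] \<phi>) \<Longrightarrow>
    Lm L Sg T (SeqA \<Gamma> [Quant q \<tau> \<phi>] (Quant q \<tau> \<psi>))"
| tensor_in: "Lm L Sg T (SeqA \<Gamma> (\<Phi> @ [\<alpha>, \<beta>] @ \<Psi>) \<theta>) \<Longrightarrow>
    Lm L Sg T (SeqA \<Gamma> (\<Phi> @ [tensor_f L \<alpha> \<beta>] @ \<Psi>) \<theta>)"
| tensor_out: "Lm L Sg T (SeqA \<Gamma> (\<Phi> @ [tensor_f L \<alpha> \<beta>] @ \<Psi>) \<theta>) \<Longrightarrow>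
    Lm L Sg T (SeqA \<Gamma> (\<Phi> @ [\<alpha>, \<beta>] @ \<Psi>) \<theta>)"
| unit_in: "Lm L Sg T (SeqA \<Gamma> (\<Phi> @ \<Psi>) \<theta>) \<Longrightarrow> Lm L Sg T (SeqA \<Gamma> (\<Phi> @ [unit_f L] @ \<Psi>) \<theta>)"
| unit_out: "Lm L Sg T (SeqA \<Gamma> (\<Phi> @ [unit_f L] @ \<Psi>) \<theta>) \<Longrightarrow> Lm L Sg T (SeqA \<Gamma> (\<Phi> @ \<Psi>) \<theta>)"

definition Lm_theory :: "('k, 'q) lang \<Rightarrow> 'u signature \<Rightarrow> ('u, 'k, 'q) assertion set \<Rightarrow> bool" where
  "Lm_theory L Sg T \<longleftrightarrow> is_theory L Sg T \<and> (\<forall>a. Lm L Sg T a \<longrightarrow> a \<in> T)"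


section \<open>Prop-categories\<close>

record ('o, 'a) fpcat =
  ob :: "'o set"
  arr :: "'a set"
  dm :: "'a \<Rightarrow> 'o"
  cd :: "'a \<Rightarrow> 'o"
  idn :: "'o \<Rightarrow> 'a"
  comp :: "'a \<Rightarrow> 'a \<Rightarrow> 'a"  \<comment> \<open>\<open>comp C g f\<close> is \<open>g \<circ> f\<close>\<close>
  one :: 'o
  prd :: "'o \<Rightarrow> 'o \<Rightarrow> 'o"
  pr1 :: "'o \<Rightarrow> 'o \<Rightarrow> 'a"
  pr2 :: "'o \<Rightarrow> 'o \<Rightarrow> 'a"

text \<open>\<open>sub C f\<close> is \<open>P(f)\<close>; \<open>quant C q b c\<close> is the component \<open>P(b \<times> c) \<Rightarrow> P(b)\<close> of the quantifier \<open>q\<close>.\<close>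

record ('o, 'a, 'p, 'k, 'q) propcat = "('o, 'a) fpcat" +
  pred :: "'o \<Rightarrow> 'p set"
  le :: "'o \<Rightarrow> 'p \<Rightarrow> 'p \<Rightarrow> bool"
  sub :: "'a \<Rightarrow> 'p \<Rightarrow> 'p"
  conn :: "'o \<Rightarrow> 'k \<Rightarrow> 'p list \<Rightarrow> 'p"
  eqp :: "'o \<Rightarrow> 'p"
  quant :: "'q \<Rightarrow> 'o \<Rightarrow> 'o \<Rightarrow> 'p \<Rightarrow> 'p"

definition hom :: "('o, 'a, 'z) fpcat_scheme \<Rightarrow> 'o \<Rightarrow> 'o \<Rightarrow> 'a set" where
  "hom C b c = {f \<in> arr C. dm C f = b \<and> cd C f = c}"

definition is_category :: "('o, 'a, 'z) fpcat_scheme \<Rightarrow> bool" where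
  "is_category C \<longleftrightarrow>
     (\<forall>f\<in>arr C. dm C f \<in> ob C \<and> cd C f \<in> ob C) \<and>
     (\<forall>c\<in>ob C. idn C c \<in> hom C c c) \<and>
     (\<forall>f\<in>arr C. \<forall>g\<in>arr C. cd C f = dm C g \<longrightarrow> comp C g f \<in> hom C (dm C f) (cd C g)) \<and>
     (\<forall>f\<in>arr C. comp C f (idn C (dm C f)) = f \<and> comp C (idn C (cd C f)) f = f) \<and>
     (\<forall>f\<in>arr C. \<forall>g\<in>arr C. \<forall>h\<in>arr C. cd C f = dm C g \<longrightarrow> cd C g = dm C h \<longrightarrow>
        comp C h (comp C g f) = comp C (comp C h g) f)"

definition has_products :: "('o, 'a, 'z) fpcat_scheme \<Rightarrow> bool" where
  "has_products C \<longleftrightarrow>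
     one C \<in> ob C \<and> (\<forall>c\<in>ob C. \<exists>!f. f \<in> hom C c (one C)) \<and>
     (\<forall>b\<in>ob C. \<forall>c\<in>ob C. prd C b c \<in> ob C \<and>
        pr1 C b c \<in> hom C (prd C b c) b \<and> pr2 C b c \<in> hom C (prd C b c) c \<and>
        (\<forall>a\<in>ob C. \<forall>f\<in>hom C a b. \<forall>g\<in>hom C a c.
           \<exists>!h. h \<in> hom C a (prd C b c) \<and> comp C (pr1 C b c) h = f \<and> comp C (pr2 C b c) h = g))"

definition bang :: "('o, 'a, 'z) fpcat_scheme \<Rightarrow> 'o \<Rightarrow> 'a" where
  "bang C c = (THE f. f \<in> hom C c (one C))"

definition pair :: "('o, 'a, 'z) fpcat_scheme \<Rightarrow> 'a \<Rightarrow> 'a \<Rightarrow> 'a" where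
  "pair C f g = (THE h. h \<in> hom C (dm C f) (prd C (cd C f) (cd C g)) \<and>
     comp C (pr1 C (cd C f) (cd C g)) h = f \<and> comp C (pr2 C (cd C f) (cd C g)) h = g)"

text \<open>\<open>times_id C f c\<close> is \<open>f \<times> id\<^sub>c\<close>, and \<open>assoc C b c d\<close> is \<open>b \<times> (c \<times> d) \<rightarrow> (b \<times> c) \<times> d\<close>.\<close>

definition times_id :: "('o, 'a, 'z) fpcat_scheme \<Rightarrow> 'a \<Rightarrow> 'o \<Rightarrow> 'a" where
  "times_id C f c = pair C (comp C f (pr1 C (dm C f) c)) (pr2 C (dm C f) c)"

definition assoc :: "('o, 'a, 'z) fpcat_scheme \<Rightarrow> 'o \<Rightarrow> 'o \<Rightarrow> 'o \<Rightarrow> 'a" where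
  "assoc C b c d =
     pair C
       (pair C (pr1 C b (prd C c d)) (comp C (pr1 C c d) (pr2 C b (prd C c d))))
       (comp C (pr2 C c d) (pr2 C b (prd C c d)))"

definition is_inverse :: "('o, 'a, 'z) fpcat_scheme \<Rightarrow> 'a \<Rightarrow> 'a \<Rightarrow> bool" where
  "is_inverse C f g \<longleftrightarrow> f \<in> arr C \<and> g \<in> hom C (cd C f) (dm C f) \<and>
     comp C g f = idn C (dm C f) \<and> comp C f g = idn C (cd C f)"

definition is_iso :: "('o, 'a, 'z) fpcat_scheme \<Rightarrow> 'a \<Rightarrow> bool" where
  "is_iso C f \<longleftrightarrow> (\<exists>g. is_inverse C f g)"

definition inv_arr :: "('o, 'a, 'z) fpcat_scheme \<Rightarrow> 'a \<Rightarrow> 'a" where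
  "inv_arr C f = (THE g. is_inverse C f g)"

definition is_poset :: "'p set \<Rightarrow> ('p \<Rightarrow> 'p \<Rightarrow> bool) \<Rightarrow> bool" where
  "is_poset A r \<longleftrightarrow> (\<forall>x\<in>A. r x x) \<and>
     (\<forall>x\<in>A. \<forall>y\<in>A. r x y \<longrightarrow> r y x \<longrightarrow> x = y) \<and>
     (\<forall>x\<in>A. \<forall>y\<in>A. \<forall>z\<in>A. r x y \<longrightarrow> r y z \<longrightarrow> r x z)"

definition unit_p :: "('k, 'q) lang \<Rightarrow> ('o, 'a, 'p, 'k, 'q) propcat \<Rightarrow> 'o \<Rightarrow> 'p" where
  "unit_p L C c = conn C c (unit_c L) []"

definition tensor_p ::
  "('k, 'q) lang \<Rightarrow> ('o, 'a, 'p, 'k, 'q) propcat \<Rightarrow> 'o \<Rightarrow> 'p \<Rightarrow> 'p \<Rightarrow> 'p" where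
  "tensor_p L C c x y = conn C c (tensor_c L) [x, y]"

definition is_presheaf :: "('o, 'a, 'p, 'k, 'q) propcat \<Rightarrow> bool" where
  "is_presheaf C \<longleftrightarrow>
     (\<forall>c\<in>ob C. is_poset (pred C c) (le C c)) \<and>
     (\<forall>f\<in>arr C. \<forall>x\<in>pred C (cd C f). sub C f x \<in> pred C (dm C f)) \<and>
     (\<forall>f\<in>arr C. \<forall>x\<in>pred C (cd C f). \<forall>y\<in>pred C (cd C f).
        le C (cd C f) x y \<longrightarrow> le C (dm C f) (sub C f x) (sub C f y)) \<and>
     (\<forall>c\<in>ob C. \<forall>x\<in>pred C c. sub C (idn C c) x = x) \<and>
     (\<forall>f\<in>arr C. \<forall>g\<in>arr C. cd C f = dm C g \<longrightarrow>
        (\<forall>x\<in>pred C (cd C g). sub C (comp C g f) x = sub C f (sub C g x)))"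

definition has_connectives :: "('k, 'q) lang \<Rightarrow> ('o, 'a, 'p, 'k, 'q) propcat \<Rightarrow> bool" where
  "has_connectives L C \<longleftrightarrow>
     (\<forall>c\<in>ob C. \<forall>k\<in>conns L. \<forall>xs\<in>lists (pred C c). length xs = arity L k \<longrightarrow>
        conn C c k xs \<in> pred C c) \<and>
     (\<forall>f\<in>arr C. \<forall>k\<in>conns L. \<forall>xs\<in>lists (pred C (cd C f)). length xs = arity L k \<longrightarrow>
        sub C f (conn C (cd C f) k xs) = conn C (dm C f) k (map (sub C f) xs))"

text \<open>
  \<open>P(c)\<close> is an object of \<open>Pos\<close>, and its monoid structure is one in \<open>Pos\<close>: the multiplication is
  monotone.  Cut is unsound otherwise.  No other connective, and no quantifier, need be monotone.
\<close>

definition has_monoids :: "('k, 'q) lang \<Rightarrow> ('o, 'a, 'p, 'k, 'q) propcat \<Rightarrow> bool" where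
  "has_monoids L C \<longleftrightarrow> (\<forall>c\<in>ob C.
     (\<forall>x\<in>pred C c. tensor_p L C c (unit_p L C c) x = x \<and> tensor_p L C c x (unit_p L C c) = x) \<and>
     (\<forall>x\<in>pred C c. \<forall>y\<in>pred C c. \<forall>z\<in>pred C c.
        tensor_p L C c (tensor_p L C c x y) z = tensor_p L C c x (tensor_p L C c y z)) \<and>
     (\<forall>x\<in>pred C c. \<forall>x'\<in>pred C c. \<forall>y\<in>pred C c. \<forall>y'\<in>pred C c. le C c x x' \<longrightarrow> le C c y y' \<longrightarrow>
        le C c (tensor_p L C c x y) (tensor_p L C c x' y')))"

definition has_quantifiers :: "('k, 'q) lang \<Rightarrow> ('o, 'a, 'p, 'k, 'q) propcat \<Rightarrow> bool" where
  "has_quantifiers L C \<longleftrightarrow> (\<forall>q\<in>quants L.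
     (\<forall>b\<in>ob C. \<forall>c\<in>ob C. \<forall>x\<in>pred C (prd C b c). quant C q b c x \<in> pred C b) \<and>
     (\<forall>f\<in>arr C. \<forall>c\<in>ob C. \<forall>x\<in>pred C (prd C (cd C f) c).
        sub C f (quant C q (cd C f) c x) = quant C q (dm C f) c (sub C (times_id C f c) x)) \<and>
     (\<forall>b\<in>ob C. \<forall>x\<in>pred C b. quant C q b (one C) (sub C (pr1 C b (one C)) x) = x) \<and>
     (\<forall>b\<in>ob C. \<forall>c\<in>ob C. \<forall>d\<in>ob C. \<forall>x\<in>pred C (prd C (prd C b c) d).
        quant C q b (prd C c d) (sub C (assoc C b c d) x) =
        quant C q b c (quant C q (prd C b c) d x)))"

definition has_equality :: "('k, 'q) lang \<Rightarrow> ('o, 'a, 'p, 'k, 'q) propcat \<Rightarrow> bool" where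
  "has_equality L C \<longleftrightarrow>
     (\<forall>c\<in>ob C. eqp C c \<in> pred C (prd C c c)) \<and>
     eqp C (one C) = unit_p L C (prd C (one C) (one C)) \<and>
     (\<forall>c\<in>ob C. \<forall>d\<in>ob C. let e = prd C c d; p = pr1 C e e; p' = pr2 C e e in
        eqp C e = tensor_p L C (prd C e e)
          (sub C (pair C (comp C (pr1 C c d) p) (comp C (pr1 C c d) p')) (eqp C c))
          (sub C (pair C (comp C (pr2 C c d) p) (comp C (pr2 C c d) p')) (eqp C d)))"

definition is_propcat :: "('k, 'q) lang \<Rightarrow> ('o, 'a, 'p, 'k, 'q) propcat \<Rightarrow> bool" where
  "is_propcat L C \<longleftrightarrow> is_category C \<and> has_products C \<and> is_presheaf C \<and> has_connectives L C \<and>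
     has_monoids L C \<and> has_quantifiers L C \<and> has_equality L C"


section \<open>Morphisms, isomorphic copies and products\<close>

record ('o, 'a, 'p, 'o', 'a', 'p') pmor =
  mo :: "'o \<Rightarrow> 'o'"
  ma :: "'a \<Rightarrow> 'a'"
  mp :: "'o \<Rightarrow> 'p \<Rightarrow> 'p'"

text \<open>The canonical comparison \<open>F(b \<times> c) \<rightarrow> F(b) \<times> F(c)\<close>.\<close>

definition cmp ::
  "('o, 'a, 'p, 'k, 'q) propcat \<Rightarrow> ('o', 'a', 'p', 'k, 'q) propcat \<Rightarrow>
   ('o, 'a, 'p, 'o', 'a', 'p') pmor \<Rightarrow> 'o \<Rightarrow> 'o \<Rightarrow> 'a'" where
  "cmp C D F b c = pair D (ma F (pr1 C b c)) (ma F (pr2 C b c))"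

definition is_functor ::
  "('o, 'a, 'p, 'k, 'q) propcat \<Rightarrow> ('o', 'a', 'p', 'k, 'q) propcat \<Rightarrow>
   ('o, 'a, 'p, 'o', 'a', 'p') pmor \<Rightarrow> bool" where
  "is_functor C D F \<longleftrightarrow>
     (\<forall>c\<in>ob C. mo F c \<in> ob D \<and> ma F (idn C c) = idn D (mo F c)) \<and>
     (\<forall>f\<in>arr C. ma F f \<in> hom D (mo F (dm C f)) (mo F (cd C f))) \<and>
     (\<forall>f\<in>arr C. \<forall>g\<in>arr C. cd C f = dm C g \<longrightarrow> ma F (comp C g f) = comp D (ma F g) (ma F f)) \<and>
     is_iso D (bang D (mo F (one C))) \<and>
     (\<forall>b\<in>ob C. \<forall>c\<in>ob C. is_iso D (cmp C D F b c))"

definition is_morphism ::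
  "('k, 'q) lang \<Rightarrow> ('o, 'a, 'p, 'k, 'q) propcat \<Rightarrow> ('o', 'a', 'p', 'k, 'q) propcat \<Rightarrow>
   ('o, 'a, 'p, 'o', 'a', 'p') pmor \<Rightarrow> bool" where
  "is_morphism L C D F \<longleftrightarrow> is_functor C D F \<and>
     (\<forall>c\<in>ob C. \<forall>x\<in>pred C c. mp F c x \<in> pred D (mo F c)) \<and>
     (\<forall>c\<in>ob C. \<forall>x\<in>pred C c. \<forall>y\<in>pred C c. le C c x y \<longrightarrow> le D (mo F c) (mp F c x) (mp F c y)) \<and>
     (\<forall>f\<in>arr C. \<forall>x\<in>pred C (cd C f). mp F (dm C f) (sub C f x) = sub D (ma F f) (mp F (cd C f) x)) \<and>
     (\<forall>c\<in>ob C. \<forall>k\<in>conns L. \<forall>xs\<in>lists (pred C c). length xs = arity L k \<longrightarrow>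
        mp F c (conn C c k xs) = conn D (mo F c) k (map (mp F c) xs)) \<and>
     (\<forall>q\<in>quants L. \<forall>b\<in>ob C. \<forall>c\<in>ob C. \<forall>x\<in>pred C (prd C b c).
        mp F b (quant C q b c x) =
        quant D q (mo F b) (mo F c) (sub D (inv_arr D (cmp C D F b c)) (mp F (prd C b c) x))) \<and>
     (\<forall>c\<in>ob C. mp F (prd C c c) (eqp C c) = sub D (cmp C D F c c) (eqp D (mo F c)))"

definition is_inclusion ::
  "('k, 'q) lang \<Rightarrow> ('o, 'a, 'p, 'k, 'q) propcat \<Rightarrow> ('o', 'a', 'p', 'k, 'q) propcat \<Rightarrow>
   ('o, 'a, 'p, 'o', 'a', 'p') pmor \<Rightarrow> bool" where
  "is_inclusion L E D F \<longleftrightarrow> is_morphism L E D F \<and>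
     (\<forall>b\<in>ob E. \<forall>c\<in>ob E. inj_on (ma F) (hom E b c)) \<and>
     (\<forall>c\<in>ob E. \<forall>x\<in>pred E c. \<forall>y\<in>pred E c. le D (mo F c) (mp F c x) (mp F c y) \<longrightarrow> le E c x y)"

definition is_sub ::
  "('k, 'q) lang \<Rightarrow> ('o, 'a, 'p, 'k, 'q) propcat \<Rightarrow> ('o', 'a', 'p', 'k, 'q) propcat \<Rightarrow> bool" where
  "is_sub L E D \<longleftrightarrow> (\<exists>F. is_inclusion L E D F)"

text \<open>
  \<open>E\<close> is a copy of \<open>C\<close> if it arises from \<open>C\<close> by renaming objects, arrows and predicates; the
  designated products are preserved on the nose.  This is needed only because products of
  prop-categories and classifying prop-categories are built over other types than their
  ingredients.
\<close>

definition is_copy ::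
  "('k, 'q) lang \<Rightarrow> ('o, 'a, 'p, 'k, 'q) propcat \<Rightarrow> ('o', 'a', 'p', 'k, 'q) propcat \<Rightarrow> bool" where
  "is_copy L E C \<longleftrightarrow> (\<exists>F. is_inclusion L E C F \<and>
     bij_betw (mo F) (ob E) (ob C) \<and> bij_betw (ma F) (arr E) (arr C) \<and>
     (\<forall>c\<in>ob E. bij_betw (mp F c) (pred E c) (pred C (mo F c))) \<and>
     mo F (one E) = one C \<and>
     (\<forall>b\<in>ob E. \<forall>c\<in>ob E. mo F (prd E b c) = prd C (mo F b) (mo F c) \<and>
        ma F (pr1 E b c) = pr1 C (mo F b) (mo F c) \<and>
        ma F (pr2 E b c) = pr2 C (mo F b) (mo F c)))"

definition prod_propcat ::
  "'i set \<Rightarrow> ('i \<Rightarrow> ('o, 'a, 'p, 'k, 'q) propcat) \<Rightarrow>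
   ('i \<Rightarrow> 'o, 'i \<Rightarrow> 'a, 'i \<Rightarrow> 'p, 'k, 'q) propcat" where
  "prod_propcat I C = \<lparr>
     ob = (\<Pi>\<^sub>E i\<in>I. ob (C i)),
     arr = (\<Pi>\<^sub>E i\<in>I. arr (C i)),
     dm = (\<lambda>f. \<lambda>i\<in>I. dm (C i) (f i)),
     cd = (\<lambda>f. \<lambda>i\<in>I. cd (C i) (f i)),
     idn = (\<lambda>c. \<lambda>i\<in>I. idn (C i) (c i)),
     comp = (\<lambda>g f. \<lambda>i\<in>I. comp (C i) (g i) (f i)),
     one = (\<lambda>i\<in>I. one (C i)),
     prd = (\<lambda>b c. \<lambda>i\<in>I. prd (C i) (b i) (c i)),
     pr1 = (\<lambda>b c. \<lambda>i\<in>I. pr1 (C i) (b i) (c i)),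
     pr2 = (\<lambda>b c. \<lambda>i\<in>I. pr2 (C i) (b i) (c i)),
     pred = (\<lambda>c. \<Pi>\<^sub>E i\<in>I. pred (C i) (c i)),
     le = (\<lambda>c x y. \<forall>i\<in>I. le (C i) (c i) (x i) (y i)),
     sub = (\<lambda>f x. \<lambda>i\<in>I. sub (C i) (f i) (x i)),
     conn = (\<lambda>c k xs. \<lambda>i\<in>I. conn (C i) (c i) k (map (\<lambda>x. x i) xs)),
     eqp = (\<lambda>c. \<lambda>i\<in>I. eqp (C i) (c i)),
     quant = (\<lambda>q b c x. \<lambda>i\<in>I. quant (C i) q (b i) (c i) (x i)) \<rparr>"


section \<open>Structures and satisfaction\<close>

record ('u, 'o, 'a, 'p) struc =
  isort :: "'u \<Rightarrow> 'o"
  ifun :: "'u \<Rightarrow> 'a"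
  irel :: "'u \<Rightarrow> 'p"

fun ctx_ob :: "('o, 'a, 'z) fpcat_scheme \<Rightarrow> ('u, 'o, 'a, 'p) struc \<Rightarrow> 'u ctx \<Rightarrow> 'o" where
  "ctx_ob C M [] = one C"
| "ctx_ob C M (\<tau> # \<Gamma>) = prd C (ctx_ob C M \<Gamma>) (isort M \<tau>)"

definition is_struc ::
  "('o, 'a, 'p, 'k, 'q) propcat \<Rightarrow> 'u signature \<Rightarrow> ('u, 'o, 'a, 'p) struc \<Rightarrow> bool" where
  "is_struc C Sg M \<longleftrightarrow>
     (\<forall>\<sigma>\<in>sorts Sg. isort M \<sigma> \<in> ob C) \<and>
     (\<forall>f\<in>funs Sg. ifun M f \<in> hom C (ctx_ob C M (fdom Sg f)) (isort M (fcod Sg f))) \<and>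
     (\<forall>r\<in>rels Sg. irel M r \<in> pred C (ctx_ob C M (rdom Sg r)))"

fun var_arr :: "('o, 'a, 'z) fpcat_scheme \<Rightarrow> ('u, 'o, 'a, 'p) struc \<Rightarrow> 'u ctx \<Rightarrow> nat \<Rightarrow> 'a" where
  "var_arr C M [] i = undefined"
| "var_arr C M (\<tau> # \<Gamma>) 0 = pr2 C (ctx_ob C M \<Gamma>) (isort M \<tau>)"
| "var_arr C M (\<tau> # \<Gamma>) (Suc i) = comp C (var_arr C M \<Gamma> i) (pr1 C (ctx_ob C M \<Gamma>) (isort M \<tau>))"

fun tuple :: "('o, 'a, 'z) fpcat_scheme \<Rightarrow> 'o \<Rightarrow> 'a list \<Rightarrow> 'a" where
  "tuple C b [] = bang C b"
| "tuple C b (f # fs) = pair C (tuple C b fs) f"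

fun trm_arr :: "('o, 'a, 'z) fpcat_scheme \<Rightarrow> ('u, 'o, 'a, 'p) struc \<Rightarrow> 'u ctx \<Rightarrow> 'u trm \<Rightarrow> 'a" where
  "trm_arr C M \<Gamma> (Var i) = var_arr C M \<Gamma> i"
| "trm_arr C M \<Gamma> (Fn f Ms) = comp C (ifun M f) (tuple C (ctx_ob C M \<Gamma>) (map (trm_arr C M \<Gamma>) Ms))"

fun fml_val :: "('o, 'a, 'p, 'k, 'q) propcat \<Rightarrow> ('u, 'o, 'a, 'p) struc \<Rightarrow> 'u ctx \<Rightarrow>
    ('u, 'k, 'q) fml \<Rightarrow> 'p" where
  "fml_val C M \<Gamma> (Rel r Ms) = sub C (tuple C (ctx_ob C M \<Gamma>) (map (trm_arr C M \<Gamma>) Ms)) (irel M r)"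
| "fml_val C M \<Gamma> (Equ \<sigma> N K) = sub C (pair C (trm_arr C M \<Gamma> N) (trm_arr C M \<Gamma> K)) (eqp C (isort M \<sigma>))"
| "fml_val C M \<Gamma> (Conn k \<phi>s) = conn C (ctx_ob C M \<Gamma>) k (map (fml_val C M \<Gamma>) \<phi>s)"
| "fml_val C M \<Gamma> (Quant q \<tau> \<phi>) = quant C q (ctx_ob C M \<Gamma>) (isort M \<tau>) (fml_val C M (\<tau> # \<Gamma>) \<phi>)"

fun satisfies :: "('k, 'q) lang \<Rightarrow> ('o, 'a, 'p, 'k, 'q) propcat \<Rightarrow> ('u, 'o, 'a, 'p) struc \<Rightarrow>
    ('u, 'k, 'q) assertion \<Rightarrow> bool" where
  "satisfies L C M (EqA \<Gamma> \<sigma> N K) \<longleftrightarrow> trm_arr C M \<Gamma> N = trm_arr C M \<Gamma> K"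
| "satisfies L C M (SeqA \<Gamma> \<Phi> \<phi>) \<longleftrightarrow>
     le C (ctx_ob C M \<Gamma>)
       (foldr (tensor_p L C (ctx_ob C M \<Gamma>)) (map (fml_val C M \<Gamma>) \<Phi>) (unit_p L C (ctx_ob C M \<Gamma>)))
       (fml_val C M \<Gamma> \<phi>)"

definition is_model :: "('k, 'q) lang \<Rightarrow> ('o, 'a, 'p, 'k, 'q) propcat \<Rightarrow> 'u signature \<Rightarrow>
    ('u, 'k, 'q) assertion set \<Rightarrow> ('u, 'o, 'a, 'p) struc \<Rightarrow> bool" where
  "is_model L C Sg T M \<longleftrightarrow> is_struc C Sg M \<and> (\<forall>a\<in>T. satisfies L C M a)"

text \<open>A logic, as the relation \<open>T \<turnstile> T'\<close> between theories over a common signature.\<close>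

type_synonym ('u, 'k, 'q) logic =
  "'u signature \<Rightarrow> ('u, 'k, 'q) assertion set \<Rightarrow> ('u, 'k, 'q) assertion set \<Rightarrow> bool"

definition entails ::
  "('k, 'q) lang \<Rightarrow> ('o, 'a, 'p, 'k, 'q) propcat set \<Rightarrow> ('u, 'k, 'q) logic" where
  "entails L X Sg T T' \<longleftrightarrow>
     (\<forall>C\<in>X. \<forall>M. is_model L C Sg T M \<longrightarrow> (\<forall>a\<in>T'. satisfies L C M a))"


section \<open>Classifying prop-categories\<close>

definition trms_class :: "('u, 'k, 'q) assertion set \<Rightarrow> 'u ctx \<Rightarrow> 'u ctx \<Rightarrow> 'u trm list \<Rightarrow>
    'u trm list set" where
  "trms_class T \<Gamma> \<Delta> Ms = {Ns. length Ns = length \<Delta> \<and>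
     (\<forall>i<length \<Delta>. EqA \<Gamma> (\<Delta> ! i) (Ms ! i) (Ns ! i) \<in> T)}"

definition fml_class :: "('u, 'k, 'q) assertion set \<Rightarrow> 'u ctx \<Rightarrow> ('u, 'k, 'q) fml \<Rightarrow>
    ('u, 'k, 'q) fml set" where
  "fml_class T \<Gamma> \<phi> = {\<psi>. SeqA \<Gamma> [\<phi>] \<psi> \<in> T \<and> SeqA \<Gamma> [\<psi>] \<phi> \<in> T}"

definition rep :: "'x set \<Rightarrow> 'x" where
  "rep A = (SOME x. x \<in> A)"

definition cl_arr :: "('u, 'k, 'q) assertion set \<Rightarrow> 'u ctx \<Rightarrow> 'u ctx \<Rightarrow> 'u trm list \<Rightarrow>
    'u ctx \<times> 'u ctx \<times> 'u trm list set" where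
  "cl_arr T \<Gamma> \<Delta> Ms = (\<Gamma>, \<Delta>, trms_class T \<Gamma> \<Delta> Ms)"

fun tensor_list :: "('k, 'q) lang \<Rightarrow> ('u, 'k, 'q) fml list \<Rightarrow> ('u, 'k, 'q) fml" where
  "tensor_list L [] = unit_f L"
| "tensor_list L [\<phi>] = \<phi>"
| "tensor_list L (\<phi> # \<psi> # \<phi>s) = tensor_f L \<phi> (tensor_list L (\<psi> # \<phi>s))"

text \<open>
  In the context \<open>\<Gamma> @ \<Gamma>\<close> (\<open>\<Gamma>\<close> followed by a second copy of \<open>\<Gamma>\<close>), \<open>Var (length \<Gamma> + i)\<close> is a variable
  of the first copy and \<open>Var i\<close> the corresponding variable of the second.  The reversal lists the
  equations beginning with the first variable of \<open>\<Gamma>\<close> in the usual order.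
\<close>

definition eq_fml :: "('k, 'q) lang \<Rightarrow> 'u ctx \<Rightarrow> ('u, 'k, 'q) fml" where
  "eq_fml L \<Gamma> = tensor_list L
     (map (\<lambda>i. Equ (\<Gamma> ! i) (Var (length \<Gamma> + i)) (Var i)) (rev [0..<length \<Gamma>]))"

fun quants_fml :: "'q \<Rightarrow> 'u ctx \<Rightarrow> ('u, 'k, 'q) fml \<Rightarrow> ('u, 'k, 'q) fml" where
  "quants_fml q [] \<phi> = \<phi>"
| "quants_fml q (\<tau> # \<Delta>) \<phi> = quants_fml q \<Delta> (Quant q \<tau> \<phi>)"

definition classifying :: "('k, 'q) lang \<Rightarrow> 'u signature \<Rightarrow> ('u, 'k, 'q) assertion set \<Rightarrow>
    ('u ctx, 'u ctx \<times> 'u ctx \<times> 'u trm list set, ('u, 'k, 'q) fml set, 'k, 'q) propcat" where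
  "classifying L Sg T = \<lparr>
     ob = {\<Gamma>. is_ctx Sg \<Gamma>},
     arr = {cl_arr T \<Gamma> \<Delta> Ms | \<Gamma> \<Delta> Ms.
       is_ctx Sg \<Gamma> \<and> is_ctx Sg \<Delta> \<and> list_all2 (wt_trm Sg \<Gamma>) Ms \<Delta>},
     dm = (\<lambda>(\<Gamma>, \<Delta>, A). \<Gamma>),
     cd = (\<lambda>(\<Gamma>, \<Delta>, A). \<Delta>),
     idn = (\<lambda>\<Gamma>. cl_arr T \<Gamma> \<Gamma> (map Var [0..<length \<Gamma>])),
     comp = (\<lambda>(\<Delta>, \<Theta>, B) (\<Gamma>, \<Delta>', A). cl_arr T \<Gamma> \<Theta> (map (tsub (inst (rep A))) (rep B))),
     one = [],
     prd = (\<lambda>\<Gamma> \<Delta>. \<Delta> @ \<Gamma>),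
     pr1 = (\<lambda>\<Gamma> \<Delta>. cl_arr T (\<Delta> @ \<Gamma>) \<Gamma> (map (\<lambda>i. Var (length \<Delta> + i)) [0..<length \<Gamma>])),
     pr2 = (\<lambda>\<Gamma> \<Delta>. cl_arr T (\<Delta> @ \<Gamma>) \<Delta> (map Var [0..<length \<Delta>])),
     pred = (\<lambda>\<Gamma>. {fml_class T \<Gamma> \<phi> | \<phi>. wt_fml L Sg \<Gamma> \<phi>}),
     le = (\<lambda>\<Gamma> A B. SeqA \<Gamma> [rep A] (rep B) \<in> T),
     sub = (\<lambda>(\<Gamma>, \<Delta>, A) B. fml_class T \<Gamma> (fsub (inst (rep A)) (rep B))),
     conn = (\<lambda>\<Gamma> k As. fml_class T \<Gamma> (Conn k (map rep As))),
     eqp = (\<lambda>\<Gamma>. fml_class T (\<Gamma> @ \<Gamma>) (eq_fml L \<Gamma>)),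
     quant = (\<lambda>q \<Gamma> \<Delta> A. fml_class T \<Gamma> (quants_fml q \<Delta> (rep A))) \<rparr>"


section \<open>Smallness\<close>

text \<open>
  Two notions of smallness for subsets of a fixed type of urelements: \<open>small\<close> for signatures and
  index sets of products, \<open>fits\<close> for the carriers of prop-categories.  With \<open>small\<close> and \<open>fits\<close> both
  the sets of a Grothendieck universe containing an infinite set, this is smallness in the usual
  sense.  The two are kept apart because for \<open>small = fits\<close> the assumptions say that an
  inaccessible cardinal exists, whereas the general form is realised in HOL itself, as
  \<open>universe_nat_bool\<close> below shows.
\<close>

definition universe :: "('u set \<Rightarrow> bool) \<Rightarrow> ('u set \<Rightarrow> bool) \<Rightarrow> bool" where
  "universe small fits \<longleftrightarrow>
     (\<exists>A. small A \<and> infinite A) \<and>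
     (\<forall>A B. small A \<longrightarrow> B \<lesssim> A \<longrightarrow> small B) \<and>
     (\<forall>A B. small A \<longrightarrow> small B \<longrightarrow> small (A \<union> B)) \<and>
     (\<forall>A. small A \<longrightarrow> fits A) \<and>
     (\<forall>A B. fits A \<longrightarrow> B \<lesssim> A \<longrightarrow> fits B) \<and>
     (\<forall>I A. small I \<longrightarrow> (\<forall>i\<in>I. fits (A i)) \<longrightarrow> (\<exists>B. fits B \<and> (\<Pi>\<^sub>E i\<in>I. A i) \<lesssim> B))"

lemma universe_nat_bool: "universe countable (\<lambda>_ :: (nat \<Rightarrow> bool) set. True)"
proof -
  have inf: "infinite (range (\<lambda>n::nat. (=) n))"
    by (rule range_inj_infinite) (auto simp: inj_def fun_eq_iff)
  have cnt: "countable B" if "countable A" "B \<lesssim> A" for A B :: "(nat \<Rightarrow> bool) set"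
    using that by (meson countable_image_inj_on countable_subset lepoll_def)
  have PiE: "(\<Pi>\<^sub>E i\<in>I. A i) \<lesssim> (UNIV :: (nat \<Rightarrow> bool) set)" if I: "countable I"
    for I :: "(nat \<Rightarrow> bool) set" and A :: "(nat \<Rightarrow> bool) \<Rightarrow> (nat \<Rightarrow> bool) set"
  proof -
    define c where "c f n = f (from_nat_into I (fst (prod_decode n))) (snd (prod_decode n))"
      for f :: "(nat \<Rightarrow> bool) \<Rightarrow> nat \<Rightarrow> bool" and n
    have "f = g" if f: "f \<in> (\<Pi>\<^sub>E i\<in>I. A i)" and g: "g \<in> (\<Pi>\<^sub>E i\<in>I. A i)" and eq: "c f = c g" for f g
    proof (rule PiE_ext[OF f g])
      fix i assume i: "i \<in> I"
      have "f i m = g i m" for m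
        using fun_cong[OF eq, of "prod_encode (to_nat_on I i, m)"] i I by (simp add: c_def)
      then show "f i = g i" by blast
    qed
    then have "inj_on c (\<Pi>\<^sub>E i\<in>I. A i)" by (auto intro: inj_onI)
    then show ?thesis unfolding lepoll_def by blast
  qed
  have "\<exists>A :: (nat \<Rightarrow> bool) set. countable A \<and> infinite A"
    using inf by (intro exI[of _ "range (\<lambda>n::nat. (=) n)"]) simp
  then show ?thesis
    unfolding universe_def using cnt PiE by blast
qed

definition small_language :: "('u set \<Rightarrow> bool) \<Rightarrow> ('k, 'q) lang \<Rightarrow> bool" where
  "small_language small L \<longleftrightarrow> (\<exists>A. small A \<and> conns L \<lesssim> A) \<and> (\<exists>A. small A \<and> quants L \<lesssim> A)"

definition small_sig :: "('u set \<Rightarrow> bool) \<Rightarrow> 'u signature \<Rightarrow> bool" where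
  "small_sig small Sg \<longleftrightarrow> is_sig Sg \<and> small (sorts Sg) \<and> small (funs Sg) \<and> small (rels Sg)"

type_synonym ('u, 'k, 'q) upropcat = "('u, 'u, 'u, 'k, 'q) propcat"


section \<open>Classes of prop-categories\<close>

definition ObFA :: "('k, 'q) lang \<Rightarrow> ('u set \<Rightarrow> bool) \<Rightarrow> ('u, 'k, 'q) upropcat set" where
  "ObFA L fits = {C. is_propcat L C \<and> fits (ob C) \<and> fits (arr C) \<and> (\<forall>c\<in>ob C. fits (pred C c))}"

definition ObFA_logic :: "('k, 'q) lang \<Rightarrow> ('u set \<Rightarrow> bool) \<Rightarrow> ('u set \<Rightarrow> bool) \<Rightarrow>
    ('u, 'k, 'q) logic \<Rightarrow> ('u, 'k, 'q) upropcat set" where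
  "ObFA_logic L small fits \<L> = {D \<in> ObFA L fits.
     \<forall>Sg T T'. small_sig small Sg \<longrightarrow> is_theory L Sg T \<longrightarrow> is_theory L Sg T' \<longrightarrow>
       \<L> Sg T T' \<longrightarrow> entails L {D} Sg T T'}"

inductive_set PP :: "('k, 'q) lang \<Rightarrow> ('u set \<Rightarrow> bool) \<Rightarrow> ('u set \<Rightarrow> bool) \<Rightarrow>
    ('u, 'k, 'q) upropcat set \<Rightarrow> ('u, 'k, 'q) upropcat set"
  for L small fits X where
  base: "C \<in> X \<Longrightarrow> C \<in> PP L small fits X"
| prod: "small (I :: 'u set) \<Longrightarrow> (\<And>i. i \<in> I \<Longrightarrow> C i \<in> PP L small fits X) \<Longrightarrow>
    E \<in> ObFA L fits \<Longrightarrow> is_copy L E (prod_propcat I C) \<Longrightarrow> E \<in> PP L small fits X"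

inductive_set SS :: "('k, 'q) lang \<Rightarrow> ('u set \<Rightarrow> bool) \<Rightarrow>
    ('u, 'k, 'q) upropcat set \<Rightarrow> ('u, 'k, 'q) upropcat set"
  for L fits X where
  base: "C \<in> X \<Longrightarrow> C \<in> SS L fits X"
| sub: "D \<in> SS L fits X \<Longrightarrow> E \<in> ObFA L fits \<Longrightarrow> is_sub L E D \<Longrightarrow> E \<in> SS L fits X"

definition is_classifying_sub :: "('k, 'q) lang \<Rightarrow> ('u set \<Rightarrow> bool) \<Rightarrow> ('u set \<Rightarrow> bool) \<Rightarrow>
    ('u, 'k, 'q) upropcat \<Rightarrow> ('u, 'k, 'q) upropcat \<Rightarrow> bool" where
  "is_classifying_sub L small fits E D \<longleftrightarrow> E \<in> ObFA L fits \<and> is_sub L E D \<and>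
     (\<exists>Sg T. small_sig small Sg \<and> Lm_theory L Sg T \<and> is_copy L E (classifying L Sg T))"

definition UU :: "('k, 'q) lang \<Rightarrow> ('u set \<Rightarrow> bool) \<Rightarrow> ('u set \<Rightarrow> bool) \<Rightarrow>
    ('u, 'k, 'q) upropcat set \<Rightarrow> ('u, 'k, 'q) upropcat set" where
  "UU L small fits X = {D \<in> ObFA L fits. \<forall>E. is_classifying_sub L small fits E D \<longrightarrow> E \<in> X}"

end

theory Submission
  imports Defs
begin

text \<open>
  Both inclusions rest on the classifying prop-category of a structure.  Let \<open>M\<close> be a structure in
  \<open>D\<close> and \<open>Th\<close> the set of assertions that it satisfies.  \<open>Th\<close> is an \<open>L\<^sup>m\<close>-theory, interpretation in \<open>M\<close>
  is an inclusion of the classifying prop-category of \<open>Th\<close> into \<open>D\<close>, and the generic model satisfies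
  exactly \<open>Th\<close>.  Satisfaction is moreover preserved and reflected along inclusions and is computed
  componentwise in products, so that entailment passes from \<open>X\<close> to \<open>SS (PP X)\<close>.

  If \<open>D\<close> lies in \<open>UU (SS (PP X))\<close> and \<open>M\<close> is a model of \<open>T\<close> in \<open>D\<close>, then the classifying prop-category of
  \<open>Th\<close> lies in \<open>SS (PP X)\<close>, and its generic model is a model of \<open>T\<close>; so \<open>Th\<close> contains every consequence
  of \<open>T\<close> over \<open>X\<close>.  Conversely, let \<open>E\<close> be the classifying prop-category of \<open>T\<close>, contained in a \<open>D\<close>
  that validates the consequences over \<open>X\<close>.  Each assertion outside \<open>T\<close> fails in the generic model,
  hence has a countermodel of \<open>T\<close> in \<open>X\<close>.  The theory of the product of all these countermodels
  is \<open>T\<close>, so \<open>E\<close> is included in a product of members of \<open>X\<close>.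
\<close>

section \<open>Finite products\<close>

text \<open>Little of the algebra of classifying prop-categories is derived inside
  \<open>Lm\<close>. For the theory of a structure most axioms are pulled back along the
  interpretation, which is faithful and an order embedding. For the theory \<open>T\<close> of a
  given classifying sub-prop-category they come from the copy of it that lies in
  \<open>ObFA\<close>. The obstacle is that the interpretation preserves products only up to
  isomorphism, while \<open>eqp\<close> and the second argument of \<open>quant\<close> need not
  respect isomorphisms. The axioms about these are computed instead: concatenation of contexts is
  strictly associative and unital, and equality over a context unfolds into a tensor of equalities
  of variables, in an order that must agree on both sides because the tensor need not be
  commutative. Product and classifying prop-categories live over function and list types, so both
  are copied back to urelements. Here cardinalities enter: the assertions over a small signature
  embed in a small set, so one countermodel for each assertion outside \<open>T\<close> gives a
  small product, empty when \<open>T\<close> contains all well-formed assertions.\<close>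

locale fpcategory =
  fixes C :: "('o, 'a, 'z) fpcat_scheme"
  assumes cat: "is_category C" and prods: "has_products C"
begin

lemma hom_iff: "f \<in> hom C b c \<longleftrightarrow> f \<in> arr C \<and> dm C f = b \<and> cd C f = c"
  by (simp add: hom_def)

lemma dm_ob [simp]: "f \<in> arr C \<Longrightarrow> dm C f \<in> ob C"
  and cd_ob [simp]: "f \<in> arr C \<Longrightarrow> cd C f \<in> ob C"
  using cat unfolding is_category_def by blast+

lemma comp_typ [simp]:
  assumes "f \<in> arr C" "g \<in> arr C" "cd C f = dm C g"
  shows "comp C g f \<in> arr C" "dm C (comp C g f) = dm C f" "cd C (comp C g f) = cd C g"
  using cat assms unfolding is_category_def hom_def by blast+

lemma idn_typ [simp]:
  assumes "c \<in> ob C"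
  shows "idn C c \<in> arr C" "dm C (idn C c) = c" "cd C (idn C c) = c"
  using cat assms unfolding is_category_def hom_def by blast+

lemma comp_idn_right [simp]: "f \<in> arr C \<Longrightarrow> dm C f = c \<Longrightarrow> comp C f (idn C c) = f"
  and comp_idn_left [simp]: "f \<in> arr C \<Longrightarrow> cd C f = c \<Longrightarrow> comp C (idn C c) f = f"
  using cat unfolding is_category_def by blast+

text \<open>Oriented towards right-nested composites, the simp normal form;
  \<open>flip: comp_assoc\<close> marks places where a projection has to meet its neighbouring arrow
  first.\<close>

lemma comp_assoc [simp]:
  "f \<in> arr C \<Longrightarrow> g \<in> arr C \<Longrightarrow> h \<in> arr C \<Longrightarrow> cd C f = dm C g \<Longrightarrow> cd C g = dm C h \<Longrightarrow>
     comp C (comp C h g) f = comp C h (comp C g f)"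
  using cat unfolding is_category_def by metis

lemma one_ob [simp]: "one C \<in> ob C"
  using prods unfolding has_products_def by blast

lemma bang_hom: "c \<in> ob C \<Longrightarrow> bang C c \<in> hom C c (one C)"
  using prods unfolding has_products_def bang_def by (metis (no_types, lifting) theI')

lemma bang_typ [simp]:
  assumes "c \<in> ob C"
  shows "bang C c \<in> arr C" "dm C (bang C c) = c" "cd C (bang C c) = one C"
  using bang_hom[OF assms] by (auto simp: hom_iff)

lemma one_ext:
  assumes "f \<in> arr C" "g \<in> arr C" "dm C f = dm C g" "cd C f = one C" "cd C g = one C"
  shows "f = g"
  using prods assms dm_ob[of f] unfolding has_products_def by (metis hom_iff)

lemma prd_ob [simp]: "b \<in> ob C \<Longrightarrow> c \<in> ob C \<Longrightarrow> prd C b c \<in> ob C"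
  using prods unfolding has_products_def by blast

lemma pr1_typ [simp]:
  assumes "b \<in> ob C" "c \<in> ob C"
  shows "pr1 C b c \<in> arr C" "dm C (pr1 C b c) = prd C b c" "cd C (pr1 C b c) = b"
  using prods assms unfolding has_products_def hom_def by blast+

lemma pr2_typ [simp]:
  assumes "b \<in> ob C" "c \<in> ob C"
  shows "pr2 C b c \<in> arr C" "dm C (pr2 C b c) = prd C b c" "cd C (pr2 C b c) = c"
  using prods assms unfolding has_products_def hom_def by blast+

text \<open>Recasts the universal property with the codomains read off from \<open>f\<close> and
  \<open>g\<close>. This is the exact predicate under \<open>THE\<close> in \<open>pair\<close>, so
  \<open>theI'\<close> applies to it.\<close>

lemma ex1_pair:
  assumes "f \<in> arr C" "g \<in> arr C" "dm C f = dm C g"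
  shows "\<exists>!h. h \<in> hom C (dm C f) (prd C (cd C f) (cd C g)) \<and>
    comp C (pr1 C (cd C f) (cd C g)) h = f \<and> comp C (pr2 C (cd C f) (cd C g)) h = g"
proof -
  have "f \<in> hom C (dm C f) (cd C f)" "g \<in> hom C (dm C f) (cd C g)"
    using assms by (auto simp: hom_iff)
  moreover have "\<forall>u\<in>hom C (dm C f) (cd C f). \<forall>v\<in>hom C (dm C f) (cd C g).
      \<exists>!h. h \<in> hom C (dm C f) (prd C (cd C f) (cd C g)) \<and>
        comp C (pr1 C (cd C f) (cd C g)) h = u \<and> comp C (pr2 C (cd C f) (cd C g)) h = v"
    using prods dm_ob[OF assms(1)] cd_ob[OF assms(1)] cd_ob[OF assms(2)]
    unfolding has_products_def by blast
  ultimately show ?thesis by blast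
qed

lemma pair_typ [simp]:
  assumes "f \<in> arr C" "g \<in> arr C" "dm C f = dm C g"
  shows "pair C f g \<in> arr C" "dm C (pair C f g) = dm C f"
    "cd C (pair C f g) = prd C (cd C f) (cd C g)"
  using theI'[OF ex1_pair[OF assms]] unfolding pair_def by (auto simp: hom_iff)

lemma pr1_pair [simp]:
  "f \<in> arr C \<Longrightarrow> g \<in> arr C \<Longrightarrow> dm C f = dm C g \<Longrightarrow> b = cd C f \<Longrightarrow> c = cd C g \<Longrightarrow>
    comp C (pr1 C b c) (pair C f g) = f"
  using theI'[OF ex1_pair] unfolding pair_def by blast

lemma pr2_pair [simp]:
  "f \<in> arr C \<Longrightarrow> g \<in> arr C \<Longrightarrow> dm C f = dm C g \<Longrightarrow> b = cd C f \<Longrightarrow> c = cd C g \<Longrightarrow>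
    comp C (pr2 C b c) (pair C f g) = g"
  using theI'[OF ex1_pair] unfolding pair_def by blast

lemma prd_ext:
  assumes "h \<in> arr C" "k \<in> arr C" "dm C h = dm C k" "cd C h = prd C b c" "cd C k = prd C b c"
    "b \<in> ob C" "c \<in> ob C"
    "comp C (pr1 C b c) h = comp C (pr1 C b c) k" "comp C (pr2 C b c) h = comp C (pr2 C b c) k"
  shows "h = k"
proof -
  let ?f = "comp C (pr1 C b c) h" and ?g = "comp C (pr2 C b c) h"
  have "h \<in> hom C (dm C h) (prd C b c)" "k \<in> hom C (dm C h) (prd C b c)"
    using assms by (auto simp: hom_iff)
  with ex1_pair[of ?f ?g] show ?thesis using assms by auto
qed

lemma pair_comp [simp]:
  assumes "f \<in> arr C" "g \<in> arr C" "dm C f = dm C g" "h \<in> arr C" "cd C h = dm C f"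
  shows "comp C (pair C f g) h = pair C (comp C f h) (comp C g h)"
  using assms
  by (rule_tac prd_ext[of _ _ "cd C f" "cd C g"]) (simp_all flip: comp_assoc)

lemma pair_pr1_pr2 [simp]:
  assumes "b \<in> ob C" "c \<in> ob C"
  shows "pair C (pr1 C b c) (pr2 C b c) = idn C (prd C b c)"
  using assms by (rule_tac prd_ext[of _ _ b c]) simp_all

lemma times_id_typ [simp]:
  assumes "f \<in> arr C" "c \<in> ob C"
  shows "times_id C f c \<in> arr C" "dm C (times_id C f c) = prd C (dm C f) c"
    "cd C (times_id C f c) = prd C (cd C f) c"
  using assms unfolding times_id_def by simp_all

lemma assoc_typ [simp]:
  assumes "b \<in> ob C" "c \<in> ob C" "d \<in> ob C"
  shows "assoc C b c d \<in> arr C" "dm C (assoc C b c d) = prd C b (prd C c d)"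
    "cd C (assoc C b c d) = prd C (prd C b c) d"
  using assms unfolding assoc_def by simp_all

lemma inverse_unique: "is_inverse C f g \<Longrightarrow> is_inverse C f h \<Longrightarrow> g = h"
  unfolding is_inverse_def hom_iff by (metis comp_assoc comp_idn_left comp_idn_right)

lemma inv_arr_eq: "is_inverse C f g \<Longrightarrow> inv_arr C f = g"
  unfolding inv_arr_def using inverse_unique by blast

lemma inverse_inv_arr: "is_iso C f \<Longrightarrow> is_inverse C f (inv_arr C f)"
  unfolding is_iso_def using inv_arr_eq by metis

lemma is_isoI:
  assumes "f \<in> arr C" "g \<in> arr C" "dm C g = cd C f" "cd C g = dm C f"
    "comp C g f = idn C (dm C f)" "comp C f g = idn C (cd C f)"
  shows "is_inverse C f g"
  using assms by (auto simp: is_inverse_def hom_iff)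

lemma iso_inv [simp]:
  assumes "is_iso C f"
  shows "f \<in> arr C" "inv_arr C f \<in> arr C" "dm C (inv_arr C f) = cd C f" "cd C (inv_arr C f) = dm C f"
    "comp C (inv_arr C f) f = idn C (dm C f)" "comp C f (inv_arr C f) = idn C (cd C f)"
  using inverse_inv_arr[OF assms] by (auto simp: is_inverse_def hom_iff)

lemma iso_inv_cancel [simp]:
  assumes "is_iso C f" "g \<in> arr C"
  shows "cd C g = dm C f \<Longrightarrow> comp C (inv_arr C f) (comp C f g) = g"
    "cd C g = cd C f \<Longrightarrow> comp C f (comp C (inv_arr C f) g) = g"
  using assms by (simp_all flip: comp_assoc)

lemma is_iso_idn: "c \<in> ob C \<Longrightarrow> is_iso C (idn C c)"
  and inv_arr_idn [simp]: "c \<in> ob C \<Longrightarrow> inv_arr C (idn C c) = idn C c"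
proof -
  assume c: "c \<in> ob C"
  have "is_inverse C (idn C c) (idn C c)" using c by (intro is_isoI) simp_all
  then show "is_iso C (idn C c)" "inv_arr C (idn C c) = idn C c"
    using inv_arr_eq unfolding is_iso_def by blast+
qed

lemma is_iso_comp:
  assumes "is_iso C f" "is_iso C g" "cd C f = dm C g"
  shows "is_iso C (comp C g f)"
  unfolding is_iso_def using assms
  by (intro exI[of _ "comp C (inv_arr C f) (inv_arr C g)"] is_isoI) simp_all

lemma is_iso_times_id:
  assumes "is_iso C f" "c \<in> ob C"
  shows "is_iso C (times_id C f c)"
  unfolding is_iso_def using assms
  by (intro exI[of _ "times_id C (inv_arr C f) c"] is_isoI)
    (simp_all add: times_id_def)

subsection \<open>Interpretation of contexts\<close>

lemma ctx_ob_ob [simp]: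
  "(\<And>\<sigma>. \<sigma> \<in> set \<Gamma> \<Longrightarrow> isort M \<sigma> \<in> ob C) \<Longrightarrow> ctx_ob C M \<Gamma> \<in> ob C"
  by (induction \<Gamma>) simp_all

lemma var_arr_typ [simp]:
  assumes "\<And>\<sigma>. \<sigma> \<in> set \<Gamma> \<Longrightarrow> isort M \<sigma> \<in> ob C" "i < length \<Gamma>"
  shows "var_arr C M \<Gamma> i \<in> arr C" "dm C (var_arr C M \<Gamma> i) = ctx_ob C M \<Gamma>"
    "cd C (var_arr C M \<Gamma> i) = isort M (\<Gamma> ! i)"
proof -
  \<comment> \<open>The induction needs the three typing facts together; they are separated
    afterwards to serve as individual simp rules. The same pattern recurs below.\<close>
  have "var_arr C M \<Gamma> i \<in> arr C \<and> dm C (var_arr C M \<Gamma> i) = ctx_ob C M \<Gamma> \<and>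
    cd C (var_arr C M \<Gamma> i) = isort M (\<Gamma> ! i)" using assms
  proof (induction \<Gamma> arbitrary: i)
    case (Cons \<tau> \<Gamma>)
    then show ?case by (cases i) simp_all
  qed simp
  then show "var_arr C M \<Gamma> i \<in> arr C" "dm C (var_arr C M \<Gamma> i) = ctx_ob C M \<Gamma>"
    "cd C (var_arr C M \<Gamma> i) = isort M (\<Gamma> ! i)" by auto
qed

text \<open>A generalised element of \<open>\<Gamma>\<close> at stage \<open>b\<close>, given by
  components. That \<open>b\<close> is an object has to be said separately, since for the empty
  list, whose tuple is \<open>bang C b\<close>, no arrow witnesses it.\<close>

definition arrs :: "('u, 'o, 'a, 'p) struc \<Rightarrow> 'o \<Rightarrow> 'a list \<Rightarrow> 'u ctx \<Rightarrow> bool" where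
  "arrs M b fs \<Gamma> \<longleftrightarrow> b \<in> ob C \<and> (\<forall>\<sigma>\<in>set \<Gamma>. isort M \<sigma> \<in> ob C) \<and>
     list_all2 (\<lambda>f \<sigma>. f \<in> arr C \<and> dm C f = b \<and> cd C f = isort M \<sigma>) fs \<Gamma>"

lemma arrs_length: "arrs M b fs \<Gamma> \<Longrightarrow> length fs = length \<Gamma>"
  by (auto simp: arrs_def list_all2_lengthD)

lemma tuple_typ [simp]:
  assumes "arrs M b fs \<Gamma>"
  shows "tuple C b fs \<in> arr C" "dm C (tuple C b fs) = b" "cd C (tuple C b fs) = ctx_ob C M \<Gamma>"
proof -
  have "tuple C b fs \<in> arr C \<and> dm C (tuple C b fs) = b \<and> cd C (tuple C b fs) = ctx_ob C M \<Gamma>"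
    using assms
  proof (induction fs arbitrary: \<Gamma>)
    case (Cons f fs)
    then obtain \<tau> \<Gamma>' where G: "\<Gamma> = \<tau> # \<Gamma>'" by (cases \<Gamma>) (auto simp: arrs_def)
    with Cons(2) have "arrs M b fs \<Gamma>'" by (simp add: arrs_def)
    from Cons(1)[OF this] Cons(2) show ?case by (simp add: G arrs_def)
  qed (simp add: arrs_def)
  then show "tuple C b fs \<in> arr C" "dm C (tuple C b fs) = b" "cd C (tuple C b fs) = ctx_ob C M \<Gamma>"
    by auto
qed

lemma var_tuple:
  "arrs M b fs \<Gamma> \<Longrightarrow> i < length \<Gamma> \<Longrightarrow> comp C (var_arr C M \<Gamma> i) (tuple C b fs) = fs ! i"
proof (induction fs arbitrary: \<Gamma> i)
  case Nil
  then show ?case by (auto simp: arrs_def)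
next
  case (Cons f fs)
  then obtain \<tau> \<Gamma>' where G: "\<Gamma> = \<tau> # \<Gamma>'" by (cases \<Gamma>) (auto simp: arrs_def)
  with Cons(2) have fs: "arrs M b fs \<Gamma>'" by (simp add: arrs_def)
  have f: "f \<in> arr C" "dm C f = b" "cd C f = isort M \<tau>" "isort M \<tau> \<in> ob C"
    "\<And>\<sigma>. \<sigma> \<in> set \<Gamma>' \<Longrightarrow> isort M \<sigma> \<in> ob C"
    using Cons(2) by (auto simp: G arrs_def)
  show ?case
    using Cons(1)[OF fs] Cons(3) f tuple_typ[OF fs] by (cases i) (simp_all add: G)
qed

text \<open>The variables, as projections, are jointly monic: induction on the context splits off
  the newest variable by \<open>prd_ext\<close>. Later identities of arrows into a context are
  mostly checked variable by variable in this way.\<close>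

lemma ctx_ext:
  assumes "\<And>\<sigma>. \<sigma> \<in> set \<Gamma> \<Longrightarrow> isort M \<sigma> \<in> ob C"
    and "h \<in> arr C" "k \<in> arr C" "dm C h = dm C k" "cd C h = ctx_ob C M \<Gamma>" "cd C k = ctx_ob C M \<Gamma>"
    and "\<And>i. i < length \<Gamma> \<Longrightarrow> comp C (var_arr C M \<Gamma> i) h = comp C (var_arr C M \<Gamma> i) k"
  shows "h = k"
  using assms
proof (induction \<Gamma> arbitrary: h k)
  case Nil
  then show ?case using one_ext[of h k] by simp
next
  case (Cons \<tau> \<Gamma>)
  note IH = Cons.IH and eq = Cons.prems(7) and hk = Cons.prems(2-6)
  have ob: "isort M \<tau> \<in> ob C" "ctx_ob C M \<Gamma> \<in> ob C" "\<And>\<sigma>. \<sigma> \<in> set \<Gamma> \<Longrightarrow> isort M \<sigma> \<in> ob C"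
    using Cons.prems(1) by simp_all
  let ?p = "pr1 C (ctx_ob C M \<Gamma>) (isort M \<tau>)"
  have "comp C ?p h = comp C ?p k"
  proof (rule IH)
    fix i assume "i < length \<Gamma>"
    then show "comp C (var_arr C M \<Gamma> i) (comp C ?p h) = comp C (var_arr C M \<Gamma> i) (comp C ?p k)"
      using eq[of "Suc i"] ob hk by simp
  qed (use ob hk in simp_all)
  moreover have "comp C (pr2 C (ctx_ob C M \<Gamma>) (isort M \<tau>)) h = comp C (pr2 C (ctx_ob C M \<Gamma>) (isort M \<tau>)) k"
    using eq[of 0] by simp
  ultimately show ?case using hk ob
    by (rule_tac prd_ext[of h k "ctx_ob C M \<Gamma>" "isort M \<tau>"]) simp_all
qed

lemma arrs_comp:
  "arrs M b fs \<Gamma> \<Longrightarrow> h \<in> arr C \<Longrightarrow> cd C h = b \<Longrightarrow> arrs M (dm C h) (map (\<lambda>f. comp C f h) fs) \<Gamma>"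
  by (auto simp: arrs_def list_all2_conv_all_nth)

text \<open>Both sides have the same composites with all variables, so \<open>ctx_ext\<close>
  identifies them.\<close>

lemma tuple_comp:
  assumes "arrs M b fs \<Gamma>" "h \<in> arr C" "cd C h = b"
  shows "comp C (tuple C b fs) h = tuple C (dm C h) (map (\<lambda>f. comp C f h) fs)"
proof -
  note t = arrs_comp[OF assms]
  have ob: "\<And>\<sigma>. \<sigma> \<in> set \<Gamma> \<Longrightarrow> isort M \<sigma> \<in> ob C" using assms by (simp add: arrs_def)
  note l = arrs_length[OF assms(1)]
  show ?thesis
  proof (rule ctx_ext)
    fix i assume i: "i < length \<Gamma>"
    have "comp C (var_arr C M \<Gamma> i) (comp C (tuple C b fs) h) =
        comp C (comp C (var_arr C M \<Gamma> i) (tuple C b fs)) h"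
      using assms ob i tuple_typ[OF assms(1)] by simp
    then show "comp C (var_arr C M \<Gamma> i) (comp C (tuple C b fs) h) = comp C (var_arr C M \<Gamma> i)
          (tuple C (dm C h) (map (\<lambda>f. comp C f h) fs))"
      using var_tuple[OF assms(1) i] var_tuple[OF t i] i l by simp
  qed (use assms ob tuple_typ[OF t] tuple_typ[OF assms(1)] in simp_all)
qed

lemma tuple_eqI:
  assumes "arrs M b fs \<Gamma>" "h \<in> arr C" "dm C h = b" "cd C h = ctx_ob C M \<Gamma>"
    "\<And>i. i < length \<Gamma> \<Longrightarrow> comp C (var_arr C M \<Gamma> i) h = fs ! i"
  shows "tuple C b fs = h"
  using assms tuple_typ[OF assms(1)] var_tuple[OF assms(1)]
  by (rule_tac ctx_ext[of \<Gamma> M]) (auto simp: arrs_def)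

lemma arrs_var_arr:
  "(\<And>\<sigma>. \<sigma> \<in> set \<Gamma> \<Longrightarrow> isort M \<sigma> \<in> ob C) \<Longrightarrow>
    arrs M (ctx_ob C M \<Gamma>) (map (var_arr C M \<Gamma>) [0..<length \<Gamma>]) \<Gamma>"
  by (auto simp: arrs_def list_all2_conv_all_nth)

lemma tuple_vars:
  "(\<And>\<sigma>. \<sigma> \<in> set \<Gamma> \<Longrightarrow> isort M \<sigma> \<in> ob C) \<Longrightarrow>
    tuple C (ctx_ob C M \<Gamma>) (map (var_arr C M \<Gamma>) [0..<length \<Gamma>]) = idn C (ctx_ob C M \<Gamma>)"
  by (rule tuple_eqI[OF arrs_var_arr]) simp_all

end


section \<open>Prop-categories\<close>

locale prop_category =
  fixes L :: "('k, 'q) lang" and C :: "('o, 'a, 'p, 'k, 'q) propcat"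
  assumes lang: "language L" and propcat: "is_propcat L C"

sublocale prop_category \<subseteq> fpcategory C
  using propcat by unfold_locales (simp_all add: is_propcat_def)

context prop_category
begin

lemma presheaf: "is_presheaf C" and connectives: "has_connectives L C" and
  monoids: "has_monoids L C" and quantifiers: "has_quantifiers L C" and equality: "has_equality L C"
  using propcat by (simp_all add: is_propcat_def)

lemma poset: "c \<in> ob C \<Longrightarrow> is_poset (pred C c) (le C c)"
  using presheaf by (simp add: is_presheaf_def)

lemma le_refl [simp]: "c \<in> ob C \<Longrightarrow> x \<in> pred C c \<Longrightarrow> le C c x x"
  using poset[of c] by (simp add: is_poset_def)

lemma le_antisym:
  assumes "c \<in> ob C" "x \<in> pred C c" "y \<in> pred C c" "le C c x y" "le C c y x"
  shows "x = y"
  using poset[OF assms(1), unfolded is_poset_def, THEN conjunct2, THEN conjunct1] assms by blast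

lemma le_trans:
  assumes "c \<in> ob C" "x \<in> pred C c" "y \<in> pred C c" "z \<in> pred C c" "le C c x y" "le C c y z"
  shows "le C c x z"
  using poset[OF assms(1), unfolded is_poset_def, THEN conjunct2, THEN conjunct2] assms by blast

lemma sub_pred [simp]: "f \<in> arr C \<Longrightarrow> x \<in> pred C (cd C f) \<Longrightarrow> dm C f = b \<Longrightarrow> sub C f x \<in> pred C b"
  using presheaf unfolding is_presheaf_def by auto

lemma sub_mono:
  "f \<in> arr C \<Longrightarrow> x \<in> pred C (cd C f) \<Longrightarrow> y \<in> pred C (cd C f) \<Longrightarrow> le C (cd C f) x y \<Longrightarrow>
    le C (dm C f) (sub C f x) (sub C f y)"
  using presheaf unfolding is_presheaf_def by simp

lemma sub_idn [simp]: "x \<in> pred C c \<Longrightarrow> c \<in> ob C \<Longrightarrow> sub C (idn C c) x = x"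
  using presheaf unfolding is_presheaf_def by simp

lemma sub_sub [simp]:
  "f \<in> arr C \<Longrightarrow> g \<in> arr C \<Longrightarrow> cd C f = dm C g \<Longrightarrow> x \<in> pred C (cd C g) \<Longrightarrow>
    sub C f (sub C g x) = sub C (comp C g f) x"
  using presheaf unfolding is_presheaf_def by simp

lemma conn_pred [simp]:
  "c \<in> ob C \<Longrightarrow> k \<in> conns L \<Longrightarrow> set xs \<subseteq> pred C c \<Longrightarrow> length xs = arity L k \<Longrightarrow>
    conn C c k xs \<in> pred C c"
  using connectives unfolding has_connectives_def by (simp add: lists_eq_set)

lemma sub_conn:
  "f \<in> arr C \<Longrightarrow> k \<in> conns L \<Longrightarrow> set xs \<subseteq> pred C (cd C f) \<Longrightarrow> length xs = arity L k \<Longrightarrow> c = cd C f \<Longrightarrow>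
    sub C f (conn C c k xs) = conn C (dm C f) k (map (sub C f) xs)"
  using connectives unfolding has_connectives_def by (simp add: lists_eq_set)

lemma unit_pred [simp]: "c \<in> ob C \<Longrightarrow> unit_p L C c \<in> pred C c"
  using lang unfolding unit_p_def language_def by simp

lemma tensor_pred [simp]:
  "c \<in> ob C \<Longrightarrow> x \<in> pred C c \<Longrightarrow> y \<in> pred C c \<Longrightarrow> tensor_p L C c x y \<in> pred C c"
  using lang unfolding tensor_p_def language_def by simp

lemma sub_unit [simp]: "f \<in> arr C \<Longrightarrow> cd C f = c \<Longrightarrow> sub C f (unit_p L C c) = unit_p L C (dm C f)"
  using lang unfolding unit_p_def language_def by (auto simp: sub_conn)

lemma sub_tensor [simp]:
  "f \<in> arr C \<Longrightarrow> cd C f = c \<Longrightarrow> x \<in> pred C c \<Longrightarrow> y \<in> pred C c \<Longrightarrow>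
    sub C f (tensor_p L C c x y) = tensor_p L C (dm C f) (sub C f x) (sub C f y)"
  using lang unfolding tensor_p_def language_def by (auto simp: sub_conn)

lemma tensor_unit [simp]:
  assumes "c \<in> ob C" "x \<in> pred C c"
  shows "tensor_p L C c (unit_p L C c) x = x" "tensor_p L C c x (unit_p L C c) = x"
  using monoids assms unfolding has_monoids_def by blast+

lemma tensor_assoc [simp]:
  "c \<in> ob C \<Longrightarrow> x \<in> pred C c \<Longrightarrow> y \<in> pred C c \<Longrightarrow> z \<in> pred C c \<Longrightarrow>
     tensor_p L C c (tensor_p L C c x y) z = tensor_p L C c x (tensor_p L C c y z)"
  using monoids unfolding has_monoids_def by blast

lemma tensor_mono:
  "c \<in> ob C \<Longrightarrow> x \<in> pred C c \<Longrightarrow> y \<in> pred C c \<Longrightarrow> x' \<in> pred C c \<Longrightarrow> y' \<in> pred C c \<Longrightarrow>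
     le C c x x' \<Longrightarrow> le C c y y' \<Longrightarrow> le C c (tensor_p L C c x y) (tensor_p L C c x' y')"
  using monoids unfolding has_monoids_def by blast

lemma quant_pred [simp]:
  "q \<in> quants L \<Longrightarrow> b \<in> ob C \<Longrightarrow> c \<in> ob C \<Longrightarrow> x \<in> pred C (prd C b c) \<Longrightarrow> quant C q b c x \<in> pred C b"
  using quantifiers unfolding has_quantifiers_def by blast

lemma sub_quant:
  "q \<in> quants L \<Longrightarrow> f \<in> arr C \<Longrightarrow> c \<in> ob C \<Longrightarrow> b = cd C f \<Longrightarrow> x \<in> pred C (prd C b c) \<Longrightarrow>
    sub C f (quant C q b c x) = quant C q (dm C f) c (sub C (times_id C f c) x)"
  using quantifiers unfolding has_quantifiers_def by blast

lemma quant_one: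
  "q \<in> quants L \<Longrightarrow> b \<in> ob C \<Longrightarrow> x \<in> pred C b \<Longrightarrow> quant C q b (one C) (sub C (pr1 C b (one C)) x) = x"
  using quantifiers unfolding has_quantifiers_def by blast

lemma quant_prd:
  "q \<in> quants L \<Longrightarrow> b \<in> ob C \<Longrightarrow> c \<in> ob C \<Longrightarrow> d \<in> ob C \<Longrightarrow> x \<in> pred C (prd C (prd C b c) d) \<Longrightarrow>
     quant C q b (prd C c d) (sub C (assoc C b c d) x) =
        quant C q b c (quant C q (prd C b c) d x)"
  using quantifiers unfolding has_quantifiers_def by blast

lemma eqp_pred [simp]: "c \<in> ob C \<Longrightarrow> eqp C c \<in> pred C (prd C c c)"
  using equality unfolding has_equality_def by blast

lemma eqp_one: "eqp C (one C) = unit_p L C (prd C (one C) (one C))"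
  using equality unfolding has_equality_def by blast

lemma eqp_prd:
  assumes "c \<in> ob C" "d \<in> ob C"
  shows "let e = prd C c d; p = pr1 C e e; p' = pr2 C e e in
        eqp C e = tensor_p L C (prd C e e)
          (sub C (pair C (comp C (pr1 C c d) p) (comp C (pr1 C c d) p')) (eqp C c))
          (sub C (pair C (comp C (pr2 C c d) p) (comp C (pr2 C c d) p')) (eqp C d))"
  using equality assms unfolding has_equality_def by blast

text \<open>The axiom for \<open>eqp\<close> of a product, pulled back along an arbitrary pair; in
  this form it can be iterated along a context, as \<open>sub_eqp_ctx\<close> does.\<close>

lemma sub_eqp_prd:
  assumes "f \<in> arr C" "g \<in> arr C" "dm C f = dm C g" "cd C f = prd C c d" "cd C g = prd C c d"
    "c \<in> ob C" "d \<in> ob C"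
  shows "sub C (pair C f g) (eqp C (prd C c d)) = tensor_p L C (dm C f)
      (sub C (pair C (comp C (pr1 C c d) f) (comp C (pr1 C c d) g)) (eqp C c))
      (sub C (pair C (comp C (pr2 C c d) f) (comp C (pr2 C c d) g)) (eqp C d))"
  using assms eqp_prd[OF assms(6,7)] by (simp add: Let_def)

abbreviation tensors :: "'o \<Rightarrow> 'p list \<Rightarrow> 'p" where
  "tensors c xs \<equiv> foldr (tensor_p L C c) xs (unit_p L C c)"

lemma tensors_pred [simp]: "c \<in> ob C \<Longrightarrow> set xs \<subseteq> pred C c \<Longrightarrow> tensors c xs \<in> pred C c"
  by (induction xs) auto

text \<open>Associativity and the unit law make the fold independent of its bracketing. Cut relies
  on this, as it splits an antecedent at an inner position.\<close>

lemma tensors_append: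
  "c \<in> ob C \<Longrightarrow> set xs \<subseteq> pred C c \<Longrightarrow> set ys \<subseteq> pred C c \<Longrightarrow>
    tensors c (xs @ ys) = tensor_p L C c (tensors c xs) (tensors c ys)"
proof (induction xs)
  case Nil
  then show ?case using tensors_pred[of c ys] by simp
next
  case (Cons a xs)
  then show ?case using tensors_pred[of c ys] tensors_pred[of c xs] by simp
qed

lemma sub_tensors:
  "f \<in> arr C \<Longrightarrow> cd C f = c \<Longrightarrow> set xs \<subseteq> pred C c \<Longrightarrow> sub C f (tensors c xs) = tensors (dm C f) (map (sub C f) xs)"
  by (induction xs) auto

end

section \<open>Substitution and soundness\<close>

text \<open>Substitutions are total on \<open>nat\<close>, but only the indices of
  \<open>\<Delta>\<close> are constrained: \<open>inst Ms\<close> is the identity beyond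
  \<open>length Ms\<close>, where well-typed syntax over \<open>\<Delta>\<close> never
  looks.\<close>

definition wt_sub :: "'u signature \<Rightarrow> 'u ctx \<Rightarrow> 'u ctx \<Rightarrow> (nat \<Rightarrow> 'u trm) \<Rightarrow> bool" where
  "wt_sub Sg \<Gamma> \<Delta> s \<longleftrightarrow> (\<forall>i<length \<Delta>. wt_trm Sg \<Gamma> (s i) (\<Delta> ! i))"

lemma is_ctx_simps [simp]:
  "is_ctx Sg []" "is_ctx Sg (\<tau> # \<Gamma>) \<longleftrightarrow> \<tau> \<in> sorts Sg \<and> is_ctx Sg \<Gamma>"
  "is_ctx Sg (\<Delta> @ \<Gamma>) \<longleftrightarrow> is_ctx Sg \<Delta> \<and> is_ctx Sg \<Gamma>"
  by (auto simp: is_ctx_def)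

lemma wt_Var: "i < length \<Gamma> \<Longrightarrow> \<sigma> = \<Gamma> ! i \<Longrightarrow> wt_trm Sg \<Gamma> (Var i) \<sigma>"
  by (auto intro: wt_trm.intros)

inductive_cases wt_VarE: "wt_trm Sg \<Gamma> (Var i) \<sigma>"
inductive_cases wt_FnE: "wt_trm Sg \<Gamma> (Fn f Ms) \<sigma>"

lemma wt_trm_sort: "is_sig Sg \<Longrightarrow> is_ctx Sg \<Gamma> \<Longrightarrow> wt_trm Sg \<Gamma> t \<sigma> \<Longrightarrow> \<sigma> \<in> sorts Sg"
  by (erule wt_trm.cases) (auto simp: is_ctx_def is_sig_def)

lemma wt_tsub:
  assumes "wt_trm Sg \<Delta> t \<sigma>" "wt_sub Sg \<Gamma> \<Delta> s"
  shows "wt_trm Sg \<Gamma> (tsub s t) \<sigma>"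
  using assms
  by (induction rule: wt_trm.induct)
    (auto simp: wt_sub_def list_all2_conv_all_nth intro!: wt_trm.intros)

lemma wt_wk: "wt_sub Sg (\<tau> # \<Gamma>) \<Gamma> wk"
  by (auto simp: wt_sub_def wk_def intro: wt_Var)

lemma wt_up: "wt_sub Sg \<Gamma> \<Delta> s \<Longrightarrow> wt_sub Sg (\<tau> # \<Gamma>) (\<tau> # \<Delta>) (up s)"
  by (auto simp: wt_sub_def up_def nth_Cons intro!: wt_Var wt_tsub[OF _ wt_wk] split: nat.split)

lemma wt_fsub: "wt_fml L Sg \<Delta> \<phi> \<Longrightarrow> wt_sub Sg \<Gamma> \<Delta> s \<Longrightarrow> wt_fml L Sg \<Gamma> (fsub s \<phi>)"
  by (induction \<phi> arbitrary: \<Gamma> \<Delta> s)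
    (auto simp: list_all2_conv_all_nth intro: wt_tsub wt_up)

lemma wt_inst: "list_all2 (wt_trm Sg \<Gamma>) Ms \<Delta> \<Longrightarrow> wt_sub Sg \<Gamma> \<Delta> (inst Ms)"
  by (auto simp: wt_sub_def inst_def list_all2_conv_all_nth)

lemma wt_tensor_f: "language L \<Longrightarrow>
    wt_fml L Sg \<Gamma> (tensor_f L \<alpha> \<beta>) \<longleftrightarrow> wt_fml L Sg \<Gamma> \<alpha> \<and> wt_fml L Sg \<Gamma> \<beta>"
  and wt_unit_f: "language L \<Longrightarrow> wt_fml L Sg \<Gamma> (unit_f L)"
  by (auto simp: tensor_f_def unit_f_def language_def)

locale structure_in = prop_category L C
  for L :: "('k, 'q) lang" and C :: "('o, 'a, 'p, 'k, 'q) propcat" +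
  fixes Sg :: "'u signature" and M :: "('u, 'o, 'a, 'p) struc"
  assumes sig: "is_sig Sg" and struc: "is_struc C Sg M"
begin

lemma isort_ob [simp]: "\<sigma> \<in> sorts Sg \<Longrightarrow> isort M \<sigma> \<in> ob C"
  using struc by (simp add: is_struc_def)

lemma isorts_ob: "is_ctx Sg \<Gamma> \<Longrightarrow> \<sigma> \<in> set \<Gamma> \<Longrightarrow> isort M \<sigma> \<in> ob C"
  by (auto simp: is_ctx_def)

lemma ctx_ob [simp]: "is_ctx Sg \<Gamma> \<Longrightarrow> ctx_ob C M \<Gamma> \<in> ob C"
  by (simp add: is_ctx_def subset_iff)

lemma ctx_fdom [simp]: "f \<in> funs Sg \<Longrightarrow> is_ctx Sg (fdom Sg f)"
  and ctx_rdom [simp]: "r \<in> rels Sg \<Longrightarrow> is_ctx Sg (rdom Sg r)"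
  and sort_fcod [simp]: "f \<in> funs Sg \<Longrightarrow> fcod Sg f \<in> sorts Sg"
  using sig by (simp_all add: is_sig_def is_ctx_def)

lemma ifun_typ [simp]:
  assumes "f \<in> funs Sg"
  shows "ifun M f \<in> arr C" "dm C (ifun M f) = ctx_ob C M (fdom Sg f)"
    "cd C (ifun M f) = isort M (fcod Sg f)"
  using struc assms by (auto simp: is_struc_def hom_def)

lemma irel_pred [simp]: "r \<in> rels Sg \<Longrightarrow> irel M r \<in> pred C (ctx_ob C M (rdom Sg r))"
  using struc by (simp add: is_struc_def)

lemmas wt_sort = wt_trm_sort[OF sig]

lemma trm_arr_typ [simp]:
  assumes "wt_trm Sg \<Gamma> t \<sigma>" "is_ctx Sg \<Gamma>"
  shows "trm_arr C M \<Gamma> t \<in> arr C" "dm C (trm_arr C M \<Gamma> t) = ctx_ob C M \<Gamma>"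
    "cd C (trm_arr C M \<Gamma> t) = isort M \<sigma>"
proof -
  have "trm_arr C M \<Gamma> t \<in> arr C \<and> dm C (trm_arr C M \<Gamma> t) = ctx_ob C M \<Gamma> \<and>
    cd C (trm_arr C M \<Gamma> t) = isort M \<sigma>"
    using assms
  proof (induction rule: wt_trm.induct)
    case (1 i)
    then show ?case using isorts_ob[of \<Gamma>] by simp
  next
    case (2 f Ms)
    have "arrs M (ctx_ob C M \<Gamma>) (map (trm_arr C M \<Gamma>) Ms) (fdom Sg f)"
      using 2 isorts_ob[of "fdom Sg f"] by (auto simp: arrs_def list_all2_conv_all_nth)
    then show ?case using 2 by (simp add: tuple_typ)
  qed
  then show "trm_arr C M \<Gamma> t \<in> arr C" "dm C (trm_arr C M \<Gamma> t) = ctx_ob C M \<Gamma>"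
    "cd C (trm_arr C M \<Gamma> t) = isort M \<sigma>" by auto
qed

abbreviation tm :: "'u ctx \<Rightarrow> 'u trm list \<Rightarrow> 'a" where
  "tm \<Gamma> Ms \<equiv> tuple C (ctx_ob C M \<Gamma>) (map (trm_arr C M \<Gamma>) Ms)"

lemma arrs_trms:
  "is_ctx Sg \<Gamma> \<Longrightarrow> is_ctx Sg \<Delta> \<Longrightarrow> list_all2 (wt_trm Sg \<Gamma>) Ms \<Delta> \<Longrightarrow>
     arrs M (ctx_ob C M \<Gamma>) (map (trm_arr C M \<Gamma>) Ms) \<Delta>"
  using isorts_ob[of \<Delta>] by (auto simp: arrs_def list_all2_conv_all_nth)

lemma tm_typ [simp]:
  assumes "list_all2 (wt_trm Sg \<Gamma>) Ms \<Delta>" "is_ctx Sg \<Gamma>" "is_ctx Sg \<Delta>"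
  shows "tm \<Gamma> Ms \<in> arr C" "dm C (tm \<Gamma> Ms) = ctx_ob C M \<Gamma>" "cd C (tm \<Gamma> Ms) = ctx_ob C M \<Delta>"
  using tuple_typ[OF arrs_trms] assms by blast+

lemma fml_val_pred [simp]:
  "wt_fml L Sg \<Gamma> \<phi> \<Longrightarrow> is_ctx Sg \<Gamma> \<Longrightarrow> fml_val C M \<Gamma> \<phi> \<in> pred C (ctx_ob C M \<Gamma>)"
proof (induction \<phi> arbitrary: \<Gamma>)
  case (Quant q \<tau> \<phi>)
  then have "fml_val C M (\<tau> # \<Gamma>) \<phi> \<in> pred C (ctx_ob C M (\<tau> # \<Gamma>))"
    by (intro Quant.IH) simp_all
  then show ?case using Quant.prems by simp
qed (auto simp: image_subset_iff)

text \<open>The arrow from the interpretation of \<open>\<Gamma>\<close> to that of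
  \<open>\<Delta>\<close> that a substitution denotes.\<close>

definition msub :: "'u ctx \<Rightarrow> 'u ctx \<Rightarrow> (nat \<Rightarrow> 'u trm) \<Rightarrow> 'a" where
  "msub \<Gamma> \<Delta> s = tuple C (ctx_ob C M \<Gamma>) (map (\<lambda>i. trm_arr C M \<Gamma> (s i)) [0..<length \<Delta>])"

lemma arrs_msub:
  "wt_sub Sg \<Gamma> \<Delta> s \<Longrightarrow> is_ctx Sg \<Gamma> \<Longrightarrow> is_ctx Sg \<Delta> \<Longrightarrow>
     arrs M (ctx_ob C M \<Gamma>) (map (\<lambda>i. trm_arr C M \<Gamma> (s i)) [0..<length \<Delta>]) \<Delta>"
  using isorts_ob[of \<Delta>] by (auto simp: arrs_def wt_sub_def list_all2_conv_all_nth)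

lemma msub_typ [simp]:
  assumes "wt_sub Sg \<Gamma> \<Delta> s" "is_ctx Sg \<Gamma>" "is_ctx Sg \<Delta>"
  shows "msub \<Gamma> \<Delta> s \<in> arr C" "dm C (msub \<Gamma> \<Delta> s) = ctx_ob C M \<Gamma>"
    "cd C (msub \<Gamma> \<Delta> s) = ctx_ob C M \<Delta>"
  using tuple_typ[OF arrs_msub[OF assms]] unfolding msub_def by auto

lemma var_msub:
  assumes "wt_sub Sg \<Gamma> \<Delta> s" "is_ctx Sg \<Gamma>" "is_ctx Sg \<Delta>" "i < length \<Delta>"
  shows "comp C (var_arr C M \<Delta> i) (msub \<Gamma> \<Delta> s) = trm_arr C M \<Gamma> (s i)"
  using var_tuple[OF arrs_msub[OF assms(1-3)] assms(4)] assms(4) unfolding msub_def by simp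

lemma msub_eqI:
  assumes "wt_sub Sg \<Gamma> \<Delta> s" "is_ctx Sg \<Gamma>" "is_ctx Sg \<Delta>"
    "h \<in> arr C" "dm C h = ctx_ob C M \<Gamma>" "cd C h = ctx_ob C M \<Delta>"
    "\<And>i. i < length \<Delta> \<Longrightarrow> comp C (var_arr C M \<Delta> i) h = trm_arr C M \<Gamma> (s i)"
  shows "msub \<Gamma> \<Delta> s = h"
  unfolding msub_def using assms by (intro tuple_eqI[OF arrs_msub]) auto

lemma msub_inst: "length Ms = length \<Delta> \<Longrightarrow> msub \<Gamma> \<Delta> (inst Ms) = tm \<Gamma> Ms"
  unfolding msub_def by (rule arg_cong[of _ _ "tuple C _"], rule nth_equalityI) (auto simp: inst_def)

text \<open>Substitution lemma for terms. Tuples absorb precomposition by \<open>tuple_comp\<close>,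
  which carries the induction through function symbols.\<close>

lemma trm_arr_tsub:
  assumes "wt_trm Sg \<Delta> t \<sigma>" "wt_sub Sg \<Gamma> \<Delta> s" "is_ctx Sg \<Gamma>" "is_ctx Sg \<Delta>"
  shows "trm_arr C M \<Gamma> (tsub s t) = comp C (trm_arr C M \<Delta> t) (msub \<Gamma> \<Delta> s)"
  using assms
proof (induction rule: wt_trm.induct)
  case (1 i)
  then show ?case by (simp add: var_msub)
next
  case (2 f Ms)
  have wt: "list_all2 (wt_trm Sg \<Delta>) Ms (fdom Sg f)" using 2(2) by (auto elim: list_all2_mono)
  note t = arrs_trms[OF 2(5) _ wt]
  have "comp C (tm \<Delta> Ms) (msub \<Gamma> \<Delta> s) =
      tuple C (ctx_ob C M \<Gamma>) (map (\<lambda>f. comp C f (msub \<Gamma> \<Delta> s)) (map (trm_arr C M \<Delta>) Ms))"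
    using tuple_comp[OF t, of "msub \<Gamma> \<Delta> s"] 2 by simp
  also have "map (\<lambda>f. comp C f (msub \<Gamma> \<Delta> s)) (map (trm_arr C M \<Delta>) Ms) =
      map (trm_arr C M \<Gamma>) (map (tsub s) Ms)"
    using 2(2-5) by (auto simp: list_all2_conv_all_nth in_set_conv_nth)
  finally show ?case using 2(1,3,4,5) wt by simp
qed

lemma msub_wk: "is_ctx Sg (\<tau> # \<Gamma>) \<Longrightarrow> msub (\<tau> # \<Gamma>) \<Gamma> wk = pr1 C (ctx_ob C M \<Gamma>) (isort M \<tau>)"
  using wt_wk by (intro msub_eqI) (auto simp: wk_def)

text \<open>\<open>up\<close> fixes the newest variable and weakens the others, and weakening
  denotes the first projection. The resulting \<open>times_id\<close> is the arrow that occurs in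
  the naturality axiom for quantifiers.\<close>

lemma msub_up:
  assumes "wt_sub Sg \<Gamma> \<Delta> s" "is_ctx Sg \<Gamma>" "is_ctx Sg \<Delta>" "\<tau> \<in> sorts Sg"
  shows "msub (\<tau> # \<Gamma>) (\<tau> # \<Delta>) (up s) = times_id C (msub \<Gamma> \<Delta> s) (isort M \<tau>)"
proof (rule msub_eqI[OF wt_up[OF assms(1)]])
  fix i assume i: "i < length (\<tau> # \<Delta>)"
  show "comp C (var_arr C M (\<tau> # \<Delta>) i) (times_id C (msub \<Gamma> \<Delta> s) (isort M \<tau>)) =
    trm_arr C M (\<tau> # \<Gamma>) (up s i)"
  proof (cases i)
    case 0
    then show ?thesis using assms by (simp add: up_def times_id_def)
  next
    case (Suc j)
    then have j: "j < length \<Delta>" using i by simp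
    then have wt: "wt_trm Sg \<Gamma> (s j) (\<Delta> ! j)" using assms(1) by (simp add: wt_sub_def)
    have v: "var_arr C M \<Delta> j \<in> arr C" "dm C (var_arr C M \<Delta> j) = ctx_ob C M \<Delta>"
      using isorts_ob[OF assms(3)] j by simp_all
    have "trm_arr C M (\<tau> # \<Gamma>) (up s i) = comp C (trm_arr C M \<Gamma> (s j)) (pr1 C (ctx_ob C M \<Gamma>) (isort M \<tau>))"
      using trm_arr_tsub[OF wt wt_wk] assms by (simp add: Suc up_def msub_wk)
    also have "\<dots> = comp C (comp C (var_arr C M \<Delta> j) (msub \<Gamma> \<Delta> s)) (pr1 C (ctx_ob C M \<Gamma>) (isort M \<tau>))"
      using var_msub[OF assms(1-3) j] by simp
    finally show ?thesis using assms v by (simp add: Suc times_id_def)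
  qed
qed (use assms in simp_all)

lemma map_tm_comp:
  assumes "list_all2 (wt_trm Sg \<Delta>) Ms \<Theta>" "wt_sub Sg \<Gamma> \<Delta> s"
    "is_ctx Sg \<Gamma>" "is_ctx Sg \<Delta>" "is_ctx Sg \<Theta>"
  shows "tm \<Gamma> (map (tsub s) Ms) = comp C (tm \<Delta> Ms) (msub \<Gamma> \<Delta> s)"
proof -
  have "map (\<lambda>f. comp C f (msub \<Gamma> \<Delta> s)) (map (trm_arr C M \<Delta>) Ms) =
      map (trm_arr C M \<Gamma>) (map (tsub s) Ms)"
    using assms(1) trm_arr_tsub[OF _ assms(2-4)] by (fastforce simp: list_all2_conv_all_nth in_set_conv_nth)
  then show ?thesis using tuple_comp[OF arrs_trms[OF assms(4,5,1)], of "msub \<Gamma> \<Delta> s"] assms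
    by (simp del: map_map)
qed

text \<open>Substitution lemma for formulas. Every former is natural in the context: relations and
  equality by functoriality of \<open>sub\<close>, connectives by preservation under
  \<open>sub\<close>, quantifiers by naturality in their first object, with \<open>msub_up\<close>
  supplying the arrow under the binder.\<close>

lemma fml_val_fsub:
  assumes "wt_fml L Sg \<Delta> \<phi>" "wt_sub Sg \<Gamma> \<Delta> s" "is_ctx Sg \<Gamma>" "is_ctx Sg \<Delta>"
  shows "fml_val C M \<Gamma> (fsub s \<phi>) = sub C (msub \<Gamma> \<Delta> s) (fml_val C M \<Delta> \<phi>)"
  using assms
proof (induction \<phi> arbitrary: \<Gamma> \<Delta> s)
  case (Rel r Ms)
  then have wt: "list_all2 (wt_trm Sg \<Delta>) Ms (rdom Sg r)" "r \<in> rels Sg" by simp_all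
  show ?case using map_tm_comp[OF wt(1) Rel(2-4)] wt Rel(2-4) tm_typ[OF wt(1)] by simp
next
  case (Equ \<sigma> N K)
  then have wt: "wt_trm Sg \<Delta> N \<sigma>" "wt_trm Sg \<Delta> K \<sigma>" "\<sigma> \<in> sorts Sg" by simp_all
  show ?case using Equ(2-4) wt trm_arr_tsub[OF wt(1) Equ(2-4)] trm_arr_tsub[OF wt(2) Equ(2-4)]
    by simp
next
  case (Conn k \<phi>s)
  then have "map (fml_val C M \<Gamma>) (map (fsub s) \<phi>s) = map (sub C (msub \<Gamma> \<Delta> s)) (map (fml_val C M \<Delta>) \<phi>s)"
    by simp
  moreover have "set (map (fml_val C M \<Delta>) \<phi>s) \<subseteq> pred C (ctx_ob C M \<Delta>)"
    using Conn(2-) by auto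
  ultimately show ?case using Conn(2-)
    by (simp add: sub_conn del: map_map set_map)
next
  case (Quant q \<tau> \<phi>)
  then have wt: "wt_fml L Sg (\<tau> # \<Delta>) \<phi>" "\<tau> \<in> sorts Sg" "q \<in> quants L" by simp_all
  have val: "fml_val C M (\<tau> # \<Delta>) \<phi> \<in> pred C (ctx_ob C M (\<tau> # \<Delta>))"
    using wt Quant(3-) by (intro fml_val_pred) simp_all
  show ?case
    using Quant(1)[OF wt(1) wt_up[OF Quant(3)]] wt Quant(3-) val
    by (simp add: msub_up sub_quant)
qed

text \<open>Well-formedness is imposed because \<open>satisfies\<close> also judges ill-typed
  assertions, whereas an \<open>Lm_theory\<close> may contain only well-formed ones.\<close>

definition Th :: "('u, 'k, 'q) assertion set" where
  "Th = {a. wf_assertion L Sg a \<and> satisfies L C M a}"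

lemma EqA_Th: "EqA \<Gamma> \<sigma> N K \<in> Th \<longleftrightarrow> is_ctx Sg \<Gamma> \<and> wt_trm Sg \<Gamma> N \<sigma> \<and> wt_trm Sg \<Gamma> K \<sigma> \<and>
    trm_arr C M \<Gamma> N = trm_arr C M \<Gamma> K"
  by (auto simp: Th_def)

abbreviation vals :: "'u ctx \<Rightarrow> ('u, 'k, 'q) fml list \<Rightarrow> 'p" where
  "vals \<Gamma> \<Phi> \<equiv> tensors (ctx_ob C M \<Gamma>) (map (fml_val C M \<Gamma>) \<Phi>)"

lemma SeqA_Th: "SeqA \<Gamma> \<Phi> \<phi> \<in> Th \<longleftrightarrow> is_ctx Sg \<Gamma> \<and> (\<forall>\<psi>\<in>set \<Phi>. wt_fml L Sg \<Gamma> \<psi>) \<and> wt_fml L Sg \<Gamma> \<phi> \<and>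
    le C (ctx_ob C M \<Gamma>) (vals \<Gamma> \<Phi>) (fml_val C M \<Gamma> \<phi>)"
  by (auto simp: Th_def)

lemma SeqA1_Th: "SeqA \<Gamma> [\<psi>] \<phi> \<in> Th \<longleftrightarrow> is_ctx Sg \<Gamma> \<and> wt_fml L Sg \<Gamma> \<psi> \<and> wt_fml L Sg \<Gamma> \<phi> \<and>
    le C (ctx_ob C M \<Gamma>) (fml_val C M \<Gamma> \<psi>) (fml_val C M \<Gamma> \<phi>)"
  by (auto simp: SeqA_Th)

text \<open>Antisymmetry turns mutual derivability into equality of values. This is why the
  congruence rules are sound for connectives and quantifiers that are not monotone.\<close>

lemma SeqA_both_Th:
  "SeqA \<Gamma> [\<psi>] \<phi> \<in> Th \<and> SeqA \<Gamma> [\<phi>] \<psi> \<in> Th \<longleftrightarrow> is_ctx Sg \<Gamma> \<and> wt_fml L Sg \<Gamma> \<psi> \<and> wt_fml L Sg \<Gamma> \<phi> \<and>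
    fml_val C M \<Gamma> \<psi> = fml_val C M \<Gamma> \<phi>"
  by (auto simp: SeqA1_Th intro!: le_antisym[of "ctx_ob C M \<Gamma>"])

lemma vals_pred [simp]:
  "is_ctx Sg \<Gamma> \<Longrightarrow> \<forall>\<psi>\<in>set \<Phi>. wt_fml L Sg \<Gamma> \<psi> \<Longrightarrow> vals \<Gamma> \<Phi> \<in> pred C (ctx_ob C M \<Gamma>)"
  by (intro tensors_pred) auto

lemma vals_append:
  "is_ctx Sg \<Gamma> \<Longrightarrow> \<forall>\<psi>\<in>set \<Phi>. wt_fml L Sg \<Gamma> \<psi> \<Longrightarrow> \<forall>\<psi>\<in>set \<Psi>. wt_fml L Sg \<Gamma> \<psi> \<Longrightarrow>
    vals \<Gamma> (\<Phi> @ \<Psi>) = tensor_p L C (ctx_ob C M \<Gamma>) (vals \<Gamma> \<Phi>) (vals \<Gamma> \<Psi>)"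
  using tensors_append[of "ctx_ob C M \<Gamma>" "map (fml_val C M \<Gamma>) \<Phi>" "map (fml_val C M \<Gamma>) \<Psi>"]
  by (simp add: image_subset_iff)

lemmas wt_tensor_unit [simp] = wt_tensor_f[OF lang] wt_unit_f[OF lang]

lemma val_tensor_f [simp]: "fml_val C M \<Gamma> (tensor_f L \<alpha> \<beta>) =
    tensor_p L C (ctx_ob C M \<Gamma>) (fml_val C M \<Gamma> \<alpha>) (fml_val C M \<Gamma> \<beta>)"
  and val_unit_f [simp]: "fml_val C M \<Gamma> (unit_f L) = unit_p L C (ctx_ob C M \<Gamma>)"
  by (auto simp: tensor_f_def unit_f_def tensor_p_def unit_p_def)

text \<open>Reindexing is monotone and preserves the tensor of the antecedent. Weakening is an
  instance, and so is plain substitution of terms.\<close>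

lemma seq_fsub_Th:
  assumes "SeqA \<Delta> \<Phi> \<phi> \<in> Th" "wt_sub Sg \<Gamma> \<Delta> s" "is_ctx Sg \<Gamma>"
  shows "SeqA \<Gamma> (map (fsub s) \<Phi>) (fsub s \<phi>) \<in> Th"
proof -
  have A: "is_ctx Sg \<Delta>" "\<forall>\<psi>\<in>set \<Phi>. wt_fml L Sg \<Delta> \<psi>" "wt_fml L Sg \<Delta> \<phi>"
    "le C (ctx_ob C M \<Delta>) (vals \<Delta> \<Phi>) (fml_val C M \<Delta> \<phi>)" using assms(1) unfolding SeqA_Th by auto
  have "map (fml_val C M \<Gamma>) (map (fsub s) \<Phi>) = map (sub C (msub \<Gamma> \<Delta> s)) (map (fml_val C M \<Delta>) \<Phi>)"
    using A assms by (auto intro!: fml_val_fsub)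
  moreover have "sub C (msub \<Gamma> \<Delta> s) (vals \<Delta> \<Phi>) =
      tensors (ctx_ob C M \<Gamma>) (map (sub C (msub \<Gamma> \<Delta> s)) (map (fml_val C M \<Delta>) \<Phi>))"
    using A assms by (subst sub_tensors) auto
  ultimately have "vals \<Gamma> (map (fsub s) \<Phi>) = sub C (msub \<Gamma> \<Delta> s) (vals \<Delta> \<Phi>)"
    by metis
  moreover have "fml_val C M \<Gamma> (fsub s \<phi>) = sub C (msub \<Gamma> \<Delta> s) (fml_val C M \<Delta> \<phi>)"
    using A assms by (intro fml_val_fsub) auto
  moreover have "le C (ctx_ob C M \<Gamma>) (sub C (msub \<Gamma> \<Delta> s) (vals \<Delta> \<Phi>)) (sub C (msub \<Gamma> \<Delta> s) (fml_val C M \<Delta> \<phi>))"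
    using sub_mono[of "msub \<Gamma> \<Delta> s" "vals \<Delta> \<Phi>" "fml_val C M \<Delta> \<phi>"] A assms by simp
  ultimately show ?thesis using A assms by (auto simp: SeqA_Th intro: wt_fsub)
qed

lemma fsub_eq_val:
  assumes "wt_fml L Sg \<Delta> \<phi>" "is_ctx Sg \<Gamma>" "is_ctx Sg \<Delta>" "length Ms = length \<Delta>" "length Ms' = length \<Delta>"
    "\<And>i. i < length \<Delta> \<Longrightarrow> EqA \<Gamma> (\<Delta> ! i) (Ms ! i) (Ms' ! i) \<in> Th"
  shows "fml_val C M \<Gamma> (fsub (inst Ms) \<phi>) = fml_val C M \<Gamma> (fsub (inst Ms') \<phi>)"
proof -
  have wt: "list_all2 (wt_trm Sg \<Gamma>) Ms \<Delta>" "list_all2 (wt_trm Sg \<Gamma>) Ms' \<Delta>"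
    using assms by (auto simp: list_all2_conv_all_nth EqA_Th)
  have "map (trm_arr C M \<Gamma>) Ms = map (trm_arr C M \<Gamma>) Ms'"
    using assms by (auto simp: EqA_Th intro!: nth_equalityI)
  then have "msub \<Gamma> \<Delta> (inst Ms) = msub \<Gamma> \<Delta> (inst Ms')"
    using assms by (simp add: msub_inst)
  then show ?thesis using fml_val_fsub[OF assms(1) wt_inst[OF wt(1)]] fml_val_fsub[OF assms(1) wt_inst[OF wt(2)]]
    assms by simp
qed

text \<open>Derivations start from \<open>Th\<close> itself, so each induction hypothesis is
  membership in \<open>Th\<close>, which carries the typing of the premises along with their
  truth.\<close>

lemma soundness: "Lm L Sg Th a \<Longrightarrow> a \<in> Th"
proof (induction rule: Lm.induct)
  case (eq_subst \<Gamma> \<Delta> \<sigma> N N' Ms Ms')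
  have wt: "list_all2 (wt_trm Sg \<Gamma>) Ms \<Delta>" "list_all2 (wt_trm Sg \<Gamma>) Ms' \<Delta>"
    using eq_subst by (auto simp: list_all2_conv_all_nth EqA_Th)
  have "map (trm_arr C M \<Gamma>) Ms = map (trm_arr C M \<Gamma>) Ms'"
    using eq_subst by (auto simp: EqA_Th intro!: nth_equalityI)
  then have "msub \<Gamma> \<Delta> (inst Ms) = msub \<Gamma> \<Delta> (inst Ms')"
    using eq_subst by (simp add: msub_inst)
  then show ?case using eq_subst wt_inst[OF wt(1)] wt_inst[OF wt(2)]
    by (auto simp: EqA_Th trm_arr_tsub[where \<Delta> = \<Delta>] intro: wt_tsub)
next
  case (cut \<Gamma> \<Phi> \<phi> \<Psi> \<Psi>' \<theta>)
  let ?c = "ctx_ob C M \<Gamma>"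
  have wt: "is_ctx Sg \<Gamma>" "\<forall>\<psi>\<in>set \<Phi>. wt_fml L Sg \<Gamma> \<psi>" "\<forall>\<psi>\<in>set \<Psi>. wt_fml L Sg \<Gamma> \<psi>"
    "\<forall>\<psi>\<in>set \<Psi>'. wt_fml L Sg \<Gamma> \<psi>" "wt_fml L Sg \<Gamma> \<phi>" "wt_fml L Sg \<Gamma> \<theta>"
    "le C ?c (vals \<Gamma> \<Phi>) (fml_val C M \<Gamma> \<phi>)" "le C ?c (vals \<Gamma> (\<Psi> @ [\<phi>] @ \<Psi>')) (fml_val C M \<Gamma> \<theta>)"
    using cut.IH unfolding SeqA_Th by auto
  have e1: "vals \<Gamma> (\<Psi> @ [\<phi>] @ \<Psi>') = tensor_p L C ?c (vals \<Gamma> \<Psi>) (tensor_p L C ?c (fml_val C M \<Gamma> \<phi>) (vals \<Gamma> \<Psi>'))"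
    using wt by (subst vals_append) simp_all
  have e2: "vals \<Gamma> (\<Psi> @ \<Phi> @ \<Psi>') = tensor_p L C ?c (vals \<Gamma> \<Psi>) (tensor_p L C ?c (vals \<Gamma> \<Phi>) (vals \<Gamma> \<Psi>'))"
    using wt vals_append[of \<Gamma> \<Psi> "\<Phi> @ \<Psi>'"] vals_append[of \<Gamma> \<Phi> "\<Psi>'"] by auto
  \<comment> \<open>The cut formula is replaced inside a tensor; this is where monotonicity of the
    tensor enters.\<close>
  have "le C ?c (vals \<Gamma> (\<Psi> @ \<Phi> @ \<Psi>')) (vals \<Gamma> (\<Psi> @ [\<phi>] @ \<Psi>'))"
    unfolding e1 e2 using wt by (intro tensor_mono le_refl tensor_pred vals_pred) simp_all
  then have "le C ?c (vals \<Gamma> (\<Psi> @ \<Phi> @ \<Psi>')) (fml_val C M \<Gamma> \<theta>)"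
    using wt by (rule_tac le_trans[of _ _ "vals \<Gamma> (\<Psi> @ [\<phi>] @ \<Psi>')"])
      (simp_all only: vals_pred ctx_ob fml_val_pred set_append ball_Un set_simps ball_simps simp_thms)
  then show ?case using wt unfolding SeqA_Th by auto
next
  case (weaken \<Gamma> \<Phi> \<phi> \<tau>)
  then show ?case using seq_fsub_Th[OF _ wt_wk] by (auto simp: SeqA_Th)
next
  case (subst \<Gamma> \<Delta> \<Phi> \<phi> Ms Ms')
  have wt: "list_all2 (wt_trm Sg \<Gamma>) Ms \<Delta>" "list_all2 (wt_trm Sg \<Gamma>) Ms' \<Delta>"
    using subst by (auto simp: list_all2_conv_all_nth EqA_Th)
  have "SeqA \<Gamma> (map (fsub (inst Ms)) \<Phi>) (fsub (inst Ms) \<phi>) \<in> Th"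
    using subst wt by (intro seq_fsub_Th wt_inst) auto
  moreover have "fml_val C M \<Gamma> (fsub (inst Ms) \<phi>) = fml_val C M \<Gamma> (fsub (inst Ms') \<phi>)"
    using subst by (intro fsub_eq_val[of \<Delta>]) (auto simp: SeqA_Th)
  moreover have "wt_fml L Sg \<Gamma> (fsub (inst Ms') \<phi>)"
    using subst wt by (intro wt_fsub[of _ _ \<Delta>] wt_inst) (auto simp: SeqA_Th)
  ultimately show ?case by (auto simp: SeqA_Th)
next
  case (conn_cong \<Gamma> k \<phi>s \<psi>s)
  then have *: "is_ctx Sg \<Gamma> \<and> wt_fml L Sg \<Gamma> (\<phi>s ! i) \<and> wt_fml L Sg \<Gamma> (\<psi>s ! i) \<and>
    fml_val C M \<Gamma> (\<phi>s ! i) = fml_val C M \<Gamma> (\<psi>s ! i)" if "i < arity L k" for i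
    using SeqA_both_Th[of \<Gamma> "\<phi>s ! i" "\<psi>s ! i"] that by blast
  then have "map (fml_val C M \<Gamma>) \<phi>s = map (fml_val C M \<Gamma>) \<psi>s"
    using conn_cong(3,4) by (auto intro!: nth_equalityI)
  moreover have "\<forall>\<phi>\<in>set \<phi>s. wt_fml L Sg \<Gamma> \<phi>" "\<forall>\<phi>\<in>set \<psi>s. wt_fml L Sg \<Gamma> \<phi>"
    using * conn_cong(3,4) by (auto simp: in_set_conv_nth)
  ultimately have "SeqA \<Gamma> [Conn k \<phi>s] (Conn k \<psi>s) \<in> Th \<and> SeqA \<Gamma> [Conn k \<psi>s] (Conn k \<phi>s) \<in> Th"
    unfolding SeqA_both_Th using conn_cong by simp
  then show ?case by blast
next
  case (quant_cong q \<tau> \<Gamma> \<phi> \<psi>)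
  then have "fml_val C M (\<tau> # \<Gamma>) \<phi> = fml_val C M (\<tau> # \<Gamma>) \<psi>" "is_ctx Sg (\<tau> # \<Gamma>)"
    "wt_fml L Sg (\<tau> # \<Gamma>) \<phi>" "wt_fml L Sg (\<tau> # \<Gamma>) \<psi>"
    using SeqA_both_Th[of "\<tau> # \<Gamma>" \<phi> \<psi>] by blast+
  then have "SeqA \<Gamma> [Quant q \<tau> \<phi>] (Quant q \<tau> \<psi>) \<in> Th \<and> SeqA \<Gamma> [Quant q \<tau> \<psi>] (Quant q \<tau> \<phi>) \<in> Th"
    unfolding SeqA_both_Th using quant_cong by simp
  then show ?case by blast
next
  case (tensor_in \<Gamma> \<Phi> \<alpha> \<beta> \<Psi> \<theta>)
  then show ?case by (auto simp: SeqA_Th)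
next
  case (tensor_out \<Gamma> \<Phi> \<alpha> \<beta> \<Psi> \<theta>)
  then show ?case by (auto simp: SeqA_Th)
next
  case (unit_in \<Gamma> \<Phi> \<Psi> \<theta>)
  then show ?case by (auto simp: SeqA_Th)
next
  case (unit_out \<Gamma> \<Phi> \<Psi> \<theta>)
  then show ?case by (auto simp: SeqA_Th)
qed (auto simp: EqA_Th SeqA1_Th)

lemma Lm_theory_Th: "Lm_theory L Sg Th"
proof -
  have "is_theory L Sg Th" by (simp add: is_theory_def Th_def)
  then show ?thesis unfolding Lm_theory_def using soundness by blast
qed

end

section \<open>Transport of structures along morphisms\<close>

text \<open>Of the source only the finite-product structure is assumed: in \<open>reflection\<close>
  its remaining axioms are derived from those of the target.\<close>

locale premorphism = E: fpcategory E + D: prop_category L D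
  for L :: "('k, 'q) lang" and E :: "('o, 'a, 'p, 'k, 'q) propcat"
    and D :: "('o', 'a', 'p', 'k, 'q) propcat" +
  fixes F :: "('o, 'a, 'p, 'o', 'a', 'p') pmor"
  assumes morphism: "is_morphism L E D F"
begin

lemma functorial: "is_functor E D F"
  using morphism by (simp add: is_morphism_def)

lemma mo_ob [simp]: "c \<in> ob E \<Longrightarrow> mo F c \<in> ob D"
  and ma_idn [simp]: "c \<in> ob E \<Longrightarrow> ma F (idn E c) = idn D (mo F c)"
  using functorial by (simp_all add: is_functor_def)

lemma ma_typ [simp]:
  assumes "f \<in> arr E"
  shows "ma F f \<in> arr D" "dm D (ma F f) = mo F (dm E f)" "cd D (ma F f) = mo F (cd E f)"
  using functorial assms by (auto simp: is_functor_def hom_def)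

lemma ma_comp [simp]:
  "f \<in> arr E \<Longrightarrow> g \<in> arr E \<Longrightarrow> cd E f = dm E g \<Longrightarrow> ma F (comp E g f) = comp D (ma F g) (ma F f)"
  using functorial unfolding is_functor_def by blast

lemma iso_bang: "is_iso D (bang D (mo F (one E)))"
  and iso_cmp: "b \<in> ob E \<Longrightarrow> c \<in> ob E \<Longrightarrow> is_iso D (cmp E D F b c)"
  using functorial unfolding is_functor_def by blast+

lemma mp_pred [simp]: "x \<in> pred E c \<Longrightarrow> c \<in> ob E \<Longrightarrow> d = mo F c \<Longrightarrow> mp F c x \<in> pred D d"
  using morphism unfolding is_morphism_def by blast

lemma mp_sub: "f \<in> arr E \<Longrightarrow> x \<in> pred E (cd E f) \<Longrightarrow> b = dm E f \<Longrightarrow>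
    mp F b (sub E f x) = sub D (ma F f) (mp F (cd E f) x)"
  using morphism unfolding is_morphism_def by blast

lemma mp_conn:
  assumes "c \<in> ob E" "k \<in> conns L" "set xs \<subseteq> pred E c" "length xs = arity L k"
  shows "mp F c (conn E c k xs) = conn D (mo F c) k (map (mp F c) xs)"
proof -
  have "\<forall>c\<in>ob E. \<forall>k\<in>conns L. \<forall>xs\<in>lists (pred E c). length xs = arity L k \<longrightarrow>
        mp F c (conn E c k xs) = conn D (mo F c) k (map (mp F c) xs)"
    using morphism unfolding is_morphism_def by blast
  then show ?thesis using assms by (simp add: lists_eq_set)
qed

lemma mp_quant: "q \<in> quants L \<Longrightarrow> b \<in> ob E \<Longrightarrow> c \<in> ob E \<Longrightarrow> x \<in> pred E (prd E b c) \<Longrightarrow>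
    mp F b (quant E q b c x) =
      quant D q (mo F b) (mo F c) (sub D (inv_arr D (cmp E D F b c)) (mp F (prd E b c) x))"
  using morphism unfolding is_morphism_def by blast

lemma mp_eqp: "c \<in> ob E \<Longrightarrow> mp F (prd E c c) (eqp E c) = sub D (cmp E D F c c) (eqp D (mo F c))"
  using morphism unfolding is_morphism_def by blast

lemma cmp_typ [simp]:
  assumes "b \<in> ob E" "c \<in> ob E"
  shows "cmp E D F b c \<in> arr D" "dm D (cmp E D F b c) = mo F (prd E b c)"
    "cd D (cmp E D F b c) = prd D (mo F b) (mo F c)"
  using assms by (simp_all add: cmp_def)

lemma cmp_pair:
  assumes "f \<in> arr E" "g \<in> arr E" "dm E f = dm E g" "b = cd E f" "c = cd E g"
  shows "comp D (cmp E D F b c) (ma F (pair E f g)) = pair D (ma F f) (ma F g)"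
  using assms by (simp add: cmp_def flip: ma_comp)

lemma mp_unit [simp]: "c \<in> ob E \<Longrightarrow> mp F c (unit_p L E c) = unit_p L D (mo F c)"
  using D.lang mp_conn[of c "unit_c L" "[]"] by (simp add: unit_p_def language_def)

lemma mp_tensor [simp]: "c \<in> ob E \<Longrightarrow> x \<in> pred E c \<Longrightarrow> y \<in> pred E c \<Longrightarrow>
    mp F c (tensor_p L E c x y) = tensor_p L D (mo F c) (mp F c x) (mp F c y)"
  using D.lang mp_conn[of c "tensor_c L" "[x, y]"] by (simp add: tensor_p_def language_def)

end

locale morphism = E: prop_category L E + premorphism L E D F
  for L :: "('k, 'q) lang" and E :: "('o, 'a, 'p, 'k, 'q) propcat"
    and D :: "('o', 'a', 'p', 'k, 'q) propcat" and F :: "('o, 'a, 'p, 'o', 'a', 'p') pmor"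
begin

lemma mp_tensors: "c \<in> ob E \<Longrightarrow> set xs \<subseteq> pred E c \<Longrightarrow>
    mp F c (E.tensors c xs) = D.tensors (mo F c) (map (mp F c) xs)"
  by (induction xs) auto

text \<open>The canonical isomorphism between the image of a context and the context of the images.\<close>

fun theta :: "('u, 'o, 'a, 'p) struc \<Rightarrow> 'u ctx \<Rightarrow> 'a'" where
  "theta M [] = bang D (mo F (one E))"
| "theta M (\<tau> # \<Gamma>) = pair D (comp D (theta M \<Gamma>) (ma F (pr1 E (ctx_ob E M \<Gamma>) (isort M \<tau>))))
     (ma F (pr2 E (ctx_ob E M \<Gamma>) (isort M \<tau>)))"

text \<open>\<open>F\<close> yields symbols over the image of the argument context, while a
  structure in \<open>D\<close> needs them over the context of the images. Precomposing with the
  inverse of \<open>theta\<close> makes the change; the codomain is a single sort and requires no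
  correction.\<close>

definition push :: "'u signature \<Rightarrow> ('u, 'o, 'a, 'p) struc \<Rightarrow> ('u, 'o', 'a', 'p') struc" where
  "push Sg M = \<lparr>isort = \<lambda>\<sigma>. mo F (isort M \<sigma>),
     ifun = \<lambda>f. comp D (ma F (ifun M f)) (inv_arr D (theta M (fdom Sg f))),
     irel = \<lambda>r. sub D (inv_arr D (theta M (rdom Sg r))) (mp F (ctx_ob E M (rdom Sg r)) (irel M r))\<rparr>"

end

locale morphism_struc = morphism L E D F + S: structure_in L E Sg M
  for L :: "('k, 'q) lang" and E :: "('o, 'a, 'p, 'k, 'q) propcat"
    and D :: "('o', 'a', 'p', 'k, 'q) propcat" and F :: "('o, 'a, 'p, 'o', 'a', 'p') pmor"
    and Sg :: "'u signature" and M :: "('u, 'o, 'a, 'p) struc"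
begin

abbreviation "N \<equiv> push Sg M"
abbreviation "cE \<equiv> ctx_ob E M"
abbreviation "cD \<equiv> ctx_ob D N"
abbreviation "th \<equiv> theta M"

lemma isort_N [simp]: "isort N \<sigma> = mo F (isort M \<sigma>)"
  by (simp add: push_def)

lemma cD_ob [simp]: "is_ctx Sg \<Gamma> \<Longrightarrow> cD \<Gamma> \<in> ob D"
  by (induction \<Gamma>) auto

lemma theta_typ [simp]:
  assumes "is_ctx Sg \<Gamma>"
  shows "th \<Gamma> \<in> arr D" "dm D (th \<Gamma>) = mo F (cE \<Gamma>)" "cd D (th \<Gamma>) = cD \<Gamma>"
proof -
  have "th \<Gamma> \<in> arr D \<and> dm D (th \<Gamma>) = mo F (cE \<Gamma>) \<and> cd D (th \<Gamma>) = cD \<Gamma>"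
    using assms by (induction \<Gamma>) simp_all
  then show "th \<Gamma> \<in> arr D" "dm D (th \<Gamma>) = mo F (cE \<Gamma>)" "cd D (th \<Gamma>) = cD \<Gamma>" by auto
qed

text \<open>Factored through \<open>cmp\<close>, \<open>theta\<close> is invertible by induction,
  and the inverse of \<open>cmp\<close> in \<open>mp_quant\<close> cancels against this factor. What
  remains is a \<open>times_id\<close>, to which naturality of quantifiers in \<open>D\<close>
  applies.\<close>

lemma theta_Cons: "is_ctx Sg (\<tau> # \<Gamma>) \<Longrightarrow>
    th (\<tau> # \<Gamma>) = comp D (times_id D (th \<Gamma>) (mo F (isort M \<tau>))) (cmp E D F (cE \<Gamma>) (isort M \<tau>))"
  by (simp add: times_id_def cmp_def)

lemma iso_theta: "is_ctx Sg \<Gamma> \<Longrightarrow> is_iso D (th \<Gamma>)"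
proof (induction \<Gamma>)
  case Nil
  then show ?case using iso_bang by simp
next
  case (Cons \<tau> \<Gamma>)
  then show ?case unfolding theta_Cons[OF Cons(2)]
    by (intro D.is_iso_comp D.is_iso_times_id iso_cmp) simp_all
qed

lemma theta_inv [simp]:
  assumes "is_ctx Sg \<Gamma>"
  shows "inv_arr D (th \<Gamma>) \<in> arr D" "dm D (inv_arr D (th \<Gamma>)) = cD \<Gamma>" "cd D (inv_arr D (th \<Gamma>)) = mo F (cE \<Gamma>)"
    "comp D (inv_arr D (th \<Gamma>)) (th \<Gamma>) = idn D (mo F (cE \<Gamma>))"
    "comp D (th \<Gamma>) (inv_arr D (th \<Gamma>)) = idn D (cD \<Gamma>)"
  using D.iso_inv[OF iso_theta[OF assms]] assms by simp_all

lemma struc_N: "is_struc D Sg N"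
  by (auto simp: is_struc_def hom_def) (auto simp: push_def)

sublocale T: structure_in L D Sg N
  using S.sig struc_N by unfold_locales

lemma var_arr_theta:
  "is_ctx Sg \<Gamma> \<Longrightarrow> i < length \<Gamma> \<Longrightarrow> comp D (var_arr D N \<Gamma> i) (th \<Gamma>) = ma F (var_arr E M \<Gamma> i)"
proof (induction \<Gamma> arbitrary: i)
  case (Cons \<tau> \<Gamma>)
  show ?case
  proof (cases i)
    case 0
    then show ?thesis using Cons by simp
  next
    case (Suc j)
    then have j: "j < length \<Gamma>" "is_ctx Sg \<Gamma>" using Cons by auto
    note v = D.var_arr_typ[of \<Gamma> N j] E.var_arr_typ[of \<Gamma> M j]
    have "comp D (var_arr D N (\<tau> # \<Gamma>) i) (th (\<tau> # \<Gamma>)) =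
       comp D (comp D (var_arr D N \<Gamma> j) (th \<Gamma>)) (ma F (pr1 E (cE \<Gamma>) (isort M \<tau>)))"
      using Suc j v Cons(2) T.isorts_ob[OF j(2)] by simp
    then show ?thesis using Suc j v Cons(1)[OF j(2,1)] S.isorts_ob[OF j(2)] Cons(2) by simp
  qed
qed simp

lemma theta_tuple:
  assumes "is_ctx Sg \<Delta>" "E.arrs M b fs \<Delta>"
  shows "comp D (th \<Delta>) (ma F (tuple E b fs)) = tuple D (mo F b) (map (ma F) fs)"
proof (rule sym, rule D.tuple_eqI)
  note t = E.tuple_typ[OF assms(2)]
  show A: "D.arrs N (mo F b) (map (ma F) fs) \<Delta>"
    using assms by (auto simp: D.arrs_def E.arrs_def list_all2_conv_all_nth)
  show "comp D (th \<Delta>) (ma F (tuple E b fs)) \<in> arr D" "dm D (comp D (th \<Delta>) (ma F (tuple E b fs))) = mo F b"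
    "cd D (comp D (th \<Delta>) (ma F (tuple E b fs))) = cD \<Delta>"
    using t assms(1) by simp_all
  fix i assume i: "i < length \<Delta>"
  have "comp D (var_arr D N \<Delta> i) (comp D (th \<Delta>) (ma F (tuple E b fs))) =
     comp D (comp D (var_arr D N \<Delta> i) (th \<Delta>)) (ma F (tuple E b fs))"
    using t assms(1) i T.isorts_ob[OF assms(1)] by simp
  also have "\<dots> = ma F (comp E (var_arr E M \<Delta> i) (tuple E b fs))"
    using t assms(1) i S.isorts_ob[OF assms(1)] by (simp add: var_arr_theta)
  finally show "comp D (var_arr D N \<Delta> i) (comp D (th \<Delta>) (ma F (tuple E b fs))) = map (ma F) fs ! i"
    using E.var_tuple[OF assms(2) i] E.arrs_length[OF assms(2)] i by simp
qed

text \<open>The hypothesis on the members of \<open>Ms\<close> is the conclusion of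
  \<open>trm_arr_theta\<close>. It is left open so that the lemma serves both inside the induction
  there and afterwards for relation symbols.\<close>

lemma tuple_theta:
  assumes "is_ctx Sg \<Gamma>" "is_ctx Sg \<Delta>" "list_all2 (wt_trm Sg \<Gamma>) Ms \<Delta>"
    "\<And>t \<sigma>. t \<in> set Ms \<Longrightarrow> wt_trm Sg \<Gamma> t \<sigma> \<Longrightarrow> comp D (trm_arr D N \<Gamma> t) (th \<Gamma>) = ma F (trm_arr E M \<Gamma> t)"
  shows "comp D (T.tm \<Gamma> Ms) (th \<Gamma>) = comp D (th \<Delta>) (ma F (S.tm \<Gamma> Ms))"
proof -
  have "map (\<lambda>f. comp D f (th \<Gamma>)) (map (trm_arr D N \<Gamma>) Ms) = map (ma F) (map (trm_arr E M \<Gamma>) Ms)"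
    using assms(3,4) by (fastforce simp: list_all2_conv_all_nth in_set_conv_nth)
  then show ?thesis
    using D.tuple_comp[OF T.arrs_trms[OF assms(1-3)], of "th \<Gamma>"] theta_tuple[OF assms(2) S.arrs_trms[OF assms(1-3)]]
      assms(1) by (simp del: map_map)
qed

lemma trm_arr_theta:
  assumes "wt_trm Sg \<Gamma> t \<sigma>" "is_ctx Sg \<Gamma>"
  shows "comp D (trm_arr D N \<Gamma> t) (th \<Gamma>) = ma F (trm_arr E M \<Gamma> t)"
  using assms
proof (induction t arbitrary: \<sigma>)
  case (Var i)
  then show ?case by (auto elim: wt_VarE simp: var_arr_theta)
next
  case (Fn f Ms)
  then have f: "f \<in> funs Sg" "list_all2 (wt_trm Sg \<Gamma>) Ms (fdom Sg f)" by (auto elim: wt_FnE)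
  have "comp D (T.tm \<Gamma> Ms) (th \<Gamma>) = comp D (th (fdom Sg f)) (ma F (S.tm \<Gamma> Ms))"
    using f Fn by (intro tuple_theta) auto
  moreover have "comp D (trm_arr D N \<Gamma> (Fn f Ms)) (th \<Gamma>) = comp D (ifun N f) (comp D (T.tm \<Gamma> Ms) (th \<Gamma>))"
    using f Fn(3) T.tm_typ[OF f(2)] by simp
  \<comment> \<open>\<open>push\<close> puts the inverse of \<open>theta\<close> in front of the
    symbol, where it cancels the \<open>theta\<close> left behind by the argument tuple.\<close>
  moreover have "comp D (ifun N f) (comp D (th (fdom Sg f)) (ma F (S.tm \<Gamma> Ms))) =
      comp D (ma F (ifun M f)) (comp D (comp D (inv_arr D (th (fdom Sg f))) (th (fdom Sg f))) (ma F (S.tm \<Gamma> Ms)))"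
    using f Fn(3) S.tm_typ[OF f(2)] by (simp add: push_def del: theta_inv(4,5))
  ultimately show ?case using f Fn(3) S.tm_typ[OF f(2)] by simp
qed

lemma fml_val_theta:
  assumes "wt_fml L Sg \<Gamma> \<phi>" "is_ctx Sg \<Gamma>"
  shows "sub D (th \<Gamma>) (fml_val D N \<Gamma> \<phi>) = mp F (cE \<Gamma>) (fml_val E M \<Gamma> \<phi>)"
  using assms
proof (induction \<phi> arbitrary: \<Gamma>)
  case (Rel r Ms)
  then have wt: "list_all2 (wt_trm Sg \<Gamma>) Ms (rdom Sg r)" "r \<in> rels Sg" by simp_all
  let ?\<Delta> = "rdom Sg r"
  let ?x = "mp F (cE ?\<Delta>) (irel M r)"
  have x: "?x \<in> pred D (mo F (cE ?\<Delta>))" using wt by simp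
  have "sub D (th \<Gamma>) (fml_val D N \<Gamma> (Rel r Ms)) =
      sub D (comp D (T.tm \<Gamma> Ms) (th \<Gamma>)) (sub D (inv_arr D (th ?\<Delta>)) ?x)"
    using T.tm_typ[OF wt(1) Rel(2)] wt(2) Rel(2) T.irel_pred[OF wt(2)] by (simp add: push_def)
  also have "\<dots> = sub D (comp D (th ?\<Delta>) (ma F (S.tm \<Gamma> Ms))) (sub D (inv_arr D (th ?\<Delta>)) ?x)"
    using tuple_theta[OF Rel(2) _ wt(1) trm_arr_theta] Rel(2) wt by simp
  also have "\<dots> = sub D (comp D (comp D (inv_arr D (th ?\<Delta>)) (th ?\<Delta>)) (ma F (S.tm \<Gamma> Ms))) ?x"
    using S.tm_typ[OF wt(1) Rel(2)] wt(2) x by (simp del: theta_inv(4,5))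
  also have "\<dots> = mp F (cE \<Gamma>) (fml_val E M \<Gamma> (Rel r Ms))"
    using S.tm_typ[OF wt(1) Rel(2)] wt(2) by (simp add: mp_sub)
  finally show ?case .
next
  case (Equ \<sigma> P K)
  then have wt: "wt_trm Sg \<Gamma> P \<sigma>" "wt_trm Sg \<Gamma> K \<sigma>" "\<sigma> \<in> sorts Sg" by simp_all
  have "sub D (th \<Gamma>) (fml_val D N \<Gamma> (Equ \<sigma> P K)) =
      sub D (pair D (ma F (trm_arr E M \<Gamma> P)) (ma F (trm_arr E M \<Gamma> K))) (eqp D (mo F (isort M \<sigma>)))"
    using T.trm_arr_typ[OF wt(1) Equ(2)] T.trm_arr_typ[OF wt(2) Equ(2)] wt(3) Equ(2)
    by (simp add: trm_arr_theta[OF wt(1)] trm_arr_theta[OF wt(2)])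
  also have "\<dots> = sub D (comp D (cmp E D F (isort M \<sigma>) (isort M \<sigma>)) (ma F (pair E (trm_arr E M \<Gamma> P) (trm_arr E M \<Gamma> K))))
      (eqp D (mo F (isort M \<sigma>)))"
    using S.trm_arr_typ[OF wt(1) Equ(2)] S.trm_arr_typ[OF wt(2) Equ(2)] wt(3) by (subst cmp_pair) simp_all
  also have "\<dots> = mp F (cE \<Gamma>) (fml_val E M \<Gamma> (Equ \<sigma> P K))"
    using S.trm_arr_typ[OF wt(1) Equ(2)] S.trm_arr_typ[OF wt(2) Equ(2)] wt(3) by (simp add: mp_sub mp_eqp)
  finally show ?case .
next
  case (Conn k \<phi>s)
  then have "map (sub D (th \<Gamma>)) (map (fml_val D N \<Gamma>) \<phi>s) = map (mp F (cE \<Gamma>)) (map (fml_val E M \<Gamma>) \<phi>s)"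
    by simp
  moreover have "set (map (fml_val D N \<Gamma>) \<phi>s) \<subseteq> pred D (cD \<Gamma>)" "set (map (fml_val E M \<Gamma>) \<phi>s) \<subseteq> pred E (cE \<Gamma>)"
    using Conn(2-) by auto
  ultimately show ?case using Conn(2-)
    by (simp add: D.sub_conn mp_conn del: map_map set_map)
next
  case (Quant q \<tau> \<phi>)
  then have wt: "wt_fml L Sg (\<tau> # \<Gamma>) \<phi>" "q \<in> quants L" "is_ctx Sg (\<tau> # \<Gamma>)" "is_ctx Sg \<Gamma>" "\<tau> \<in> sorts Sg" by simp_all
  let ?t = "isort M \<tau>"
  let ?c = "cmp E D F (cE \<Gamma>) ?t"
  have x: "fml_val D N (\<tau> # \<Gamma>) \<phi> \<in> pred D (prd D (cD \<Gamma>) (mo F ?t))"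
    using T.fml_val_pred[OF wt(1,3)] by simp
  have y: "fml_val E M (\<tau> # \<Gamma>) \<phi> \<in> pred E (prd E (cE \<Gamma>) ?t)"
    using S.fml_val_pred[OF wt(1,3)] by simp
  have iso: "is_iso D ?c" using wt by (intro iso_cmp) auto
  have "mp F (prd E (cE \<Gamma>) ?t) (fml_val E M (\<tau> # \<Gamma>) \<phi>) = sub D (th (\<tau> # \<Gamma>)) (fml_val D N (\<tau> # \<Gamma>) \<phi>)"
    using Quant(1)[OF wt(1,3)] by simp
  also have "\<dots> = sub D (comp D (times_id D (th \<Gamma>) (mo F ?t)) ?c) (fml_val D N (\<tau> # \<Gamma>) \<phi>)"
    unfolding theta_Cons[OF wt(3)] ..
  finally have "sub D (inv_arr D ?c) (mp F (prd E (cE \<Gamma>) ?t) (fml_val E M (\<tau> # \<Gamma>) \<phi>)) =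
      sub D (times_id D (th \<Gamma>) (mo F ?t)) (fml_val D N (\<tau> # \<Gamma>) \<phi>)"
    using x wt D.iso_inv[OF iso] by simp
  then show ?case using wt x y by (simp add: mp_quant D.sub_quant)
qed

text \<open>Precomposition with the isomorphism \<open>theta\<close> loses nothing, so an equation
  in \<open>N\<close> can be tested on the images under \<open>F\<close>.\<close>

lemma satisfies_EqA_push:
  assumes "wf_assertion L Sg (EqA \<Gamma> \<sigma> P K)"
  shows "satisfies L D N (EqA \<Gamma> \<sigma> P K) \<longleftrightarrow> ma F (trm_arr E M \<Gamma> P) = ma F (trm_arr E M \<Gamma> K)"
proof -
  have wt: "wt_trm Sg \<Gamma> P \<sigma>" "wt_trm Sg \<Gamma> K \<sigma>" "is_ctx Sg \<Gamma>" using assms by simp_all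
  have "trm_arr D N \<Gamma> t = comp D (ma F (trm_arr E M \<Gamma> t)) (inv_arr D (th \<Gamma>))" if "wt_trm Sg \<Gamma> t \<sigma>" for t
    using T.trm_arr_typ[OF that wt(3)] wt(3) by (simp flip: trm_arr_theta[OF that wt(3)])
  moreover have "ma F (trm_arr E M \<Gamma> t) = comp D (trm_arr D N \<Gamma> t) (th \<Gamma>)" if "wt_trm Sg \<Gamma> t \<sigma>" for t
    using trm_arr_theta[OF that wt(3)] by simp
  ultimately show ?thesis using wt by (metis satisfies.simps(1))
qed

text \<open>Reindexing along \<open>theta\<close> and along its inverse is monotone, so the
  inequality may be moved to the image of the context of \<open>E\<close>, where both sides are
  values of \<open>mp F\<close>.\<close>

lemma satisfies_SeqA_push:
  assumes "wf_assertion L Sg (SeqA \<Gamma> \<Phi> \<phi>)"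
  shows "satisfies L D N (SeqA \<Gamma> \<Phi> \<phi>) \<longleftrightarrow>
    le D (mo F (cE \<Gamma>)) (mp F (cE \<Gamma>) (S.vals \<Gamma> \<Phi>)) (mp F (cE \<Gamma>) (fml_val E M \<Gamma> \<phi>))"
proof -
  have wt: "\<forall>\<psi>\<in>set \<Phi>. wt_fml L Sg \<Gamma> \<psi>" "wt_fml L Sg \<Gamma> \<phi>" "is_ctx Sg \<Gamma>" using assms by simp_all
  let ?x = "T.vals \<Gamma> \<Phi>" and ?y = "fml_val D N \<Gamma> \<phi>"
  have xy: "?x \<in> pred D (cD \<Gamma>)" "?y \<in> pred D (cD \<Gamma>)" using wt by simp_all
  have "map (sub D (th \<Gamma>)) (map (fml_val D N \<Gamma>) \<Phi>) = map (mp F (cE \<Gamma>)) (map (fml_val E M \<Gamma>) \<Phi>)"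
    using wt by (simp add: fml_val_theta)
  moreover have "sub D (th \<Gamma>) ?x = D.tensors (mo F (cE \<Gamma>)) (map (sub D (th \<Gamma>)) (map (fml_val D N \<Gamma>) \<Phi>))"
    using wt by (subst D.sub_tensors) auto
  moreover have "mp F (cE \<Gamma>) (S.vals \<Gamma> \<Phi>) = D.tensors (mo F (cE \<Gamma>)) (map (mp F (cE \<Gamma>)) (map (fml_val E M \<Gamma>) \<Phi>))"
    using wt by (subst mp_tensors) auto
  ultimately have x: "mp F (cE \<Gamma>) (S.vals \<Gamma> \<Phi>) = sub D (th \<Gamma>) ?x" by metis
  have y: "mp F (cE \<Gamma>) (fml_val E M \<Gamma> \<phi>) = sub D (th \<Gamma>) ?y" using fml_val_theta wt by simp
  have "le D (cD \<Gamma>) ?x ?y" if "le D (mo F (cE \<Gamma>)) (sub D (th \<Gamma>) ?x) (sub D (th \<Gamma>) ?y)"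
    using D.sub_mono[of "inv_arr D (th \<Gamma>)" "sub D (th \<Gamma>) ?x" "sub D (th \<Gamma>) ?y"] that wt(3) xy by simp
  moreover have "le D (mo F (cE \<Gamma>)) (sub D (th \<Gamma>) ?x) (sub D (th \<Gamma>) ?y)" if "le D (cD \<Gamma>) ?x ?y"
    using D.sub_mono[of "th \<Gamma>" ?x ?y] that wt(3) xy by simp
  ultimately show ?thesis unfolding x y satisfies.simps by blast
qed

text \<open>Equations are reflected by faithfulness and sequents by the order embedding; the
  preservation halves hold for any morphism.\<close>

lemma satisfies_push:
  assumes "is_inclusion L E D F" "wf_assertion L Sg a"
  shows "satisfies L D N a \<longleftrightarrow> satisfies L E M a"
proof (cases a)
  case (EqA \<Gamma> \<sigma> P K)
  then have wt: "wt_trm Sg \<Gamma> P \<sigma>" "wt_trm Sg \<Gamma> K \<sigma>" "is_ctx Sg \<Gamma>" using assms by simp_all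
  have "trm_arr E M \<Gamma> t \<in> hom E (cE \<Gamma>) (isort M \<sigma>)" if "wt_trm Sg \<Gamma> t \<sigma>" for t
    using S.trm_arr_typ[OF that wt(3)] by (simp add: hom_def)
  moreover have "inj_on (ma F) (hom E (cE \<Gamma>) (isort M \<sigma>))"
    using assms(1) S.wt_sort[OF wt(3,1)] wt(3) unfolding is_inclusion_def by simp
  ultimately have "ma F (trm_arr E M \<Gamma> P) = ma F (trm_arr E M \<Gamma> K) \<longleftrightarrow> trm_arr E M \<Gamma> P = trm_arr E M \<Gamma> K"
    using wt unfolding inj_on_def by metis
  then show ?thesis using satisfies_EqA_push assms(2) EqA by auto
next
  case (SeqA \<Gamma> \<Phi> \<phi>)
  then have wt: "\<forall>\<psi>\<in>set \<Phi>. wt_fml L Sg \<Gamma> \<psi>" "wt_fml L Sg \<Gamma> \<phi>" "is_ctx Sg \<Gamma>" using assms by simp_all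
  have xy: "S.vals \<Gamma> \<Phi> \<in> pred E (cE \<Gamma>)" "fml_val E M \<Gamma> \<phi> \<in> pred E (cE \<Gamma>)" "cE \<Gamma> \<in> ob E"
    using wt by simp_all
  have "le D (mo F (cE \<Gamma>)) (mp F (cE \<Gamma>) (S.vals \<Gamma> \<Phi>)) (mp F (cE \<Gamma>) (fml_val E M \<Gamma> \<phi>)) \<longleftrightarrow>
      le E (cE \<Gamma>) (S.vals \<Gamma> \<Phi>) (fml_val E M \<Gamma> \<phi>)"
    using assms(1) xy unfolding is_inclusion_def is_morphism_def by blast
  then show ?thesis using satisfies_SeqA_push assms(2) SeqA by simp
qed

end

lemma inclusion_model:
  assumes "language L" "is_propcat L E" "is_propcat L D" "is_inclusion L E D F"
    "is_sig Sg" "is_struc E Sg M"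
  obtains N where "is_struc D Sg N"
    "\<And>a. wf_assertion L Sg a \<Longrightarrow> satisfies L D N a \<longleftrightarrow> satisfies L E M a"
proof -
  interpret morphism_struc L E D F Sg M
    using assms by unfold_locales (simp_all add: is_inclusion_def is_propcat_def)
  show ?thesis using that struc_N satisfies_push[OF assms(4)] by blast
qed

section \<open>Classifying prop-categories and their generic models\<close>

text \<open>The closure conditions of \<open>is_propcat\<close> without its equations. They are
  immediate for operations on classes of syntax and for transported operations, and they are what
  makes it meaningful to pull the equations back along \<open>F\<close>.\<close>

definition typed :: "('k, 'q) lang \<Rightarrow> ('o, 'a, 'p, 'k, 'q) propcat \<Rightarrow> bool" where
  "typed L C \<longleftrightarrow>
     (\<forall>f\<in>arr C. dm C f \<in> ob C \<and> cd C f \<in> ob C) \<and>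
     (\<forall>c\<in>ob C. idn C c \<in> hom C c c) \<and>
     (\<forall>f\<in>arr C. \<forall>g\<in>arr C. cd C f = dm C g \<longrightarrow> comp C g f \<in> hom C (dm C f) (cd C g)) \<and>
     one C \<in> ob C \<and>
     (\<forall>b\<in>ob C. \<forall>c\<in>ob C. prd C b c \<in> ob C \<and>
        pr1 C b c \<in> hom C (prd C b c) b \<and> pr2 C b c \<in> hom C (prd C b c) c) \<and>
     (\<forall>f\<in>arr C. \<forall>x\<in>pred C (cd C f). sub C f x \<in> pred C (dm C f)) \<and>
     (\<forall>c\<in>ob C. \<forall>k\<in>conns L. \<forall>xs\<in>lists (pred C c). length xs = arity L k \<longrightarrow>
        conn C c k xs \<in> pred C c) \<and>
     (\<forall>q\<in>quants L. \<forall>b\<in>ob C. \<forall>c\<in>ob C. \<forall>x\<in>pred C (prd C b c). quant C q b c x \<in> pred C b) \<and>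
     (\<forall>c\<in>ob C. eqp C c \<in> pred C (prd C c c))"

locale lm_theory =
  fixes L :: "('k, 'q) lang" and Sg :: "'u signature" and T :: "('u, 'k, 'q) assertion set"
  assumes lang: "language L" and sig: "is_sig Sg" and Lm_theory: "Lm_theory L Sg T"
begin

abbreviation "C \<equiv> classifying L Sg T"

lemmas wt_tensor_unit [simp] = wt_tensor_f[OF lang] wt_unit_f[OF lang]

text \<open>\<open>T\<close> is deductively closed, so rewriting \<open>Lm.intros\<close> with this
  equivalence turns every rule into a closure property of \<open>T\<close>.\<close>

lemma Lm_iff: "Lm L Sg T a \<longleftrightarrow> a \<in> T"
proof
  show "a \<in> T" if "Lm L Sg T a" using Lm_theory that unfolding Lm_theory_def by blast
qed (rule Lm.hyp)

lemmas T_rules = Lm.intros[where L = L and Sg = Sg and T = T, unfolded Lm_iff]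
lemmas T_eq_refl = T_rules(2) and T_eq_sym = T_rules(3) and T_eq_trans = T_rules(4)
  and T_eq_subst = T_rules(5) and T_ax = T_rules(6) and T_cut = T_rules(7)
  and T_subst = T_rules(9) and T_conn_cong = T_rules(10) and T_quant_cong = T_rules(11)
  and T_tensor_in = T_rules(12) and T_tensor_out = T_rules(13)
  and T_unit_in = T_rules(14) and T_unit_out = T_rules(15)

lemma wf_T: "a \<in> T \<Longrightarrow> wf_assertion L Sg a"
  using Lm_theory by (simp add: Lm_theory_def is_theory_def)

lemma T_EqA_wt: "EqA \<Gamma> \<sigma> M N \<in> T \<Longrightarrow> is_ctx Sg \<Gamma> \<and> wt_trm Sg \<Gamma> M \<sigma> \<and> wt_trm Sg \<Gamma> N \<sigma>"
  using wf_T by fastforce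

lemma T_SeqA_wt:
  "SeqA \<Gamma> \<Phi> \<phi> \<in> T \<Longrightarrow> is_ctx Sg \<Gamma> \<and> (\<forall>\<psi>\<in>set \<Phi>. wt_fml L Sg \<Gamma> \<psi>) \<and> wt_fml L Sg \<Gamma> \<phi>"
  using wf_T by fastforce

lemma is_ctx_nth: "is_ctx Sg \<Gamma> \<Longrightarrow> i < length \<Gamma> \<Longrightarrow> \<Gamma> ! i \<in> sorts Sg"
  by (auto simp: is_ctx_def)

subsection \<open>Arrows\<close>

definition wts :: "'u ctx \<Rightarrow> 'u ctx \<Rightarrow> 'u trm list \<Rightarrow> bool" where
  "wts \<Gamma> \<Delta> Ms \<longleftrightarrow> is_ctx Sg \<Gamma> \<and> is_ctx Sg \<Delta> \<and> list_all2 (wt_trm Sg \<Gamma>) Ms \<Delta>"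

definition eqs :: "'u ctx \<Rightarrow> 'u ctx \<Rightarrow> 'u trm list \<Rightarrow> 'u trm list \<Rightarrow> bool" where
  "eqs \<Gamma> \<Delta> Ms Ns \<longleftrightarrow> length Ms = length \<Delta> \<and> length Ns = length \<Delta> \<and>
     (\<forall>i<length \<Delta>. EqA \<Gamma> (\<Delta> ! i) (Ms ! i) (Ns ! i) \<in> T)"

abbreviation "ar \<equiv> cl_arr T"

lemma wts_length: "wts \<Gamma> \<Delta> Ms \<Longrightarrow> length Ms = length \<Delta>"
  by (auto simp: wts_def list_all2_lengthD)

lemma wts_ctx: "wts \<Gamma> \<Delta> Ms \<Longrightarrow> is_ctx Sg \<Gamma>" "wts \<Gamma> \<Delta> Ms \<Longrightarrow> is_ctx Sg \<Delta>"
  by (auto simp: wts_def)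

lemma wts_nth: "wts \<Gamma> \<Delta> Ms \<Longrightarrow> i < length \<Delta> \<Longrightarrow> wt_trm Sg \<Gamma> (Ms ! i) (\<Delta> ! i)"
  by (auto simp: wts_def list_all2_conv_all_nth)

lemma wts_inst: "wts \<Gamma> \<Delta> Ms \<Longrightarrow> wt_sub Sg \<Gamma> \<Delta> (inst Ms)"
  by (simp add: wts_def wt_inst)

lemma eqs_refl: "wts \<Gamma> \<Delta> Ms \<Longrightarrow> eqs \<Gamma> \<Delta> Ms Ms"
  by (auto simp: eqs_def wts_length wts_nth wts_ctx intro: T_eq_refl)

lemma eqs_sym: "eqs \<Gamma> \<Delta> Ms Ns \<Longrightarrow> eqs \<Gamma> \<Delta> Ns Ms"
  by (auto simp: eqs_def intro: T_eq_sym)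

lemma eqs_trans: "eqs \<Gamma> \<Delta> Ms Ns \<Longrightarrow> eqs \<Gamma> \<Delta> Ns Ks \<Longrightarrow> eqs \<Gamma> \<Delta> Ms Ks"
  by (auto simp: eqs_def intro: T_eq_trans)

lemma eqs_wts: "eqs \<Gamma> \<Delta> Ms Ns \<Longrightarrow> is_ctx Sg \<Gamma> \<Longrightarrow> is_ctx Sg \<Delta> \<Longrightarrow> wts \<Gamma> \<Delta> Ns"
  by (auto simp: eqs_def wts_def list_all2_conv_all_nth dest: T_EqA_wt)

lemma mem_trms_class: "length Ms = length \<Delta> \<Longrightarrow> Ns \<in> trms_class T \<Gamma> \<Delta> Ms \<longleftrightarrow> eqs \<Gamma> \<Delta> Ms Ns"
  by (auto simp: trms_class_def eqs_def)

text \<open>Reflexivity makes the class inhabited, so the choice in \<open>rep\<close> returns a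
  provably equal list.\<close>

lemma eqs_rep:
  assumes "wts \<Gamma> \<Delta> Ms"
  shows "eqs \<Gamma> \<Delta> Ms (rep (trms_class T \<Gamma> \<Delta> Ms))"
  using assms eqs_refl[OF assms] unfolding rep_def
  by (metis mem_trms_class someI wts_length)

lemma ar_eq_iff:
  assumes "wts \<Gamma> \<Delta> Ms" "wts \<Gamma> \<Delta> Ns"
  shows "ar \<Gamma> \<Delta> Ms = ar \<Gamma> \<Delta> Ns \<longleftrightarrow> eqs \<Gamma> \<Delta> Ms Ns"
proof
  assume "ar \<Gamma> \<Delta> Ms = ar \<Gamma> \<Delta> Ns"
  then have "Ns \<in> trms_class T \<Gamma> \<Delta> Ms" using assms eqs_refl[OF assms(2)]
    by (simp add: cl_arr_def mem_trms_class wts_length)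
  then show "eqs \<Gamma> \<Delta> Ms Ns" using assms by (simp add: mem_trms_class wts_length)
next
  assume e: "eqs \<Gamma> \<Delta> Ms Ns"
  then have "trms_class T \<Gamma> \<Delta> Ms = trms_class T \<Gamma> \<Delta> Ns"
    using assms eqs_trans[OF e] eqs_trans[OF eqs_sym[OF e]] by (auto simp: mem_trms_class wts_length)
  then show "ar \<Gamma> \<Delta> Ms = ar \<Gamma> \<Delta> Ns" by (simp add: cl_arr_def)
qed

lemma dm_ar [simp]: "dm C (ar \<Gamma> \<Delta> Ms) = \<Gamma>" and cd_ar [simp]: "cd C (ar \<Gamma> \<Delta> Ms) = \<Delta>"
  by (simp_all add: classifying_def cl_arr_def)

lemma ob_C [simp]: "\<Gamma> \<in> ob C \<longleftrightarrow> is_ctx Sg \<Gamma>"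
  by (simp add: classifying_def)

lemma ar_arr [simp]: "wts \<Gamma> \<Delta> Ms \<Longrightarrow> ar \<Gamma> \<Delta> Ms \<in> arr C"
  unfolding classifying_def wts_def by auto

lemma arr_cases:
  assumes "f \<in> arr C"
  obtains Ms where "f = ar (dm C f) (cd C f) Ms" "wts (dm C f) (cd C f) Ms"
  using assms dm_ar cd_ar unfolding wts_def classifying_def by (auto simp: cl_arr_def)

lemma hom_cases:
  assumes "f \<in> hom C \<Gamma> \<Delta>"
  obtains Ms where "f = ar \<Gamma> \<Delta> Ms" "wts \<Gamma> \<Delta> Ms"
  using assms arr_cases[of f] unfolding hom_def by blast

lemma ar_hom: "wts \<Gamma> \<Delta> Ms \<Longrightarrow> ar \<Gamma> \<Delta> Ms \<in> hom C \<Gamma> \<Delta>"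
  by (simp add: hom_def)

lemma wts_tsub: "wts \<Gamma> \<Delta> Ms \<Longrightarrow> wts \<Delta> \<Theta> Ns \<Longrightarrow> wts \<Gamma> \<Theta> (map (tsub (inst Ms)) Ns)"
  using wts_inst[of \<Gamma> \<Delta> Ms] by (auto simp: wts_def list_all2_conv_all_nth intro: wt_tsub)

text \<open>Independence of the representatives: \<open>T_eq_subst\<close> replaces the outer terms
  and the substituted ones simultaneously.\<close>

lemma comp_ar [simp]:
  assumes "wts \<Gamma> \<Delta> Ms" "wts \<Delta> \<Theta> Ns"
  shows "comp C (ar \<Delta> \<Theta> Ns) (ar \<Gamma> \<Delta> Ms) = ar \<Gamma> \<Theta> (map (tsub (inst Ms)) Ns)"
proof -
  let ?Ms = "rep (trms_class T \<Gamma> \<Delta> Ms)" and ?Ns = "rep (trms_class T \<Delta> \<Theta> Ns)"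
  have e: "eqs \<Gamma> \<Delta> ?Ms Ms" "eqs \<Delta> \<Theta> ?Ns Ns" using assms by (auto intro: eqs_rep eqs_sym)
  then have w: "wts \<Gamma> \<Delta> ?Ms" "wts \<Delta> \<Theta> ?Ns" using assms by (auto intro: eqs_wts eqs_sym wts_ctx)
  have "eqs \<Gamma> \<Theta> (map (tsub (inst ?Ms)) ?Ns) (map (tsub (inst Ms)) Ns)"
    using e wts_ctx(1)[OF assms(1)] by (auto simp: eqs_def intro!: T_eq_subst)
  then have "ar \<Gamma> \<Theta> (map (tsub (inst ?Ms)) ?Ns) = ar \<Gamma> \<Theta> (map (tsub (inst Ms)) Ns)"
    using ar_eq_iff wts_tsub assms w by blast
  then show ?thesis by (simp add: classifying_def cl_arr_def[of T \<Gamma> \<Delta>] cl_arr_def[of T \<Delta> \<Theta>])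
qed

abbreviation "vars n \<equiv> map Var [0..<n]"

lemma wts_vars: "is_ctx Sg \<Gamma> \<Longrightarrow> wts \<Gamma> \<Gamma> (vars (length \<Gamma>))"
  by (auto simp: wts_def list_all2_conv_all_nth intro!: wt_Var)

lemma idn_C: "idn C \<Gamma> = ar \<Gamma> \<Gamma> (vars (length \<Gamma>))" and one_C [simp]: "one C = []"
  and prd_C [simp]: "prd C \<Gamma> \<Delta> = \<Delta> @ \<Gamma>"
  and pr1_C: "pr1 C \<Gamma> \<Delta> = ar (\<Delta> @ \<Gamma>) \<Gamma> (map (\<lambda>i. Var (length \<Delta> + i)) [0..<length \<Gamma>])"
  and pr2_C: "pr2 C \<Gamma> \<Delta> = ar (\<Delta> @ \<Gamma>) \<Delta> (vars (length \<Delta>))"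
  by (simp_all add: classifying_def)

lemma wts_pr:
  assumes "is_ctx Sg \<Gamma>" "is_ctx Sg \<Delta>"
  shows "wts (\<Delta> @ \<Gamma>) \<Gamma> (map (\<lambda>i. Var (length \<Delta> + i)) [0..<length \<Gamma>])"
    "wts (\<Delta> @ \<Gamma>) \<Delta> (vars (length \<Delta>))"
  using assms by (auto simp: wts_def list_all2_conv_all_nth nth_append intro!: wt_Var)

lemma map_inst_vars: "length Ms = n \<Longrightarrow> map (tsub (inst Ms)) (vars n) = Ms"
  by (auto simp: inst_def intro: nth_equalityI)

lemma pr_ar:
  assumes "wts \<Theta> (\<Delta> @ \<Gamma>) Ks" "is_ctx Sg \<Gamma>" "is_ctx Sg \<Delta>"
  shows "comp C (pr1 C \<Gamma> \<Delta>) (ar \<Theta> (\<Delta> @ \<Gamma>) Ks) = ar \<Theta> \<Gamma> (drop (length \<Delta>) Ks)"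
    "comp C (pr2 C \<Gamma> \<Delta>) (ar \<Theta> (\<Delta> @ \<Gamma>) Ks) = ar \<Theta> \<Delta> (take (length \<Delta>) Ks)"
proof -
  have l: "length Ks = length \<Delta> + length \<Gamma>" using wts_length[OF assms(1)] by simp
  have "map (tsub (inst Ks)) (map (\<lambda>i. Var (length \<Delta> + i)) [0..<length \<Gamma>]) = drop (length \<Delta>) Ks"
    "map (tsub (inst Ks)) (vars (length \<Delta>)) = take (length \<Delta>) Ks"
    using l by (auto simp: inst_def intro!: nth_equalityI)
  then show "comp C (pr1 C \<Gamma> \<Delta>) (ar \<Theta> (\<Delta> @ \<Gamma>) Ks) = ar \<Theta> \<Gamma> (drop (length \<Delta>) Ks)"
    "comp C (pr2 C \<Gamma> \<Delta>) (ar \<Theta> (\<Delta> @ \<Gamma>) Ks) = ar \<Theta> \<Delta> (take (length \<Delta>) Ks)"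
    unfolding pr1_C pr2_C using comp_ar[OF assms(1) wts_pr(1)[OF assms(2,3)]]
      comp_ar[OF assms(1) wts_pr(2)[OF assms(2,3)]] by simp_all
qed

lemma wts_append: "wts \<Theta> (\<Delta> @ \<Gamma>) (Ns @ Ms) \<longleftrightarrow> wts \<Theta> \<Gamma> Ms \<and> wts \<Theta> \<Delta> Ns" if "length Ms = length \<Gamma>"
proof (cases "length Ns = length \<Delta>")
  case True
  then show ?thesis using that by (auto simp: wts_def list_all2_append)
next
  case False
  then show ?thesis using that by (auto dest!: wts_length)
qed

lemma wts_take_drop:
  assumes "wts \<Theta> (\<Delta> @ \<Gamma>) Ks"
  shows "wts \<Theta> \<Delta> (take (length \<Delta>) Ks)" "wts \<Theta> \<Gamma> (drop (length \<Delta>) Ks)"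
  using wts_append[of "drop (length \<Delta>) Ks" \<Gamma> \<Theta> \<Delta> "take (length \<Delta>) Ks"] assms wts_length[OF assms] by auto

lemma eqs_append:
  assumes "eqs \<Theta> \<Delta> Ns Ns'" "eqs \<Theta> \<Gamma> Ms Ms'"
  shows "eqs \<Theta> (\<Delta> @ \<Gamma>) (Ns @ Ms) (Ns' @ Ms')"
  using assms unfolding eqs_def by (auto simp: nth_append)

text \<open>A list of terms into \<open>\<Delta> @ \<Gamma>\<close> falls apart at
  \<open>length \<Delta>\<close>. The second component stands first because contexts have the newest
  variable at the head.\<close>

lemma ex1_pair_ar:
  assumes "wts \<Theta> \<Gamma> Ms" "wts \<Theta> \<Delta> Ns"
  shows "h \<in> hom C \<Theta> (prd C \<Gamma> \<Delta>) \<and> comp C (pr1 C \<Gamma> \<Delta>) h = ar \<Theta> \<Gamma> Ms \<and> comp C (pr2 C \<Gamma> \<Delta>) h = ar \<Theta> \<Delta> Ns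
    \<longleftrightarrow> h = ar \<Theta> (\<Delta> @ \<Gamma>) (Ns @ Ms)" (is "?P h \<longleftrightarrow> h = ?h")
proof
  note c = wts_ctx[OF assms(1)] wts_ctx[OF assms(2)] and l = wts_length[OF assms(1)] wts_length[OF assms(2)]
  have w: "wts \<Theta> (\<Delta> @ \<Gamma>) (Ns @ Ms)" using assms l by (simp add: wts_append)
  show "?P h" if "h = ?h" using pr_ar[OF w c(2,4)] ar_hom[OF w] l that by simp
  assume P: "?P h"
  then obtain Ks where h: "h = ar \<Theta> (\<Delta> @ \<Gamma>) Ks" "wts \<Theta> (\<Delta> @ \<Gamma>) Ks" using hom_cases[of h] by auto
  have "eqs \<Theta> \<Delta> (take (length \<Delta>) Ks) Ns" "eqs \<Theta> \<Gamma> (drop (length \<Delta>) Ks) Ms"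
    using P pr_ar[OF h(2) c(2,4)] wts_take_drop[OF h(2)] assms unfolding h(1) by (simp_all add: ar_eq_iff)
  then have "eqs \<Theta> (\<Delta> @ \<Gamma>) Ks (Ns @ Ms)" using eqs_append by fastforce
  then show "h = ?h" using h w ar_eq_iff by blast
qed

lemma has_products_C: "has_products C"
proof -
  have "\<exists>!f. f \<in> hom C \<Gamma> (one C)" if "is_ctx Sg \<Gamma>" for \<Gamma>
  proof
    show "ar \<Gamma> [] [] \<in> hom C \<Gamma> (one C)" using that by (simp add: hom_def wts_def)
    fix f assume "f \<in> hom C \<Gamma> (one C)"
    then show "f = ar \<Gamma> [] []" by (auto elim!: hom_cases dest: wts_length)
  qed
  moreover have "\<exists>!h. h \<in> hom C \<Theta> (prd C \<Gamma> \<Delta>) \<and> comp C (pr1 C \<Gamma> \<Delta>) h = f \<and> comp C (pr2 C \<Gamma> \<Delta>) h = g"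
    if fg: "f \<in> hom C \<Theta> \<Gamma>" "g \<in> hom C \<Theta> \<Delta>" for f g \<Theta> \<Gamma> \<Delta>
  proof -
    obtain Ms Ns where "f = ar \<Theta> \<Gamma> Ms" "wts \<Theta> \<Gamma> Ms" "g = ar \<Theta> \<Delta> Ns" "wts \<Theta> \<Delta> Ns"
      using hom_cases[OF fg(1)] hom_cases[OF fg(2)] by metis
    then show ?thesis using ex1_pair_ar[of \<Theta> \<Gamma> Ms \<Delta> Ns] by simp
  qed
  moreover have "pr1 C \<Gamma> \<Delta> \<in> hom C (prd C \<Gamma> \<Delta>) \<Gamma>" "pr2 C \<Gamma> \<Delta> \<in> hom C (prd C \<Gamma> \<Delta>) \<Delta>"
    if "is_ctx Sg \<Gamma>" "is_ctx Sg \<Delta>" for \<Gamma> \<Delta>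
    using wts_pr[OF that] by (simp_all add: pr1_C pr2_C ar_hom)
  ultimately show ?thesis unfolding has_products_def by simp
qed

lemma pair_ar [simp]:
  "wts \<Theta> \<Gamma> Ms \<Longrightarrow> wts \<Theta> \<Delta> Ns \<Longrightarrow> pair C (ar \<Theta> \<Gamma> Ms) (ar \<Theta> \<Delta> Ns) = ar \<Theta> (\<Delta> @ \<Gamma>) (Ns @ Ms)"
  unfolding pair_def dm_ar cd_ar using ex1_pair_ar[of \<Theta> \<Gamma> Ms \<Delta> Ns] by simp

lemma bang_C [simp]: "is_ctx Sg \<Gamma> \<Longrightarrow> bang C \<Gamma> = ar \<Gamma> [] []"
  unfolding bang_def
proof (rule the_equality)
  show "ar \<Gamma> [] [] \<in> hom C \<Gamma> (one C)" if "is_ctx Sg \<Gamma>" using that by (simp add: hom_def wts_def)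
  show "f = ar \<Gamma> [] []" if "f \<in> hom C \<Gamma> (one C)" for f using that by (auto elim!: hom_cases dest: wts_length)
qed

subsection \<open>Predicates\<close>

definition feq :: "'u ctx \<Rightarrow> ('u, 'k, 'q) fml \<Rightarrow> ('u, 'k, 'q) fml \<Rightarrow> bool" where
  "feq \<Gamma> \<phi> \<psi> \<longleftrightarrow> SeqA \<Gamma> [\<phi>] \<psi> \<in> T \<and> SeqA \<Gamma> [\<psi>] \<phi> \<in> T"

abbreviation "fc \<equiv> fml_class T"

lemma seq_trans: "SeqA \<Gamma> [\<phi>] \<psi> \<in> T \<Longrightarrow> SeqA \<Gamma> [\<psi>] \<theta> \<in> T \<Longrightarrow> SeqA \<Gamma> [\<phi>] \<theta> \<in> T"
  using T_cut[of \<Gamma> "[\<phi>]" \<psi> "[]" "[]" \<theta>] by simp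

lemma feq_refl: "is_ctx Sg \<Gamma> \<Longrightarrow> wt_fml L Sg \<Gamma> \<phi> \<Longrightarrow> feq \<Gamma> \<phi> \<phi>"
  by (simp add: feq_def T_ax)

lemma feq_sym: "feq \<Gamma> \<phi> \<psi> \<Longrightarrow> feq \<Gamma> \<psi> \<phi>"
  by (simp add: feq_def)

lemma feq_trans: "feq \<Gamma> \<phi> \<psi> \<Longrightarrow> feq \<Gamma> \<psi> \<theta> \<Longrightarrow> feq \<Gamma> \<phi> \<theta>"
  unfolding feq_def using seq_trans by blast

lemma feq_wt: "feq \<Gamma> \<phi> \<psi> \<Longrightarrow> is_ctx Sg \<Gamma> \<and> wt_fml L Sg \<Gamma> \<phi> \<and> wt_fml L Sg \<Gamma> \<psi>"
  unfolding feq_def using T_SeqA_wt by fastforce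

lemma fc_eq: "fc \<Gamma> \<phi> = {\<psi>. feq \<Gamma> \<phi> \<psi>}"
  by (simp add: fml_class_def feq_def)

lemma fc_eq_iff: "is_ctx Sg \<Gamma> \<Longrightarrow> wt_fml L Sg \<Gamma> \<phi> \<Longrightarrow> fc \<Gamma> \<psi> = fc \<Gamma> \<phi> \<longleftrightarrow> feq \<Gamma> \<psi> \<phi>"
  using feq_refl[of \<Gamma> \<phi>] feq_sym[of \<Gamma>] feq_trans[of \<Gamma>] unfolding fc_eq by blast

lemma feq_rep:
  assumes "is_ctx Sg \<Gamma>" "wt_fml L Sg \<Gamma> \<phi>"
  shows "feq \<Gamma> \<phi> (rep (fc \<Gamma> \<phi>))"
  using feq_refl[OF assms] unfolding rep_def fc_eq by (metis mem_Collect_eq someI)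

lemma pred_C: "pred C \<Gamma> = {fc \<Gamma> \<phi> | \<phi>. wt_fml L Sg \<Gamma> \<phi>}"
  by (simp add: classifying_def)

lemma pred_cases:
  assumes "x \<in> pred C \<Gamma>"
  obtains \<phi> where "x = fc \<Gamma> \<phi>" "wt_fml L Sg \<Gamma> \<phi>"
  using assms unfolding pred_C by blast

lemma fc_pred [simp]: "wt_fml L Sg \<Gamma> \<phi> \<Longrightarrow> fc \<Gamma> \<phi> \<in> pred C \<Gamma>"
  unfolding pred_C by blast

lemma le_fc:
  assumes "is_ctx Sg \<Gamma>" "wt_fml L Sg \<Gamma> \<phi>" "wt_fml L Sg \<Gamma> \<psi>"
  shows "le C \<Gamma> (fc \<Gamma> \<phi>) (fc \<Gamma> \<psi>) \<longleftrightarrow> SeqA \<Gamma> [\<phi>] \<psi> \<in> T"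
  using feq_rep[OF assms(1,2)] feq_rep[OF assms(1,3)] seq_trans
  unfolding feq_def classifying_def by (simp, meson)

text \<open>Rule \<open>subst\<close> admits provably equal but different terms on the two sides of
  a sequent; used in both directions, it exchanges formula and terms at once.\<close>

lemma feq_fsub:
  assumes "eqs \<Gamma> \<Delta> Ms Ns" "feq \<Delta> \<phi> \<psi>" "is_ctx Sg \<Gamma>"
  shows "feq \<Gamma> (fsub (inst Ms) \<phi>) (fsub (inst Ns) \<psi>)"
  using T_subst[of \<Gamma> \<Delta> "[\<phi>]" \<psi> Ms Ns] T_subst[of \<Gamma> \<Delta> "[\<psi>]" \<phi> Ns Ms] assms eqs_sym[OF assms(1)]
  unfolding feq_def eqs_def by simp

lemma wt_fsub_inst: "wts \<Gamma> \<Delta> Ms \<Longrightarrow> wt_fml L Sg \<Delta> \<phi> \<Longrightarrow> wt_fml L Sg \<Gamma> (fsub (inst Ms) \<phi>)"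
  by (auto intro: wt_fsub wts_inst)

lemma sub_fc [simp]:
  assumes "wts \<Gamma> \<Delta> Ms" "wt_fml L Sg \<Delta> \<phi>"
  shows "sub C (ar \<Gamma> \<Delta> Ms) (fc \<Delta> \<phi>) = fc \<Gamma> (fsub (inst Ms) \<phi>)"
proof -
  let ?Ms = "rep (trms_class T \<Gamma> \<Delta> Ms)" and ?\<phi> = "rep (fc \<Delta> \<phi>)"
  note c = wts_ctx[OF assms(1)]
  have "feq \<Gamma> (fsub (inst ?Ms) ?\<phi>) (fsub (inst Ms) \<phi>)"
    using eqs_rep[OF assms(1)] feq_rep[OF c(2) assms(2)] c(1) by (intro feq_fsub) (auto intro: eqs_sym feq_sym)
  then have "fc \<Gamma> (fsub (inst ?Ms) ?\<phi>) = fc \<Gamma> (fsub (inst Ms) \<phi>)"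
    using fc_eq_iff feq_wt by blast
  then show ?thesis by (simp add: classifying_def cl_arr_def)
qed

lemma feq_Conn:
  assumes "is_ctx Sg \<Gamma>" "k \<in> conns L" "length \<phi>s = arity L k" "length \<psi>s = arity L k"
    "\<And>i. i < arity L k \<Longrightarrow> feq \<Gamma> (\<phi>s ! i) (\<psi>s ! i)"
  shows "feq \<Gamma> (Conn k \<phi>s) (Conn k \<psi>s)"
  using assms unfolding feq_def by (simp add: T_conn_cong)

lemma conn_fc [simp]:
  assumes "is_ctx Sg \<Gamma>" "k \<in> conns L" "length \<phi>s = arity L k" "\<forall>\<phi>\<in>set \<phi>s. wt_fml L Sg \<Gamma> \<phi>"
  shows "conn C \<Gamma> k (map (fc \<Gamma>) \<phi>s) = fc \<Gamma> (Conn k \<phi>s)"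
proof -
  have "feq \<Gamma> (Conn k (map rep (map (fc \<Gamma>) \<phi>s))) (Conn k \<phi>s)"
    using assms feq_rep[OF assms(1)] by (intro feq_Conn) (auto intro: feq_sym)
  then have "fc \<Gamma> (Conn k (map rep (map (fc \<Gamma>) \<phi>s))) = fc \<Gamma> (Conn k \<phi>s)"
    using fc_eq_iff feq_wt by blast
  then show ?thesis by (simp add: classifying_def)
qed

lemma feq_quants:
  "feq (\<Delta> @ \<Gamma>) \<phi> \<psi> \<Longrightarrow> q \<in> quants L \<Longrightarrow> feq \<Gamma> (quants_fml q \<Delta> \<phi>) (quants_fml q \<Delta> \<psi>)"
proof (induction \<Delta> arbitrary: \<phi> \<psi>)
  case (Cons \<tau> \<Delta>)
  have "feq (\<Delta> @ \<Gamma>) (Quant q \<tau> \<phi>) (Quant q \<tau> \<psi>)"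
    using Cons(2,3) unfolding feq_def by (simp add: T_quant_cong)
  then show ?case using Cons by simp
qed simp

lemma quant_fc [simp]:
  assumes "is_ctx Sg \<Gamma>" "is_ctx Sg \<Delta>" "q \<in> quants L" "wt_fml L Sg (\<Delta> @ \<Gamma>) \<phi>"
  shows "quant C q \<Gamma> \<Delta> (fc (\<Delta> @ \<Gamma>) \<phi>) = fc \<Gamma> (quants_fml q \<Delta> \<phi>)"
proof -
  have "feq \<Gamma> (quants_fml q \<Delta> (rep (fc (\<Delta> @ \<Gamma>) \<phi>))) (quants_fml q \<Delta> \<phi>)"
    using assms by (intro feq_quants feq_sym[OF feq_rep]) simp_all
  then have "fc \<Gamma> (quants_fml q \<Delta> (rep (fc (\<Delta> @ \<Gamma>) \<phi>))) = fc \<Gamma> (quants_fml q \<Delta> \<phi>)"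
    using fc_eq_iff feq_wt by blast
  then show ?thesis by (simp add: classifying_def)
qed

lemma wt_quants: "is_ctx Sg \<Delta> \<Longrightarrow> q \<in> quants L \<Longrightarrow> wt_fml L Sg (\<Delta> @ \<Gamma>) \<phi> \<Longrightarrow> wt_fml L Sg \<Gamma> (quants_fml q \<Delta> \<phi>)"
  by (induction \<Delta> arbitrary: \<phi>) simp_all

lemma wt_tensor_list: "\<forall>\<phi>\<in>set \<phi>s. wt_fml L Sg \<Gamma> \<phi> \<Longrightarrow> wt_fml L Sg \<Gamma> (tensor_list L \<phi>s)"
  by (induction \<phi>s rule: induct_list012) simp_all

lemma wt_eq_fml: "is_ctx Sg \<Gamma> \<Longrightarrow> wt_fml L Sg (\<Gamma> @ \<Gamma>) (eq_fml L \<Gamma>)"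
  unfolding eq_fml_def by (rule wt_tensor_list) (auto simp: is_ctx_nth nth_append intro!: wt_Var)

lemma eqp_C: "eqp C \<Gamma> = fc (\<Gamma> @ \<Gamma>) (eq_fml L \<Gamma>)"
  by (simp add: classifying_def)

lemma lists_pred_cases:
  assumes "xs \<in> lists (pred C \<Gamma>)"
  obtains \<phi>s where "xs = map (fc \<Gamma>) \<phi>s" "\<forall>\<phi>\<in>set \<phi>s. wt_fml L Sg \<Gamma> \<phi>"
proof -
  have "\<exists>\<phi>s. xs = map (fc \<Gamma>) \<phi>s \<and> (\<forall>\<phi>\<in>set \<phi>s. wt_fml L Sg \<Gamma> \<phi>)" using assms
  proof (induction xs)
    case (Cons x xs)
    then obtain \<phi> \<phi>s where "x = fc \<Gamma> \<phi>" "wt_fml L Sg \<Gamma> \<phi>" "xs = map (fc \<Gamma>) \<phi>s" "\<forall>\<phi>\<in>set \<phi>s. wt_fml L Sg \<Gamma> \<phi>"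
      by (auto elim: pred_cases)
    then show ?case by (intro exI[of _ "\<phi> # \<phi>s"]) simp
  qed simp
  then show ?thesis using that by blast
qed

lemma typed_C: "typed L C"
  unfolding typed_def
proof (intro conjI ballI impI)
  fix f assume "f \<in> arr C"
  then obtain Ms where f: "f = ar (dm C f) (cd C f) Ms" "wts (dm C f) (cd C f) Ms" by (rule arr_cases)
  then show "dm C f \<in> ob C" "cd C f \<in> ob C" using wts_ctx by auto
  show "sub C f x \<in> pred C (dm C f)" if x: "x \<in> pred C (cd C f)" for x
  proof -
    obtain \<phi> where "x = fc (cd C f) \<phi>" "wt_fml L Sg (cd C f) \<phi>" using x by (rule pred_cases)
    then show ?thesis using sub_fc[OF f(2)] wt_fsub_inst[OF f(2)] f(1) fc_pred by metis
  qed
  show "comp C g f \<in> hom C (dm C f) (cd C g)" if g: "g \<in> arr C" "cd C f = dm C g" for g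
  proof -
    obtain Ns where "g = ar (cd C f) (cd C g) Ns" "wts (cd C f) (cd C g) Ns"
      using arr_cases[OF g(1)] g(2) by metis
    then show ?thesis using comp_ar[OF f(2)] wts_tsub[OF f(2)] f(1) ar_hom by metis
  qed
next
  fix \<Gamma> k xs assume "\<Gamma> \<in> ob C" "k \<in> conns L" "xs \<in> lists (pred C \<Gamma>)" "length xs = arity L k"
  then show "conn C \<Gamma> k xs \<in> pred C \<Gamma>" by (auto elim!: lists_pred_cases)
next
  fix q \<Gamma> \<Delta> x assume "q \<in> quants L" "\<Gamma> \<in> ob C" "\<Delta> \<in> ob C" "x \<in> pred C (prd C \<Gamma> \<Delta>)"
  then show "quant C q \<Gamma> \<Delta> x \<in> pred C \<Gamma>" by (auto elim!: pred_cases simp: wt_quants)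
qed (auto simp: idn_C pr1_C pr2_C eqp_C wt_eq_fml ar_hom wts_vars wts_pr)

subsection \<open>The generic model\<close>

definition generic :: "('u, 'u ctx, 'u ctx \<times> 'u ctx \<times> 'u trm list set, ('u, 'k, 'q) fml set) struc" where
  "generic = \<lparr>isort = \<lambda>\<sigma>. [\<sigma>],
     ifun = \<lambda>f. ar (fdom Sg f) [fcod Sg f] [Fn f (vars (length (fdom Sg f)))],
     irel = \<lambda>r. fc (rdom Sg r) (Rel r (vars (length (rdom Sg r))))\<rparr>"

abbreviation "G \<equiv> generic"

lemma isort_G [simp]: "isort G \<sigma> = [\<sigma>]"
  and ifun_G: "ifun G f = ar (fdom Sg f) [fcod Sg f] [Fn f (vars (length (fdom Sg f)))]"
  and irel_G: "irel G r = fc (rdom Sg r) (Rel r (vars (length (rdom Sg r))))"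
  by (simp_all add: generic_def)

text \<open>Holds on the nose because the designated product is concatenation and the terminal
  object is the empty context. The generic interpretation therefore involves no canonical
  isomorphisms.\<close>

lemma ctx_ob_G [simp]: "ctx_ob C G \<Gamma> = \<Gamma>"
  by (induction \<Gamma>) simp_all

lemma var_arr_G: "is_ctx Sg \<Gamma> \<Longrightarrow> i < length \<Gamma> \<Longrightarrow> var_arr C G \<Gamma> i = ar \<Gamma> [\<Gamma> ! i] [Var i]"
proof (induction \<Gamma> arbitrary: i)
  case (Cons \<tau> \<Gamma>)
  show ?case
  proof (cases i)
    case 0
    then show ?thesis by (simp add: pr2_C)
  next
    case (Suc j)
    then have j: "j < length \<Gamma>" "is_ctx Sg \<Gamma>" "is_ctx Sg [\<tau>]" "\<Gamma> ! j \<in> sorts Sg"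
      using Cons is_ctx_nth by auto
    have "wts \<Gamma> [\<Gamma> ! j] [Var j]" using j by (auto simp: wts_def intro!: wt_Var)
    then have "comp C (ar \<Gamma> [\<Gamma> ! j] [Var j]) (pr1 C \<Gamma> [\<tau>]) = ar (\<tau> # \<Gamma>) [\<Gamma> ! j] [Var (Suc j)]"
      unfolding pr1_C using wts_pr(1)[OF j(2,3)] j(1) by (simp add: inst_def)
    then show ?thesis using Suc Cons(1)[OF j(2,1)] by simp
  qed
qed simp

lemma tuple_G:
  "wts \<Gamma> \<Delta> Ms \<Longrightarrow> tuple C \<Gamma> (map2 (\<lambda>t \<sigma>. ar \<Gamma> [\<sigma>] [t]) Ms \<Delta>) = ar \<Gamma> \<Delta> Ms"
proof (induction Ms arbitrary: \<Delta>)
  case Nil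
  then show ?case by (simp add: wts_def)
next
  case (Cons t Ms)
  then obtain \<tau> \<Delta>' where D: "\<Delta> = \<tau> # \<Delta>'" "wts \<Gamma> \<Delta>' Ms" "wts \<Gamma> [\<tau>] [t]"
    by (cases \<Delta>) (auto simp: wts_def)
  then show ?case using Cons(1)[OF D(2)] by simp
qed

lemma trms_arr_G:
  assumes "wts \<Gamma> \<Delta> Ms" "\<And>t \<sigma>. t \<in> set Ms \<Longrightarrow> wt_trm Sg \<Gamma> t \<sigma> \<Longrightarrow> trm_arr C G \<Gamma> t = ar \<Gamma> [\<sigma>] [t]"
  shows "tuple C \<Gamma> (map (trm_arr C G \<Gamma>) Ms) = ar \<Gamma> \<Delta> Ms"
proof -
  have "map (trm_arr C G \<Gamma>) Ms = map2 (\<lambda>t \<sigma>. ar \<Gamma> [\<sigma>] [t]) Ms \<Delta>"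
    using assms wts_length[OF assms(1)] wts_nth[OF assms(1)] by (auto intro!: nth_equalityI)
  then show ?thesis using tuple_G[OF assms(1)] by simp
qed

lemma trm_arr_G: "wt_trm Sg \<Gamma> t \<sigma> \<Longrightarrow> is_ctx Sg \<Gamma> \<Longrightarrow> trm_arr C G \<Gamma> t = ar \<Gamma> [\<sigma>] [t]"
proof (induction t arbitrary: \<sigma>)
  case (Var i)
  then show ?case by (auto elim: wt_VarE simp: var_arr_G)
next
  case (Fn f Ms)
  then have f: "f \<in> funs Sg" "list_all2 (wt_trm Sg \<Gamma>) Ms (fdom Sg f)" "\<sigma> = fcod Sg f" by (auto elim: wt_FnE)
  let ?n = "length (fdom Sg f)"
  have s: "is_ctx Sg (fdom Sg f)" "fcod Sg f \<in> sorts Sg" using sig f(1) by (auto simp: is_sig_def is_ctx_def)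
  have w: "wts \<Gamma> (fdom Sg f) Ms" using f Fn(3) s by (simp add: wts_def)
  have w': "wts (fdom Sg f) [fcod Sg f] [Fn f (vars ?n)]"
    using s f(1) wts_vars[OF s(1)] by (auto simp: wts_def intro!: wt_trm.intros)
  have "tuple C \<Gamma> (map (trm_arr C G \<Gamma>) Ms) = ar \<Gamma> (fdom Sg f) Ms"
    using Fn by (intro trms_arr_G[OF w]) auto
  then have "trm_arr C G \<Gamma> (Fn f Ms) = comp C (ifun G f) (ar \<Gamma> (fdom Sg f) Ms)" by simp
  also have "\<dots> = ar \<Gamma> [\<sigma>] (map (tsub (inst Ms)) [Fn f (vars ?n)])"
    unfolding ifun_G using comp_ar[OF w w'] f(3) by simp
  also have "\<dots> = ar \<Gamma> [\<sigma>] [Fn f Ms]"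
    using map_inst_vars[OF wts_length[OF w]] by simp
  finally show ?case .
qed

lemma is_struc_G: "is_struc C Sg G"
proof -
  have "wts (fdom Sg f) [fcod Sg f] [Fn f (vars (length (fdom Sg f)))]" if "f \<in> funs Sg" for f
    using that sig wts_vars[of "fdom Sg f"] by (auto simp: is_sig_def is_ctx_def wts_def intro!: wt_trm.intros)
  moreover have "wt_fml L Sg (rdom Sg r) (Rel r (vars (length (rdom Sg r))))" if "r \<in> rels Sg" for r
    using that sig wts_vars[of "rdom Sg r"] by (auto simp: is_sig_def is_ctx_def wts_def)
  ultimately show ?thesis using sig
    by (auto simp: is_struc_def ifun_G irel_G hom_def is_sig_def)
qed

lemma fml_val_G: "wt_fml L Sg \<Gamma> \<phi> \<Longrightarrow> is_ctx Sg \<Gamma> \<Longrightarrow> fml_val C G \<Gamma> \<phi> = fc \<Gamma> \<phi>"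
proof (induction \<phi> arbitrary: \<Gamma>)
  case (Rel r Ms)
  then have w: "wts \<Gamma> (rdom Sg r) Ms" "r \<in> rels Sg" using sig by (auto simp: wts_def is_sig_def is_ctx_def)
  have w': "wt_fml L Sg (rdom Sg r) (Rel r (vars (length (rdom Sg r))))"
    using w wts_vars[OF wts_ctx(2)[OF w(1)]] by (simp add: wts_def)
  have "tuple C \<Gamma> (map (trm_arr C G \<Gamma>) Ms) = ar \<Gamma> (rdom Sg r) Ms"
    using Rel trm_arr_G by (intro trms_arr_G[OF w(1)]) auto
  then have "fml_val C G \<Gamma> (Rel r Ms) = sub C (ar \<Gamma> (rdom Sg r) Ms) (irel G r)" by simp
  also have "\<dots> = fc \<Gamma> (fsub (inst Ms) (Rel r (vars (length (rdom Sg r)))))"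
    unfolding irel_G using sub_fc[OF w(1) w'] by simp
  also have "\<dots> = fc \<Gamma> (Rel r Ms)"
    using map_inst_vars[OF wts_length[OF w(1)]] by simp
  finally show ?case .
next
  case (Equ \<sigma> N K)
  then have w: "wts \<Gamma> [\<sigma>] [N]" "wts \<Gamma> [\<sigma>] [K]" "is_ctx Sg [\<sigma>]" by (auto simp: wts_def)
  then have w': "wts \<Gamma> [\<sigma>, \<sigma>] [K, N]" by (auto simp: wts_def)
  \<comment> \<open>Over a single sort \<open>eq_fml\<close> is the bare equation of
    \<open>Var 1\<close> with \<open>Var 0\<close>. Pairing puts the second component at the head,
    so these become \<open>N\<close> and \<open>K\<close>, in the right order.\<close>
  have "sub C (ar \<Gamma> [\<sigma>, \<sigma>] [K, N]) (eqp C [\<sigma>]) = fc \<Gamma> (Equ \<sigma> N K)"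
    unfolding eqp_C using sub_fc[OF w'] wt_eq_fml[OF w(3)] by (simp add: eq_fml_def inst_def)
  then show ?case using Equ pair_ar[OF w(1,2)] trm_arr_G[of \<Gamma> N \<sigma>] trm_arr_G[of \<Gamma> K \<sigma>] by simp
next
  case (Conn k \<phi>s)
  then have "map (fml_val C G \<Gamma>) \<phi>s = map (fc \<Gamma>) \<phi>s" by simp
  then show ?case using Conn(2,3) by (simp del: map_eq_conv)
next
  case (Quant q \<tau> \<phi>)
  then show ?case using quant_fc[of \<Gamma> "[\<tau>]" q \<phi>] by simp
qed

text \<open>The two-way rules for tensor and unit compress an antecedent into one formula. The
  prefix \<open>\<Psi>\<close> collects the formulas already unpacked and keeps the induction
  going.\<close>

lemma T_tensors: "wt_fml L Sg \<Gamma> \<theta> \<Longrightarrow>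
    SeqA \<Gamma> (\<Psi> @ [foldr (tensor_f L) \<Phi> (unit_f L)]) \<theta> \<in> T \<longleftrightarrow> SeqA \<Gamma> (\<Psi> @ \<Phi>) \<theta> \<in> T"
proof (induction \<Phi> arbitrary: \<Psi>)
  case Nil
  then show ?case using T_unit_in[of \<Gamma> \<Psi> "[]" \<theta>] T_unit_out[of \<Gamma> \<Psi> "[]" \<theta>] by auto
next
  case (Cons \<phi> \<Phi>)
  let ?t = "foldr (tensor_f L) \<Phi> (unit_f L)"
  have "SeqA \<Gamma> (\<Psi> @ [tensor_f L \<phi> ?t]) \<theta> \<in> T \<longleftrightarrow> SeqA \<Gamma> ((\<Psi> @ [\<phi>]) @ [?t]) \<theta> \<in> T"
    using T_tensor_in[of \<Gamma> \<Psi> \<phi> ?t "[]" \<theta>] T_tensor_out[of \<Gamma> \<Psi> \<phi> ?t "[]" \<theta>] by auto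
  then show ?case using Cons.IH[of "\<Psi> @ [\<phi>]"] Cons.prems by simp
qed

lemma tensors_fc:
  assumes "is_ctx Sg \<Gamma>" "\<forall>\<phi>\<in>set \<Phi>. wt_fml L Sg \<Gamma> \<phi>"
  shows "foldr (tensor_p L C \<Gamma>) (map (fc \<Gamma>) \<Phi>) (unit_p L C \<Gamma>) = fc \<Gamma> (foldr (tensor_f L) \<Phi> (unit_f L)) \<and>
     wt_fml L Sg \<Gamma> (foldr (tensor_f L) \<Phi> (unit_f L))"
  using assms(2)
proof (induction \<Phi>)
  case Nil
  have "conn C \<Gamma> (unit_c L) (map (fc \<Gamma>) []) = fc \<Gamma> (Conn (unit_c L) [])"
    using lang assms(1) by (intro conn_fc) (auto simp: language_def)
  then show ?case by (simp add: unit_p_def unit_f_def[symmetric])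
next
  case (Cons \<phi> \<Phi>)
  let ?t = "foldr (tensor_f L) \<Phi> (unit_f L)"
  have "conn C \<Gamma> (tensor_c L) (map (fc \<Gamma>) [\<phi>, ?t]) = fc \<Gamma> (Conn (tensor_c L) [\<phi>, ?t])"
    using lang assms(1) Cons by (intro conn_fc) (auto simp: language_def)
  then show ?case using Cons by (simp add: tensor_p_def tensor_f_def[symmetric])
qed

text \<open>Values in the generic model are classes of syntax, so satisfaction comes down to
  membership in \<open>T\<close>. This is the completeness of \<open>Lm\<close> in the form used
  below.\<close>

lemma satisfies_G:
  assumes "wf_assertion L Sg a"
  shows "satisfies L C G a \<longleftrightarrow> a \<in> T"
proof (cases a)
  case (EqA \<Gamma> \<sigma> N K)
  then have w: "is_ctx Sg \<Gamma>" "wt_trm Sg \<Gamma> N \<sigma>" "wt_trm Sg \<Gamma> K \<sigma>" using assms by auto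
  have "\<sigma> \<in> sorts Sg"
    using w(2,1) sig by (auto simp: is_ctx_def is_sig_def elim!: wt_trm.cases)
  then have "wts \<Gamma> [\<sigma>] [N]" "wts \<Gamma> [\<sigma>] [K]" using w by (auto simp: wts_def)
  then show ?thesis using w trm_arr_G[of \<Gamma> N \<sigma>] trm_arr_G[of \<Gamma> K \<sigma>]
    by (simp add: EqA ar_eq_iff eqs_def)
next
  case (SeqA \<Gamma> \<Phi> \<phi>)
  then have w: "is_ctx Sg \<Gamma>" "\<forall>\<psi>\<in>set \<Phi>. wt_fml L Sg \<Gamma> \<psi>" "wt_fml L Sg \<Gamma> \<phi>" using assms by auto
  have m: "map (fml_val C G \<Gamma>) \<Phi> = map (fc \<Gamma>) \<Phi>" using w by (simp add: fml_val_G)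
  show ?thesis using w tensors_fc[OF w(1,2)] T_tensors[OF w(3), of "[]" \<Phi>]
    unfolding SeqA satisfies.simps m by (simp add: fml_val_G le_fc)
qed

end

section \<open>Reflection of the axioms along inclusions\<close>

text \<open>Each axiom equates two parallel arrows, and \<open>F\<close> is injective on parallel
  arrows only; hence the typing has to be known beforehand.\<close>

lemma reflect_category:
  assumes C: "typed L C" and D: "is_category D" and F: "is_functor C D F"
    and inj: "\<And>b c. b \<in> ob C \<Longrightarrow> c \<in> ob C \<Longrightarrow> inj_on (ma F) (hom C b c)"
  shows "is_category C"
proof -
  have ty: "\<And>f. f \<in> arr C \<Longrightarrow> dm C f \<in> ob C \<and> cd C f \<in> ob C" "\<And>c. c \<in> ob C \<Longrightarrow> idn C c \<in> hom C c c"
    "\<And>f g. f \<in> arr C \<Longrightarrow> g \<in> arr C \<Longrightarrow> cd C f = dm C g \<Longrightarrow> comp C g f \<in> hom C (dm C f) (cd C g)"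
    using C unfolding typed_def by blast+
  have F': "\<And>c. c \<in> ob C \<Longrightarrow> ma F (idn C c) = idn D (mo F c)"
    "\<And>f. f \<in> arr C \<Longrightarrow> ma F f \<in> hom D (mo F (dm C f)) (mo F (cd C f))"
    "\<And>f g. f \<in> arr C \<Longrightarrow> g \<in> arr C \<Longrightarrow> cd C f = dm C g \<Longrightarrow> ma F (comp C g f) = comp D (ma F g) (ma F f)"
    using F unfolding is_functor_def by blast+
  have ext: "f = g" if "f \<in> hom C b c" "g \<in> hom C b c" "ma F f = ma F g" for f g b c
    using inj_onD[OF inj that(3,1,2)] ty(1)[of f] that(1) unfolding hom_def by blast
  have idD: "\<And>f. f \<in> arr D \<Longrightarrow> comp D f (idn D (dm D f)) = f \<and> comp D (idn D (cd D f)) f = f"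
    and assocD: "\<And>f g h. f \<in> arr D \<Longrightarrow> g \<in> arr D \<Longrightarrow> h \<in> arr D \<Longrightarrow> cd D f = dm D g \<Longrightarrow> cd D g = dm D h \<Longrightarrow>
        comp D h (comp D g f) = comp D (comp D h g) f"
    using D unfolding is_category_def by blast+
  have "comp C f (idn C (dm C f)) = f \<and> comp C (idn C (cd C f)) f = f" if f: "f \<in> arr C" for f
  proof
    have i: "idn C (dm C f) \<in> hom C (dm C f) (dm C f)" "idn C (cd C f) \<in> hom C (cd C f) (cd C f)"
      using ty(1)[OF f] ty(2) by auto
    show "comp C f (idn C (dm C f)) = f"
      using i ty(1,3) f F' idD[of "ma F f"] by (intro ext[of _ "dm C f" "cd C f"]) (auto simp: hom_def)
    show "comp C (idn C (cd C f)) f = f"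
      using i ty(1,3) f F' idD[of "ma F f"] by (intro ext[of _ "dm C f" "cd C f"]) (auto simp: hom_def)
  qed
  moreover have "comp C h (comp C g f) = comp C (comp C h g) f"
    if a: "f \<in> arr C" "g \<in> arr C" "h \<in> arr C" "cd C f = dm C g" "cd C g = dm C h" for f g h
  proof -
    have c: "comp C g f \<in> hom C (dm C f) (cd C g)" "comp C h g \<in> hom C (dm C g) (cd C h)"
      using ty(3)[OF a(1,2,4)] ty(3)[OF a(2,3,5)] by auto
    show ?thesis
    proof (rule ext)
      show "comp C h (comp C g f) \<in> hom C (dm C f) (cd C h)" "comp C (comp C h g) f \<in> hom C (dm C f) (cd C h)"
        using c ty(3)[of "comp C g f" h] ty(3)[of f "comp C h g"] a by (auto simp: hom_def)
      show "ma F (comp C h (comp C g f)) = ma F (comp C (comp C h g) f)"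
        using c a F'(2)[OF a(1)] F'(2)[OF a(2)] F'(2)[OF a(3)] by (simp add: F'(3) hom_def assocD)
    qed
  qed
  ultimately show ?thesis using ty unfolding is_category_def by blast
qed

text \<open>The order embedding yields injectivity of \<open>mp F c\<close> only if the order of
  \<open>C\<close> is antisymmetric, which is among the things to be derived; so
  \<open>mp_inj\<close> is assumed separately.\<close>

locale reflection = premorphism L C D F
  for L :: "('k, 'q) lang" and C :: "('o, 'a, 'p, 'k, 'q) propcat"
    and D :: "('o', 'a', 'p', 'k, 'q) propcat" and F :: "('o, 'a, 'p, 'o', 'a', 'p') pmor" +
  assumes typed: "typed L C" and incl: "is_inclusion L C D F"
    and mp_inj: "\<And>c x y. c \<in> ob C \<Longrightarrow> x \<in> pred C c \<Longrightarrow> y \<in> pred C c \<Longrightarrow> mp F c x = mp F c y \<Longrightarrow> x = y"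
begin

lemma le_iff: "c \<in> ob C \<Longrightarrow> x \<in> pred C c \<Longrightarrow> y \<in> pred C c \<Longrightarrow> le C c x y \<longleftrightarrow> le D (mo F c) (mp F c x) (mp F c y)"
  using incl unfolding is_inclusion_def is_morphism_def by blast

lemma sub_C [simp]: "f \<in> arr C \<Longrightarrow> x \<in> pred C (cd C f) \<Longrightarrow> b = dm C f \<Longrightarrow> sub C f x \<in> pred C b"
  and quant_C [simp]:
    "q \<in> quants L \<Longrightarrow> b \<in> ob C \<Longrightarrow> c \<in> ob C \<Longrightarrow> x \<in> pred C (prd C b c) \<Longrightarrow> quant C q b c x \<in> pred C b"
  and eqp_C [simp]: "c \<in> ob C \<Longrightarrow> eqp C c \<in> pred C (prd C c c)"
  using typed unfolding typed_def by blast+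

lemma conn_C [simp]:
  assumes "c \<in> ob C" "k \<in> conns L" "set xs \<subseteq> pred C c" "length xs = arity L k"
  shows "conn C c k xs \<in> pred C c"
proof -
  have "\<forall>c\<in>ob C. \<forall>k\<in>conns L. \<forall>xs\<in>lists (pred C c). length xs = arity L k \<longrightarrow> conn C c k xs \<in> pred C c"
    using typed unfolding typed_def by blast
  then show ?thesis using assms by (simp add: lists_eq_set)
qed

lemma tensor_C [simp]: "c \<in> ob C \<Longrightarrow> x \<in> pred C c \<Longrightarrow> y \<in> pred C c \<Longrightarrow> tensor_p L C c x y \<in> pred C c"
  and unit_C [simp]: "c \<in> ob C \<Longrightarrow> unit_p L C c \<in> pred C c"
  using D.lang unfolding tensor_p_def unit_p_def language_def by simp_all

lemma presheaf: "is_presheaf C"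
  unfolding is_presheaf_def
proof (intro conjI ballI impI)
  fix c assume c: "c \<in> ob C"
  show "is_poset (pred C c) (le C c)"
    unfolding is_poset_def
  proof (intro conjI ballI impI)
    fix x assume x: "x \<in> pred C c"
    show "le C c x x" using c x by (simp add: le_iff)
    fix y assume y: "y \<in> pred C c"
    show "x = y" if "le C c x y" "le C c y x"
      using that c x y D.le_antisym[of "mo F c" "mp F c x" "mp F c y"] mp_inj[OF c x y] by (simp add: le_iff)
    fix z assume z: "z \<in> pred C c"
    show "le C c x z" if "le C c x y" "le C c y z"
      using that c x y z D.le_trans[of "mo F c" "mp F c x" "mp F c y" "mp F c z"] by (simp add: le_iff)
  qed
  fix x assume x: "x \<in> pred C c"
  show "sub C (idn C c) x = x" using c x by (intro mp_inj[OF c]) (simp_all add: mp_sub)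
next
  fix f x assume fx: "f \<in> arr C" "x \<in> pred C (cd C f)"
  then show "sub C f x \<in> pred C (dm C f)" by simp
  fix y assume y: "y \<in> pred C (cd C f)" "le C (cd C f) x y"
  then show "le C (dm C f) (sub C f x) (sub C f y)"
    using fx D.sub_mono[of "ma F f" "mp F (cd C f) x" "mp F (cd C f) y"] by (simp add: le_iff mp_sub)
next
  fix f g x assume "f \<in> arr C" "g \<in> arr C" "cd C f = dm C g" "x \<in> pred C (cd C g)"
  then show "sub C (comp C g f) x = sub C f (sub C g x)"
    by (intro mp_inj[of "dm C f"]) (simp_all add: mp_sub)
qed

lemma connectives: "has_connectives L C"
  unfolding has_connectives_def
proof (intro conjI ballI impI)
  fix c k xs assume "c \<in> ob C" "k \<in> conns L" "xs \<in> lists (pred C c)" "length xs = arity L k"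
  then show "conn C c k xs \<in> pred C c" by (simp add: lists_eq_set)
next
  fix f k xs assume a: "f \<in> arr C" "k \<in> conns L" "xs \<in> lists (pred C (cd C f))" "length xs = arity L k"
  then have xs: "set xs \<subseteq> pred C (cd C f)" by (simp add: lists_eq_set)
  then have ys: "set (map (sub C f) xs) \<subseteq> pred C (dm C f)" using a(1) by auto
  have zs: "set (map (mp F (cd C f)) xs) \<subseteq> pred D (mo F (cd C f))" using a(1) xs by auto
  have "map (mp F (dm C f)) (map (sub C f) xs) = map (sub D (ma F f)) (map (mp F (cd C f)) xs)"
    using a(1) xs by (auto simp: mp_sub)
  then show "sub C f (conn C (cd C f) k xs) = conn C (dm C f) k (map (sub C f) xs)"
    using a xs ys zs
    by (intro mp_inj[of "dm C f"]) (simp_all add: mp_sub mp_conn D.sub_conn del: map_map set_map map_eq_conv)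
qed

lemma monoids: "has_monoids L C"
  unfolding has_monoids_def
proof (intro conjI ballI impI)
  fix c x assume cx: "c \<in> ob C" "x \<in> pred C c"
  show "tensor_p L C c (unit_p L C c) x = x" "tensor_p L C c x (unit_p L C c) = x"
    using cx by (auto intro: mp_inj[of c])
  fix y z assume yz: "y \<in> pred C c" "z \<in> pred C c"
  then show "tensor_p L C c (tensor_p L C c x y) z = tensor_p L C c x (tensor_p L C c y z)"
    using cx by (intro mp_inj[of c]) simp_all
next
  fix c x x' y y'
  assume "c \<in> ob C" "x \<in> pred C c" "x' \<in> pred C c" "y \<in> pred C c" "y' \<in> pred C c" "le C c x x'" "le C c y y'"
  then show "le C c (tensor_p L C c x y) (tensor_p L C c x' y')"
    by (simp add: le_iff D.tensor_mono)
qed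

text \<open>This axiom is reflected because only the first object varies and the comparison is
  natural in it: it carries \<open>F\<close> of a product with an identity to such a product in
  \<open>D\<close>. Passing to the inverses of the comparisons gives the arrows that occur in
  \<open>mp_quant\<close>.\<close>

lemma sub_quant:
  assumes "q \<in> quants L" "f \<in> arr C" "c \<in> ob C" "x \<in> pred C (prd C (cd C f) c)"
  shows "sub C f (quant C q (cd C f) c x) = quant C q (dm C f) c (sub C (times_id C f c) x)"
proof (rule mp_inj[of "dm C f"])
  let ?b = "cd C f" and ?a = "dm C f"
  let ?k = "cmp C D F ?b c" and ?h = "cmp C D F ?a c"
  have isos: "is_iso D ?k" "is_iso D ?h" using assms by (simp_all add: iso_cmp)
  note ty = D.iso_inv[OF isos(1)] D.iso_inv[OF isos(2)]
  let ?x = "mp F (prd C ?b c) x"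
  have "comp D ?k (ma F (times_id C f c)) = comp D (times_id D (ma F f) (mo F c)) ?h"
    unfolding times_id_def using assms
    by (subst cmp_pair) (simp_all add: cmp_def)
  then have "comp D (inv_arr D ?k) (comp D (comp D ?k (ma F (times_id C f c))) (inv_arr D ?h)) =
      comp D (inv_arr D ?k) (comp D (comp D (times_id D (ma F f) (mo F c)) ?h) (inv_arr D ?h))" by simp
  then have e: "comp D (ma F (times_id C f c)) (inv_arr D ?h) = comp D (inv_arr D ?k) (times_id D (ma F f) (mo F c))"
    using assms isos ty by simp
  have "mp F ?a (sub C f (quant C q ?b c x)) =
     quant D q (mo F ?a) (mo F c) (sub D (times_id D (ma F f) (mo F c)) (sub D (inv_arr D ?k) ?x))"
    using assms ty isos by (simp add: mp_sub mp_quant D.sub_quant)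
  also have "\<dots> = quant D q (mo F ?a) (mo F c) (sub D (inv_arr D ?h) (sub D (ma F (times_id C f c)) ?x))"
    using assms isos ty by (simp add: e)
  also have "\<dots> = mp F ?a (quant C q ?a c (sub C (times_id C f c) x))"
    using assms by (simp add: mp_sub mp_quant)
  finally show "mp F ?a (sub C f (quant C q ?b c x)) = mp F ?a (quant C q ?a c (sub C (times_id C f c) x))" .
qed (use assms in simp_all)

text \<open>
  The remaining axioms are not reflected: quantifiers need not be natural in their second object, nor
  equality predicates invariant under isomorphisms of their object, whereas \<open>F\<close> preserves products
  only up to isomorphism.
\<close>

lemma propcatI:
  assumes "\<And>q b x. q \<in> quants L \<Longrightarrow> b \<in> ob C \<Longrightarrow> x \<in> pred C b \<Longrightarrow>
      quant C q b (one C) (sub C (pr1 C b (one C)) x) = x"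
    and "\<And>q b c d x. q \<in> quants L \<Longrightarrow> b \<in> ob C \<Longrightarrow> c \<in> ob C \<Longrightarrow> d \<in> ob C \<Longrightarrow> x \<in> pred C (prd C (prd C b c) d) \<Longrightarrow>
      quant C q b (prd C c d) (sub C (assoc C b c d) x) = quant C q b c (quant C q (prd C b c) d x)"
    and "has_equality L C"
  shows "is_propcat L C"
  unfolding is_propcat_def has_quantifiers_def
  using E.cat E.prods presheaf connectives monoids assms sub_quant by simp

lemma mp_sub_eqp:
  assumes "f \<in> arr C" "g \<in> arr C" "dm C f = dm C g" "c = cd C f" "c = cd C g" "b = dm C f"
  shows "mp F b (sub C (pair C f g) (eqp C c)) = sub D (pair D (ma F f) (ma F g)) (eqp D (mo F c))"
  using assms cmp_pair[of f g c c] by (simp add: mp_sub mp_eqp)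

end

section \<open>The theory of a structure and its classifying prop-category\<close>

lemma quants_fml_append: "quants_fml q (\<Theta> @ \<Delta>) \<phi> = quants_fml q \<Delta> (quants_fml q \<Theta> \<phi>)"
  by (induction \<Theta> arbitrary: \<phi>) simp_all

text \<open>The order in which \<open>eq_fml\<close> runs through
  \<open>\<Delta> @ \<Gamma>\<close>: the variables of \<open>\<Gamma>\<close>, shifted by
  \<open>length \<Delta>\<close>, come before those of \<open>\<Delta>\<close>. Equality over a
  concatenation thus splits without commuting tensor factors.\<close>

lemma rev_upt_add: "rev [0..<m + n] = map (\<lambda>i. m + i) (rev [0..<n]) @ rev [0..<m]" for m n :: nat
  by (induction n) simp_all

context structure_in
begin

sublocale Y: lm_theory L Sg Th
  using lang sig Lm_theory_Th by unfold_locales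

section \<open>Interpretation of the classifying prop-category of \<open>Th\<close> in
  \<open>C\<close>\<close>

lemma wts_iff: "Y.wts \<Gamma> \<Delta> Ms \<longleftrightarrow> is_ctx Sg \<Gamma> \<and> is_ctx Sg \<Delta> \<and> list_all2 (wt_trm Sg \<Gamma>) Ms \<Delta>"
  by (simp add: Y.wts_def)

text \<open>A tuple determines its components, as its composites with the variables, and equality of
  components is what \<open>Th\<close> records.\<close>

lemma eqs_iff:
  assumes "Y.wts \<Gamma> \<Delta> Ms" "Y.wts \<Gamma> \<Delta> Ns"
  shows "Y.eqs \<Gamma> \<Delta> Ms Ns \<longleftrightarrow> tm \<Gamma> Ms = tm \<Gamma> Ns"
proof
  note l = Y.wts_length[OF assms(1)] Y.wts_length[OF assms(2)]
  have c: "is_ctx Sg \<Gamma>" "is_ctx Sg \<Delta>" using assms by (simp_all add: wts_iff)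
  show "tm \<Gamma> Ms = tm \<Gamma> Ns" if "Y.eqs \<Gamma> \<Delta> Ms Ns"
  proof -
    have "map (trm_arr C M \<Gamma>) Ms = map (trm_arr C M \<Gamma>) Ns"
      using that l by (auto simp: Y.eqs_def EqA_Th intro!: nth_equalityI)
    then show ?thesis by simp
  qed
  assume e: "tm \<Gamma> Ms = tm \<Gamma> Ns"
  have a: "arrs M (ctx_ob C M \<Gamma>) (map (trm_arr C M \<Gamma>) Ms) \<Delta>"
    "arrs M (ctx_ob C M \<Gamma>) (map (trm_arr C M \<Gamma>) Ns) \<Delta>"
    using arrs_trms assms c by (simp_all add: wts_iff)
  have "trm_arr C M \<Gamma> (Ms ! i) = trm_arr C M \<Gamma> (Ns ! i)" if "i < length \<Delta>" for i
    using var_tuple[OF a(1) that] var_tuple[OF a(2) that] e l that by simp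
  then show "Y.eqs \<Gamma> \<Delta> Ms Ns"
    using l c Y.wts_nth[OF assms(1)] Y.wts_nth[OF assms(2)] by (simp add: Y.eqs_def EqA_Th)
qed

lemma feq_iff: "Y.feq \<Gamma> \<phi> \<psi> \<longleftrightarrow> is_ctx Sg \<Gamma> \<and> wt_fml L Sg \<Gamma> \<phi> \<and> wt_fml L Sg \<Gamma> \<psi> \<and>
    fml_val C M \<Gamma> \<phi> = fml_val C M \<Gamma> \<psi>"
  unfolding Y.feq_def SeqA_both_Th ..

text \<open>Interpretation in \<open>M\<close>, evaluated at chosen representatives;
  \<open>ma_K\<close> and \<open>mp_K\<close> show that the choice is immaterial.\<close>

definition comparison ::
  "('u ctx, 'u ctx \<times> 'u ctx \<times> 'u trm list set, ('u, 'k, 'q) fml set, 'o, 'a, 'p) pmor" where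
  "comparison = \<lparr>mo = ctx_ob C M, ma = \<lambda>(\<Gamma>, \<Delta>, A). tm \<Gamma> (rep A), mp = \<lambda>\<Gamma> A. fml_val C M \<Gamma> (rep A)\<rparr>"

abbreviation "K \<equiv> comparison"

lemma mo_K [simp]: "mo K = ctx_ob C M"
  by (simp add: comparison_def)

lemma ma_K [simp]:
  assumes "Y.wts \<Gamma> \<Delta> Ms"
  shows "ma K (Y.ar \<Gamma> \<Delta> Ms) = tm \<Gamma> Ms"
proof -
  have e: "Y.eqs \<Gamma> \<Delta> Ms (rep (trms_class Th \<Gamma> \<Delta> Ms))" using assms by (rule Y.eqs_rep)
  then have "tm \<Gamma> Ms = tm \<Gamma> (rep (trms_class Th \<Gamma> \<Delta> Ms))"
    using eqs_iff[OF assms Y.eqs_wts[OF e]] assms by (simp add: wts_iff)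
  then show ?thesis by (simp add: comparison_def cl_arr_def)
qed

lemma mp_K [simp]:
  assumes "is_ctx Sg \<Gamma>" "wt_fml L Sg \<Gamma> \<phi>"
  shows "mp K \<Gamma> (Y.fc \<Gamma> \<phi>) = fml_val C M \<Gamma> \<phi>"
  using Y.feq_rep[OF assms] by (simp add: comparison_def feq_iff)

lemma tm_wts [simp]:
  assumes "Y.wts \<Gamma> \<Delta> Ms"
  shows "tm \<Gamma> Ms \<in> arr C" "dm C (tm \<Gamma> Ms) = ctx_ob C M \<Gamma>" "cd C (tm \<Gamma> Ms) = ctx_ob C M \<Delta>"
  using tm_typ assms unfolding wts_iff by blast+

lemma tm_vars: "is_ctx Sg \<Gamma> \<Longrightarrow> tm \<Gamma> (Y.vars (length \<Gamma>)) = idn C (ctx_ob C M \<Gamma>)"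
  using tuple_vars[of \<Gamma> M] by (simp add: isorts_ob o_def)

lemma tm_comp:
  assumes "Y.wts \<Gamma> \<Delta> Ms" "Y.wts \<Delta> \<Theta> Ns"
  shows "tm \<Gamma> (map (tsub (inst Ms)) Ns) = comp C (tm \<Delta> Ns) (tm \<Gamma> Ms)"
  using map_tm_comp[OF _ Y.wts_inst[OF assms(1)], of Ns \<Theta>] msub_inst[of Ms \<Delta> \<Gamma>] Y.wts_length[OF assms(1)] assms
  by (simp add: wts_iff)

lemma var_tm:
  assumes "Y.wts \<Gamma> \<Delta> Ms" "i < length \<Delta>"
  shows "comp C (var_arr C M \<Delta> i) (tm \<Gamma> Ms) = trm_arr C M \<Gamma> (Ms ! i)"
  using var_tuple[OF arrs_trms[of \<Gamma> \<Delta> Ms] assms(2)] Y.wts_length[OF assms(1)] assms by (simp add: wts_iff)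

lemma var_typ [simp]:
  assumes "is_ctx Sg \<Gamma>" "i < length \<Gamma>"
  shows "var_arr C M \<Gamma> i \<in> arr C" "dm C (var_arr C M \<Gamma> i) = ctx_ob C M \<Gamma>"
    "cd C (var_arr C M \<Gamma> i) = isort M (\<Gamma> ! i)"
  using var_arr_typ[of \<Gamma> M i] isorts_ob[OF assms(1)] assms by simp_all

text \<open>The isomorphism between the interpretations of \<open>\<Gamma>, \<Delta>\<close> and \<open>\<Gamma> \<times> \<Delta>\<close>.\<close>

definition P1 :: "'u ctx \<Rightarrow> 'u ctx \<Rightarrow> 'a" where "P1 \<Gamma> \<Delta> = ma K (pr1 Y.C \<Gamma> \<Delta>)"
definition P2 :: "'u ctx \<Rightarrow> 'u ctx \<Rightarrow> 'a" where "P2 \<Gamma> \<Delta> = ma K (pr2 Y.C \<Gamma> \<Delta>)"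

fun icmp :: "'u ctx \<Rightarrow> 'u ctx \<Rightarrow> 'a" where
  "icmp \<Gamma> [] = pr1 C (ctx_ob C M \<Gamma>) (one C)"
| "icmp \<Gamma> (\<tau> # \<Delta>) = comp C (times_id C (icmp \<Gamma> \<Delta>) (isort M \<tau>))
     (assoc C (ctx_ob C M \<Gamma>) (ctx_ob C M \<Delta>) (isort M \<tau>))"

lemma P1:
  assumes "is_ctx Sg \<Gamma>" "is_ctx Sg \<Delta>"
  shows "P1 \<Gamma> \<Delta> \<in> arr C" "dm C (P1 \<Gamma> \<Delta>) = ctx_ob C M (\<Delta> @ \<Gamma>)" "cd C (P1 \<Gamma> \<Delta>) = ctx_ob C M \<Gamma>"
    "j < length \<Gamma> \<Longrightarrow> comp C (var_arr C M \<Gamma> j) (P1 \<Gamma> \<Delta>) = var_arr C M (\<Delta> @ \<Gamma>) (length \<Delta> + j)"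
  unfolding P1_def Y.pr1_C ma_K[OF Y.wts_pr(1)[OF assms]]
  using tm_wts[OF Y.wts_pr(1)[OF assms]] var_tm[OF Y.wts_pr(1)[OF assms], of j] by auto

lemma P2:
  assumes "is_ctx Sg \<Gamma>" "is_ctx Sg \<Delta>"
  shows "P2 \<Gamma> \<Delta> \<in> arr C" "dm C (P2 \<Gamma> \<Delta>) = ctx_ob C M (\<Delta> @ \<Gamma>)" "cd C (P2 \<Gamma> \<Delta>) = ctx_ob C M \<Delta>"
    "j < length \<Delta> \<Longrightarrow> comp C (var_arr C M \<Delta> j) (P2 \<Gamma> \<Delta>) = var_arr C M (\<Delta> @ \<Gamma>) j"
  unfolding P2_def Y.pr2_C ma_K[OF Y.wts_pr(2)[OF assms]]
  using tm_wts[OF Y.wts_pr(2)[OF assms]] var_tm[OF Y.wts_pr(2)[OF assms], of j] by auto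

lemma icmp_typ [simp]:
  assumes "is_ctx Sg \<Gamma>" "is_ctx Sg \<Delta>"
  shows "icmp \<Gamma> \<Delta> \<in> arr C" "dm C (icmp \<Gamma> \<Delta>) = prd C (ctx_ob C M \<Gamma>) (ctx_ob C M \<Delta>)"
    "cd C (icmp \<Gamma> \<Delta>) = ctx_ob C M (\<Delta> @ \<Gamma>)"
proof -
  have "icmp \<Gamma> \<Delta> \<in> arr C \<and> dm C (icmp \<Gamma> \<Delta>) = prd C (ctx_ob C M \<Gamma>) (ctx_ob C M \<Delta>) \<and>
    cd C (icmp \<Gamma> \<Delta>) = ctx_ob C M (\<Delta> @ \<Gamma>)"
    using assms by (induction \<Delta>) simp_all
  then show "icmp \<Gamma> \<Delta> \<in> arr C" "dm C (icmp \<Gamma> \<Delta>) = prd C (ctx_ob C M \<Gamma>) (ctx_ob C M \<Delta>)"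
    "cd C (icmp \<Gamma> \<Delta>) = ctx_ob C M (\<Delta> @ \<Gamma>)" by auto
qed

lemma var_icmp:
  assumes "is_ctx Sg \<Gamma>" "is_ctx Sg \<Delta>"
  shows "i < length \<Delta> \<Longrightarrow> comp C (var_arr C M (\<Delta> @ \<Gamma>) i) (icmp \<Gamma> \<Delta>) =
      comp C (var_arr C M \<Delta> i) (pr2 C (ctx_ob C M \<Gamma>) (ctx_ob C M \<Delta>))"
    and "j < length \<Gamma> \<Longrightarrow> comp C (var_arr C M (\<Delta> @ \<Gamma>) (length \<Delta> + j)) (icmp \<Gamma> \<Delta>) =
      comp C (var_arr C M \<Gamma> j) (pr1 C (ctx_ob C M \<Gamma>) (ctx_ob C M \<Delta>))"
proof -
  \<comment> \<open>Both claims are proved as one about a single index, since the induction strips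
    the newest sort of \<open>\<Delta>\<close> whichever part the index falls in.\<close>
  have "comp C (var_arr C M (\<Delta> @ \<Gamma>) k) (icmp \<Gamma> \<Delta>) = (if k < length \<Delta> then
      comp C (var_arr C M \<Delta> k) (pr2 C (ctx_ob C M \<Gamma>) (ctx_ob C M \<Delta>)) else
      comp C (var_arr C M \<Gamma> (k - length \<Delta>)) (pr1 C (ctx_ob C M \<Gamma>) (ctx_ob C M \<Delta>)))"
    if "k < length (\<Delta> @ \<Gamma>)" for k
    using assms(2) that
  proof (induction \<Delta> arbitrary: k)
    case (Cons \<tau> \<Delta>)
    let ?g = "ctx_ob C M \<Gamma>" and ?d = "ctx_ob C M \<Delta>" and ?t = "isort M \<tau>"
    have ob: "?g \<in> ob C" "?d \<in> ob C" "?t \<in> ob C" "ctx_ob C M (\<Delta> @ \<Gamma>) \<in> ob C" using Cons(2) assms(1) by simp_all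
    show ?case
    proof (cases k)
      case 0
      then show ?thesis using Cons(2) assms(1) by (simp add: times_id_def assoc_def)
    next
      case (Suc i)
      then have i: "i < length (\<Delta> @ \<Gamma>)" using Cons(3) by simp
      have "comp C (var_arr C M ((\<tau> # \<Delta>) @ \<Gamma>) k) (icmp \<Gamma> (\<tau> # \<Delta>)) =
        comp C (comp C (var_arr C M (\<Delta> @ \<Gamma>) i) (icmp \<Gamma> \<Delta>))
          (comp C (pr1 C (prd C ?g ?d) ?t) (assoc C ?g ?d ?t))"
        using var_typ[of "\<Delta> @ \<Gamma>" i] i Cons(2) assms(1) ob by (simp add: Suc times_id_def)
      also have "comp C (pr1 C (prd C ?g ?d) ?t) (assoc C ?g ?d ?t) =
          pair C (pr1 C ?g (prd C ?d ?t)) (comp C (pr1 C ?d ?t) (pr2 C ?g (prd C ?d ?t)))"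
        using ob by (simp add: assoc_def)
      finally show ?thesis using Cons(1)[OF _ i] Cons(2) i assms(1) ob var_typ[of \<Delta> i] var_typ[of \<Gamma> "i - length \<Delta>"]
        by (simp add: Suc)
    qed
  qed simp
  from this[of i] this[of "length \<Delta> + j"] show "i < length \<Delta> \<Longrightarrow> comp C (var_arr C M (\<Delta> @ \<Gamma>) i) (icmp \<Gamma> \<Delta>) =
      comp C (var_arr C M \<Delta> i) (pr2 C (ctx_ob C M \<Gamma>) (ctx_ob C M \<Delta>))"
    and "j < length \<Gamma> \<Longrightarrow> comp C (var_arr C M (\<Delta> @ \<Gamma>) (length \<Delta> + j)) (icmp \<Gamma> \<Delta>) =
      comp C (var_arr C M \<Gamma> j) (pr1 C (ctx_ob C M \<Gamma>) (ctx_ob C M \<Delta>))" by auto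
qed

lemma P_icmp:
  assumes "is_ctx Sg \<Gamma>" "is_ctx Sg \<Delta>"
  shows "comp C (P1 \<Gamma> \<Delta>) (icmp \<Gamma> \<Delta>) = pr1 C (ctx_ob C M \<Gamma>) (ctx_ob C M \<Delta>)"
    "comp C (P2 \<Gamma> \<Delta>) (icmp \<Gamma> \<Delta>) = pr2 C (ctx_ob C M \<Gamma>) (ctx_ob C M \<Delta>)"
proof -
  note p = P1[OF assms] P2[OF assms]
  show "comp C (P1 \<Gamma> \<Delta>) (icmp \<Gamma> \<Delta>) = pr1 C (ctx_ob C M \<Gamma>) (ctx_ob C M \<Delta>)"
  proof (rule ctx_ext[of \<Gamma> M])
    fix i assume i: "i < length \<Gamma>"
    have "comp C (comp C (var_arr C M \<Gamma> i) (P1 \<Gamma> \<Delta>)) (icmp \<Gamma> \<Delta>) =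
        comp C (var_arr C M \<Gamma> i) (pr1 C (ctx_ob C M \<Gamma>) (ctx_ob C M \<Delta>))"
      using i p(4) var_icmp(2)[OF assms] by simp
    then show "comp C (var_arr C M \<Gamma> i) (comp C (P1 \<Gamma> \<Delta>) (icmp \<Gamma> \<Delta>)) =
        comp C (var_arr C M \<Gamma> i) (pr1 C (ctx_ob C M \<Gamma>) (ctx_ob C M \<Delta>))"
      using i p(1-3) assms by simp
  qed (use p assms isorts_ob in simp_all)
  show "comp C (P2 \<Gamma> \<Delta>) (icmp \<Gamma> \<Delta>) = pr2 C (ctx_ob C M \<Gamma>) (ctx_ob C M \<Delta>)"
  proof (rule ctx_ext[of \<Delta> M])
    fix i assume i: "i < length \<Delta>"
    have "comp C (comp C (var_arr C M \<Delta> i) (P2 \<Gamma> \<Delta>)) (icmp \<Gamma> \<Delta>) =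
        comp C (var_arr C M \<Delta> i) (pr2 C (ctx_ob C M \<Gamma>) (ctx_ob C M \<Delta>))"
      using i p(8) var_icmp(1)[OF assms] by simp
    then show "comp C (var_arr C M \<Delta> i) (comp C (P2 \<Gamma> \<Delta>) (icmp \<Gamma> \<Delta>)) =
        comp C (var_arr C M \<Delta> i) (pr2 C (ctx_ob C M \<Gamma>) (ctx_ob C M \<Delta>))"
      using i p(5-7) assms by simp
  qed (use p assms isorts_ob in simp_all)
qed

lemma cmp_K: "cmp Y.C C K \<Gamma> \<Delta> = pair C (P1 \<Gamma> \<Delta>) (P2 \<Gamma> \<Delta>)"
  by (simp add: cmp_def P1_def P2_def)

text \<open>One composite is checked on the two projections of the product, the other on the
  variables of \<open>\<Delta> @ \<Gamma>\<close>.\<close>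

lemma inverse_cmp:
  assumes "is_ctx Sg \<Gamma>" "is_ctx Sg \<Delta>"
  shows "is_inverse C (cmp Y.C C K \<Gamma> \<Delta>) (icmp \<Gamma> \<Delta>)"
  unfolding cmp_K
proof (rule is_isoI)
  note p = P1[OF assms] P2[OF assms]
  let ?c = "pair C (P1 \<Gamma> \<Delta>) (P2 \<Gamma> \<Delta>)"
  show "?c \<in> arr C" "icmp \<Gamma> \<Delta> \<in> arr C" "dm C (icmp \<Gamma> \<Delta>) = cd C ?c" "cd C (icmp \<Gamma> \<Delta>) = dm C ?c"
    using p assms by simp_all
  show "comp C ?c (icmp \<Gamma> \<Delta>) = idn C (cd C ?c)"
    using p assms by (simp add: P_icmp)
  show "comp C (icmp \<Gamma> \<Delta>) ?c = idn C (dm C ?c)"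
  proof (rule ctx_ext[of "\<Delta> @ \<Gamma>" M])
    fix i assume i: "i < length (\<Delta> @ \<Gamma>)"
    have v: "var_arr C M (\<Delta> @ \<Gamma>) i \<in> arr C" "dm C (var_arr C M (\<Delta> @ \<Gamma>) i) = ctx_ob C M (\<Delta> @ \<Gamma>)"
      using var_typ[of "\<Delta> @ \<Gamma>" i] assms i by simp_all
    have "comp C (comp C (var_arr C M (\<Delta> @ \<Gamma>) i) (icmp \<Gamma> \<Delta>)) ?c = var_arr C M (\<Delta> @ \<Gamma>) i"
    proof (cases "i < length \<Delta>")
      case True
      then show ?thesis using p assms var_icmp(1)[OF assms True] by simp
    next
      case False
      then have j: "i - length \<Delta> < length \<Gamma>" "length \<Delta> + (i - length \<Delta>) = i" using i by auto
      then show ?thesis using p(1-3) p(5-7) assms var_icmp(2)[OF assms j(1)] P1(4)[OF assms j(1)] by simp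
    qed
    then show "comp C (var_arr C M (\<Delta> @ \<Gamma>) i) (comp C (icmp \<Gamma> \<Delta>) ?c) =
        comp C (var_arr C M (\<Delta> @ \<Gamma>) i) (idn C (dm C ?c))"
      using p v assms by simp
  qed (use p assms isorts_ob[of "\<Delta> @ \<Gamma>"] in simp_all)
qed

lemma inv_cmp_K: "is_ctx Sg \<Gamma> \<Longrightarrow> is_ctx Sg \<Delta> \<Longrightarrow> inv_arr C (cmp Y.C C K \<Gamma> \<Delta>) = icmp \<Gamma> \<Delta>"
  using inv_arr_eq[OF inverse_cmp] .

text \<open>\<open>quants_fml\<close> and \<open>icmp\<close> recurse in step: each quantified sort
  costs one use of naturality, which yields the \<open>times_id\<close> factor, and one use of
  \<open>quant_prd\<close>, which yields \<open>assoc\<close>. The empty prefix is the axiom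
  \<open>quant_one\<close>.\<close>

lemma fml_val_quants:
  assumes "q \<in> quants L" "is_ctx Sg \<Gamma>" "is_ctx Sg \<Delta>" "wt_fml L Sg (\<Delta> @ \<Gamma>) \<phi>"
  shows "fml_val C M \<Gamma> (quants_fml q \<Delta> \<phi>) =
    quant C q (ctx_ob C M \<Gamma>) (ctx_ob C M \<Delta>) (sub C (icmp \<Gamma> \<Delta>) (fml_val C M (\<Delta> @ \<Gamma>) \<phi>))"
  using assms
proof (induction \<Delta> arbitrary: \<phi>)
  case Nil
  then show ?case by (simp add: quant_one)
next
  case (Cons \<tau> \<Delta>)
  let ?g = "ctx_ob C M \<Gamma>" and ?d = "ctx_ob C M \<Delta>" and ?t = "isort M \<tau>"
  let ?x = "fml_val C M ((\<tau> # \<Delta>) @ \<Gamma>) \<phi>"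
  have ob: "?g \<in> ob C" "?d \<in> ob C" "?t \<in> ob C" "ctx_ob C M (\<Delta> @ \<Gamma>) \<in> ob C" "is_ctx Sg \<Delta>"
    using Cons.prems by simp_all
  have x: "?x \<in> pred C (prd C (ctx_ob C M (\<Delta> @ \<Gamma>)) ?t)"
    using fml_val_pred[OF Cons.prems(4)] Cons.prems(2,3) by simp
  have "fml_val C M \<Gamma> (quants_fml q (\<tau> # \<Delta>) \<phi>) =
     quant C q ?g ?d (sub C (icmp \<Gamma> \<Delta>) (quant C q (ctx_ob C M (\<Delta> @ \<Gamma>)) ?t ?x))"
    using Cons by simp
  also have "\<dots> = quant C q ?g ?d (quant C q (prd C ?g ?d) ?t (sub C (times_id C (icmp \<Gamma> \<Delta>) ?t) ?x))"
    using sub_quant[of q "icmp \<Gamma> \<Delta>" ?t "ctx_ob C M (\<Delta> @ \<Gamma>)" ?x] ob x Cons.prems by simp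
  also have "\<dots> = quant C q ?g (prd C ?d ?t)
      (sub C (assoc C ?g ?d ?t) (sub C (times_id C (icmp \<Gamma> \<Delta>) ?t) ?x))"
    using ob x Cons.prems by (intro quant_prd[symmetric]) simp_all
  also have "\<dots> = quant C q ?g (prd C ?d ?t) (sub C (icmp \<Gamma> (\<tau> # \<Delta>)) ?x)"
    using ob x Cons.prems by simp
  finally show ?case by simp
qed

text \<open>Iterates \<open>sub_eqp_prd\<close> along the context. The newest variable contributes
  the right-hand tensor factor, hence the reversed list of indices.\<close>

lemma sub_eqp_ctx:
  assumes "is_ctx Sg \<Gamma>" "f \<in> arr C" "g \<in> arr C" "dm C f = dm C g" "cd C f = ctx_ob C M \<Gamma>" "cd C g = ctx_ob C M \<Gamma>"
  shows "sub C (pair C f g) (eqp C (ctx_ob C M \<Gamma>)) = tensors (dm C f)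
    (map (\<lambda>i. sub C (pair C (comp C (var_arr C M \<Gamma> i) f) (comp C (var_arr C M \<Gamma> i) g)) (eqp C (isort M (\<Gamma> ! i))))
      (rev [0..<length \<Gamma>]))"
  using assms
proof (induction \<Gamma> arbitrary: f g)
  case Nil
  then show ?case by (simp add: eqp_one)
next
  case (Cons \<tau> \<Gamma>)
  let ?g = "ctx_ob C M \<Gamma>" and ?t = "isort M \<tau>"
  have ob: "is_ctx Sg \<Gamma>" "\<tau> \<in> sorts Sg" using Cons.prems by simp_all
  let ?e = "\<lambda>\<Gamma> f g i. sub C (pair C (comp C (var_arr C M \<Gamma> i) f) (comp C (var_arr C M \<Gamma> i) g)) (eqp C (isort M (\<Gamma> ! i)))"
  let ?p = "pr1 C ?g ?t"
  have m: "map (?e \<Gamma> (comp C ?p f) (comp C ?p g)) (rev [0..<length \<Gamma>]) = map (?e (\<tau> # \<Gamma>) f g) (map Suc (rev [0..<length \<Gamma>]))"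
    using Cons.prems ob by simp
  have r: "rev [0..<length (\<tau> # \<Gamma>)] = map Suc (rev [0..<length \<Gamma>]) @ [0]"
    by (simp add: rev_map[symmetric] map_Suc_upt upt_conv_Cons del: upt_Suc)
  have s: "set (map (?e (\<tau> # \<Gamma>) f g) (map Suc (rev [0..<length \<Gamma>]))) \<subseteq> pred C (dm C f)"
    "?e (\<tau> # \<Gamma>) f g 0 \<in> pred C (dm C f)"
    using Cons.prems ob by (auto simp: isorts_ob)
  have "sub C (pair C f g) (eqp C (prd C ?g ?t)) = tensor_p L C (dm C f)
      (sub C (pair C (comp C ?p f) (comp C ?p g)) (eqp C ?g)) (?e (\<tau> # \<Gamma>) f g 0)"
    using Cons.prems ob by (subst sub_eqp_prd) simp_all
  also have "sub C (pair C (comp C ?p f) (comp C ?p g)) (eqp C ?g) = tensors (dm C f) (map (?e \<Gamma> (comp C ?p f) (comp C ?p g)) (rev [0..<length \<Gamma>]))"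
    using Cons.prems ob by (subst Cons.IH) simp_all
  also have "tensor_p L C (dm C f) \<dots> (?e (\<tau> # \<Gamma>) f g 0) = tensors (dm C f) (map (?e (\<tau> # \<Gamma>) f g) (rev [0..<length (\<tau> # \<Gamma>)]))"
    using s Cons.prems unfolding m r map_append
    by (subst tensors_append) (simp_all del: set_map map_map)
  finally show ?case by simp
qed

text \<open>The two folds differ by a final unit, which the unit law absorbs.\<close>

lemma fml_val_tensor_list:
  "is_ctx Sg \<Gamma> \<Longrightarrow> \<forall>\<phi>\<in>set \<phi>s. wt_fml L Sg \<Gamma> \<phi> \<Longrightarrow> fml_val C M \<Gamma> (tensor_list L \<phi>s) = vals \<Gamma> \<phi>s"
  by (induction \<phi>s rule: induct_list012) simp_all

text \<open>The interpreted projections from \<open>\<Gamma> @ \<Gamma>\<close> send variable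
  \<open>i\<close> to \<open>Var (length \<Gamma> + i)\<close> and \<open>Var i\<close>, so
  \<open>sub_eqp_ctx\<close> produces exactly the equations listed in \<open>eq_fml\<close>.\<close>

lemma fml_val_eq_fml:
  assumes "is_ctx Sg \<Gamma>"
  shows "fml_val C M (\<Gamma> @ \<Gamma>) (eq_fml L \<Gamma>) = sub C (cmp Y.C C K \<Gamma> \<Gamma>) (eqp C (ctx_ob C M \<Gamma>))"
proof -
  let ?\<phi> = "\<lambda>i. Equ (\<Gamma> ! i) (Var (length \<Gamma> + i)) (Var i)"
  note p = P1[OF assms assms] P2[OF assms assms]
  have "fml_val C M (\<Gamma> @ \<Gamma>) (eq_fml L \<Gamma>) = vals (\<Gamma> @ \<Gamma>) (map ?\<phi> (rev [0..<length \<Gamma>]))"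
    unfolding eq_fml_def using assms
    by (intro fml_val_tensor_list) (auto simp: Y.is_ctx_nth nth_append intro!: wt_Var)
  also have "\<dots> = tensors (dm C (P1 \<Gamma> \<Gamma>)) (map (\<lambda>i. sub C (pair C (comp C (var_arr C M \<Gamma> i) (P1 \<Gamma> \<Gamma>))
      (comp C (var_arr C M \<Gamma> i) (P2 \<Gamma> \<Gamma>))) (eqp C (isort M (\<Gamma> ! i)))) (rev [0..<length \<Gamma>]))"
    unfolding p(2) by (rule arg_cong[of _ _ "tensors _"]) (use p(4,8) in auto)
  also have "\<dots> = sub C (cmp Y.C C K \<Gamma> \<Gamma>) (eqp C (ctx_ob C M \<Gamma>))"
    unfolding cmp_K using p assms by (intro sub_eqp_ctx[symmetric]) simp_all
  finally show ?thesis .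
qed

lemma is_morphism_K: "is_morphism L Y.C C K"
  unfolding is_morphism_def is_functor_def
proof (intro conjI ballI impI)
  fix \<Gamma> assume "\<Gamma> \<in> ob Y.C"
  then have G: "is_ctx Sg \<Gamma>" by simp
  then show "mo K \<Gamma> \<in> ob C" "ma K (idn Y.C \<Gamma>) = idn C (mo K \<Gamma>)"
    by (simp_all add: Y.idn_C Y.wts_vars tm_vars del: map_map)
  show "mp K (prd Y.C \<Gamma> \<Gamma>) (eqp Y.C \<Gamma>) = sub C (cmp Y.C C K \<Gamma> \<Gamma>) (eqp C (mo K \<Gamma>))"
    using G by (simp add: Y.eqp_C Y.wt_eq_fml fml_val_eq_fml)
  show "mp K \<Gamma> x \<in> pred C (mo K \<Gamma>)" if "x \<in> pred Y.C \<Gamma>" for x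
    using that G by (auto elim!: Y.pred_cases)
  show "le C (mo K \<Gamma>) (mp K \<Gamma> x) (mp K \<Gamma> y)" if "x \<in> pred Y.C \<Gamma>" "y \<in> pred Y.C \<Gamma>" "le Y.C \<Gamma> x y" for x y
    using that G by (auto elim!: Y.pred_cases simp: Y.le_fc SeqA1_Th)
  show "is_iso C (cmp Y.C C K \<Gamma> \<Delta>)" if "\<Delta> \<in> ob Y.C" for \<Delta>
    using inverse_cmp G that unfolding is_iso_def by auto
  fix k xs assume k: "k \<in> conns L" and xs': "xs \<in> lists (pred Y.C \<Gamma>)" and l: "length xs = arity L k"
  from xs' obtain \<phi>s where xs: "xs = map (Y.fc \<Gamma>) \<phi>s" "\<forall>\<phi>\<in>set \<phi>s. wt_fml L Sg \<Gamma> \<phi>"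
    by (rule Y.lists_pred_cases)
  then have m: "map (mp K \<Gamma>) xs = map (fml_val C M \<Gamma>) \<phi>s" using G by simp
  show "mp K \<Gamma> (conn Y.C \<Gamma> k xs) = conn C (mo K \<Gamma>) k (map (mp K \<Gamma>) xs)"
    unfolding m using G k l xs by simp
next
  fix f assume f': "f \<in> arr Y.C"
  then obtain Ms where f: "f = Y.ar (dm Y.C f) (cd Y.C f) Ms" "Y.wts (dm Y.C f) (cd Y.C f) Ms" by (rule Y.arr_cases)
  have m: "ma K f = tm (dm Y.C f) Ms" using f ma_K by metis
  show "ma K f \<in> hom C (mo K (dm Y.C f)) (mo K (cd Y.C f))"
    unfolding m using f(2) by (simp add: hom_def)
  show "ma K (comp Y.C g f) = comp C (ma K g) (ma K f)" if g: "g \<in> arr Y.C" "cd Y.C f = dm Y.C g" for g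
  proof -
    obtain Ns where g': "g = Y.ar (cd Y.C f) (cd Y.C g) Ns" "Y.wts (cd Y.C f) (cd Y.C g) Ns"
      using Y.arr_cases[OF g(1)] g(2) by metis
    then have "ma K g = tm (cd Y.C f) Ns" using ma_K by metis
    moreover have "comp Y.C g f = Y.ar (dm Y.C f) (cd Y.C g) (map (tsub (inst Ms)) Ns)"
      using Y.comp_ar[OF f(2) g'(2)] f(1) g'(1) by metis
    ultimately show ?thesis using ma_K[OF Y.wts_tsub[OF f(2) g'(2)]] tm_comp[OF f(2) g'(2)] m by simp
  qed
  fix x assume "x \<in> pred Y.C (cd Y.C f)"
  then obtain \<phi> where x: "x = Y.fc (cd Y.C f) \<phi>" "wt_fml L Sg (cd Y.C f) \<phi>" by (rule Y.pred_cases)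
  have s: "sub Y.C f x = Y.fc (dm Y.C f) (fsub (inst Ms) \<phi>)"
    using Y.sub_fc[OF f(2) x(2)] f(1) x(1) by metis
  have c: "is_ctx Sg (dm Y.C f)" "is_ctx Sg (cd Y.C f)" using Y.wts_ctx[OF f(2)] by auto
  have "msub (dm Y.C f) (cd Y.C f) (inst Ms) = tm (dm Y.C f) Ms"
    using msub_inst Y.wts_length[OF f(2)] by blast
  then show "mp K (dm Y.C f) (sub Y.C f x) = sub C (ma K f) (mp K (cd Y.C f) x)"
    unfolding s m unfolding x(1) using mp_K[OF c(2) x(2)] mp_K[OF c(1) Y.wt_fsub_inst[OF f(2) x(2)]]
      fml_val_fsub[OF x(2) Y.wts_inst[OF f(2)] c] by simp
next
  show "is_iso C (bang C (mo K (one Y.C)))"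
    using one_ext[of "bang C (one C)" "idn C (one C)"] is_iso_idn[of "one C"] by simp
next
  fix q \<Gamma> \<Delta> x assume "q \<in> quants L" "\<Gamma> \<in> ob Y.C" "\<Delta> \<in> ob Y.C" "x \<in> pred Y.C (prd Y.C \<Gamma> \<Delta>)"
  then show "mp K \<Gamma> (quant Y.C q \<Gamma> \<Delta> x) =
      quant C q (mo K \<Gamma>) (mo K \<Delta>) (sub C (inv_arr C (cmp Y.C C K \<Gamma> \<Delta>)) (mp K (prd Y.C \<Gamma> \<Delta>) x))"
    by (auto elim!: Y.pred_cases simp: inv_cmp_K Y.wt_quants fml_val_quants)
qed

text \<open>\<open>Th\<close> contains everything that holds in \<open>M\<close>, so parallel arrows
  with equal interpretations are already identified, and every inequality of values is
  derivable.\<close>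

lemma is_inclusion_K: "is_inclusion L Y.C C K"
  unfolding is_inclusion_def
proof (intro conjI ballI impI is_morphism_K)
  fix \<Gamma> \<Delta> assume "\<Gamma> \<in> ob Y.C" "\<Delta> \<in> ob Y.C"
  show "inj_on (ma K) (hom Y.C \<Gamma> \<Delta>)"
  proof (rule inj_onI)
    fix f g assume "f \<in> hom Y.C \<Gamma> \<Delta>" "g \<in> hom Y.C \<Gamma> \<Delta>" and e: "ma K f = ma K g"
    then obtain Ms Ns where "f = Y.ar \<Gamma> \<Delta> Ms" "Y.wts \<Gamma> \<Delta> Ms" "g = Y.ar \<Gamma> \<Delta> Ns" "Y.wts \<Gamma> \<Delta> Ns"
      by (metis Y.hom_cases)
    then show "f = g" using e by (simp add: Y.ar_eq_iff eqs_iff)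
  qed
next
  fix \<Gamma> x y assume "\<Gamma> \<in> ob Y.C" "x \<in> pred Y.C \<Gamma>" "y \<in> pred Y.C \<Gamma>" "le C (mo K \<Gamma>) (mp K \<Gamma> x) (mp K \<Gamma> y)"
  then show "le Y.C \<Gamma> x y" by (auto elim!: Y.pred_cases simp: Y.le_fc SeqA1_Th)
qed

section \<open>The axioms of the classifying prop-category of \<open>Th\<close>\<close>

lemma is_category_Y: "is_category Y.C"
  using reflect_category[OF Y.typed_C cat, of K] is_inclusion_K unfolding is_inclusion_def is_morphism_def by blast

sublocale R: reflection L Y.C C K
proof unfold_locales
  show "x = y" if "c \<in> ob Y.C" "x \<in> pred Y.C c" "y \<in> pred Y.C c" "mp K c x = mp K c y" for c x y
  proof -
    note h = that
    obtain \<phi> \<psi> where "x = Y.fc c \<phi>" "wt_fml L Sg c \<phi>" "y = Y.fc c \<psi>" "wt_fml L Sg c \<psi>"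
      using h(2,3) by (metis Y.pred_cases)
    then show ?thesis using h(1,4) by (simp add: Y.fc_eq_iff feq_iff)
  qed
qed (rule is_category_Y Y.has_products_C is_morphism_K Y.typed_C is_inclusion_K)+

text \<open>Concatenation is strictly associative, and the associator lists all variables in their
  order. The axiom for iterated quantifiers becomes a statement about prefixes.\<close>

lemma assoc_Y:
  assumes "is_ctx Sg \<Gamma>" "is_ctx Sg \<Delta>" "is_ctx Sg \<Theta>"
  shows "assoc Y.C \<Gamma> \<Delta> \<Theta> = idn Y.C (\<Theta> @ \<Delta> @ \<Gamma>)"
proof -
  let ?X = "\<Theta> @ \<Delta> @ \<Gamma>" and ?n = "length \<Theta> + length \<Delta>"
  let ?a = "map (\<lambda>i. Var (?n + i)) [0..<length \<Gamma>]" and ?v = "Y.vars ?n"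
  have c: "is_ctx Sg (\<Theta> @ \<Delta>)" using assms by simp
  have w: "Y.wts ?X \<Gamma> ?a" "Y.wts ?X (\<Theta> @ \<Delta>) ?v"
    using Y.wts_pr[OF assms(1) c] by simp_all
  have w': "Y.wts ?X \<Theta> (take (length \<Theta>) ?v)" "Y.wts ?X \<Delta> (drop (length \<Theta>) ?v)"
    using Y.wts_take_drop[OF w(2)] by auto
  have pr: "pr1 Y.C \<Gamma> (prd Y.C \<Delta> \<Theta>) = Y.ar ?X \<Gamma> ?a" "pr2 Y.C \<Gamma> (prd Y.C \<Delta> \<Theta>) = Y.ar ?X (\<Theta> @ \<Delta>) ?v"
    by (simp_all add: Y.pr1_C Y.pr2_C)
  have "assoc Y.C \<Gamma> \<Delta> \<Theta> = pair Y.C (pair Y.C (Y.ar ?X \<Gamma> ?a) (Y.ar ?X \<Delta> (drop (length \<Theta>) ?v))) (Y.ar ?X \<Theta> (take (length \<Theta>) ?v))"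
    unfolding assoc_def pr Y.pr_ar[OF w(2) assms(2,3)] ..
  also have "\<dots> = Y.ar ?X ?X (take (length \<Theta>) ?v @ drop (length \<Theta>) ?v @ ?a)"
    using Y.wts_append[of ?a \<Gamma> ?X \<Delta> "drop (length \<Theta>) ?v"] w w' by (simp del: drop_map take_map)
  also have "take (length \<Theta>) ?v @ drop (length \<Theta>) ?v @ ?a = Y.vars (length ?X)"
    by (auto simp: nth_append intro!: nth_equalityI)
  finally show ?thesis by (simp add: Y.idn_C)
qed

text \<open>Although the axiom is not reflected by inclusions as such, its two sides can be compared
  after applying the injective \<open>mp K\<close>: \<open>sub_eqp_ctx\<close> unfolds each into a
  tensor of equalities of variables, and the lists of factors agree, order included.\<close>

lemma has_equality_Y: "has_equality L Y.C"
  unfolding has_equality_def Let_def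
proof (intro conjI ballI)
  show "eqp Y.C (one Y.C) = unit_p L Y.C (prd Y.C (one Y.C) (one Y.C))"
    using Y.tensors_fc[of "[]" "[]"] by (simp add: Y.eqp_C eq_fml_def)
next
  fix \<Gamma> \<Delta> assume "\<Gamma> \<in> ob Y.C" "\<Delta> \<in> ob Y.C"
  then have c: "is_ctx Sg \<Gamma>" "is_ctx Sg \<Delta>" by simp_all
  let ?e = "prd Y.C \<Gamma> \<Delta>"
  let ?p = "pr1 Y.C ?e ?e" and ?p' = "pr2 Y.C ?e ?e"
  let ?f = "ma K ?p" and ?g = "ma K ?p'"
  let ?a = "ctx_ob C M (prd Y.C ?e ?e)"
  have ce: "is_ctx Sg ?e" "is_ctx Sg (prd Y.C ?e ?e)" using c by simp_all
  have f: "?p \<in> arr Y.C" "?p' \<in> arr Y.C" "dm Y.C ?p = prd Y.C ?e ?e" "dm Y.C ?p' = prd Y.C ?e ?e"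
     "cd Y.C ?p = ?e" "cd Y.C ?p' = ?e" "pr1 Y.C \<Gamma> \<Delta> \<in> arr Y.C" "pr2 Y.C \<Gamma> \<Delta> \<in> arr Y.C"
     "dm Y.C (pr1 Y.C \<Gamma> \<Delta>) = ?e" "dm Y.C (pr2 Y.C \<Gamma> \<Delta>) = ?e"
     "cd Y.C (pr1 Y.C \<Gamma> \<Delta>) = \<Gamma>" "cd Y.C (pr2 Y.C \<Gamma> \<Delta>) = \<Delta>"
    using c ce R.E.pr1_typ[of ?e ?e] R.E.pr2_typ[of ?e ?e] R.E.pr1_typ[of \<Gamma> \<Delta>] R.E.pr2_typ[of \<Gamma> \<Delta>]
    by (simp_all del: Y.prd_C)
  have fg: "?f \<in> arr C" "?g \<in> arr C" "dm C ?f = ?a" "dm C ?g = ?a" "cd C ?f = ctx_ob C M ?e" "cd C ?g = ctx_ob C M ?e"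
    using R.ma_typ[OF f(1)] R.ma_typ[OF f(2)] f by (simp_all del: Y.prd_C)
  let ?E = "\<lambda>\<Gamma> f g i. sub C (pair C (comp C (var_arr C M \<Gamma> i) f) (comp C (var_arr C M \<Gamma> i) g)) (eqp C (isort M (\<Gamma> ! i)))"
  let ?fG = "comp C (P1 \<Gamma> \<Delta>) ?f" and ?gG = "comp C (P1 \<Gamma> \<Delta>) ?g" and
    ?fD = "comp C (P2 \<Gamma> \<Delta>) ?f" and ?gD = "comp C (P2 \<Gamma> \<Delta>) ?g"
  note p = P1[OF c] P2[OF c]
  have e1: "mp K (prd Y.C ?e ?e) (eqp Y.C ?e) = tensors ?a (map (?E (\<Delta> @ \<Gamma>) ?f ?g) (rev [0..<length (\<Delta> @ \<Gamma>)]))"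
  proof -
    have "mp K (prd Y.C ?e ?e) (eqp Y.C ?e) = sub C (pair C ?f ?g) (eqp C (ctx_ob C M ?e))"
      using R.mp_eqp[of ?e] ce by (simp add: cmp_def del: Y.prd_C)
    then show ?thesis using sub_eqp_ctx[OF ce(1) fg(1,2)] fg by simp
  qed
  have ma: "ma K (comp Y.C (pr1 Y.C \<Gamma> \<Delta>) ?p) = ?fG" "ma K (comp Y.C (pr1 Y.C \<Gamma> \<Delta>) ?p') = ?gG"
    "ma K (comp Y.C (pr2 Y.C \<Gamma> \<Delta>) ?p) = ?fD" "ma K (comp Y.C (pr2 Y.C \<Gamma> \<Delta>) ?p') = ?gD"
    using f by (simp_all add: P1_def P2_def del: Y.prd_C)
  let ?l = "sub Y.C (pair Y.C (comp Y.C (pr1 Y.C \<Gamma> \<Delta>) ?p) (comp Y.C (pr1 Y.C \<Gamma> \<Delta>) ?p')) (eqp Y.C \<Gamma>)" and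
    ?r = "sub Y.C (pair Y.C (comp Y.C (pr2 Y.C \<Gamma> \<Delta>) ?p) (comp Y.C (pr2 Y.C \<Gamma> \<Delta>) ?p')) (eqp Y.C \<Delta>)"
  have e2: "mp K (prd Y.C ?e ?e) ?l = tensors ?a (map (?E \<Gamma> ?fG ?gG) (rev [0..<length \<Gamma>]))"
  proof -
    have "mp K (prd Y.C ?e ?e) ?l = sub C (pair C ?fG ?gG) (eqp C (ctx_ob C M \<Gamma>))"
      using f c by (subst R.mp_sub_eqp) (simp_all add: ma del: Y.prd_C)
    then show ?thesis using sub_eqp_ctx[OF c(1), of ?fG ?gG] fg p by simp
  qed
  have e3: "mp K (prd Y.C ?e ?e) ?r = tensors ?a (map (?E \<Delta> ?fD ?gD) (rev [0..<length \<Delta>]))"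
  proof -
    have "mp K (prd Y.C ?e ?e) ?r = sub C (pair C ?fD ?gD) (eqp C (ctx_ob C M \<Delta>))"
      using f c by (subst R.mp_sub_eqp) (simp_all add: ma del: Y.prd_C)
    then show ?thesis using sub_eqp_ctx[OF c(2), of ?fD ?gD] fg p by simp
  qed
  \<comment> \<open>\<open>P1\<close> shifts the variables of \<open>\<Gamma>\<close> past
    \<open>\<Delta>\<close>, while \<open>P2\<close> leaves those of \<open>\<Delta>\<close> in
    place; so both lists are segments of the list for \<open>\<Delta> @ \<Gamma>\<close>.\<close>
  have m1: "map (?E \<Gamma> ?fG ?gG) (rev [0..<length \<Gamma>]) = map (?E (\<Delta> @ \<Gamma>) ?f ?g) (map (\<lambda>i. length \<Delta> + i) (rev [0..<length \<Gamma>]))"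
  proof -
    have "comp C (var_arr C M \<Gamma> i) (comp C (P1 \<Gamma> \<Delta>) h) = comp C (var_arr C M (\<Delta> @ \<Gamma>) (length \<Delta> + i)) h"
      if "i < length \<Gamma>" "h \<in> arr C" "cd C h = ctx_ob C M ?e" for i h
      using p(1-3) that c by (simp flip: comp_assoc add: p(4))
    then show ?thesis using fg by simp
  qed
  have m2: "map (?E \<Delta> ?fD ?gD) (rev [0..<length \<Delta>]) = map (?E (\<Delta> @ \<Gamma>) ?f ?g) (rev [0..<length \<Delta>])"
  proof -
    have "comp C (var_arr C M \<Delta> i) (comp C (P2 \<Gamma> \<Delta>) h) = comp C (var_arr C M (\<Delta> @ \<Gamma>) i) h"
      if "i < length \<Delta>" "h \<in> arr C" "cd C h = ctx_ob C M ?e" for i h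
      using p(5-7) that c by (simp flip: comp_assoc add: p(8))
    then show ?thesis using fg by (simp add: nth_append)
  qed
  have s: "?E (\<Delta> @ \<Gamma>) ?f ?g i \<in> pred C ?a" if "i < length (\<Delta> @ \<Gamma>)" for i
    using that fg var_typ[of "\<Delta> @ \<Gamma>" i] c isorts_ob[of "\<Delta> @ \<Gamma>" "(\<Delta> @ \<Gamma>) ! i"] nth_mem[OF that]
    by (intro sub_pred) (simp_all del: nth_mem)
  have s': "?E (\<Delta> @ \<Gamma>) ?f ?g (length \<Delta> + j) \<in> pred C ?a" if "j < length \<Gamma>" for j
    by (rule s) (use that in simp)
  have r: "rev [0..<length (\<Delta> @ \<Gamma>)] = map (\<lambda>i. length \<Delta> + i) (rev [0..<length \<Gamma>]) @ rev [0..<length \<Delta>]"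
    using rev_upt_add by simp
  have a: "?a \<in> ob C" using ce by simp
  show "eqp Y.C ?e = tensor_p L Y.C (prd Y.C ?e ?e) ?l ?r"
  proof (rule R.mp_inj)
    have lr: "?l \<in> pred Y.C (prd Y.C ?e ?e)" "?r \<in> pred Y.C (prd Y.C ?e ?e)"
      using f c by (auto simp del: Y.prd_C)
    then show "tensor_p L Y.C (prd Y.C ?e ?e) ?l ?r \<in> pred Y.C (prd Y.C ?e ?e)"
      using ce by (intro R.tensor_C) simp_all
    have "mp K (prd Y.C ?e ?e) (tensor_p L Y.C (prd Y.C ?e ?e) ?l ?r) =
       tensor_p L C ?a (mp K (prd Y.C ?e ?e) ?l) (mp K (prd Y.C ?e ?e) ?r)"
      using R.mp_tensor[OF _ lr] ce by simp
    also have "\<dots> = mp K (prd Y.C ?e ?e) (eqp Y.C ?e)"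
      unfolding e1 e2 e3 m1 m2 r map_append
      by (rule tensors_append[symmetric, OF a]) (use s s' in auto)
    finally show "mp K (prd Y.C ?e ?e) (eqp Y.C ?e) = mp K (prd Y.C ?e ?e) (tensor_p L Y.C (prd Y.C ?e ?e) ?l ?r)" ..
  qed (use ce R.eqp_C[of ?e] in simp_all)
qed (auto simp: Y.eqp_C Y.wt_eq_fml)

text \<open>With contexts strictly unital and associative, the two remaining quantifier axioms say
  that the empty prefix does nothing and that prefixes concatenate.\<close>

lemma propcat_Y: "is_propcat L Y.C"
proof (rule R.propcatI[OF _ _ has_equality_Y])
  fix q \<Gamma> x assume q: "q \<in> quants L" "\<Gamma> \<in> ob Y.C" "x \<in> pred Y.C \<Gamma>"
  then obtain \<phi> where x: "x = Y.fc \<Gamma> \<phi>" "wt_fml L Sg \<Gamma> \<phi>" by (auto elim: Y.pred_cases)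
  have "pr1 Y.C \<Gamma> (one Y.C) = idn Y.C \<Gamma>" by (simp add: Y.pr1_C Y.idn_C)
  moreover have "sub Y.C (idn Y.C \<Gamma>) x = x" using R.presheaf q unfolding is_presheaf_def by blast
  ultimately show "quant Y.C q \<Gamma> (one Y.C) (sub Y.C (pr1 Y.C \<Gamma> (one Y.C)) x) = x"
    using Y.quant_fc[of \<Gamma> "[]" q \<phi>] q x by simp
next
  fix q \<Gamma> \<Delta> \<Theta> x assume q: "q \<in> quants L" "\<Gamma> \<in> ob Y.C" "\<Delta> \<in> ob Y.C" "\<Theta> \<in> ob Y.C"
    "x \<in> pred Y.C (prd Y.C (prd Y.C \<Gamma> \<Delta>) \<Theta>)"
  then have c: "is_ctx Sg \<Gamma>" "is_ctx Sg \<Delta>" "is_ctx Sg \<Theta>" by simp_all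
  obtain \<phi> where x: "x = Y.fc (\<Theta> @ \<Delta> @ \<Gamma>) \<phi>" "wt_fml L Sg (\<Theta> @ \<Delta> @ \<Gamma>) \<phi>" using q(5) by (auto elim: Y.pred_cases)
  have "sub Y.C (idn Y.C (\<Theta> @ \<Delta> @ \<Gamma>)) x = x"
    using R.presheaf q(5) c unfolding is_presheaf_def by simp
  then show "quant Y.C q \<Gamma> (prd Y.C \<Delta> \<Theta>) (sub Y.C (assoc Y.C \<Gamma> \<Delta> \<Theta>) x) =
      quant Y.C q \<Gamma> \<Delta> (quant Y.C q (prd Y.C \<Gamma> \<Delta>) \<Theta> x)"
    using x c q(1) Y.quant_fc[of \<Gamma> "\<Theta> @ \<Delta>" q \<phi>] Y.quant_fc[of "\<Delta> @ \<Gamma>" \<Theta> q \<phi>]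
      Y.quant_fc[of \<Gamma> \<Delta> q "quants_fml q \<Theta> \<phi>"] Y.wt_quants[of \<Theta> q "\<Delta> @ \<Gamma>" \<phi>]
    by (simp add: assoc_Y quants_fml_append)
qed

end

section \<open>Strict isomorphisms and copies\<close>

text \<open>Everything is preserved on the nose, without \<open>cmp\<close> or
  \<open>inv_arr\<close>. In this form the notion can be inverted, and it makes sense before either
  side is known to be a prop-category.\<close>

definition strict_iso ::
  "('k, 'q) lang \<Rightarrow> ('o, 'a, 'p, 'k, 'q) propcat \<Rightarrow> ('o', 'a', 'p', 'k, 'q) propcat \<Rightarrow>
   ('o, 'a, 'p, 'o', 'a', 'p') pmor \<Rightarrow> bool" where
  "strict_iso L C D F \<longleftrightarrow>
     bij_betw (mo F) (ob C) (ob D) \<and> bij_betw (ma F) (arr C) (arr D) \<and>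
     (\<forall>c\<in>ob C. bij_betw (mp F c) (pred C c) (pred D (mo F c))) \<and>
     (\<forall>f\<in>arr C. dm D (ma F f) = mo F (dm C f) \<and> cd D (ma F f) = mo F (cd C f)) \<and>
     (\<forall>c\<in>ob C. ma F (idn C c) = idn D (mo F c)) \<and>
     (\<forall>f\<in>arr C. \<forall>g\<in>arr C. cd C f = dm C g \<longrightarrow> ma F (comp C g f) = comp D (ma F g) (ma F f)) \<and>
     mo F (one C) = one D \<and>
     (\<forall>b\<in>ob C. \<forall>c\<in>ob C. mo F (prd C b c) = prd D (mo F b) (mo F c) \<and>
        ma F (pr1 C b c) = pr1 D (mo F b) (mo F c) \<and> ma F (pr2 C b c) = pr2 D (mo F b) (mo F c)) \<and>
     (\<forall>c\<in>ob C. \<forall>x\<in>pred C c. \<forall>y\<in>pred C c. le C c x y \<longleftrightarrow> le D (mo F c) (mp F c x) (mp F c y)) \<and>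
     (\<forall>f\<in>arr C. \<forall>x\<in>pred C (cd C f). mp F (dm C f) (sub C f x) = sub D (ma F f) (mp F (cd C f) x)) \<and>
     (\<forall>c\<in>ob C. \<forall>k\<in>conns L. \<forall>xs\<in>lists (pred C c). length xs = arity L k \<longrightarrow>
        mp F c (conn C c k xs) = conn D (mo F c) k (map (mp F c) xs)) \<and>
     (\<forall>q\<in>quants L. \<forall>b\<in>ob C. \<forall>c\<in>ob C. \<forall>x\<in>pred C (prd C b c).
        mp F b (quant C q b c x) = quant D q (mo F b) (mo F c) (mp F (prd C b c) x)) \<and>
     (\<forall>c\<in>ob C. mp F (prd C c c) (eqp C c) = eqp D (mo F c))"

locale strict_typed =
  fixes L :: "('k, 'q) lang" and C :: "('o, 'a, 'p, 'k, 'q) propcat"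
    and D :: "('o', 'a', 'p', 'k, 'q) propcat" and F :: "('o, 'a, 'p, 'o', 'a', 'p') pmor"
  assumes typed: "typed L C" and strict: "strict_iso L C D F"
begin

lemma C_typ [simp]:
  "f \<in> arr C \<Longrightarrow> dm C f \<in> ob C" "f \<in> arr C \<Longrightarrow> cd C f \<in> ob C"
  "c \<in> ob C \<Longrightarrow> idn C c \<in> arr C" "c \<in> ob C \<Longrightarrow> dm C (idn C c) = c" "c \<in> ob C \<Longrightarrow> cd C (idn C c) = c"
  "one C \<in> ob C" "b \<in> ob C \<Longrightarrow> c \<in> ob C \<Longrightarrow> prd C b c \<in> ob C"
  "b \<in> ob C \<Longrightarrow> c \<in> ob C \<Longrightarrow> pr1 C b c \<in> arr C"
  "b \<in> ob C \<Longrightarrow> c \<in> ob C \<Longrightarrow> dm C (pr1 C b c) = prd C b c"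
  "b \<in> ob C \<Longrightarrow> c \<in> ob C \<Longrightarrow> cd C (pr1 C b c) = b"
  "b \<in> ob C \<Longrightarrow> c \<in> ob C \<Longrightarrow> pr2 C b c \<in> arr C"
  "b \<in> ob C \<Longrightarrow> c \<in> ob C \<Longrightarrow> dm C (pr2 C b c) = prd C b c"
  "b \<in> ob C \<Longrightarrow> c \<in> ob C \<Longrightarrow> cd C (pr2 C b c) = c"
  "f \<in> arr C \<Longrightarrow> x \<in> pred C (cd C f) \<Longrightarrow> sub C f x \<in> pred C (dm C f)"
  "q \<in> quants L \<Longrightarrow> b \<in> ob C \<Longrightarrow> c \<in> ob C \<Longrightarrow> x \<in> pred C (prd C b c) \<Longrightarrow> quant C q b c x \<in> pred C b"
  "c \<in> ob C \<Longrightarrow> eqp C c \<in> pred C (prd C c c)"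
  using typed unfolding typed_def hom_def by blast+

lemma C_comp [simp]:
  assumes "f \<in> arr C" "g \<in> arr C" "cd C f = dm C g"
  shows "comp C g f \<in> arr C" "dm C (comp C g f) = dm C f" "cd C (comp C g f) = cd C g"
  using typed assms unfolding typed_def hom_def by blast+

lemma C_conn:
  "c \<in> ob C \<Longrightarrow> k \<in> conns L \<Longrightarrow> xs \<in> lists (pred C c) \<Longrightarrow> length xs = arity L k \<Longrightarrow> conn C c k xs \<in> pred C c"
  using typed unfolding typed_def by blast

lemma mo_bij: "bij_betw (mo F) (ob C) (ob D)"
  and ma_bij: "bij_betw (ma F) (arr C) (arr D)"
  and mp_bij: "c \<in> ob C \<Longrightarrow> bij_betw (mp F c) (pred C c) (pred D (mo F c))"
  using strict unfolding strict_iso_def by blast+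

lemma F_in [simp]:
  shows "c \<in> ob C \<Longrightarrow> mo F c \<in> ob D" "f \<in> arr C \<Longrightarrow> ma F f \<in> arr D"
    "c \<in> ob C \<Longrightarrow> x \<in> pred C c \<Longrightarrow> mp F c x \<in> pred D (mo F c)"
  using mo_bij ma_bij mp_bij[of c] by (auto dest: bij_betwE)

lemma F_inj:
  shows "b \<in> ob C \<Longrightarrow> c \<in> ob C \<Longrightarrow> mo F b = mo F c \<longleftrightarrow> b = c"
    "f \<in> arr C \<Longrightarrow> g \<in> arr C \<Longrightarrow> ma F f = ma F g \<longleftrightarrow> f = g"
    "c \<in> ob C \<Longrightarrow> x \<in> pred C c \<Longrightarrow> y \<in> pred C c \<Longrightarrow> mp F c x = mp F c y \<longleftrightarrow> x = y"
  using mo_bij ma_bij mp_bij[of c] by (auto simp: bij_betw_def inj_on_eq_iff)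

text \<open>Oriented to move operations of \<open>D\<close> back into \<open>C\<close>, so that
  goals about images become goals about preimages.\<close>

lemma F_strict [simp]:
  "f \<in> arr C \<Longrightarrow> dm D (ma F f) = mo F (dm C f)" "f \<in> arr C \<Longrightarrow> cd D (ma F f) = mo F (cd C f)"
  "c \<in> ob C \<Longrightarrow> idn D (mo F c) = ma F (idn C c)"
  "f \<in> arr C \<Longrightarrow> g \<in> arr C \<Longrightarrow> cd C f = dm C g \<Longrightarrow> comp D (ma F g) (ma F f) = ma F (comp C g f)"
  "one D = mo F (one C)"
  "b \<in> ob C \<Longrightarrow> c \<in> ob C \<Longrightarrow> prd D (mo F b) (mo F c) = mo F (prd C b c)"
  "b \<in> ob C \<Longrightarrow> c \<in> ob C \<Longrightarrow> pr1 D (mo F b) (mo F c) = ma F (pr1 C b c)"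
  "b \<in> ob C \<Longrightarrow> c \<in> ob C \<Longrightarrow> pr2 D (mo F b) (mo F c) = ma F (pr2 C b c)"
  "c \<in> ob C \<Longrightarrow> x \<in> pred C c \<Longrightarrow> y \<in> pred C c \<Longrightarrow> le D (mo F c) (mp F c x) (mp F c y) \<longleftrightarrow> le C c x y"
  "f \<in> arr C \<Longrightarrow> x \<in> pred C (cd C f) \<Longrightarrow> sub D (ma F f) (mp F (cd C f) x) = mp F (dm C f) (sub C f x)"
  "q \<in> quants L \<Longrightarrow> b \<in> ob C \<Longrightarrow> c \<in> ob C \<Longrightarrow> x \<in> pred C (prd C b c) \<Longrightarrow>
      quant D q (mo F b) (mo F c) (mp F (prd C b c) x) = mp F b (quant C q b c x)"
  "c \<in> ob C \<Longrightarrow> eqp D (mo F c) = mp F (prd C c c) (eqp C c)"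
  using strict unfolding strict_iso_def by simp_all

lemma F_conn:
  "c \<in> ob C \<Longrightarrow> k \<in> conns L \<Longrightarrow> xs \<in> lists (pred C c) \<Longrightarrow> length xs = arity L k \<Longrightarrow>
     conn D (mo F c) k (map (mp F c) xs) = mp F c (conn C c k xs)"
  using strict unfolding strict_iso_def by simp

lemma ob_cases: assumes "d \<in> ob D" obtains c where "c \<in> ob C" "d = mo F c"
  using assms mo_bij by (auto simp: bij_betw_def)

lemma arr_cases: assumes "g \<in> arr D" obtains f where "f \<in> arr C" "g = ma F f"
  using assms ma_bij by (auto simp: bij_betw_def)

lemma pred_cases: assumes "c \<in> ob C" "y \<in> pred D (mo F c)" obtains x where "x \<in> pred C c" "y = mp F c x"
  using assms mp_bij[of c] by (auto simp: bij_betw_def)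

lemma lists_cases:
  assumes "c \<in> ob C" "ys \<in> lists (pred D (mo F c))"
  obtains xs where "xs \<in> lists (pred C c)" "ys = map (mp F c) xs"
  using assms mp_bij[OF assms(1)] lists_image[of "mp F c" "pred C c"] by (auto simp: bij_betw_def)

lemma arr_D [simp]: "g \<in> arr D \<Longrightarrow> dm D g \<in> ob D" "g \<in> arr D \<Longrightarrow> cd D g \<in> ob D"
  by (auto elim!: arr_cases)

lemma typed_D: "typed L D"
  unfolding typed_def
proof (intro conjI ballI impI)
  fix f g assume "f \<in> arr D" "g \<in> arr D" "cd D f = dm D g"
  then show "comp D g f \<in> hom D (dm D f) (cd D g)"
    by (auto elim!: arr_cases simp: hom_def F_inj)
next
  fix f x assume f: "f \<in> arr D" and x: "x \<in> pred D (cd D f)"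
  obtain f' where f': "f' \<in> arr C" "f = ma F f'" using f by (rule arr_cases)
  then obtain x' where "x' \<in> pred C (cd C f')" "x = mp F (cd C f') x'"
    using x by (auto elim: pred_cases[rotated])
  then show "sub D f x \<in> pred D (dm D f)" using f' by simp
next
  fix c k xs assume c: "c \<in> ob D" and k: "k \<in> conns L" and xs: "xs \<in> lists (pred D c)" and l: "length xs = arity L k"
  obtain c' where c': "c' \<in> ob C" "c = mo F c'" using c by (rule ob_cases)
  obtain xs' where "xs' \<in> lists (pred C c')" "xs = map (mp F c') xs'"
    using lists_cases[OF c'(1) xs[unfolded c'(2)]] .
  then show "conn D c k xs \<in> pred D c" using c' l k C_conn by (simp add: F_conn)
next
  fix q b c x assume q: "q \<in> quants L" and bc: "b \<in> ob D" "c \<in> ob D" and x: "x \<in> pred D (prd D b c)"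
  obtain b' c' where b': "b' \<in> ob C" "b = mo F b'" "c' \<in> ob C" "c = mo F c'" using bc by (auto elim!: ob_cases)
  then obtain x' where "x' \<in> pred C (prd C b' c')" "x = mp F (prd C b' c') x'"
    using x by (auto elim: pred_cases[rotated])
  then show "quant D q b c x \<in> pred D b" using b' q by simp
qed (auto elim!: ob_cases simp: hom_def)

definition Finv :: "('o', 'a', 'p', 'o, 'a, 'p) pmor" where
  "Finv = \<lparr>mo = inv_into (ob C) (mo F), ma = inv_into (arr C) (ma F),
     mp = \<lambda>d. inv_into (pred C (inv_into (ob C) (mo F) d)) (mp F (inv_into (ob C) (mo F) d))\<rparr>"

lemma Finv [simp]:
  "c \<in> ob C \<Longrightarrow> mo Finv (mo F c) = c" "f \<in> arr C \<Longrightarrow> ma Finv (ma F f) = f"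
  "c \<in> ob C \<Longrightarrow> x \<in> pred C c \<Longrightarrow> mp Finv (mo F c) (mp F c x) = x"
  using mo_bij ma_bij mp_bij[of c] by (simp_all add: Finv_def bij_betw_def)

lemma Finv_bij:
  "bij_betw (mo Finv) (ob D) (ob C)" "bij_betw (ma Finv) (arr D) (arr C)"
  "c \<in> ob C \<Longrightarrow> bij_betw (mp Finv (mo F c)) (pred D (mo F c)) (pred C c)"
  using mo_bij ma_bij mp_bij[of c] Finv(1)[of c] by (simp_all add: Finv_def bij_betw_inv_into)

lemma strict_iso_inv: "strict_iso L D C Finv"
  unfolding strict_iso_def
proof (intro conjI ballI impI)
  show "bij_betw (mo Finv) (ob D) (ob C)" "bij_betw (ma Finv) (arr D) (arr C)" using Finv_bij by auto
  show "bij_betw (mp Finv d) (pred D d) (pred C (mo Finv d))" if "d \<in> ob D" for d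
    using that Finv_bij(3) by (auto elim!: ob_cases)
next
  fix f g assume "f \<in> arr D" "g \<in> arr D" "cd D f = dm D g"
  then show "ma Finv (comp D g f) = comp C (ma Finv g) (ma Finv f)"
    by (auto elim!: arr_cases simp: F_inj)
next
  fix d x y assume d: "d \<in> ob D" and x: "x \<in> pred D d" and y: "y \<in> pred D d"
  obtain c where c: "c \<in> ob C" "d = mo F c" using d by (rule ob_cases)
  obtain x' y' where "x' \<in> pred C c" "x = mp F c x'" "y' \<in> pred C c" "y = mp F c y'"
    using x y c by (auto elim!: pred_cases[rotated])
  then show "le D d x y \<longleftrightarrow> le C (mo Finv d) (mp Finv d x) (mp Finv d y)" using c by simp
next
  fix f x assume f: "f \<in> arr D" and x: "x \<in> pred D (cd D f)"
  obtain f' where f': "f' \<in> arr C" "f = ma F f'" using f by (rule arr_cases)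
  then obtain x' where "x' \<in> pred C (cd C f')" "x = mp F (cd C f') x'"
    using x by (auto elim: pred_cases[rotated])
  then show "mp Finv (dm D f) (sub D f x) = sub C (ma Finv f) (mp Finv (cd D f) x)" using f' by simp
next
  fix c k xs assume c: "c \<in> ob D" and k: "k \<in> conns L" and xs: "xs \<in> lists (pred D c)" and l: "length xs = arity L k"
  obtain c' where c': "c' \<in> ob C" "c = mo F c'" using c by (rule ob_cases)
  obtain xs' where xs': "xs' \<in> lists (pred C c')" "xs = map (mp F c') xs'"
    using lists_cases[OF c'(1) xs[unfolded c'(2)]] .
  then have "map (mp Finv c) xs = xs'" using c' by (auto simp: lists_eq_set subset_iff map_idI)
  then show "mp Finv c (conn D c k xs) = conn C (mo Finv c) k (map (mp Finv c) xs)"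
    using c' l k xs' C_conn by (simp add: F_conn)
next
  fix q b c x assume q: "q \<in> quants L" and bc: "b \<in> ob D" "c \<in> ob D" and x: "x \<in> pred D (prd D b c)"
  obtain b' c' where b': "b' \<in> ob C" "b = mo F b'" "c' \<in> ob C" "c = mo F c'" using bc by (auto elim!: ob_cases)
  then obtain x' where "x' \<in> pred C (prd C b' c')" "x = mp F (prd C b' c') x'"
    using x by (auto elim: pred_cases[rotated])
  then show "mp Finv b (quant D q b c x) = quant C q (mo Finv b) (mo Finv c) (mp Finv (prd D b c) x)"
    using b' q by simp
qed (auto elim!: ob_cases arr_cases)

end

text \<open>Transports the axioms from target to source. Both later uses instantiate
  \<open>F\<close> with the inverse \<open>Finv\<close> of a strict isomorphism that starts at the
  known prop-category.\<close>

locale strict_propcat = strict_typed L C D F + D: prop_category L D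
  for L :: "('k, 'q) lang" and C :: "('o, 'a, 'p, 'k, 'q) propcat"
    and D :: "('o', 'a', 'p', 'k, 'q) propcat" and F :: "('o, 'a, 'p, 'o', 'a', 'p') pmor"
begin

lemma cmp_strict:
  assumes "b \<in> ob C" "c \<in> ob C"
  shows "cmp C D F b c = idn D (mo F (prd C b c))"
  using D.pair_pr1_pr2[of "mo F b" "mo F c"] assms by (simp add: cmp_def)

lemma is_functor: "is_functor C D F"
  unfolding is_functor_def
proof (intro conjI ballI impI)
  have "bang D (mo F (one C)) = idn D (mo F (one C))"
    using D.bang_typ[of "mo F (one C)"] D.idn_typ[of "mo F (one C)"] by (intro D.one_ext) simp_all
  then show "is_iso D (bang D (mo F (one C)))" using D.is_iso_idn[of "mo F (one C)"] by simp
  show "is_iso D (cmp C D F b c)" if "b \<in> ob C" "c \<in> ob C" for b c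
    unfolding cmp_strict[OF that] using that by (intro D.is_iso_idn) simp
qed (auto simp: hom_def)

lemma inclusion: "is_inclusion L C D F"
  unfolding is_inclusion_def is_morphism_def
proof (intro conjI ballI impI is_functor)
  fix b c assume bc: "b \<in> ob C" "c \<in> ob C"
  show "inj_on (ma F) (hom C b c)" by (rule inj_onI) (auto simp: hom_def F_inj)
next
  fix q b c x assume a: "q \<in> quants L" "b \<in> ob C" "c \<in> ob C" "x \<in> pred C (prd C b c)"
  then show "mp F b (quant C q b c x) =
      quant D q (mo F b) (mo F c) (sub D (inv_arr D (cmp C D F b c)) (mp F (prd C b c) x))"
    unfolding cmp_strict[OF a(2,3)]
    using D.inv_arr_idn[of "mo F (prd C b c)"] D.sub_idn[of "mp F (prd C b c) x" "mo F (prd C b c)"] by simp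
next
  fix c assume c: "c \<in> ob C"
  then show "mp F (prd C c c) (eqp C c) = sub D (cmp C D F c c) (eqp D (mo F c))"
    unfolding cmp_strict[OF c c]
    using D.sub_idn[of "mp F (prd C c c) (eqp C c)" "mo F (prd C c c)"] by simp
next
  fix c k xs assume "c \<in> ob C" "k \<in> conns L" "xs \<in> lists (pred C c)" "length xs = arity L k"
  then show "mp F c (conn C c k xs) = conn D (mo F c) k (map (mp F c) xs)" by (simp add: F_conn)
qed simp_all

lemma is_category: "is_category C"
  using reflect_category[OF typed D.cat is_functor] inclusion unfolding is_inclusion_def by blast

lemma hom_F: "f \<in> arr C \<Longrightarrow> b \<in> ob C \<Longrightarrow> c \<in> ob C \<Longrightarrow> ma F f \<in> hom D (mo F b) (mo F c) \<longleftrightarrow> f \<in> hom C b c"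
  by (simp add: hom_def F_inj)

text \<open>Universal arrows are formed in \<open>D\<close> and pulled back through the bijections;
  uniqueness is inherited by injectivity.\<close>

lemma has_products: "has_products C"
proof -
  have T1: "\<exists>!f. f \<in> hom C c (one C)" if c: "c \<in> ob C" for c
  proof -
    have "bang D (mo F c) \<in> arr D" using c by simp
    then obtain f where f: "f \<in> arr C" "bang D (mo F c) = ma F f" by (rule arr_cases)
    then have fh: "f \<in> hom C c (one C)" using D.bang_hom[of "mo F c"] c hom_F[OF f(1)] by simp
    have "g = f" if "g \<in> hom C c (one C)" for g
      using D.one_ext[of "ma F g" "ma F f"] that fh by (auto simp: hom_def F_inj)
    then show ?thesis using fh by blast
  qed
  have T2: "\<exists>!h. h \<in> hom C a (prd C b c) \<and> comp C (pr1 C b c) h = f \<and> comp C (pr2 C b c) h = g"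
    if fg: "a \<in> ob C" "b \<in> ob C" "c \<in> ob C" "f \<in> hom C a b" "g \<in> hom C a c" for a b c f g
  proof -
    have fg': "f \<in> arr C" "g \<in> arr C" "dm C f = a" "dm C g = a" "cd C f = b" "cd C g = c"
      using fg by (auto simp: hom_def)
    let ?p = "pair D (ma F f) (ma F g)"
    have p: "?p \<in> arr D" "dm D ?p = mo F a" "cd D ?p = mo F (prd C b c)"
      "comp D (ma F (pr1 C b c)) ?p = ma F f" "comp D (ma F (pr2 C b c)) ?p = ma F g"
      using D.pair_typ[of "ma F f" "ma F g"] D.pr1_pair[of "ma F f" "ma F g" "mo F b" "mo F c"]
        D.pr2_pair[of "ma F f" "ma F g" "mo F b" "mo F c"] fg fg' by simp_all
    obtain h where h: "h \<in> arr C" "?p = ma F h" using p(1) by (rule arr_cases)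
    have hh: "dm C h = a" "cd C h = prd C b c" using p(2,3) h fg by (simp_all add: F_inj)
    have "comp C (pr1 C b c) h = f" "comp C (pr2 C b c) h = g"
      using p(4,5) h hh fg fg' by (simp_all add: F_inj)
    moreover have "k = h" if k: "k \<in> hom C a (prd C b c)" "comp C (pr1 C b c) k = f" "comp C (pr2 C b c) k = g" for k
    proof -
      have k': "k \<in> arr C" "dm C k = a" "cd C k = prd C b c" using k by (auto simp: hom_def)
      have "ma F k = ma F h"
      proof (rule D.prd_ext[of _ _ "mo F b" "mo F c"])
        show "comp D (pr1 D (mo F b) (mo F c)) (ma F k) = comp D (pr1 D (mo F b) (mo F c)) (ma F h)"
          "comp D (pr2 D (mo F b) (mo F c)) (ma F k) = comp D (pr2 D (mo F b) (mo F c)) (ma F h)"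
          using k k' h hh fg p(4,5) by simp_all
      qed (use k' h hh fg in simp_all)
      then show ?thesis using k' h by (simp add: F_inj)
    qed
    moreover have "h \<in> hom C a (prd C b c)" using h hh by (simp add: hom_def)
    ultimately show ?thesis by blast
  qed
  show ?thesis unfolding has_products_def
  proof (intro conjI ballI)
    fix b c assume "b \<in> ob C" "c \<in> ob C"
    then show "prd C b c \<in> ob C" "pr1 C b c \<in> hom C (prd C b c) b" "pr2 C b c \<in> hom C (prd C b c) c"
      by (simp_all add: hom_def)
  qed (use T1 T2 in simp_all)
qed

sublocale R: reflection L C D F
proof unfold_locales
  show "is_morphism L C D F" using inclusion by (simp add: is_inclusion_def)
qed (use is_category has_products inclusion typed in \<open>auto simp: F_inj\<close>)

text \<open>These two are converses of rules in \<open>F_strict\<close>; together they would make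
  the simplifier loop.\<close>

declare R.ma_comp [simp del] R.ma_idn [simp del]

lemma ma_pair:
  assumes "f \<in> arr C" "g \<in> arr C" "dm C f = dm C g"
  shows "ma F (pair C f g) = pair D (ma F f) (ma F g)"
  using R.cmp_pair[OF assms refl refl] cmp_strict[of "cd C f" "cd C g"] assms
    D.comp_idn_left[of "ma F (pair C f g)" "mo F (prd C (cd C f) (cd C g))"] by simp

text \<open>The comparisons are identities here, so the axioms that an inclusion need not reflect
  carry over as well.\<close>

lemma propcat: "is_propcat L C"
proof (rule R.propcatI)
  fix q b x assume a: "q \<in> quants L" "b \<in> ob C" "x \<in> pred C b"
  have s: "sub C (pr1 C b (one C)) x \<in> pred C (prd C b (one C))"
    using C_typ(14)[of "pr1 C b (one C)" x] a by simp
  have "mp F b (quant C q b (one C) (sub C (pr1 C b (one C)) x)) =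
      quant D q (mo F b) (mo F (one C)) (mp F (prd C b (one C)) (sub C (pr1 C b (one C)) x))"
    using a s by simp
  also have "mp F (prd C b (one C)) (sub C (pr1 C b (one C)) x) = sub D (pr1 D (mo F b) (mo F (one C))) (mp F b x)"
    using F_strict(10)[of "pr1 C b (one C)" x] a by simp
  also have "quant D q (mo F b) (mo F (one C)) \<dots> = mp F b x"
    using D.quant_one[of q "mo F b" "mp F b x"] a by simp
  finally show "quant C q b (one C) (sub C (pr1 C b (one C)) x) = x"
    using a s by (simp add: F_inj)
next
  fix q b c d x
  assume a: "q \<in> quants L" "b \<in> ob C" "c \<in> ob C" "d \<in> ob C" "x \<in> pred C (prd C (prd C b c) d)"
  have as: "ma F (assoc C b c d) = assoc D (mo F b) (mo F c) (mo F d)"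
    unfolding assoc_def using a by (simp add: ma_pair)
  have s: "sub C (assoc C b c d) x \<in> pred C (prd C b (prd C c d))"
    using C_typ(14)[of "assoc C b c d" x] a by simp
  have q: "quant C q (prd C b c) d x \<in> pred C (prd C b c)" using a by simp
  have "mp F b (quant C q b (prd C c d) (sub C (assoc C b c d) x)) =
      quant D q (mo F b) (mo F (prd C c d)) (mp F (prd C b (prd C c d)) (sub C (assoc C b c d) x))"
    using a s by simp
  also have "mp F (prd C b (prd C c d)) (sub C (assoc C b c d) x) =
      sub D (assoc D (mo F b) (mo F c) (mo F d)) (mp F (prd C (prd C b c) d) x)"
    using F_strict(10)[of "assoc C b c d" x] a as by simp
  also have "quant D q (mo F b) (mo F (prd C c d)) \<dots> =
     quant D q (mo F b) (mo F c) (quant D q (mo F (prd C b c)) (mo F d) (mp F (prd C (prd C b c) d) x))"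
    using D.quant_prd[of q "mo F b" "mo F c" "mo F d" "mp F (prd C (prd C b c) d) x"] a by simp
  also have "\<dots> = mp F b (quant C q b c (quant C q (prd C b c) d x))"
    using a q by simp
  finally show "quant C q b (prd C c d) (sub C (assoc C b c d) x) = quant C q b c (quant C q (prd C b c) d x)"
    using a s q by (simp add: F_inj)
next
  show "has_equality L C"
    unfolding has_equality_def Let_def
  proof (intro conjI ballI)
    show "eqp C (one C) = unit_p L C (prd C (one C) (one C))"
    proof (rule R.mp_inj)
      show "mp F (prd C (one C) (one C)) (eqp C (one C)) = mp F (prd C (one C) (one C)) (unit_p L C (prd C (one C) (one C)))"
        using D.eqp_one R.mp_unit[of "prd C (one C) (one C)"] by simp
    qed simp_all
  next
    fix c d assume cd: "c \<in> ob C" "d \<in> ob C"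
    let ?e = "prd C c d"
    let ?p = "pr1 C ?e ?e" and ?p' = "pr2 C ?e ?e"
    let ?l = "sub C (pair C (comp C (pr1 C c d) ?p) (comp C (pr1 C c d) ?p')) (eqp C c)" and
      ?r = "sub C (pair C (comp C (pr2 C c d) ?p) (comp C (pr2 C c d) ?p')) (eqp C d)"
    have lr: "?l \<in> pred C (prd C ?e ?e)" "?r \<in> pred C (prd C ?e ?e)"
      using cd by (auto intro!: R.sub_C)
    let ?E = "mo F ?e"
    have "mp F (prd C ?e ?e) (tensor_p L C (prd C ?e ?e) ?l ?r) =
      tensor_p L D (mo F (prd C ?e ?e)) (mp F (prd C ?e ?e) ?l) (mp F (prd C ?e ?e) ?r)"
      using lr cd by simp
    also have "mp F (prd C ?e ?e) ?l = sub D (pair D (comp D (pr1 D (mo F c) (mo F d)) (pr1 D ?E ?E))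
        (comp D (pr1 D (mo F c) (mo F d)) (pr2 D ?E ?E))) (eqp D (mo F c))"
      using cd by (subst R.mp_sub_eqp) simp_all
    also have "mp F (prd C ?e ?e) ?r = sub D (pair D (comp D (pr2 D (mo F c) (mo F d)) (pr1 D ?E ?E))
        (comp D (pr2 D (mo F c) (mo F d)) (pr2 D ?E ?E))) (eqp D (mo F d))"
      using cd by (subst R.mp_sub_eqp) simp_all
    finally have "mp F (prd C ?e ?e) (tensor_p L C (prd C ?e ?e) ?l ?r) = eqp D ?E"
      using D.eqp_prd[of "mo F c" "mo F d"] cd by (simp add: Let_def)
    then show "eqp C ?e = tensor_p L C (prd C ?e ?e) ?l ?r"
      using cd lr by (intro R.mp_inj[of "prd C ?e ?e"]) simp_all
  qed simp
qed

lemma copy: "is_copy L C D"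
  unfolding is_copy_def
  using inclusion mo_bij ma_bij mp_bij by (intro exI[of _ F]) simp

end

section \<open>Copies: inversion, composition with inclusions, existence\<close>

lemma typed_propcat: "is_propcat L C \<Longrightarrow> typed L C"
  unfolding typed_def is_propcat_def is_category_def has_products_def is_presheaf_def has_connectives_def
    has_quantifiers_def has_equality_def by simp

text \<open>Preservation of the designated products should force the comparisons and their inverses
  to be identities. As \<open>C\<close> is only known to be typed, the descriptions in
  \<open>pair\<close> and \<open>inv_arr\<close> are evaluated by hand, with existence and
  uniqueness imported from \<open>E\<close> through the bijection on arrows.\<close>

lemma copy_strict_iso:
  assumes E: "is_propcat L E" and C: "typed L C" and cp: "is_copy L E C"
  obtains F where "strict_iso L E C F"
proof -
  obtain F where F: "is_inclusion L E C F" "bij_betw (mo F) (ob E) (ob C)" "bij_betw (ma F) (arr E) (arr C)"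
    "\<And>c. c \<in> ob E \<Longrightarrow> bij_betw (mp F c) (pred E c) (pred C (mo F c))"
    "mo F (one E) = one C"
    "\<And>b c. b \<in> ob E \<Longrightarrow> c \<in> ob E \<Longrightarrow> mo F (prd E b c) = prd C (mo F b) (mo F c) \<and>
        ma F (pr1 E b c) = pr1 C (mo F b) (mo F c) \<and> ma F (pr2 E b c) = pr2 C (mo F b) (mo F c)"
    using cp unfolding is_copy_def by blast
  interpret E: fpcategory E using E by unfold_locales (simp_all add: is_propcat_def)
  have M: "is_morphism L E C F" and Fu: "is_functor E C F"
    using F(1) by (simp_all add: is_inclusion_def is_morphism_def)
  have mo: "\<And>c. c \<in> ob E \<Longrightarrow> mo F c \<in> ob C" "\<And>b c. b \<in> ob E \<Longrightarrow> c \<in> ob E \<Longrightarrow> mo F b = mo F c \<longleftrightarrow> b = c"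
    using F(2) by (auto simp: bij_betw_def inj_on_eq_iff)
  have idn: "\<And>c. c \<in> ob E \<Longrightarrow> ma F (idn E c) = idn C (mo F c)"
    and comp: "\<And>f g. f \<in> arr E \<Longrightarrow> g \<in> arr E \<Longrightarrow> cd E f = dm E g \<Longrightarrow> ma F (comp E g f) = comp C (ma F g) (ma F f)"
    using Fu unfolding is_functor_def by blast+
  have ty: "ma F f \<in> arr C \<and> dm C (ma F f) = mo F (dm E f) \<and> cd C (ma F f) = mo F (cd E f)" if "f \<in> arr E" for f
    using Fu that unfolding is_functor_def hom_def by blast
  have inj: "\<And>f g. f \<in> arr E \<Longrightarrow> g \<in> arr E \<Longrightarrow> ma F f = ma F g \<longleftrightarrow> f = g"
    using F(3) by (auto simp: bij_betw_def inj_on_eq_iff)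
  have hom: "\<exists>h'. h' \<in> hom E a b \<and> h = ma F h'" if h: "h \<in> hom C (mo F a) (mo F b)" "a \<in> ob E" "b \<in> ob E" for h a b
  proof -
    obtain h' where h': "h' \<in> arr E" "h = ma F h'" using h(1) F(3) by (auto simp: bij_betw_def hom_def)
    then have "h' \<in> hom E a b" using ty[OF h'(1)] h mo by (simp add: hom_def)
    then show ?thesis using h' by blast
  qed
  have cmp: "cmp E C F b c = idn C (mo F (prd E b c))" if bc: "b \<in> ob E" "c \<in> ob E" for b c
  proof -
    let ?p = "pr1 C (mo F b) (mo F c)" and ?q = "pr2 C (mo F b) (mo F c)" and ?e = "mo F (prd E b c)"
    have pq: "?p = ma F (pr1 E b c)" "?q = ma F (pr2 E b c)" using F(6) bc by auto
    have "(THE h. h \<in> hom C ?e ?e \<and> comp C ?p h = ?p \<and> comp C ?q h = ?q) = idn C ?e"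
    proof (rule the_equality)
      have "ma F (idn E (prd E b c)) \<in> hom C ?e ?e" using ty[of "idn E (prd E b c)"] bc by (simp add: hom_def)
      moreover have "comp C ?p (ma F (idn E (prd E b c))) = ?p" "comp C ?q (ma F (idn E (prd E b c))) = ?q"
        unfolding pq using comp[of "idn E (prd E b c)" "pr1 E b c"] comp[of "idn E (prd E b c)" "pr2 E b c"] bc by simp_all
      ultimately show "idn C ?e \<in> hom C ?e ?e \<and> comp C ?p (idn C ?e) = ?p \<and> comp C ?q (idn C ?e) = ?q"
        using idn[of "prd E b c"] bc by simp
      fix h assume h: "h \<in> hom C ?e ?e \<and> comp C ?p h = ?p \<and> comp C ?q h = ?q"
      then obtain h' where h': "h' \<in> hom E (prd E b c) (prd E b c)" "h = ma F h'" using hom bc by fastforce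
      then have a: "h' \<in> arr E" "dm E h' = prd E b c" "cd E h' = prd E b c" by (auto simp: hom_def)
      have "comp E (pr1 E b c) h' = pr1 E b c" "comp E (pr2 E b c) h' = pr2 E b c"
        using h a bc unfolding pq h'(2) by (simp_all add: inj flip: comp)
      then have "h' = idn E (prd E b c)" using a bc by (rule_tac E.prd_ext[of _ _ b c]) simp_all
      then show "h = idn C ?e" using h' idn bc by simp
    qed
    moreover have t: "dm C ?p = ?e" "cd C ?p = mo F b" "cd C ?q = mo F c" "prd C (mo F b) (mo F c) = ?e"
      using ty[of "pr1 E b c"] ty[of "pr2 E b c"] bc F(6) unfolding pq by simp_all
    ultimately show ?thesis by (simp only: cmp_def pair_def t pq[symmetric])
  qed
  have inv: "inv_arr C (idn C (mo F c)) = idn C (mo F c)" if c: "c \<in> ob E" for c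
    unfolding inv_arr_def
  proof (rule the_equality)
    have i: "idn C (mo F c) \<in> arr C" "dm C (idn C (mo F c)) = mo F c" "cd C (idn C (mo F c)) = mo F c"
      using ty[of "idn E c"] c by (simp_all flip: idn)
    have "comp C (idn C (mo F c)) (idn C (mo F c)) = idn C (mo F c)"
      using comp[of "idn E c" "idn E c"] c by (simp flip: idn)
    then show "is_inverse C (idn C (mo F c)) (idn C (mo F c))"
      using i by (simp add: is_inverse_def hom_def)
    fix g assume g: "is_inverse C (idn C (mo F c)) g"
    then have "g \<in> hom C (mo F c) (mo F c)" "comp C g (idn C (mo F c)) = idn C (mo F c)"
      using i by (auto simp: is_inverse_def)
    moreover from this(1) obtain g' where g': "g' \<in> hom E c c" "g = ma F g'" using hom c by blast
    ultimately have "ma F (comp E g' (idn E c)) = ma F (idn E c)"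
      using c comp[of "idn E c" g'] idn by (auto simp: hom_def)
    then have "g' = idn E c" using g' c by (auto simp: hom_def inj)
    then show "g = idn C (mo F c)" using g' idn c by simp
  qed
  have sub: "\<And>f x. f \<in> arr E \<Longrightarrow> x \<in> pred E (cd E f) \<Longrightarrow> mp F (dm E f) (sub E f x) = sub C (ma F f) (mp F (cd E f) x)"
    using M unfolding is_morphism_def by blast
  \<comment> \<open>\<open>C\<close> is not known to be a presheaf at this point, but every
    predicate of it over \<open>mo F c\<close> comes from \<open>E\<close>, where the identity law
    holds.\<close>
  have sub_id: "sub C (idn C (mo F c)) y = y" if c: "c \<in> ob E" "y \<in> pred C (mo F c)" for c y
  proof -
    obtain x where x: "x \<in> pred E c" "y = mp F c x" using F(4)[OF c(1)] c(2) by (auto simp: bij_betw_def)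
    have "sub E (idn E c) x = x" using E x(1) c(1) unfolding is_propcat_def is_presheaf_def by blast
    then show ?thesis using sub[of "idn E c" x] x c idn by simp
  qed
  have "strict_iso L E C F"
    unfolding strict_iso_def
  proof (intro conjI ballI impI)
    fix c x y assume "c \<in> ob E" "x \<in> pred E c" "y \<in> pred E c"
    then show "le E c x y \<longleftrightarrow> le C (mo F c) (mp F c x) (mp F c y)"
      using F(1) unfolding is_inclusion_def is_morphism_def by blast
  next
    fix c k xs assume "c \<in> ob E" "k \<in> conns L" "xs \<in> lists (pred E c)" "length xs = arity L k"
    then show "mp F c (conn E c k xs) = conn C (mo F c) k (map (mp F c) xs)"
      using M unfolding is_morphism_def by blast
  next
    fix q b c x assume a: "q \<in> quants L" "b \<in> ob E" "c \<in> ob E" "x \<in> pred E (prd E b c)"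
    have "mp F (prd E b c) x \<in> pred C (mo F (prd E b c))" using F(4)[of "prd E b c"] a by (auto simp: bij_betw_def)
    moreover have "mp F b (quant E q b c x) = quant C q (mo F b) (mo F c) (sub C (inv_arr C (cmp E C F b c)) (mp F (prd E b c) x))"
      using M a unfolding is_morphism_def by blast
    ultimately show "mp F b (quant E q b c x) = quant C q (mo F b) (mo F c) (mp F (prd E b c) x)"
      using a by (simp add: cmp inv sub_id)
  next
    fix c assume c: "c \<in> ob E"
    have "eqp C (mo F c) \<in> pred C (mo F (prd E c c))" using C mo c F(6) unfolding typed_def by simp
    moreover have "mp F (prd E c c) (eqp E c) = sub C (cmp E C F c c) (eqp C (mo F c))"
      using M c unfolding is_morphism_def by blast
    ultimately show "mp F (prd E c c) (eqp E c) = eqp C (mo F c)" using c by (simp add: cmp sub_id)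
  qed (use F ty idn comp sub in auto)
  then show ?thesis by (rule that)
qed

text \<open>For an arbitrary \<open>Lm_theory\<close>, this is how its classifying prop-category is
  seen to satisfy the axioms: they come from a copy that satisfies them.\<close>

lemma copy_inverse:
  assumes "language L" "is_propcat L E" "typed L C" "is_copy L E C"
  shows "is_propcat L C" "is_sub L C E"
proof -
  obtain F where "strict_iso L E C F" using copy_strict_iso[OF assms(2-4)] .
  then interpret S: strict_typed L E C F using assms typed_propcat by unfold_locales auto
  interpret S': strict_propcat L C E S.Finv
    using S.strict_iso_inv S.typed_D assms by unfold_locales auto
  show "is_propcat L C" "is_sub L C E" using S'.propcat S'.inclusion unfolding is_sub_def by auto
qed

text \<open>With a strict first factor the comparison of the composite is that of \<open>G\<close>
  at the image objects, so no comparison isomorphisms have to be composed.\<close>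

lemma copy_sub_trans:
  assumes L: "language L" and E: "is_propcat L E" and C: "is_propcat L C" and D: "is_propcat L D"
    and cp: "is_copy L E C" and sub: "is_sub L C D"
  shows "is_sub L E D"
proof -
  obtain F where "strict_iso L E C F" using copy_strict_iso[OF E typed_propcat[OF C] cp] .
  then interpret F: strict_typed L E C F using E typed_propcat by unfold_locales auto
  obtain G where G: "is_inclusion L C D G" using sub unfolding is_sub_def by blast
  interpret G: premorphism L C D G
    using L C D G by unfold_locales (auto simp: is_propcat_def is_inclusion_def)
  let ?H = "\<lparr>mo = mo G \<circ> mo F, ma = ma G \<circ> ma F, mp = \<lambda>c. mp G (mo F c) \<circ> mp F c\<rparr>"
  have cmp: "cmp E D ?H b c = cmp C D G (mo F b) (mo F c)" if "b \<in> ob E" "c \<in> ob E" for b c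
    using that by (simp add: cmp_def)
  have le: "le C c x y \<longleftrightarrow> le D (mo G c) (mp G c x) (mp G c y)" if "c \<in> ob C" "x \<in> pred C c" "y \<in> pred C c" for c x y
    using that G unfolding is_inclusion_def is_morphism_def by blast
  have comp: "ma G (ma F (comp E g f)) = comp D (ma G (ma F g)) (ma G (ma F f))"
    if "f \<in> arr E" "g \<in> arr E" "cd E f = dm E g" for f g
    using G.ma_comp[of "ma F f" "ma F g"] that by simp
  have quant: "mp G (mo F b) (mp F b (quant E q b c x)) =
      quant D q (mo G (mo F b)) (mo G (mo F c))
        (sub D (inv_arr D (cmp C D G (mo F b) (mo F c))) (mp G (mo F (prd E b c)) (mp F (prd E b c) x)))"
    if "q \<in> quants L" "b \<in> ob E" "c \<in> ob E" "x \<in> pred E (prd E b c)" for q b c x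
    using G.mp_quant[of q "mo F b" "mo F c" "mp F (prd E b c) x"] that by simp
  have eqp: "mp G (mo F (prd E c c)) (mp F (prd E c c) (eqp E c)) =
      sub D (cmp C D G (mo F c) (mo F c)) (eqp D (mo G (mo F c)))"
    if "c \<in> ob E" for c
    using G.mp_eqp[of "mo F c"] that by simp
  have sub: "mp G (mo F (dm E f)) (mp F (dm E f) (sub E f x)) = sub D (ma G (ma F f)) (mp G (mo F (cd E f)) (mp F (cd E f) x))"
    if "f \<in> arr E" "x \<in> pred E (cd E f)" for f x
    using G.mp_sub[of "ma F f" "mp F (cd E f) x"] that by simp
  have idn: "ma G (ma F (idn E c)) = idn D (mo G (mo F c))" if "c \<in> ob E" for c
    using G.ma_idn[of "mo F c"] that by simp
  have conn: "mp G (mo F c) (mp F c (conn E c k xs)) = conn D (mo G (mo F c)) k (map (mp G (mo F c) \<circ> mp F c) xs)"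
    if "c \<in> ob E" "k \<in> conns L" "xs \<in> lists (pred E c)" "length xs = arity L k" for c k xs
  proof -
    have "set (map (mp F c) xs) \<subseteq> pred C (mo F c)" using that by (auto simp: lists_eq_set)
    then show ?thesis using G.mp_conn[of "mo F c" k "map (mp F c) xs"] that by (simp add: F.F_conn)
  qed
  have iso: "is_iso D (bang D (mo G (mo F (one E))))" using G.iso_bang by simp
  have inj: "f = g" if "f \<in> arr E" "g \<in> arr E" "dm E f = dm E g" "cd E f = cd E g" "ma G (ma F f) = ma G (ma F g)" for f g
  proof -
    have "ma F f \<in> hom C (mo F (dm E f)) (mo F (cd E f))" "ma F g \<in> hom C (mo F (dm E f)) (mo F (cd E f))"
      using that by (simp_all add: hom_def)
    moreover have "inj_on (ma G) (hom C (mo F (dm E f)) (mo F (cd E f)))"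
      using G that unfolding is_inclusion_def by simp
    ultimately show ?thesis using that by (auto simp: F.F_inj dest: inj_onD)
  qed
  have "is_inclusion L E D ?H"
    unfolding is_inclusion_def is_morphism_def is_functor_def
  proof (intro conjI ballI impI)
    show "inj_on (ma ?H) (hom E b c)" for b c
      using inj by (auto intro!: inj_onI simp: hom_def)
  qed (use cmp comp quant eqp sub idn conn iso G.iso_cmp in \<open>auto simp: hom_def le[symmetric]\<close>)
  then show ?thesis unfolding is_sub_def by blast
qed

text \<open>Transport of structure along injections into urelements: an operation decodes its
  arguments, acts in \<open>C\<close> and encodes the result. The encoding of predicates may vary
  with the object because all operations on predicates are indexed by objects or arrows.\<close>

lemma copy_exists:
  fixes C :: "('o, 'a, 'p, 'k, 'q) propcat"
  assumes L: "language L" and C: "is_propcat L C"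
    and "ob C \<lesssim> A" "arr C \<lesssim> B" "\<And>c. c \<in> ob C \<Longrightarrow> \<exists>P. fits P \<and> pred C c \<lesssim> P" "fits A" "fits B"
    and fits: "\<And>A B :: 'u set. fits A \<Longrightarrow> B \<lesssim> A \<Longrightarrow> fits B"
  obtains E :: "('u, 'k, 'q) upropcat" where "E \<in> ObFA L fits" "is_copy L E C"
proof -
  obtain i where i: "inj_on i (ob C)" "i ` ob C \<subseteq> A" using assms(3) unfolding lepoll_def by blast
  obtain j where j: "inj_on j (arr C)" "j ` arr C \<subseteq> B" using assms(4) unfolding lepoll_def by blast
  have "\<forall>c. \<exists>f P. c \<in> ob C \<longrightarrow> fits P \<and> inj_on f (pred C c) \<and> f ` pred C c \<subseteq> P"
    using assms(5) unfolding lepoll_def by blast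
  then obtain r P where r: "\<And>c. c \<in> ob C \<Longrightarrow> fits (P c) \<and> inj_on (r c) (pred C c) \<and> r c ` pred C c \<subseteq> P c"
    by metis
  define i' where "i' = inv_into (ob C) i"
  define j' where "j' = inv_into (arr C) j"
  define r' where "r' c = inv_into (pred C c) (r c)" for c
  have i' [simp]: "i' (i c) = c" if "c \<in> ob C" for c using i that by (simp add: i'_def)
  have j' [simp]: "j' (j f) = f" if "f \<in> arr C" for f using j that by (simp add: j'_def)
  have r' [simp]: "r' c (r c x) = x" if "c \<in> ob C" "x \<in> pred C c" for c x using r that by (simp add: r'_def)
  define E :: "('u, 'k, 'q) upropcat" where "E = \<lparr>
     ob = i ` ob C, arr = j ` arr C, dm = \<lambda>f. i (dm C (j' f)), cd = \<lambda>f. i (cd C (j' f)),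
     idn = \<lambda>c. j (idn C (i' c)), comp = \<lambda>g f. j (comp C (j' g) (j' f)), one = i (one C),
     prd = \<lambda>b c. i (prd C (i' b) (i' c)), pr1 = \<lambda>b c. j (pr1 C (i' b) (i' c)), pr2 = \<lambda>b c. j (pr2 C (i' b) (i' c)),
     pred = \<lambda>c. r (i' c) ` pred C (i' c), le = \<lambda>c x y. le C (i' c) (r' (i' c) x) (r' (i' c) y),
     sub = \<lambda>f x. r (dm C (j' f)) (sub C (j' f) (r' (cd C (j' f)) x)),
     conn = \<lambda>c k xs. r (i' c) (conn C (i' c) k (map (r' (i' c)) xs)),
     eqp = \<lambda>c. r (prd C (i' c) (i' c)) (eqp C (i' c)),
     quant = \<lambda>q b c x. r (i' b) (quant C q (i' b) (i' c) (r' (prd C (i' b) (i' c)) x))\<rparr>"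
  have "fits (pred E c)" if c: "c \<in> ob E" for c
  proof -
    obtain c' where c': "c' \<in> ob C" "c = i c'" using c by (auto simp: E_def)
    have "fits (r c' ` pred C c')" using r[OF c'(1)] fits[OF _ subset_imp_lepoll] by blast
    then show ?thesis using c' by (simp add: E_def)
  qed
  moreover have "fits (ob E)" "fits (arr E)"
    using fits[OF assms(6) subset_imp_lepoll[OF i(2)]] fits[OF assms(7) subset_imp_lepoll[OF j(2)]]
    by (simp_all add: E_def)
  ultimately have fits_E: "fits (ob E) \<and> fits (arr E) \<and> (\<forall>c\<in>ob E. fits (pred E c))" by blast
  interpret C: prop_category L C using L C by unfold_locales
  have "strict_iso L C E \<lparr>mo = i, ma = j, mp = r\<rparr>"
    unfolding strict_iso_def
  proof (intro conjI ballI impI)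
    fix c k xs assume "c \<in> ob C" "k \<in> conns L" "xs \<in> lists (pred C c)" "length xs = arity L k"
    then have "map (r' c) (map (r c) xs) = xs" by (auto simp: lists_eq_set subset_iff intro!: map_idI)
    then show "mp \<lparr>mo = i, ma = j, mp = r\<rparr> c (conn C c k xs) =
        conn E (mo \<lparr>mo = i, ma = j, mp = r\<rparr> c) k (map (mp \<lparr>mo = i, ma = j, mp = r\<rparr> c) xs)"
      using \<open>c \<in> ob C\<close> by (simp add: E_def del: map_map)
  qed (use i j r in \<open>auto simp: E_def bij_betw_def\<close>)
  then interpret S: strict_typed L C E "\<lparr>mo = i, ma = j, mp = r\<rparr>"
    using typed_propcat[OF C] by unfold_locales auto
  interpret S': strict_propcat L E C S.Finv
    using S.strict_iso_inv S.typed_D L C by unfold_locales auto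
  have "E \<in> ObFA L fits" using S'.propcat fits_E by (simp only: ObFA_def mem_Collect_eq) blast
  then show ?thesis using S'.copy by (rule that)
qed

section \<open>Products\<close>

locale product =
  fixes L :: "('k, 'q) lang" and I :: "'i set" and C :: "'i \<Rightarrow> ('o, 'a, 'p, 'k, 'q) propcat"
  assumes lang: "language L" and propcat: "\<And>i. i \<in> I \<Longrightarrow> is_propcat L (C i)"
begin

lemma factor: "i \<in> I \<Longrightarrow> prop_category L (C i)"
  using lang propcat by unfold_locales

abbreviation "P \<equiv> prod_propcat I C"

lemma P_sel:
  "ob P = (\<Pi>\<^sub>E i\<in>I. ob (C i))" "arr P = (\<Pi>\<^sub>E i\<in>I. arr (C i))"
  "dm P f = (\<lambda>i\<in>I. dm (C i) (f i))" "cd P f = (\<lambda>i\<in>I. cd (C i) (f i))"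
  "idn P c = (\<lambda>i\<in>I. idn (C i) (c i))" "comp P g f = (\<lambda>i\<in>I. comp (C i) (g i) (f i))"
  "one P = (\<lambda>i\<in>I. one (C i))" "prd P b c = (\<lambda>i\<in>I. prd (C i) (b i) (c i))"
  "pr1 P b c = (\<lambda>i\<in>I. pr1 (C i) (b i) (c i))" "pr2 P b c = (\<lambda>i\<in>I. pr2 (C i) (b i) (c i))"
  "pred P c = (\<Pi>\<^sub>E i\<in>I. pred (C i) (c i))" "le P c x y \<longleftrightarrow> (\<forall>i\<in>I. le (C i) (c i) (x i) (y i))"
  "sub P f x = (\<lambda>i\<in>I. sub (C i) (f i) (x i))"
  "conn P c k xs = (\<lambda>i\<in>I. conn (C i) (c i) k (map (\<lambda>x. x i) xs))"
  "eqp P c = (\<lambda>i\<in>I. eqp (C i) (c i))" "quant P q b c x = (\<lambda>i\<in>I. quant (C i) q (b i) (c i) (x i))"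
  by (simp_all add: prod_propcat_def)

lemma restrict_eq_iff: "(\<lambda>i\<in>I. f i) = (\<lambda>i\<in>I. g i) \<longleftrightarrow> (\<forall>i\<in>I. f i = g i)"
  by (metis restrict_apply' restrict_ext)

lemma P_ext:
  assumes "x \<in> Pi\<^sub>E I A" "y \<in> Pi\<^sub>E I B" "\<And>i. i \<in> I \<Longrightarrow> x i = y i"
  shows "x = y"
  using assms by (intro extensionalityI[of x I y]) (simp_all add: PiE_iff)

lemma P_restrict_eq: "y \<in> Pi\<^sub>E I B \<Longrightarrow> (\<lambda>i\<in>I. f i) = y \<longleftrightarrow> (\<forall>i\<in>I. f i = y i)"
  by (auto intro!: extensionalityI[of _ I y] simp: PiE_iff)

lemma hom_P:
  assumes "b \<in> ob P" "c \<in> ob P"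
  shows "f \<in> hom P b c \<longleftrightarrow> f \<in> Pi\<^sub>E I (\<lambda>i. hom (C i) (b i) (c i))"
  using assms by (auto simp: hom_def P_sel P_restrict_eq PiE_iff)

lemma is_category_P: "is_category P"
  unfolding is_category_def
proof (intro conjI ballI impI)
  fix f assume f: "f \<in> arr P"
  then have fi: "f i \<in> arr (C i)" if "i \<in> I" for i using that by (auto simp: P_sel)
  show "dm P f \<in> ob P" "cd P f \<in> ob P"
    using fi propcat by (auto simp: P_sel is_propcat_def is_category_def)
  have "comp (C i) (f i) (idn (C i) (dm (C i) (f i))) = f i" "comp (C i) (idn (C i) (cd (C i) (f i))) (f i) = f i"
    if i: "i \<in> I" for i
  proof -
    interpret prop_category L "C i" using factor[OF i] .
    show "comp (C i) (f i) (idn (C i) (dm (C i) (f i))) = f i" "comp (C i) (idn (C i) (cd (C i) (f i))) (f i) = f i"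
      using fi[OF i] by simp_all
  qed
  then show "comp P f (idn P (dm P f)) = f" "comp P (idn P (cd P f)) f = f"
    using f by (auto simp: P_sel P_restrict_eq)
  fix g assume g: "g \<in> arr P" "cd P f = dm P g"
  then have gi: "g i \<in> arr (C i)" "cd (C i) (f i) = dm (C i) (g i)" if "i \<in> I" for i
    using that by (auto simp: P_sel restrict_eq_iff)
  have c: "comp (C i) (g i) (f i) \<in> arr (C i)" "dm (C i) (comp (C i) (g i) (f i)) = dm (C i) (f i)"
    "cd (C i) (comp (C i) (g i) (f i)) = cd (C i) (g i)" if i: "i \<in> I" for i
  proof -
    interpret prop_category L "C i" using factor[OF i] .
    show "comp (C i) (g i) (f i) \<in> arr (C i)" "dm (C i) (comp (C i) (g i) (f i)) = dm (C i) (f i)"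
      "cd (C i) (comp (C i) (g i) (f i)) = cd (C i) (g i)"
      using fi[OF i] gi[OF i] by simp_all
  qed
  then show "comp P g f \<in> hom P (dm P f) (cd P g)"
    by (auto simp: hom_def P_sel restrict_eq_iff)
  fix h assume h: "h \<in> arr P" "cd P g = dm P h"
  then have hi: "h i \<in> arr (C i)" "cd (C i) (g i) = dm (C i) (h i)" if "i \<in> I" for i
    using that by (auto simp: P_sel restrict_eq_iff)
  have "comp (C i) (h i) (comp (C i) (g i) (f i)) = comp (C i) (comp (C i) (h i) (g i)) (f i)" if i: "i \<in> I" for i
  proof -
    interpret prop_category L "C i" using factor[OF i] .
    show ?thesis using fi[OF i] gi[OF i] hi[OF i] by simp
  qed
  then show "comp P h (comp P g f) = comp P (comp P h g) f" by (simp add: P_sel restrict_eq_iff)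
next
  fix c assume c: "c \<in> ob P"
  have "idn (C i) (c i) \<in> hom (C i) (c i) (c i)" if i: "i \<in> I" for i
  proof -
    interpret prop_category L "C i" using factor[OF i] .
    have "c i \<in> ob (C i)" using c i by (auto simp: P_sel)
    then show ?thesis by (simp add: hom_def)
  qed
  then show "idn P c \<in> hom P c c" using c by (simp add: hom_P) (simp add: P_sel)
qed

lemma has_products_P: "has_products P"
  unfolding has_products_def
proof (intro conjI ballI)
  have one: "one (C i) \<in> ob (C i)" if "i \<in> I" for i
    using propcat[OF that] by (simp add: is_propcat_def has_products_def)
  then show oneP: "one P \<in> ob P" by (simp add: P_sel)
  fix c assume c: "c \<in> ob P"
  have b: "g = bang (C i) (c i) \<longleftrightarrow> g \<in> hom (C i) (c i) (one (C i))" if i: "i \<in> I" for i g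
  proof -
    interpret prop_category L "C i" using factor[OF i] .
    have "c i \<in> ob (C i)" using c i by (auto simp: P_sel)
    then show ?thesis using one_ext[of g "bang (C i) (c i)"] by (auto simp: hom_def)
  qed
  show "\<exists>!f. f \<in> hom P c (one P)"
  proof
    show "(\<lambda>i\<in>I. bang (C i) (c i)) \<in> hom P c (one P)"
      unfolding hom_P[OF c oneP] using b[THEN iffD1, OF _ refl] by (auto simp: P_sel(7))
    fix f assume "f \<in> hom P c (one P)"
    then have "f \<in> Pi\<^sub>E I (\<lambda>i. hom (C i) (c i) (one (C i)))" using c oneP by (simp add: hom_P) (simp add: P_sel PiE_iff)
    then show "f = (\<lambda>i\<in>I. bang (C i) (c i))" using b by (intro P_ext[of f _ _ "\<lambda>i. {bang (C i) (c i)}"]) (auto simp: PiE_iff)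
  qed
next
  fix b c assume bc: "b \<in> ob P" "c \<in> ob P"
  have bci: "b i \<in> ob (C i)" "c i \<in> ob (C i)" if "i \<in> I" for i using bc that by (auto simp: P_sel)
  have t: "prd (C i) (b i) (c i) \<in> ob (C i)" "pr1 (C i) (b i) (c i) \<in> hom (C i) (prd (C i) (b i) (c i)) (b i)"
    "pr2 (C i) (b i) (c i) \<in> hom (C i) (prd (C i) (b i) (c i)) (c i)" if i: "i \<in> I" for i
  proof -
    interpret prop_category L "C i" using factor[OF i] .
    show "prd (C i) (b i) (c i) \<in> ob (C i)" "pr1 (C i) (b i) (c i) \<in> hom (C i) (prd (C i) (b i) (c i)) (b i)"
      "pr2 (C i) (b i) (c i) \<in> hom (C i) (prd (C i) (b i) (c i)) (c i)"
      using bci[OF i] by (simp_all add: hom_def)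
  qed
  show p: "prd P b c \<in> ob P" using t by (simp add: P_sel)
  show "pr1 P b c \<in> hom P (prd P b c) b" "pr2 P b c \<in> hom P (prd P b c) c"
    using t by (simp_all add: hom_P bc p) (simp_all add: P_sel)
  fix a f g assume a: "a \<in> ob P" and fg: "f \<in> hom P a b" "g \<in> hom P a c"
  have fgi: "f i \<in> hom (C i) (a i) (b i)" "g i \<in> hom (C i) (a i) (c i)" if "i \<in> I" for i
    using fg that a bc by (auto simp: hom_P)
  let ?Q = "\<lambda>i h. h \<in> hom (C i) (a i) (prd (C i) (b i) (c i)) \<and> comp (C i) (pr1 (C i) (b i) (c i)) h = f i \<and>
     comp (C i) (pr2 (C i) (b i) (c i)) h = g i"
  have q: "?Q i h \<longleftrightarrow> h = pair (C i) (f i) (g i)" if i: "i \<in> I" for i h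
  proof -
    interpret prop_category L "C i" using factor[OF i] .
    have t: "f i \<in> arr (C i)" "g i \<in> arr (C i)" "dm (C i) (f i) = a i" "dm (C i) (g i) = a i"
      "cd (C i) (f i) = b i" "cd (C i) (g i) = c i" using fgi[OF i] by (auto simp: hom_def)
    show ?thesis using t bci[OF i] prd_ext[of h "pair (C i) (f i) (g i)" "b i" "c i"] by (auto simp: hom_def)
  qed
  have f': "f \<in> Pi\<^sub>E I (\<lambda>i. hom (C i) (a i) (b i))" and g': "g \<in> Pi\<^sub>E I (\<lambda>i. hom (C i) (a i) (c i))"
    using fg a bc by (simp_all add: hom_P)
  \<comment> \<open>The universal property splits into a condition on each factor and extensionality
    of \<open>h\<close>; the latter is what makes the family of pairings unique as a
    function.\<close>
  have Q: "h \<in> hom P a (prd P b c) \<and> comp P (pr1 P b c) h = f \<and> comp P (pr2 P b c) h = g \<longleftrightarrow>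
     h \<in> extensional I \<and> (\<forall>i\<in>I. ?Q i (h i))" for h
    unfolding hom_P[OF a p] by (auto simp: P_sel P_restrict_eq[OF f'] P_restrict_eq[OF g'] PiE_iff)
  show "\<exists>!h. h \<in> hom P a (prd P b c) \<and> comp P (pr1 P b c) h = f \<and> comp P (pr2 P b c) h = g"
    unfolding Q
  proof
    show "(\<lambda>i\<in>I. pair (C i) (f i) (g i)) \<in> extensional I \<and> (\<forall>i\<in>I. ?Q i ((\<lambda>i\<in>I. pair (C i) (f i) (g i)) i))"
      using q by simp
    show "h = (\<lambda>i\<in>I. pair (C i) (f i) (g i))" if "h \<in> extensional I \<and> (\<forall>i\<in>I. ?Q i (h i))" for h
      using that q by (intro extensionalityI[of h I]) auto
  qed
qed

sublocale PP: fpcategory P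
  using is_category_P has_products_P by unfold_locales

section \<open>Componentwise evaluation of operations and the prop-category axioms for
  products\<close>

lemma arr_P_nth: "f \<in> arr P \<Longrightarrow> i \<in> I \<Longrightarrow> f i \<in> arr (C i)"
  and ob_P_nth: "c \<in> ob P \<Longrightarrow> i \<in> I \<Longrightarrow> c i \<in> ob (C i)"
  and pred_P_nth: "x \<in> pred P c \<Longrightarrow> i \<in> I \<Longrightarrow> x i \<in> pred (C i) (c i)"
  and dm_P_nth: "i \<in> I \<Longrightarrow> dm P f i = dm (C i) (f i)"
  and cd_P_nth: "i \<in> I \<Longrightarrow> cd P f i = cd (C i) (f i)"
  by (auto simp: P_sel)

lemma comp_P_nth: "i \<in> I \<Longrightarrow> comp P g f i = comp (C i) (g i) (f i)"
  and prd_P_nth: "i \<in> I \<Longrightarrow> prd P b c i = prd (C i) (b i) (c i)"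
  and pr1_P_nth: "i \<in> I \<Longrightarrow> pr1 P b c i = pr1 (C i) (b i) (c i)"
  and pr2_P_nth: "i \<in> I \<Longrightarrow> pr2 P b c i = pr2 (C i) (b i) (c i)"
  and sub_P_nth: "i \<in> I \<Longrightarrow> sub P f x i = sub (C i) (f i) (x i)"
  and eqp_P_nth: "i \<in> I \<Longrightarrow> eqp P c i = eqp (C i) (c i)"
  and quant_P_nth: "i \<in> I \<Longrightarrow> quant P q b c x i = quant (C i) q (b i) (c i) (x i)"
  and conn_P_nth: "i \<in> I \<Longrightarrow> conn P c k xs i = conn (C i) (c i) k (map (\<lambda>x. x i) xs)"
  and one_P_nth: "i \<in> I \<Longrightarrow> one P i = one (C i)"
  and idn_P_nth: "i \<in> I \<Longrightarrow> idn P c i = idn (C i) (c i)"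
  by (simp_all add: P_sel)

lemmas P_nth = comp_P_nth prd_P_nth pr1_P_nth pr2_P_nth sub_P_nth eqp_P_nth quant_P_nth conn_P_nth
  dm_P_nth cd_P_nth one_P_nth idn_P_nth

lemma tensor_P_nth: "i \<in> I \<Longrightarrow> tensor_p L P c x y i = tensor_p L (C i) (c i) (x i) (y i)"
  and unit_P_nth: "i \<in> I \<Longrightarrow> unit_p L P c i = unit_p L (C i) (c i)"
  by (simp_all add: tensor_p_def unit_p_def P_nth)

text \<open>\<open>pair\<close> is a description and does not unfold componentwise; its component is
  identified by the uniqueness of pairing in the factor.\<close>

lemma pair_P_nth:
  assumes "f \<in> arr P" "g \<in> arr P" "dm P f = dm P g" "i \<in> I"
  shows "pair P f g i = pair (C i) (f i) (g i)"
proof -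
  interpret prop_category L "C i" using factor[OF assms(4)] .
  note t = assms(1,2)[THEN arr_P_nth, OF assms(4)]
  have d: "dm (C i) (f i) = dm (C i) (g i)" using fun_cong[OF assms(3), of i] assms(4) by (simp add: P_nth)
  have p: "pair P f g i \<in> arr (C i)" "dm (C i) (pair P f g i) = dm (C i) (f i)"
    "cd (C i) (pair P f g i) = prd (C i) (cd (C i) (f i)) (cd (C i) (g i))"
    using arr_P_nth[OF PP.pair_typ(1)[OF assms(1-3)] assms(4)]
      fun_cong[OF PP.pair_typ(2)[OF assms(1-3)], of i] fun_cong[OF PP.pair_typ(3)[OF assms(1-3)], of i] assms(4)
    by (simp_all add: P_nth)
  show ?thesis
  proof (rule prd_ext)
    show "comp (C i) (pr1 (C i) (cd (C i) (f i)) (cd (C i) (g i))) (pair P f g i) =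
        comp (C i) (pr1 (C i) (cd (C i) (f i)) (cd (C i) (g i))) (pair (C i) (f i) (g i))"
      using fun_cong[OF PP.pr1_pair[OF assms(1-3) refl refl], of i] assms(4) t d by (simp add: P_nth)
    show "comp (C i) (pr2 (C i) (cd (C i) (f i)) (cd (C i) (g i))) (pair P f g i) =
        comp (C i) (pr2 (C i) (cd (C i) (f i)) (cd (C i) (g i))) (pair (C i) (f i) (g i))"
      using fun_cong[OF PP.pr2_pair[OF assms(1-3) refl refl], of i] assms(4) t d by (simp add: P_nth)
  qed (use p t d in simp_all)
qed

lemma bang_P_nth:
  assumes "c \<in> ob P" "i \<in> I"
  shows "bang P c i = bang (C i) (c i)"
proof -
  interpret prop_category L "C i" using factor[OF assms(2)] .
  show ?thesis
    using arr_P_nth[OF PP.bang_typ(1)[OF assms(1)] assms(2)] fun_cong[OF PP.bang_typ(2)[OF assms(1)], of i]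
      fun_cong[OF PP.bang_typ(3)[OF assms(1)], of i] ob_P_nth[OF assms] assms(2)
    by (intro one_ext) (simp_all add: P_nth)
qed

lemma times_id_P_nth:
  assumes "f \<in> arr P" "c \<in> ob P" "i \<in> I"
  shows "times_id P f c i = times_id (C i) (f i) (c i)"
  unfolding times_id_def using assms by (simp add: pair_P_nth P_nth)

lemma assoc_P_nth:
  assumes "b \<in> ob P" "c \<in> ob P" "d \<in> ob P" "i \<in> I"
  shows "assoc P b c d i = assoc (C i) (b i) (c i) (d i)"
  unfolding assoc_def using assms by (simp add: pair_P_nth P_nth)

lemma in_P: "x \<in> pred P c \<longleftrightarrow> x \<in> extensional I \<and> (\<forall>i\<in>I. x i \<in> pred (C i) (c i))"
  by (auto simp: P_sel PiE_iff)

lemma P_extensional [simp]: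
  "sub P f x \<in> extensional I" "conn P c k xs \<in> extensional I" "eqp P c \<in> extensional I"
  "quant P q b c x \<in> extensional I" "tensor_p L P c x y \<in> extensional I" "unit_p L P c \<in> extensional I"
  by (simp_all add: P_sel tensor_p_def unit_p_def)

lemma presheaf_P: "is_presheaf P"
  unfolding is_presheaf_def
proof (intro conjI ballI impI)
  fix c assume c: "c \<in> ob P"
  show "is_poset (pred P c) (le P c)"
    unfolding is_poset_def
  proof (intro conjI ballI impI)
    fix x assume x: "x \<in> pred P c"
    show "le P c x x"
      using c x prop_category.le_refl[OF factor] by (simp add: P_sel(12) ob_P_nth pred_P_nth)
    fix y assume y: "y \<in> pred P c"
    show "x = y" if l: "le P c x y" "le P c y x"
    proof (rule extensionalityI)
      fix i assume i: "i \<in> I"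
      show "x i = y i"
        using prop_category.le_antisym[OF factor[OF i] ob_P_nth[OF c i] pred_P_nth[OF x i] pred_P_nth[OF y i]] l i
        by (simp add: P_sel(12))
    qed (use x y in \<open>auto simp: in_P\<close>)
    fix z assume z: "z \<in> pred P c"
    show "le P c x z" if l: "le P c x y" "le P c y z"
      unfolding P_sel(12)
    proof
      fix i assume i: "i \<in> I"
      show "le (C i) (c i) (x i) (z i)"
        using prop_category.le_trans[OF factor[OF i] ob_P_nth[OF c i] pred_P_nth[OF x i] pred_P_nth[OF y i] pred_P_nth[OF z i]] l i
        by (simp add: P_sel(12))
    qed
  qed
  fix x assume x: "x \<in> pred P c"
  show "sub P (idn P c) x = x"
  proof (rule extensionalityI)
    fix i assume i: "i \<in> I"
    show "sub P (idn P c) x i = x i"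
      using prop_category.sub_idn[OF factor[OF i] pred_P_nth[OF x i] ob_P_nth[OF c i]] i by (simp add: P_nth)
  qed (use x in \<open>auto simp: in_P\<close>)
next
  fix f x assume f: "f \<in> arr P" and x: "x \<in> pred P (cd P f)"
  have xi: "x i \<in> pred (C i) (cd (C i) (f i))" if "i \<in> I" for i using pred_P_nth[OF x that] that by (simp add: P_nth)
  show "sub P f x \<in> pred P (dm P f)"
    using prop_category.sub_pred[OF factor arr_P_nth[OF f] xi] by (simp add: in_P P_nth)
  fix y assume y: "y \<in> pred P (cd P f)" "le P (cd P f) x y"
  have yi: "y i \<in> pred (C i) (cd (C i) (f i))" if "i \<in> I" for i using pred_P_nth[OF y(1) that] that by (simp add: P_nth)
  show "le P (dm P f) (sub P f x) (sub P f y)"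
    using prop_category.sub_mono[OF factor arr_P_nth[OF f] xi yi] y(2) by (simp add: P_sel(12) P_nth)
next
  fix f g x assume f: "f \<in> arr P" and g: "g \<in> arr P" and fg: "cd P f = dm P g" and x: "x \<in> pred P (cd P g)"
  have "sub (C i) (comp (C i) (g i) (f i)) (x i) = sub (C i) (f i) (sub (C i) (g i) (x i))" if i: "i \<in> I" for i
  proof -
    interpret prop_category L "C i" using factor[OF i] .
    have "x i \<in> pred (C i) (cd (C i) (g i))" using pred_P_nth[OF x i] i by (simp add: P_nth)
    moreover have "cd (C i) (f i) = dm (C i) (g i)" using fun_cong[OF fg, of i] i by (simp add: P_nth)
    ultimately show ?thesis using arr_P_nth[OF f i] arr_P_nth[OF g i] by simp
  qed
  then show "sub P (comp P g f) x = sub P f (sub P g x)" by (simp add: P_sel restrict_eq_iff)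
qed

lemma lists_P_nth: "xs \<in> lists (pred P c) \<Longrightarrow> i \<in> I \<Longrightarrow> map (\<lambda>x. x i) xs \<in> lists (pred (C i) (c i))"
  by (auto simp: lists_eq_set in_P)

lemma connectives_P: "has_connectives L P"
  unfolding has_connectives_def
proof (intro conjI ballI impI)
  fix c k xs assume "c \<in> ob P" "k \<in> conns L" "xs \<in> lists (pred P c)" "length xs = arity L k"
  then show "conn P c k xs \<in> pred P c"
    using prop_category.conn_pred[OF factor ob_P_nth] lists_P_nth by (simp add: in_P P_nth lists_eq_set)
next
  fix f k xs assume f: "f \<in> arr P" and k: "k \<in> conns L" and xs: "xs \<in> lists (pred P (cd P f))" and l: "length xs = arity L k"
  have "sub (C i) (f i) (conn (C i) (cd (C i) (f i)) k (map (\<lambda>x. x i) xs)) =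
      conn (C i) (dm (C i) (f i)) k (map (sub (C i) (f i)) (map (\<lambda>x. x i) xs))" if i: "i \<in> I" for i
    using lists_P_nth[OF xs i] i l by (intro prop_category.sub_conn[OF factor[OF i] arr_P_nth[OF f i] k]) (auto simp: lists_eq_set P_nth)
  then show "sub P f (conn P (cd P f) k xs) = conn P (dm P f) k (map (sub P f) xs)"
    by (simp add: P_sel restrict_eq_iff o_def)
qed

lemma monoids_P: "has_monoids L P"
  unfolding has_monoids_def
proof (intro conjI ballI impI)
  fix c x assume c: "c \<in> ob P" and x: "x \<in> pred P c"
  show "tensor_p L P c (unit_p L P c) x = x" "tensor_p L P c x (unit_p L P c) = x"
    using prop_category.tensor_unit[OF factor ob_P_nth[OF c] pred_P_nth[OF x]] x
    by (auto intro!: extensionalityI[of _ I] simp: tensor_P_nth unit_P_nth in_P)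
  fix y z assume y: "y \<in> pred P c" and z: "z \<in> pred P c"
  show "tensor_p L P c (tensor_p L P c x y) z = tensor_p L P c x (tensor_p L P c y z)"
    using prop_category.tensor_assoc[OF factor ob_P_nth[OF c] pred_P_nth[OF x] pred_P_nth[OF y] pred_P_nth[OF z]]
    by (auto intro!: extensionalityI[of _ I] simp: tensor_P_nth)
next
  fix c x x' y y'
  assume c: "c \<in> ob P" and x: "x \<in> pred P c" "x' \<in> pred P c" and y: "y \<in> pred P c" "y' \<in> pred P c"
    and le: "le P c x x'" "le P c y y'"
  show "le P c (tensor_p L P c x y) (tensor_p L P c x' y')"
    using prop_category.tensor_mono[OF factor ob_P_nth[OF c] pred_P_nth[OF x(1)] pred_P_nth[OF y(1)]
      pred_P_nth[OF x(2)] pred_P_nth[OF y(2)]] le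
    by (simp add: P_sel(12) tensor_P_nth)
qed

lemma quantifiers_P: "has_quantifiers L P"
  unfolding has_quantifiers_def
proof (intro conjI ballI)
  fix q assume q: "q \<in> quants L"
  show "quant P q b c x \<in> pred P b" if b: "b \<in> ob P" and c: "c \<in> ob P" and x: "x \<in> pred P (prd P b c)" for b c x
    using prop_category.quant_pred[OF factor q ob_P_nth[OF b] ob_P_nth[OF c]] pred_P_nth[OF x] by (simp add: in_P P_nth)
  show "sub P f (quant P q (cd P f) c x) = quant P q (dm P f) c (sub P (times_id P f c) x)"
    if f: "f \<in> arr P" and c: "c \<in> ob P" and x: "x \<in> pred P (prd P (cd P f) c)" for f c x
    using prop_category.sub_quant[OF factor q arr_P_nth[OF f] ob_P_nth[OF c] refl] pred_P_nth[OF x]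
    by (auto intro!: extensionalityI[of _ I] simp: P_nth times_id_P_nth[OF f c])
  show "quant P q b (one P) (sub P (pr1 P b (one P)) x) = x" if b: "b \<in> ob P" and x: "x \<in> pred P b" for b x
    using prop_category.quant_one[OF factor q ob_P_nth[OF b] pred_P_nth[OF x]] x
    by (auto intro!: extensionalityI[of _ I] simp: P_nth in_P)
  show "quant P q b (prd P c d) (sub P (assoc P b c d) x) = quant P q b c (quant P q (prd P b c) d x)"
    if b: "b \<in> ob P" and c: "c \<in> ob P" and d: "d \<in> ob P" and x: "x \<in> pred P (prd P (prd P b c) d)" for b c d x
    using prop_category.quant_prd[OF factor q ob_P_nth[OF b] ob_P_nth[OF c] ob_P_nth[OF d]] pred_P_nth[OF x]
    by (auto intro!: extensionalityI[of _ I] simp: P_nth assoc_P_nth[OF b c d])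
qed

lemma equality_P: "has_equality L P"
  unfolding has_equality_def Let_def
proof (intro conjI ballI)
  show "eqp P c \<in> pred P (prd P c c)" if c: "c \<in> ob P" for c
    using prop_category.eqp_pred[OF factor ob_P_nth[OF c]] by (simp add: in_P P_nth)
  show "eqp P (one P) = unit_p L P (prd P (one P) (one P))"
    using prop_category.eqp_one[OF factor]
    by (auto intro!: extensionalityI[of _ I] simp: P_nth unit_P_nth)
  fix c d assume c: "c \<in> ob P" and d: "d \<in> ob P"
  let ?e = "prd P c d"
  let ?p = "pr1 P ?e ?e" and ?p' = "pr2 P ?e ?e"
  show "eqp P ?e = tensor_p L P (prd P ?e ?e)
          (sub P (pair P (comp P (pr1 P c d) ?p) (comp P (pr1 P c d) ?p')) (eqp P c))
          (sub P (pair P (comp P (pr2 P c d) ?p) (comp P (pr2 P c d) ?p')) (eqp P d))"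
  proof (rule extensionalityI[of _ I])
    fix i assume i: "i \<in> I"
    have "pair P (comp P (pr1 P c d) ?p) (comp P (pr1 P c d) ?p') i =
       pair (C i) (comp P (pr1 P c d) ?p i) (comp P (pr1 P c d) ?p' i)"
      "pair P (comp P (pr2 P c d) ?p) (comp P (pr2 P c d) ?p') i =
       pair (C i) (comp P (pr2 P c d) ?p i) (comp P (pr2 P c d) ?p' i)"
      using c d i by (auto intro!: pair_P_nth)
    then show "eqp P ?e i = tensor_p L P (prd P ?e ?e)
          (sub P (pair P (comp P (pr1 P c d) ?p) (comp P (pr1 P c d) ?p')) (eqp P c))
          (sub P (pair P (comp P (pr2 P c d) ?p) (comp P (pr2 P c d) ?p')) (eqp P d)) i"
      using prop_category.eqp_prd[OF factor[OF i] ob_P_nth[OF c i] ob_P_nth[OF d i]] i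
      by (simp add: P_nth tensor_P_nth Let_def)
  qed simp_all
qed

lemma propcat_P: "is_propcat L P"
  unfolding is_propcat_def
  using is_category_P has_products_P presheaf_P connectives_P monoids_P quantifiers_P equality_P by blast

sublocale PP: prop_category L P
  using lang propcat_P by unfold_locales

subsection \<open>Structures in products\<close>

definition at :: "('u, 'i \<Rightarrow> 'o, 'i \<Rightarrow> 'a, 'i \<Rightarrow> 'p) struc \<Rightarrow> 'i \<Rightarrow> ('u, 'o, 'a, 'p) struc" where
  "at M i = \<lparr>isort = \<lambda>\<sigma>. isort M \<sigma> i, ifun = \<lambda>f. ifun M f i, irel = \<lambda>r. irel M r i\<rparr>"

lemma at_sel [simp]: "isort (at M i) \<sigma> = isort M \<sigma> i" "ifun (at M i) f = ifun M f i" "irel (at M i) r = irel M r i"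
  by (simp_all add: at_def)

lemma ctx_ob_at: "i \<in> I \<Longrightarrow> ctx_ob (C i) (at M i) \<Gamma> = ctx_ob P M \<Gamma> i"
  by (induction \<Gamma>) (simp_all add: P_nth)

lemma var_arr_at: "i \<in> I \<Longrightarrow> j < length \<Gamma> \<Longrightarrow> var_arr (C i) (at M i) \<Gamma> j = var_arr P M \<Gamma> j i"
proof (induction \<Gamma> arbitrary: j)
  case (Cons \<tau> \<Gamma>)
  then show ?case by (cases j) (simp_all add: P_nth ctx_ob_at)
qed simp

lemma tuple_at:
  "i \<in> I \<Longrightarrow> PP.arrs M b fs \<Gamma> \<Longrightarrow> tuple (C i) (b i) (map (\<lambda>f. f i) fs) = tuple P b fs i"
proof (induction fs arbitrary: \<Gamma>)
  case Nil
  then show ?case by (simp add: PP.arrs_def bang_P_nth)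
next
  case (Cons f fs)
  then obtain \<tau> \<Gamma>' where G: "\<Gamma> = \<tau> # \<Gamma>'" by (cases \<Gamma>) (auto simp: PP.arrs_def)
  with Cons(3) have fs: "PP.arrs M b fs \<Gamma>'" by (simp add: PP.arrs_def)
  have "pair P (tuple P b fs) f i = pair (C i) (tuple P b fs i) (f i)"
    using PP.tuple_typ[OF fs] Cons(2,3) by (intro pair_P_nth) (simp_all add: G PP.arrs_def)
  then show ?case using Cons(1)[OF Cons(2) fs] by simp
qed

context
  fixes Sg :: "'u signature" and M :: "('u, 'i \<Rightarrow> 'o, 'i \<Rightarrow> 'a, 'i \<Rightarrow> 'p) struc"
  assumes sig: "is_sig Sg" and struc: "is_struc P Sg M"
begin

interpretation S: structure_in L P Sg M
  using sig struc by unfold_locales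

lemma trm_arr_at:
  "i \<in> I \<Longrightarrow> wt_trm Sg \<Gamma> t \<sigma> \<Longrightarrow> is_ctx Sg \<Gamma> \<Longrightarrow> trm_arr (C i) (at M i) \<Gamma> t = trm_arr P M \<Gamma> t i"
proof (induction t arbitrary: \<sigma>)
  case (Var j)
  then show ?case by (auto elim: wt_VarE simp: var_arr_at)
next
  case (Fn f Ms)
  then have f: "f \<in> funs Sg" "list_all2 (wt_trm Sg \<Gamma>) Ms (fdom Sg f)" by (auto elim: wt_FnE)
  have "trm_arr (C i) (at M i) \<Gamma> t = trm_arr P M \<Gamma> t i" if ts: "t \<in> set Ms" for t
  proof -
    obtain j where "j < length Ms" "t = Ms ! j" using ts by (auto simp: in_set_conv_nth)
    then have "wt_trm Sg \<Gamma> t (fdom Sg f ! j)" using f(2) by (simp add: list_all2_conv_all_nth)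
    then show ?thesis using Fn.IH[OF ts Fn(2) _ Fn(4)] by blast
  qed
  then have "map (trm_arr (C i) (at M i) \<Gamma>) Ms = map (\<lambda>f. f i) (map (trm_arr P M \<Gamma>) Ms)" by simp
  then show ?case using tuple_at[OF Fn(2) S.arrs_trms[OF Fn(4) _ f(2)]] f Fn(2)
    by (simp add: P_nth ctx_ob_at del: map_map)
qed

lemma trms_at:
  assumes "i \<in> I" "is_ctx Sg \<Gamma>" "is_ctx Sg \<Delta>" "list_all2 (wt_trm Sg \<Gamma>) Ms \<Delta>"
  shows "tuple (C i) (ctx_ob P M \<Gamma> i) (map (trm_arr (C i) (at M i) \<Gamma>) Ms) = S.tm \<Gamma> Ms i"
proof -
  have "map (trm_arr (C i) (at M i) \<Gamma>) Ms = map (\<lambda>f. f i) (map (trm_arr P M \<Gamma>) Ms)"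
    using assms trm_arr_at by (fastforce simp: list_all2_conv_all_nth in_set_conv_nth)
  then show ?thesis using tuple_at[OF assms(1) S.arrs_trms[OF assms(2-4)]] by (simp del: map_map)
qed

lemma fml_val_at:
  "i \<in> I \<Longrightarrow> wt_fml L Sg \<Gamma> \<phi> \<Longrightarrow> is_ctx Sg \<Gamma> \<Longrightarrow> fml_val (C i) (at M i) \<Gamma> \<phi> = fml_val P M \<Gamma> \<phi> i"
proof (induction \<phi> arbitrary: \<Gamma>)
  case (Rel r Ms)
  then show ?case using trms_at[of i \<Gamma> "rdom Sg r" Ms] by (simp add: P_nth ctx_ob_at)
next
  case (Equ \<sigma> N K)
  then have wt: "wt_trm Sg \<Gamma> N \<sigma>" "wt_trm Sg \<Gamma> K \<sigma>" by simp_all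
  have "pair P (trm_arr P M \<Gamma> N) (trm_arr P M \<Gamma> K) i = pair (C i) (trm_arr P M \<Gamma> N i) (trm_arr P M \<Gamma> K i)"
    using S.trm_arr_typ[OF wt(1) Equ(3)] S.trm_arr_typ[OF wt(2) Equ(3)] Equ(1) by (intro pair_P_nth) simp_all
  then show ?case using trm_arr_at[OF Equ(1) wt(1) Equ(3)] trm_arr_at[OF Equ(1) wt(2) Equ(3)] Equ(1)
    by (simp add: P_nth)
next
  case (Conn k \<phi>s)
  then have "map (fml_val (C i) (at M i) \<Gamma>) \<phi>s = map (\<lambda>x. x i) (map (fml_val P M \<Gamma>) \<phi>s)" by simp
  then show ?case using Conn(2) by (simp add: P_nth ctx_ob_at del: map_map)
next
  case (Quant q \<tau> \<phi>)
  then show ?case by (simp add: P_nth ctx_ob_at)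
qed

lemma struc_at: "i \<in> I \<Longrightarrow> is_struc (C i) Sg (at M i)"
  using struc unfolding is_struc_def
  by (auto simp: ctx_ob_at hom_def dm_P_nth[symmetric] cd_P_nth[symmetric] ob_P_nth pred_P_nth arr_P_nth)

text \<open>Equality and order in the product are componentwise; for equations this rests on arrows
  of \<open>P\<close> being extensional functions.\<close>

lemma satisfies_at:
  assumes "wf_assertion L Sg a"
  shows "satisfies L P M a \<longleftrightarrow> (\<forall>i\<in>I. satisfies L (C i) (at M i) a)"
proof (cases a)
  case (EqA \<Gamma> \<sigma> N K)
  then have w: "is_ctx Sg \<Gamma>" "wt_trm Sg \<Gamma> N \<sigma>" "wt_trm Sg \<Gamma> K \<sigma>" using assms by auto
  have "trm_arr P M \<Gamma> N \<in> extensional I" "trm_arr P M \<Gamma> K \<in> extensional I"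
    using S.trm_arr_typ(1)[OF w(2,1)] S.trm_arr_typ(1)[OF w(3,1)] by (auto simp: P_sel PiE_iff)
  then have "trm_arr P M \<Gamma> N = trm_arr P M \<Gamma> K \<longleftrightarrow> (\<forall>i\<in>I. trm_arr P M \<Gamma> N i = trm_arr P M \<Gamma> K i)"
    using extensionalityI by metis
  then show ?thesis using w trm_arr_at[OF _ w(2,1)] trm_arr_at[OF _ w(3,1)] by (simp add: EqA)
next
  case (SeqA \<Gamma> \<Phi> \<phi>)
  then have w: "is_ctx Sg \<Gamma>" "\<forall>\<psi>\<in>set \<Phi>. wt_fml L Sg \<Gamma> \<psi>" "wt_fml L Sg \<Gamma> \<phi>" using assms by auto
  have "foldr (tensor_p L (C i) (ctx_ob P M \<Gamma> i)) (map (fml_val (C i) (at M i) \<Gamma>) \<Phi>) (unit_p L (C i) (ctx_ob P M \<Gamma> i)) =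
      S.vals \<Gamma> \<Phi> i" if i: "i \<in> I" for i
    using w(2) by (induction \<Phi>) (simp_all add: fml_val_at[OF i _ w(1)] tensor_P_nth[OF i] unit_P_nth[OF i])
  then show ?thesis using w by (simp add: SeqA ctx_ob_at fml_val_at P_sel(12))
qed

end

text \<open>Converse to \<open>at\<close>. Restricting to \<open>I\<close> makes the assembled
  objects, arrows and predicates extensional, as the carriers of \<open>P\<close> demand.\<close>

lemma struc_of_family:
  assumes "\<And>i. i \<in> I \<Longrightarrow> is_struc (C i) Sg (N i)"
  obtains M where "is_struc P Sg M" "\<And>i. i \<in> I \<Longrightarrow> at M i = N i"
proof -
  define M where "M = \<lparr>isort = \<lambda>\<sigma>. \<lambda>i\<in>I. isort (N i) \<sigma>, ifun = \<lambda>f. \<lambda>i\<in>I. ifun (N i) f, irel = \<lambda>r. \<lambda>i\<in>I. irel (N i) r\<rparr>"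
  have N: "at M i = N i" if "i \<in> I" for i using that by (simp add: at_def M_def)
  have ext: "ctx_ob P M \<Gamma> = (\<lambda>i\<in>I. ctx_ob (C i) (N i) \<Gamma>)" for \<Gamma>
  proof -
    have "ctx_ob P M \<Gamma> \<in> extensional I" by (cases \<Gamma>) (simp_all add: P_sel)
    then show ?thesis using ctx_ob_at[of _ M \<Gamma>] N by (intro extensionalityI[of _ I]) auto
  qed
  have "is_struc P Sg M"
    using assms unfolding is_struc_def ext
    by (auto simp: hom_def P_sel M_def restrict_eq_iff)
  then show ?thesis using N by (rule that)
qed

end

section \<open>Cardinality of the syntax\<close>

lemma lepoll_iff_ordLeq: "A \<lesssim> B \<longleftrightarrow> (card_of A, card_of B) \<in> ordLeq"
  by (simp add: lepoll_def card_of_ordLeq)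

lemma list_all2_wt: "list_all2 (wt_trm Sg \<Gamma>) Ms \<Delta> \<Longrightarrow> u \<in> set Ms \<Longrightarrow> \<exists>\<Gamma> \<sigma>. wt_trm Sg \<Gamma> u \<sigma>"
  by (metis in_set_conv_nth list_all2_conv_all_nth)

context
  fixes K :: "'z set"
  assumes inf: "infinite K"
begin

lemma lepoll_UN: "I \<lesssim> K \<Longrightarrow> (\<And>i. i \<in> I \<Longrightarrow> A i \<lesssim> K) \<Longrightarrow> (\<Union>i\<in>I. A i) \<lesssim> K"
  unfolding lepoll_iff_ordLeq using inf by (intro card_of_UNION_ordLeq_infinite) auto

lemma lepoll_Times: "A \<lesssim> K \<Longrightarrow> B \<lesssim> K \<Longrightarrow> A \<times> B \<lesssim> K"
  unfolding lepoll_iff_ordLeq using inf by (intro card_of_Sigma_ordLeq_infinite) auto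

lemma nat_lepoll: "(UNIV :: nat set) \<lesssim> K"
  using inf infinite_le_lepoll by blast

lemma lepoll_UN_nat: "(\<And>n. A n \<lesssim> K) \<Longrightarrow> (\<Union>n::nat. A n) \<lesssim> K"
  using lepoll_UN[OF nat_lepoll] by blast

lemma lepoll_Un:
  assumes "A \<lesssim> K" "B \<lesssim> K"
  shows "A \<union> B \<lesssim> K"
proof -
  have "A \<union> B = (\<Union>n::nat. if n = 0 then A else B)" by (auto split: if_splits)
  then show ?thesis using lepoll_UN_nat[of "\<lambda>n. if n = 0 then A else B"] assms by simp
qed

lemma lepoll_image: "A \<lesssim> K \<Longrightarrow> f ` A \<lesssim> K"
  using image_lepoll lepoll_trans by blast

lemma lepoll_subset: "A \<lesssim> K \<Longrightarrow> B \<subseteq> A \<Longrightarrow> B \<lesssim> K"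
  using subset_imp_lepoll lepoll_trans by blast

text \<open>Stratification by length: each layer is covered by a product of two sets bounded by the
  infinite \<open>K\<close>, and there are countably many layers.\<close>

lemma lepoll_lists:
  assumes "A \<lesssim> K"
  shows "lists A \<lesssim> K"
proof -
  have "{xs \<in> lists A. length xs = n} \<lesssim> K" for n
  proof (induction n)
    case 0
    have "{xs \<in> lists A. length xs = 0} = (\<lambda>_. []) ` {0::nat}" by auto
    then show ?case using lepoll_image[OF lepoll_subset[OF nat_lepoll]] by (metis subset_UNIV)
  next
    case (Suc n)
    have "{xs \<in> lists A. length xs = Suc n} \<subseteq> (\<lambda>(x, xs). x # xs) ` (A \<times> {xs \<in> lists A. length xs = n})"
      by (auto simp: length_Suc_conv image_iff)
    then show ?case by (rule lepoll_subset[OF lepoll_image[OF lepoll_Times[OF assms Suc]]])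
  qed
  from lepoll_UN_nat[OF this] show ?thesis by (rule lepoll_subset) auto
qed

text \<open>Stratification by size, which copes with the nested recursion: a layer consists of
  variables and of symbols paired with lists over the layer below.\<close>

lemma trms_lepoll:
  assumes "funs Sg \<lesssim> K"
  shows "{t. \<exists>\<Gamma> \<sigma>. wt_trm Sg \<Gamma> t \<sigma>} \<lesssim> K" (is "?W \<lesssim> K")
proof -
  have "{t \<in> ?W. size t < n} \<lesssim> K" for n
  proof (induction n)
    case 0
    show ?case using lepoll_subset[OF nat_lepoll, of "{}"] by (simp add: lepoll_def)
  next
    case (Suc n)
    let ?S = "Var ` (UNIV :: nat set) \<union> (\<lambda>(f, Ms). Fn f Ms) ` (funs Sg \<times> lists {t \<in> ?W. size t < n})"
    have "{t \<in> ?W. size t < Suc n} \<subseteq> ?S"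
    proof
      fix t assume t: "t \<in> {t \<in> ?W. size t < Suc n}"
      show "t \<in> ?S"
      proof (cases t)
        case (Fn f Ms)
        then obtain \<Gamma> \<sigma> where "wt_trm Sg \<Gamma> (Fn f Ms) \<sigma>" using t by auto
        then have f: "f \<in> funs Sg" "list_all2 (wt_trm Sg \<Gamma>) Ms (fdom Sg f)" by (auto elim: wt_FnE)
        have "u \<in> {t \<in> ?W. size t < n}" if u: "u \<in> set Ms" for u
        proof -
          have "size u < Suc (size_list size Ms)" using size_list_estimation'[OF u, of "size u" size] by simp
          moreover have "size t = Suc (size_list size Ms)" by (simp add: Fn)
          ultimately have "size u < n" using t by simp
          then show ?thesis using list_all2_wt[OF f(2) u] by simp
        qed
        then show ?thesis using f by (auto simp: Fn image_iff)
      qed auto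
    qed
    moreover have "?S \<lesssim> K"
      by (intro lepoll_Un lepoll_image lepoll_Times lepoll_lists nat_lepoll assms Suc)
    ultimately show ?case using lepoll_subset by blast
  qed
  from lepoll_UN_nat[OF this] show ?thesis
    by (rule lepoll_subset) (rule subsetI, rule UN_I[OF UNIV_I], rule CollectI, rule conjI, assumption, rule lessI)
qed

text \<open>Stratified by size like the terms. Formulas over all contexts are counted together,
  because the body of a quantifier lives in a longer context.\<close>

lemma fmls_lepoll:
  assumes "sorts Sg \<lesssim> K" "funs Sg \<lesssim> K" "rels Sg \<lesssim> K" "conns L \<lesssim> K" "quants L \<lesssim> K"
  shows "{\<phi>. \<exists>\<Gamma>. wt_fml L Sg \<Gamma> \<phi>} \<lesssim> K" (is "?F \<lesssim> K")
proof -
  let ?W = "{t. \<exists>\<Gamma> \<sigma>. wt_trm Sg \<Gamma> t \<sigma>}"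
  have "{\<phi> \<in> ?F. size \<phi> < n} \<lesssim> K" for n
  proof (induction n)
    case 0
    show ?case using lepoll_subset[OF nat_lepoll, of "{}"] by (simp add: lepoll_def)
  next
    case (Suc n)
    let ?Fn = "{\<phi> \<in> ?F. size \<phi> < n}"
    let ?S = "(\<lambda>(r, Ms). Rel r Ms) ` (rels Sg \<times> lists ?W) \<union>
      (\<lambda>(\<sigma>, M, N). Equ \<sigma> M N) ` (sorts Sg \<times> ?W \<times> ?W) \<union>
      (\<lambda>(k, \<phi>s). Conn k \<phi>s) ` (conns L \<times> lists ?Fn) \<union>
      (\<lambda>(q, \<tau>, \<phi>). Quant q \<tau> \<phi>) ` (quants L \<times> sorts Sg \<times> ?Fn)"
    have "{\<phi> \<in> ?F. size \<phi> < Suc n} \<subseteq> ?S"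
    proof
      fix \<phi> assume p: "\<phi> \<in> {\<phi> \<in> ?F. size \<phi> < Suc n}"
      then obtain \<Gamma> where wt: "wt_fml L Sg \<Gamma> \<phi>" and sz: "size \<phi> < Suc n" by auto
      show "\<phi> \<in> ?S"
      proof (cases \<phi>)
        case (Rel r Ms)
        then have "r \<in> rels Sg" "Ms \<in> lists ?W"
          using wt list_all2_wt by auto
        then show ?thesis unfolding Rel by (intro UnI1, rule_tac image_eqI[of _ _ "(r, Ms)"]) simp_all
      next
        case (Equ \<sigma> M N)
        then have "\<sigma> \<in> sorts Sg" "M \<in> ?W" "N \<in> ?W" using wt by auto
        then show ?thesis unfolding Equ
          by (rule_tac UnI1, rule_tac UnI1, rule_tac UnI2, rule_tac image_eqI[of _ _ "(\<sigma>, M, N)"]) simp_all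
      next
        case (Conn k \<phi>s)
        have "\<psi> \<in> ?Fn" if u: "\<psi> \<in> set \<phi>s" for \<psi>
        proof -
          have "size \<psi> < Suc (size_list size \<phi>s)" using size_list_estimation'[OF u, of "size \<psi>" size] by simp
          moreover have "size \<phi> = Suc (size_list size \<phi>s)" by (simp add: Conn)
          ultimately show ?thesis using sz wt u by (auto simp: Conn)
        qed
        then show ?thesis unfolding Conn using wt
          by (rule_tac UnI1, rule_tac UnI2, rule_tac image_eqI[of _ _ "(k, \<phi>s)"]) (auto simp: Conn)
      next
        case (Quant q \<tau> \<psi>)
        then have "\<psi> \<in> ?Fn" "q \<in> quants L" "\<tau> \<in> sorts Sg" using wt sz by auto
        then show ?thesis unfolding Quant
          by (rule_tac UnI2, rule_tac image_eqI[of _ _ "(q, \<tau>, \<psi>)"]) simp_all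
      qed
    qed
    moreover have "?S \<lesssim> K"
      by (intro lepoll_Un lepoll_image lepoll_Times lepoll_lists trms_lepoll assms Suc)
    ultimately show ?case using lepoll_subset by blast
  qed
  from lepoll_UN_nat[OF this] show ?thesis
    by (rule lepoll_subset) (rule subsetI, rule UN_I[OF UNIV_I], rule CollectI, rule conjI, assumption, rule lessI)
qed

lemma ctxs_lepoll: "sorts Sg \<lesssim> K \<Longrightarrow> {\<Gamma>. is_ctx Sg \<Gamma>} \<lesssim> K"
  by (rule lepoll_subset[OF lepoll_lists]) (auto simp: is_ctx_def)

lemma assertions_lepoll:
  assumes "is_sig Sg" "sorts Sg \<lesssim> K" "funs Sg \<lesssim> K" "rels Sg \<lesssim> K" "conns L \<lesssim> K" "quants L \<lesssim> K"
  shows "{a. wf_assertion L Sg a} \<lesssim> K"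
proof -
  let ?W = "{t. \<exists>\<Gamma> \<sigma>. wt_trm Sg \<Gamma> t \<sigma>}" and ?F = "{\<phi>. \<exists>\<Gamma>. wt_fml L Sg \<Gamma> \<phi>}" and ?G = "{\<Gamma>. is_ctx Sg \<Gamma>}"
  let ?S = "(\<lambda>(\<Gamma>, \<sigma>, M, N). EqA \<Gamma> \<sigma> M N) ` (?G \<times> sorts Sg \<times> ?W \<times> ?W) \<union>
    (\<lambda>(\<Gamma>, \<Phi>, \<phi>). SeqA \<Gamma> \<Phi> \<phi>) ` (?G \<times> lists ?F \<times> ?F)"
  have "{a. wf_assertion L Sg a} \<subseteq> ?S"
  proof
    fix a assume a: "a \<in> {a. wf_assertion L Sg a}"
    show "a \<in> ?S"
    proof (cases a)
      case (EqA \<Gamma> \<sigma> M N)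
      then have "\<Gamma> \<in> ?G" "\<sigma> \<in> sorts Sg" "M \<in> ?W" "N \<in> ?W" using a wt_trm_sort[OF assms(1)] by auto
      then show ?thesis unfolding EqA by (intro UnI1 image_eqI[of _ _ "(\<Gamma>, \<sigma>, M, N)"]) simp_all
    next
      case (SeqA \<Gamma> \<Phi> \<phi>)
      then have "\<Gamma> \<in> ?G" "\<Phi> \<in> lists ?F" "\<phi> \<in> ?F" using a by auto
      then show ?thesis unfolding SeqA by (intro UnI2 image_eqI[of _ _ "(\<Gamma>, \<Phi>, \<phi>)"]) simp_all
    qed
  qed
  moreover have "?S \<lesssim> K"
    by (intro lepoll_Un lepoll_image lepoll_Times lepoll_lists trms_lepoll fmls_lepoll ctxs_lepoll assms)
  ultimately show ?thesis using lepoll_subset by blast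
qed

text \<open>Arrows and predicates are images of syntactic data, so passing to classes does not raise
  the bound.\<close>

lemma classifying_lepoll:
  fixes L :: "('k, 'q) lang" and Sg :: "'u signature" and T :: "('u, 'k, 'q) assertion set"
  assumes "sorts Sg \<lesssim> K" "funs Sg \<lesssim> K" "rels Sg \<lesssim> K" "conns L \<lesssim> K" "quants L \<lesssim> K"
  shows "ob (classifying L Sg T) \<lesssim> K" "arr (classifying L Sg T) \<lesssim> K" "pred (classifying L Sg T) \<Gamma> \<lesssim> K"
proof -
  let ?W = "{t. \<exists>\<Gamma> \<sigma>. wt_trm Sg \<Gamma> t \<sigma>}" and ?F = "{\<phi>. \<exists>\<Gamma>. wt_fml L Sg \<Gamma> \<phi>}" and ?G = "{\<Gamma>. is_ctx Sg \<Gamma>}"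
  show "ob (classifying L Sg T) \<lesssim> K" using ctxs_lepoll[OF assms(1)] by (simp add: classifying_def)
  have "Ms \<in> lists ?W" if "list_all2 (wt_trm Sg \<Gamma>) Ms \<Delta>" for Ms \<Gamma> \<Delta>
    using list_all2_wt[OF that] by auto
  then have "arr (classifying L Sg T) \<subseteq> (\<lambda>(\<Gamma>, \<Delta>, Ms). cl_arr T \<Gamma> \<Delta> Ms) ` (?G \<times> ?G \<times> lists ?W)"
    unfolding classifying_def by (fastforce simp: image_iff)
  moreover have "(\<lambda>(\<Gamma>, \<Delta>, Ms). cl_arr T \<Gamma> \<Delta> Ms) ` (?G \<times> ?G \<times> lists ?W) \<lesssim> K"
    by (intro lepoll_image lepoll_Times lepoll_lists trms_lepoll ctxs_lepoll assms)
  ultimately show "arr (classifying L Sg T) \<lesssim> K" using lepoll_subset by blast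
  have "pred (classifying L Sg T) \<Gamma> \<subseteq> fml_class T \<Gamma> ` ?F" unfolding classifying_def by auto
  moreover have "fml_class T \<Gamma> ` ?F \<lesssim> K" by (intro lepoll_image fmls_lepoll assms)
  ultimately show "pred (classifying L Sg T) \<Gamma> \<lesssim> K" using lepoll_subset by blast
qed

end


section \<open>The theorem\<close>

lemma ObFA_propcat: "C \<in> ObFA L fits \<Longrightarrow> is_propcat L C"
  by (simp add: ObFA_def)

lemma copy_imp_sub: "is_copy L E C \<Longrightarrow> is_sub L E C"
  unfolding is_copy_def is_sub_def by blast

text \<open>A model in \<open>E\<close> is pushed forward to \<open>D\<close>, and the conclusion is
  read back: satisfaction is both preserved and reflected.\<close>

lemma sub_entails:
  assumes L: "language L" and E: "is_propcat L E" and D: "is_propcat L D" and sub: "is_sub L E D"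
    and Sg: "is_sig Sg" and T: "is_theory L Sg T" "is_theory L Sg T'" and ent: "entails L {D} Sg T T'"
  shows "entails L {E} Sg T T'"
  unfolding entails_def
proof (intro ballI allI impI)
  fix C M a assume "C \<in> {E}" "is_model L C Sg T M" and a: "a \<in> T'"
  then have C: "C = E" and M: "is_struc E Sg M" "\<forall>a\<in>T. satisfies L E M a" by (auto simp: is_model_def)
  obtain F where F: "is_inclusion L E D F" using sub unfolding is_sub_def by blast
  obtain N where N: "is_struc D Sg N" "\<And>a. wf_assertion L Sg a \<Longrightarrow> satisfies L D N a \<longleftrightarrow> satisfies L E M a"
    using inclusion_model[OF L E D F Sg M(1)] by blast
  then have "is_model L D Sg T N" using M T unfolding is_model_def is_theory_def by blast
  then have "satisfies L D N a" using ent a unfolding entails_def by blast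
  then show "satisfies L C M a" using N(2) T(2) a unfolding is_theory_def C by blast
qed

lemma SS_ObFA: "X \<subseteq> ObFA L fits \<Longrightarrow> D \<in> SS L fits X \<Longrightarrow> D \<in> ObFA L fits"
  by (erule SS.induct) auto

lemma PP_ObFA: "X \<subseteq> ObFA L fits \<Longrightarrow> D \<in> PP L small fits X \<Longrightarrow> D \<in> ObFA L fits"
  by (erule PP.induct) auto

text \<open>The components of a model in a product are models, so the induction hypothesis applies
  factor by factor; the copy \<open>E\<close> is then treated as a sub-prop-category of the
  product.\<close>

lemma PP_sound:
  assumes L: "language L" and X: "X \<subseteq> ObFA L fits" and D: "D \<in> PP L small fits X"
    and Sg: "is_sig Sg" and T: "is_theory L Sg T" "is_theory L Sg T'" and ent: "entails L X Sg T T'"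
  shows "entails L {D} Sg T T'"
  using D
proof (induction rule: PP.induct)
  case (base C)
  then show ?case using ent unfolding entails_def by blast
next
  case (prod I C E)
  interpret product L I C
    using L prod.hyps(2) PP_ObFA[OF X] ObFA_propcat by unfold_locales blast+
  have "entails L {P} Sg T T'"
    unfolding entails_def
  proof (intro ballI allI impI)
    fix P' M a assume "P' \<in> {P}" "is_model L P' Sg T M" and a: "a \<in> T'"
    then have P': "P' = P" and M: "is_struc P Sg M" "\<forall>a\<in>T. satisfies L P M a" by (auto simp: is_model_def)
    have "satisfies L (C i) (at M i) a" if i: "i \<in> I" for i
    proof -
      have "is_model L (C i) Sg T (at M i)"
        using struc_at[OF Sg M(1) i] satisfies_at[OF Sg M(1)] M(2) T(1) i unfolding is_model_def is_theory_def by blast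
      then show ?thesis using prod.IH[OF i] a unfolding entails_def by blast
    qed
    then show "satisfies L P' M a" using satisfies_at[OF Sg M(1)] T(2) a unfolding P' is_theory_def by blast
  qed
  then show ?case
    using sub_entails[OF L ObFA_propcat[OF prod.hyps(3)] propcat_P copy_imp_sub[OF prod.hyps(4)] Sg T] by blast
qed

lemma SS_sound:
  assumes L: "language L" and X: "X \<subseteq> ObFA L fits" and D: "D \<in> SS L fits X"
    and Sg: "is_sig Sg" and T: "is_theory L Sg T" "is_theory L Sg T'"
    and ent: "\<And>C. C \<in> X \<Longrightarrow> entails L {C} Sg T T'"
  shows "entails L {D} Sg T T'"
  using D
proof (induction rule: SS.induct)
  case (base C)
  then show ?case using ent by blast
next
  case (sub D E)
  then show ?case
    using sub_entails[OF L ObFA_propcat[OF sub(2)] ObFA_propcat[OF SS_ObFA[OF X sub(1)]] sub(3) Sg T] by blast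
qed

section \<open>Smallness, and copies over urelements\<close>

lemma universeD:
  assumes "universe small fits"
  shows universe_infinite: "\<exists>A. small A \<and> infinite A"
    and universe_small: "small A \<Longrightarrow> B \<lesssim> A \<Longrightarrow> small B"
    and universe_Un: "small A \<Longrightarrow> small B \<Longrightarrow> small (A \<union> B)"
    and universe_small_fits: "small A \<Longrightarrow> fits A"
    and universe_fits: "fits A \<Longrightarrow> B \<lesssim> A \<Longrightarrow> fits B"
    and universe_PiE: "small I \<Longrightarrow> (\<And>i. i \<in> I \<Longrightarrow> fits (F i)) \<Longrightarrow> \<exists>B. fits B \<and> (\<Pi>\<^sub>E i\<in>I. F i) \<lesssim> B"
proof -
  note u = assms[unfolded universe_def]
  show "\<exists>A. small A \<and> infinite A" by (rule u[THEN conjunct1])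
  note u = u[THEN conjunct2]
  show "small A \<Longrightarrow> B \<lesssim> A \<Longrightarrow> small B" by (rule u[THEN conjunct1, rule_format])
  note u = u[THEN conjunct2]
  show "small A \<Longrightarrow> small B \<Longrightarrow> small (A \<union> B)" by (rule u[THEN conjunct1, rule_format])
  note u = u[THEN conjunct2]
  show "small A \<Longrightarrow> fits A" by (rule u[THEN conjunct1, rule_format])
  note u = u[THEN conjunct2]
  show "fits A \<Longrightarrow> B \<lesssim> A \<Longrightarrow> fits B" by (rule u[THEN conjunct1, rule_format])
  note u = u[THEN conjunct2]
  show "small I \<Longrightarrow> (\<And>i. i \<in> I \<Longrightarrow> fits (F i)) \<Longrightarrow> \<exists>B. fits B \<and> (\<Pi>\<^sub>E i\<in>I. F i) \<lesssim> B"
    by (rule u[rule_format])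
qed

text \<open>One infinite small set dominates all data at once, so that the bounds on syntax can be
  used with a common \<open>K\<close>.\<close>

lemma small_bound:
  fixes small fits :: "'u set \<Rightarrow> bool"
  assumes "universe small fits" "small_language small L" "small_sig small Sg"
  obtains K where "small K" "infinite K" "sorts Sg \<lesssim> K" "funs Sg \<lesssim> K" "rels Sg \<lesssim> K" "conns L \<lesssim> K" "quants L \<lesssim> K"
proof -
  note Un = universe_Un[OF assms(1)]
  obtain A where A: "small A" "infinite A" using universe_infinite[OF assms(1)] by blast
  obtain B C where BC: "small B" "conns L \<lesssim> B" "small C" "quants L \<lesssim> C"
    using assms(2) unfolding small_language_def by blast
  have Sg: "small (sorts Sg)" "small (funs Sg)" "small (rels Sg)" using assms(3) by (auto simp: small_sig_def)
  let ?K = "A \<union> B \<union> C \<union> sorts Sg \<union> funs Sg \<union> rels Sg"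
  have "small ?K" by (intro Un A BC Sg)
  moreover have "infinite ?K" using A by simp
  moreover have "sorts Sg \<lesssim> ?K" "funs Sg \<lesssim> ?K" "rels Sg \<lesssim> ?K" "B \<lesssim> ?K" "C \<lesssim> ?K"
    by (rule subset_imp_lepoll, blast)+
  moreover from this have "conns L \<lesssim> ?K" "quants L \<lesssim> ?K"
    using lepoll_trans[OF BC(2)] lepoll_trans[OF BC(4)] by blast+
  ultimately show ?thesis using that by blast
qed

lemma classifying_copy_exists:
  fixes small fits :: "'u set \<Rightarrow> bool" and L :: "('k, 'q) lang"
  assumes U: "universe small fits" and L: "language L" "small_language small L" and Sg: "small_sig small Sg"
    and C: "is_propcat L (classifying L Sg T)"
  obtains E :: "('u, 'k, 'q) upropcat" where "E \<in> ObFA L fits" "is_copy L E (classifying L Sg T)"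
proof -
  obtain K where K: "small K" "infinite K" "sorts Sg \<lesssim> K" "funs Sg \<lesssim> K" "rels Sg \<lesssim> K" "conns L \<lesssim> K" "quants L \<lesssim> K"
    using small_bound[OF U L(2) Sg] .
  note fK = universe_small_fits[OF U K(1)] and fits = universe_fits[OF U]
  have "\<exists>B. fits B \<and> pred (classifying L Sg T) \<Gamma> \<lesssim> B" for \<Gamma>
    using fK classifying_lepoll(3)[OF K(2-7)] by blast
  then show ?thesis
    by (rule copy_exists[where fits = fits, OF L(1) C classifying_lepoll(1,2)[OF K(2-7)] _ fK fK fits that])
qed

text \<open>Smallness of the index set is essential: \<open>universe\<close> makes products of
  fitting sets fit only over small families.\<close>

lemma product_copy_exists:
  fixes small fits :: "'u set \<Rightarrow> bool" and L :: "('k, 'q) lang" and C :: "'u \<Rightarrow> ('u, 'k, 'q) upropcat"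
  assumes U: "universe small fits" and L: "language L" and I: "small I" and C: "\<And>i. i \<in> I \<Longrightarrow> C i \<in> ObFA L fits"
  obtains E :: "('u, 'k, 'q) upropcat" where "E \<in> ObFA L fits" "is_copy L E (prod_propcat I C)"
proof -
  interpret product L I C using L C ObFA_propcat by unfold_locales blast+
  note fits = universe_fits[OF U] and pi = universe_PiE[OF U I]
  obtain A where A: "fits A" "ob P \<lesssim> A" using pi[of "\<lambda>i. ob (C i)"] C unfolding P_sel ObFA_def by blast
  obtain B where B: "fits B" "arr P \<lesssim> B" using pi[of "\<lambda>i. arr (C i)"] C unfolding P_sel ObFA_def by blast
  have pr: "\<exists>B. fits B \<and> pred P c \<lesssim> B" if "c \<in> ob P" for c
    using pi[of "\<lambda>i. pred (C i) (c i)"] C ob_P_nth[OF that] unfolding P_sel(11) ObFA_def by blast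
  show ?thesis by (rule copy_exists[where fits = fits, OF L propcat_P A(2) B(2) pr A(1) B(1) fits that])
qed

section \<open>The two inclusions\<close>

lemma UU_sound:
  fixes L :: "('k, 'q) lang" and small fits :: "'u set \<Rightarrow> bool" and X :: "('u, 'k, 'q) upropcat set"
  assumes U: "universe small fits" and L: "language L" "small_language small L" and X: "X \<subseteq> ObFA L fits"
    and D: "D \<in> UU L small fits (SS L fits (PP L small fits X))"
  shows "D \<in> ObFA_logic L small fits (entails L X)"
proof -
  have DO: "D \<in> ObFA L fits" using D by (simp add: UU_def)
  have PX: "PP L small fits X \<subseteq> ObFA L fits" using PP_ObFA[OF X] by blast
  have "entails L {D} Sg T T'"
    if Sg: "small_sig small Sg" and T: "is_theory L Sg T" "is_theory L Sg T'" and ent: "entails L X Sg T T'" for Sg T T'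
    unfolding entails_def
  proof (intro ballI allI impI)
    fix D' M a assume "D' \<in> {D}" "is_model L D' Sg T M" and a: "a \<in> T'"
    then have D': "D' = D" and M: "is_struc D Sg M" "\<forall>a\<in>T. satisfies L D M a" by (auto simp: is_model_def)
    have sig: "is_sig Sg" using Sg by (simp add: small_sig_def)
    interpret S: structure_in L D Sg M
      using L(1) ObFA_propcat[OF DO] sig M(1) by unfold_locales
    let ?C = "classifying L Sg S.Th"
    obtain E where E: "E \<in> ObFA L fits" "is_copy L E ?C"
      using classifying_copy_exists[OF U L Sg S.propcat_Y] .
    have "is_sub L ?C D" using S.is_inclusion_K unfolding is_sub_def by blast
    then have "is_sub L E D"
      using copy_sub_trans[OF L(1) ObFA_propcat[OF E(1)] S.propcat_Y S.propcat E(2)] by blast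
    then have "is_classifying_sub L small fits E D"
      unfolding is_classifying_sub_def using E Sg S.Lm_theory_Th by blast
    then have "E \<in> SS L fits (PP L small fits X)" using D by (simp add: UU_def)
    then have entE: "entails L {E} Sg T T'"
      using SS_sound[OF L(1) PX _ sig T] PP_sound[OF L(1) X _ sig T ent] by blast
    \<comment> \<open>The generic model lives in the classifying prop-category, whereas the closure
      hypothesis on \<open>D\<close> speaks of the copy \<open>E\<close>; the model is carried over
      by inverting the copy.\<close>
    obtain F where F: "is_inclusion L ?C E F"
      using copy_inverse(2)[OF L(1) ObFA_propcat[OF E(1)] S.Y.typed_C E(2)] unfolding is_sub_def by blast
    obtain N where N: "is_struc E Sg N" "\<And>a. wf_assertion L Sg a \<Longrightarrow> satisfies L E N a \<longleftrightarrow> satisfies L ?C S.Y.G a"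
      using inclusion_model[OF L(1) S.propcat_Y ObFA_propcat[OF E(1)] F sig S.Y.is_struc_G] by blast
    have wf: "\<And>a. a \<in> T \<Longrightarrow> wf_assertion L Sg a" "wf_assertion L Sg a" using T a unfolding is_theory_def by blast+
    have "satisfies L E N b" if "b \<in> T" for b
      using N(2) S.Y.satisfies_G wf(1)[OF that] M(2) that by (simp add: S.Th_def)
    then have "is_model L E Sg T N" using N(1) by (simp add: is_model_def)
    then have "satisfies L E N a" using entE a unfolding entails_def by blast
    then have "a \<in> S.Th" using N(2)[OF wf(2)] S.Y.satisfies_G[OF wf(2)] by simp
    then show "satisfies L D' M a" by (simp add: S.Th_def D')
  qed
  then show ?thesis using DO unfolding ObFA_logic_def by blast
qed

lemma UU_complete:
  fixes L :: "('k, 'q) lang" and small fits :: "'u set \<Rightarrow> bool" and X :: "('u, 'k, 'q) upropcat set"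
  assumes U: "universe small fits" and L: "language L" "small_language small L" and X: "X \<subseteq> ObFA L fits"
    and D: "D \<in> ObFA_logic L small fits (entails L X)"
  shows "D \<in> UU L small fits (SS L fits (PP L small fits X))"
proof -
  have DO: "D \<in> ObFA L fits" using D by (simp add: ObFA_logic_def)
  have "E \<in> SS L fits (PP L small fits X)" if cs: "is_classifying_sub L small fits E D" for E
  proof -
    obtain Sg T where E: "E \<in> ObFA L fits" "is_sub L E D" and Sg: "small_sig small Sg" and T: "Lm_theory L Sg T"
      and cp: "is_copy L E (classifying L Sg T)"
      using cs unfolding is_classifying_sub_def by blast
    have sig: "is_sig Sg" using Sg by (simp add: small_sig_def)
    have thT: "is_theory L Sg T" using T by (simp add: Lm_theory_def)
    interpret Y: lm_theory L Sg T using L(1) sig T by unfold_locales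
    have EP: "is_propcat L E" using ObFA_propcat[OF E(1)] .
    have CP: "is_propcat L Y.C" "is_sub L Y.C E" using copy_inverse[OF L(1) EP Y.typed_C cp] by auto
    then obtain F where F: "is_inclusion L Y.C E F" unfolding is_sub_def by blast
    obtain N where N: "is_struc E Sg N" "\<And>a. wf_assertion L Sg a \<Longrightarrow> satisfies L E N a \<longleftrightarrow> satisfies L Y.C Y.G a"
      using inclusion_model[OF L(1) CP(1) EP F sig Y.is_struc_G] by blast
    have N': "is_model L E Sg T N" using N Y.satisfies_G Y.wf_T by (simp add: is_model_def)
    let ?J = "{a. wf_assertion L Sg a \<and> a \<notin> T}"
    let ?R = "\<lambda>a p. fst p \<in> X \<and> is_model L (fst p) Sg T (snd p) \<and> \<not> satisfies L (fst p) (snd p) a"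
    have "\<exists>p. ?R a p" if a: "a \<in> ?J" for a
    proof (rule ccontr)
      \<comment> \<open>Without a countermodel, \<open>a\<close> would be a consequence of
        \<open>T\<close> over \<open>X\<close>, hence valid in \<open>D\<close> and in its
        sub-prop-category \<open>E\<close>, although the model \<open>N\<close> of \<open>T\<close>
        in \<open>E\<close> satisfies only members of \<open>T\<close>.\<close>
      assume "\<not> ?thesis"
      then have "entails L X Sg T {a}" unfolding entails_def by auto
      moreover have tha: "is_theory L Sg {a}" using a by (simp add: is_theory_def)
      ultimately have "entails L {D} Sg T {a}" using D Sg thT unfolding ObFA_logic_def by blast
      then have "entails L {E} Sg T {a}"
        using sub_entails[OF L(1) EP ObFA_propcat[OF DO] E(2) sig thT tha] by blast
      then have "satisfies L E N a" using N' unfolding entails_def by blast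
      then show False using a N(2) Y.satisfies_G by blast
    qed
    then have "\<forall>a\<in>?J. \<exists>p. ?R a p" by blast
    then obtain p where p: "\<forall>a\<in>?J. ?R a (p a)" by (rule bchoice[THEN exE])
    define C where "C a = fst (p a)" for a
    define M where "M a = snd (p a)" for a
    have CM: "C a \<in> X" "is_model L (C a) Sg T (M a)" "\<not> satisfies L (C a) (M a) a" if "a \<in> ?J" for a
      using bspec[OF p that] by (simp_all add: C_def M_def)
    obtain K where K: "small K" "infinite K" "sorts Sg \<lesssim> K" "funs Sg \<lesssim> K" "rels Sg \<lesssim> K" "conns L \<lesssim> K" "quants L \<lesssim> K"
      using small_bound[OF U L(2) Sg] .
    \<comment> \<open>Index sets in \<open>PP\<close> consist of urelements, so the assertions
      outside \<open>T\<close> are coded by \<open>g\<close> into the small set \<open>K\<close>;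
      \<open>h\<close> decodes them.\<close>
    have "?J \<lesssim> {a. wf_assertion L Sg a}" by (intro subset_imp_lepoll) blast
    then have "?J \<lesssim> K" using assertions_lepoll[OF K(2) sig K(3-7)] lepoll_trans by blast
    then obtain g where g: "inj_on g ?J" "g ` ?J \<subseteq> K" unfolding lepoll_def by blast
    define I where "I = g ` ?J"
    have "small I" unfolding I_def by (rule universe_small[OF U K(1) subset_imp_lepoll[OF g(2)]])
    define h where "h = inv_into ?J g"
    have h: "h i \<in> ?J" if "i \<in> I" for i using that unfolding I_def h_def by (rule inv_into_into)
    have hg: "h (g a) = a" if "a \<in> ?J" for a using that g(1) unfolding h_def by (rule_tac inv_into_f_f)
    let ?C = "\<lambda>i. C (h i)"
    have CX: "?C i \<in> X" if "i \<in> I" for i using CM(1) h that by blast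
    then have CO: "?C i \<in> ObFA L fits" if "i \<in> I" for i using X that by blast
    interpret product L I ?C using L(1) CO ObFA_propcat by unfold_locales blast+
    obtain Q where Q: "Q \<in> ObFA L fits" "is_copy L Q P" using product_copy_exists[OF U L(1) \<open>small I\<close> CO] .
    have "Q \<in> PP L small fits X"
      by (rule PP.prod[where small = small, OF \<open>small I\<close> _ Q]) (rule PP.base[OF CX])
    have QP: "is_propcat L Q" using ObFA_propcat[OF Q(1)] .
    have "is_struc (?C i) Sg (M (h i))" if "i \<in> I" for i using CM(2) h that unfolding is_model_def by blast
    then obtain M' where M': "is_struc P Sg M'" "\<And>i. i \<in> I \<Longrightarrow> at M' i = M (h i)"
      using struc_of_family[of Sg "\<lambda>i. M (h i)"] by blast
    have sat: "satisfies L P M' a \<longleftrightarrow> a \<in> T" if a: "wf_assertion L Sg a" for a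
    proof -
      have "satisfies L P M' a \<longleftrightarrow> (\<forall>i\<in>I. satisfies L (?C i) (M (h i)) a)"
        using satisfies_at[OF sig M'(1) a] M'(2) by simp
      moreover have "satisfies L (?C i) (M (h i)) a" if "a \<in> T" "i \<in> I" for i
        using CM(2)[OF h[OF that(2)]] that(1) unfolding is_model_def by blast
      \<comment> \<open>An assertion outside \<open>T\<close> is refuted in the factor that was
        chosen for it, whose index is \<open>g a\<close>.\<close>
      moreover have "\<exists>i\<in>I. \<not> satisfies L (?C i) (M (h i)) a" if "a \<notin> T"
        using CM(3)[of a] hg[of a] a that unfolding I_def by (intro bexI[of _ "g a"]) auto
      ultimately show ?thesis by blast
    qed
    obtain H where H: "is_inclusion L P Q H"
      using copy_inverse(2)[OF L(1) QP typed_propcat[OF propcat_P] Q(2)] unfolding is_sub_def by blast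
    obtain N'' where N'': "is_struc Q Sg N''" "\<And>a. wf_assertion L Sg a \<Longrightarrow> satisfies L Q N'' a \<longleftrightarrow> satisfies L P M' a"
      using inclusion_model[OF L(1) propcat_P QP H sig M'(1)] by blast
    interpret S: structure_in L Q Sg N'' using L(1) QP sig N''(1) by unfold_locales
    \<comment> \<open>This makes \<open>S.Y.C\<close> and \<open>Y.C\<close> the same prop-category,
      so the inclusion obtained for the theory of a structure becomes one for
      \<open>T\<close>.\<close>
    have "S.Th = T" unfolding S.Th_def using N''(2) sat Y.wf_T by blast
    then have "is_sub L Y.C Q" using S.is_inclusion_K unfolding is_sub_def by auto
    then have "is_sub L E Q" using copy_sub_trans[OF L(1) EP CP(1) QP cp] by blast
    then show ?thesis using SS.sub[OF SS.base[OF \<open>Q \<in> PP L small fits X\<close>] E(1)] by blast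
  qed
  then show ?thesis using DO by (simp add: UU_def)
qed

theorem mainTheorem16:
  fixes L :: "('k, 'q) lang"
    and small fits :: "'u set \<Rightarrow> bool"
    and X :: "('u, 'k, 'q) upropcat set"
  assumes "universe small fits"
    and "language L"
    and "small_language small L"
    and "X \<subseteq> ObFA L fits"
  shows "ObFA_logic L small fits (entails L X) = UU L small fits (SS L fits (PP L small fits X))"
  using UU_complete[OF assms] UU_sound[OF assms] by blast

end
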